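(* Let $B_0$ be a base hierarchy such that there is no $c\ge2$ with $S_{B_0}(b)\le\min(b^2,bc)$ for every $b\in B_0$. Define $B_{i+1}=(B_i)_{+(i+1)}$ for every $i$ and $\mathcal B=(B_i)_{i\in\mathbb N}$. Then $\mathsf{ACA}_0$ does not prove that for every $n$ there is some $i$ such that $\mathbb G^{\mathcal B}_i(n)=0$.
   Context: Let $\mathbb N=\{0,1,2,\dots\}$; $\infty$ is regarded as greater than, and divisible by, every positive integer. For $b\ge 2$ and $n>0$, the $b$-decomposition of $n$ is the unique $n=b^e a+r$ with $b^e\le n<b^{e+1}$, $0<a<b$, $r<b^e$. For nonempty $B\subseteq\mathbb N\setminus\{0,1\}$: $\mathrm{base}_B(n)=\max\{b\in B: b\le n\}$ if $n\ge\min B$, else $\min B$; $S_B(n)=\min\{b\in B:b>n\}$ if this exists, else $\infty$. A base hierarchy is a nonempty $B\subseteq\mathbb N\setminus\{0,1\}$ with $b\mid S_B(b)$ for all $b\in B$. $n$ is $B$-critical if $\mathrm{base}_B(n)\mid n$. Upgrade: for base hierarchies $B,C$ with $\min B\le\min C$, define ${\uparrow}n={\uparrow}_B^C n\in\mathbb N\cup\{\infty\}$ recursively. If $n<\min B$, ${\uparrow}n=n$. Otherwise $b=\mathrm{base}_B(n)$; for an integer $c\ge2$ define $\langle b\to c\rangle m={\uparrow}m$ if $m<b$, and $\langle b\to c\rangle m=c^{\langle b\to c\rangle e}\cdot{\uparrow}a+\langle b\to c\rangle r$ if $m\ge b$ has $b$-decomposition $m=b^ea+r$. Then ${\uparrow}n=\langle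 b\to c\rangle n$ where $c$ is the least element of $C$ with ${\uparrow}(n-1)<\langle b\to c\rangle n<S_C(c)$; ${\uparrow}n=\infty$ if none exists. Ouroboros successor: for a base hierarchy $B$ and integer $i\ge1$, $B_{+i}=\bigcup_{n}B^n_{+i}$, where recursively $B^n_{+i}=\{\min B+1\}$ for $n\le\min B$, and for $n>\min B$, with $c=\max B^{n-1}_{+i}$ and operators $\langle\cdot\to\cdot\rangle$ taken with respect to ${\uparrow}_B^{B^{n-1}_{+i}}$: (a) if $n$ is not $B$-critical, $B^n_{+i}=B^{n-1}_{+i}$; (b) if $n\in B$, let $b=\mathrm{base}_B(n-1)$ and $B^n_{+i}=B^{n-1}_{+i}\cup\{ca\}$ with $a$ least such that $\langle b\to c\rangle(n-1)<ca$; (c) if $n\notin B$ is $B$-critical, let $b=\mathrm{base}_B(n)$, $d_0=c$, $d_{j+1}=\langle b\to d_j\rangle n$, and $B^n_{+i}=B^{n-1}_{+i}\cup\{d_1,\dots,d_i\}$. Goodstein sequence: $\mathbb G^{\mathcal B}_0(n)=n$, $\mathbb G^{\mathcal B}_{i+1}(n)={\uparrow}_{B_i}^{B_{i+1}}\mathbb G^{\mathcal B}_i(n)-1$ if $\mathbb G^{\mathcal B}_i(n)>0$, else $0$. *)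

theory Defs
  imports "HOL-Library.Extended_Nat"
begin

section \<open>Base hierarchies and their Goodstein sequences\<close>

definition base_of :: "nat set \<Rightarrow> nat \<Rightarrow> nat" where
  "base_of B n = (if Inf B \<le> n then Max {b \<in> B. b \<le> n} else Inf B)"

definition next_base :: "nat set \<Rightarrow> nat \<Rightarrow> enat" where
  "next_base B n = (if \<exists>b\<in>B. n < b then enat (LEAST b. b \<in> B \<and> n < b) else \<infinity>)"

text \<open>In \<^typ>\<open>enat\<close> every nonzero number divides \<open>\<infinity>\<close>, which is the intended convention.\<close>

definition base_hierarchy :: "nat set \<Rightarrow> bool" where
  "base_hierarchy B \<longleftrightarrow> B \<noteq> {} \<and> B \<subseteq> - {0, 1} \<and> (\<forall>b\<in>B. enat b dvd next_base B b)"

definition critical :: "nat set \<Rightarrow> nat \<Rightarrow> bool" where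
  "critical B n \<longleftrightarrow> base_of B n dvd n"

text \<open>The exponent \<open>e\<close> of the \<open>b\<close>-decomposition \<open>n = b ^ e * a + r\<close>; then
  \<open>a = n div b ^ e\<close> and \<open>r = n mod b ^ e\<close>.\<close>

definition bexp :: "nat \<Rightarrow> nat \<Rightarrow> nat" where
  "bexp b n = (GREATEST e. b ^ e \<le> n)"

lemma power_gt_self: "2 \<le> b \<Longrightarrow> n < b ^ n" for b :: nat
  using less_exp[of n] power_mono[of 2 b n] by linarith

lemma bexp_bounds:
  assumes "2 \<le> b" "0 < n"
  shows "b ^ bexp b n \<le> n" "n < b ^ Suc (bexp b n)"
proof -
  have bnd: "\<forall>e. b ^ e \<le> n \<longrightarrow> e \<le> n"
    using power_gt_self[OF assms(1)] by (meson le_trans less_imp_le_nat)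
  have 0: "b ^ 0 \<le> n" using assms by simp
  show "b ^ bexp b n \<le> n"
    unfolding bexp_def by (rule GreatestI_nat[of "\<lambda>e. b ^ e \<le> n", OF 0]) (use bnd in auto)
  show "n < b ^ Suc (bexp b n)"
  proof (rule ccontr)
    assume "\<not> n < b ^ Suc (bexp b n)"
    then have "Suc (bexp b n) \<le> bexp b n"
      unfolding bexp_def
      by (intro Greatest_le_nat[of "\<lambda>e. b ^ e \<le> n" _ n]) (use bnd in \<open>auto simp: bexp_def\<close>)
    then show False by simp
  qed
qed

lemma bexp_less: "2 \<le> b \<Longrightarrow> 0 < n \<Longrightarrow> bexp b n < n"
  using bexp_bounds(1)[of b n] power_gt_self[of b "bexp b n"] by linarith

lemma bmod_less: "2 \<le> b \<Longrightarrow> 0 < n \<Longrightarrow> n mod b ^ bexp b n < n"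
  using bexp_bounds(1)[of b n]
  by (metis less_le_trans mod_less_divisor power_gt_self gr0I le0 less_nat_zero_code neq0_conv not_less_zero order_le_less_trans zero_less_power)

text \<open>\<open>epow c x\<close> is \<open>c ^ x\<close> for an extended exponent.\<close>

fun epow :: "nat \<Rightarrow> enat \<Rightarrow> enat" where
  "epow c (enat k) = enat (c ^ k)"
| "epow c \<infinity> = \<infinity>"

text \<open>\<open>change u b c m\<close> is \<open>\<langle>b \<rightarrow> c\<rangle>m\<close> with \<open>u\<close> in the role of \<open>\<up>\<close>; the
  case \<open>b < 2\<close> is only there to make the recursion terminate.\<close>

function change :: "(nat \<Rightarrow> enat) \<Rightarrow> nat \<Rightarrow> nat \<Rightarrow> nat \<Rightarrow> enat" where
  "change u b c m =
    (if m < b \<or> b < 2 then u m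
     else epow c (change u b c (bexp b m)) * u (m div b ^ bexp b m)
          + change u b c (m mod b ^ bexp b m))"
  by pat_completeness auto
termination
  by (relation "measure (\<lambda>(u, b, c, m). m)") (auto intro!: bexp_less bmod_less)

declare change.simps [simp del]

text \<open>\<open>upgrade B C n\<close> is \<open>\<up>n\<close>. Only values of \<open>\<up>\<close> below \<open>n\<close> enter the recursion, and \<open>u\<close> is
  cut off at \<open>n\<close> to make this visible (cf. \<open>upgrade_eq\<close> below).\<close>

function upgrade :: "nat set \<Rightarrow> nat set \<Rightarrow> nat \<Rightarrow> enat" where
  "upgrade B C n =
    (if n < Inf B then enat n
     else
       let u = (\<lambda>m. if m < n then upgrade B C m else 0);
           b = base_of B n;
           K = {c \<in> C. u (n - 1) < change u b c n \<and> change u b c n < next_base C c}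
       in if K = {} then \<infinity> else change u b (Inf K) n)"
  by pat_completeness auto
termination
  by (relation "measure (\<lambda>(B, C, n). n)") auto

declare upgrade.simps [simp del]

text \<open>The numbers \<open>d\<^sub>j\<close> of the Ouroboros successor.\<close>

fun iter_change :: "(nat \<Rightarrow> enat) \<Rightarrow> nat \<Rightarrow> nat \<Rightarrow> nat \<Rightarrow> nat \<Rightarrow> enat" where
  "iter_change u b n c 0 = enat c"
| "iter_change u b n c (Suc j) =
    (case iter_change u b n c j of enat d \<Rightarrow> change u b d n | \<infinity> \<Rightarrow> \<infinity>)"

fun ouro_stage :: "nat set \<Rightarrow> nat \<Rightarrow> nat \<Rightarrow> nat set" where
  "ouro_stage B i 0 = {Inf B + 1}"
| "ouro_stage B i (Suc p) =
    (let n = Suc p; C = ouro_stage B i p; c = Max C; u = upgrade B C in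
     if n \<le> Inf B then {Inf B + 1}
     else if \<not> critical B n then C
     else if n \<in> B then
       C \<union> {c * a | a. change u (base_of B p) c p < enat (c * a) \<and>
                        (\<forall>a'<a. \<not> change u (base_of B p) c p < enat (c * a'))}
     else C \<union> {x. \<exists>j. 1 \<le> j \<and> j \<le> i \<and> iter_change u (base_of B n) n c j = enat x})"

definition ouro :: "nat set \<Rightarrow> nat \<Rightarrow> nat set" where
  "ouro B i = (\<Union>n. ouro_stage B i n)"

fun ouro_seq :: "nat set \<Rightarrow> nat \<Rightarrow> nat set" where
  "ouro_seq B 0 = B"
| "ouro_seq B (Suc i) = ouro (ouro_seq B i) (Suc i)"

fun goodstein :: "(nat \<Rightarrow> nat set) \<Rightarrow> nat \<Rightarrow> nat \<Rightarrow> enat" where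
  "goodstein B n 0 = enat n"
| "goodstein B n (Suc i) =
    (case goodstein B n i of
       enat k \<Rightarrow> if k > 0 then upgrade (B i) (B (Suc i)) k - 1 else 0
     | \<infinity> \<Rightarrow> \<infinity>)"


section \<open>Second-order arithmetic\<close>

text \<open>De Bruijn indices, separately for number variables (bound by \<open>Forall\<close>) and set variables
  (bound by \<open>ForallS\<close>).\<close>

datatype tm = Var nat | Zero | One | Add tm tm | Mul tm tm

datatype fm =
    Bot
  | Eq tm tm
  | Less tm tm
  | Mem tm nat
  | Imp fm fm
  | Forall fm
  | ForallS fm

definition Neg :: "fm \<Rightarrow> fm" where "Neg p = Imp p Bot"
definition Conj :: "fm \<Rightarrow> fm \<Rightarrow> fm" where "Conj p q = Neg (Imp p (Neg q))"
definition Disj :: "fm \<Rightarrow> fm \<Rightarrow> fm" where "Disj p q = Imp (Neg p) q"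
definition Iff :: "fm \<Rightarrow> fm \<Rightarrow> fm" where "Iff p q = Conj (Imp p q) (Imp q p)"
definition Exists :: "fm \<Rightarrow> fm" where "Exists p = Neg (Forall (Neg p))"
definition ExistsS :: "fm \<Rightarrow> fm" where "ExistsS p = Neg (ForallS (Neg p))"

subsection \<open>Substitution\<close>

primrec subst_tm :: "(nat \<Rightarrow> tm) \<Rightarrow> tm \<Rightarrow> tm" where
  "subst_tm \<sigma> (Var n) = \<sigma> n"
| "subst_tm \<sigma> Zero = Zero"
| "subst_tm \<sigma> One = One"
| "subst_tm \<sigma> (Add s t) = Add (subst_tm \<sigma> s) (subst_tm \<sigma> t)"
| "subst_tm \<sigma> (Mul s t) = Mul (subst_tm \<sigma> s) (subst_tm \<sigma> t)"

definition lift_tm :: "tm \<Rightarrow> tm" where "lift_tm = subst_tm (\<lambda>n. Var (Suc n))"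

primrec subst_fm :: "(nat \<Rightarrow> tm) \<Rightarrow> (nat \<Rightarrow> nat) \<Rightarrow> fm \<Rightarrow> fm" where
  "subst_fm \<sigma> \<rho> Bot = Bot"
| "subst_fm \<sigma> \<rho> (Eq s t) = Eq (subst_tm \<sigma> s) (subst_tm \<sigma> t)"
| "subst_fm \<sigma> \<rho> (Less s t) = Less (subst_tm \<sigma> s) (subst_tm \<sigma> t)"
| "subst_fm \<sigma> \<rho> (Mem t X) = Mem (subst_tm \<sigma> t) (\<rho> X)"
| "subst_fm \<sigma> \<rho> (Imp p q) = Imp (subst_fm \<sigma> \<rho> p) (subst_fm \<sigma> \<rho> q)"
| "subst_fm \<sigma> \<rho> (Forall p) = Forall (subst_fm (case_nat (Var 0) (\<lambda>n. lift_tm (\<sigma> n))) \<rho> p)"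
| "subst_fm \<sigma> \<rho> (ForallS p) = ForallS (subst_fm \<sigma> (case_nat 0 (\<lambda>n. Suc (\<rho> n))) p)"

definition lift_fm :: "fm \<Rightarrow> fm" where "lift_fm = subst_fm (\<lambda>n. Var (Suc n)) id"
definition liftS_fm :: "fm \<Rightarrow> fm" where "liftS_fm = subst_fm Var Suc"
definition inst :: "tm \<Rightarrow> fm \<Rightarrow> fm" where "inst t = subst_fm (case_nat t Var) id"
definition instS :: "nat \<Rightarrow> fm \<Rightarrow> fm" where "instS X = subst_fm Var (case_nat X id)"

subsection \<open>Provability\<close>

text \<open>Natural deduction for two-sorted classical logic with equality. The formulas in \<open>T\<close> are
  axioms and may be used in any context, so their free variables are implicitly universally
  quantified; the formulas in the list \<open>\<Gamma>\<close> are ordinary hypotheses.\<close>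

inductive deriv :: "fm set \<Rightarrow> fm list \<Rightarrow> fm \<Rightarrow> bool" for T where
  Ax: "p \<in> T \<Longrightarrow> deriv T \<Gamma> p"
| Hyp: "p \<in> set \<Gamma> \<Longrightarrow> deriv T \<Gamma> p"
| ImpI: "deriv T (p # \<Gamma>) q \<Longrightarrow> deriv T \<Gamma> (Imp p q)"
| ImpE: "deriv T \<Gamma> (Imp p q) \<Longrightarrow> deriv T \<Gamma> p \<Longrightarrow> deriv T \<Gamma> q"
| Classical: "deriv T (Neg p # \<Gamma>) Bot \<Longrightarrow> deriv T \<Gamma> p"
| AllI: "deriv T (map lift_fm \<Gamma>) p \<Longrightarrow> deriv T \<Gamma> (Forall p)"
| AllE: "deriv T \<Gamma> (Forall p) \<Longrightarrow> deriv T \<Gamma> (inst t p)"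
| AllSI: "deriv T (map liftS_fm \<Gamma>) p \<Longrightarrow> deriv T \<Gamma> (ForallS p)"
| AllSE: "deriv T \<Gamma> (ForallS p) \<Longrightarrow> deriv T \<Gamma> (instS X p)"
| Refl: "deriv T \<Gamma> (Eq t t)"
| Subst: "deriv T \<Gamma> (Eq s t) \<Longrightarrow> deriv T \<Gamma> (inst s p) \<Longrightarrow> deriv T \<Gamma> (inst t p)"

definition proves :: "fm set \<Rightarrow> fm \<Rightarrow> bool" (infix "\<turnstile>" 50) where
  "T \<turnstile> p \<longleftrightarrow> deriv T [] p"

subsection \<open>The theory \<open>ACA\<^sub>0\<close>\<close>

primrec arithmetical :: "fm \<Rightarrow> bool" where
  "arithmetical Bot = True"
| "arithmetical (Eq s t) = True"
| "arithmetical (Less s t) = True"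
| "arithmetical (Mem t X) = True"
| "arithmetical (Imp p q) = (arithmetical p \<and> arithmetical q)"
| "arithmetical (Forall p) = arithmetical p"
| "arithmetical (ForallS p) = False"

definition basic_axioms :: "fm set" where
  "basic_axioms = (let m = Var 0; n = Var 1 in
    {Neg (Eq (Add n One) Zero),
     Imp (Eq (Add m One) (Add n One)) (Eq m n),
     Eq (Add m Zero) m,
     Eq (Add m (Add n One)) (Add (Add m n) One),
     Eq (Mul m Zero) Zero,
     Eq (Mul m (Add n One)) (Add (Mul m n) m),
     Neg (Less m Zero),
     Iff (Less m (Add n One)) (Disj (Less m n) (Eq m n))})"

definition induction_axiom :: fm where
  "induction_axiom =
    Imp (Conj (Mem Zero 0) (Forall (Imp (Mem (Var 0) 0) (Mem (Add (Var 0) One) 0))))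
        (Forall (Mem (Var 0) 0))"

text \<open>In \<open>p\<close>, the number variable 0 is the one that is abstracted; the lifting ensures that the
  new set is not free in \<open>p\<close>.\<close>

definition comprehension :: "fm \<Rightarrow> fm" where
  "comprehension p = ExistsS (Forall (Iff (Mem (Var 0) 0) (liftS_fm p)))"

definition ACA0 :: "fm set" where
  "ACA0 = basic_axioms \<union> {induction_axiom} \<union> {comprehension p | p. arithmetical p}"

subsection \<open>Truth in the standard model\<close>

primrec eval :: "(nat \<Rightarrow> nat) \<Rightarrow> tm \<Rightarrow> nat" where
  "eval e (Var n) = e n"
| "eval e Zero = 0"
| "eval e One = 1"
| "eval e (Add s t) = eval e s + eval e t"
| "eval e (Mul s t) = eval e s * eval e t"

primrec sat :: "(nat \<Rightarrow> nat) \<Rightarrow> (nat \<Rightarrow> nat set) \<Rightarrow> fm \<Rightarrow> bool" where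
  "sat e E Bot = False"
| "sat e E (Eq s t) = (eval e s = eval e t)"
| "sat e E (Less s t) = (eval e s < eval e t)"
| "sat e E (Mem t X) = (eval e t \<in> E X)"
| "sat e E (Imp p q) = (sat e E p \<longrightarrow> sat e E q)"
| "sat e E (Forall p) = (\<forall>n. sat (case_nat n e) E p)"
| "sat e E (ForallS p) = (\<forall>X. sat e (case_nat X E) p)"

inductive delta0 :: "fm \<Rightarrow> bool" where
  "delta0 Bot"
| "delta0 (Eq s t)"
| "delta0 (Less s t)"
| "delta0 (Mem t X)"
| "delta0 p \<Longrightarrow> delta0 q \<Longrightarrow> delta0 (Imp p q)"
| "delta0 p \<Longrightarrow> delta0 (Forall (Imp (Less (Var 0) (lift_tm t)) p))"

inductive pi1 :: "fm \<Rightarrow> bool" where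
  "delta0 p \<Longrightarrow> pi1 p"
| "pi1 p \<Longrightarrow> pi1 (Forall p)"

text \<open>\<open>true_pi1 \<theta> B\<close>: the \<open>\<Pi>\<^sup>0\<^sub>1\<close> formula \<open>\<theta>\<close> is true of the set \<open>B\<close>, which is assigned to the
  free set variable 0. A set of numbers, possibly undecidable, can enter a formula of
  second-order arithmetic only as a set variable \<open>X\<close>, and \<open>ACA\<^sub>0\<close> has to be told which set \<open>X\<close> is
  meant: a claim about \<open>B\<close> is rendered as \<open>\<theta>(X) \<longrightarrow> \<dots>\<close>, where \<open>\<theta>\<close> is any such description.
  If, for example, \<open>B\<close> is the extension of a bounded formula \<open>\<delta>\<close>, then
  \<open>\<forall>x. x \<in> X \<longleftrightarrow> \<delta>(x)\<close> can be taken for \<open>\<theta>\<close>; the trivial description \<open>\<theta>\<close> is \<open>0 = 0\<close>.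
  For descriptions of arbitrary complexity, unprovability would depend on the description
  and not only on \<open>B\<close>.\<close>

definition true_pi1 :: "fm \<Rightarrow> nat set \<Rightarrow> bool" where
  "true_pi1 \<theta> B \<longleftrightarrow> pi1 \<theta> \<and> (\<forall>e E. sat e (case_nat B E) \<theta>)"


section \<open>The Goodstein principle as a formula of second-order arithmetic\<close>

text \<open>To write large formulas without manipulating indices, we use functions of the number of
  enclosing number quantifiers \<open>d\<close> and of enclosing set quantifiers \<open>s\<close>. The variable bound
  by a quantifier at depth \<open>d\<close> has index \<open>d' - Suc d\<close> at depth \<open>d'\<close>. Sets are represented by
  classes, i.e. formulas with an argument place for a term.\<close>

type_synonym xtm = "nat \<Rightarrow> tm"
type_synonym xfm = "nat \<Rightarrow> nat \<Rightarrow> fm"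
type_synonym xcl = "xtm \<Rightarrow> xfm"

definition xzero :: xtm ("0\<^sub>f") where "xzero d = Zero"
definition xone :: xtm ("1\<^sub>f") where "xone d = One"
definition xadd :: "xtm \<Rightarrow> xtm \<Rightarrow> xtm" (infixl "+\<^sub>f" 65) where
  "xadd x y d = Add (x d) (y d)"
definition xmul :: "xtm \<Rightarrow> xtm \<Rightarrow> xtm" (infixl "*\<^sub>f" 70) where
  "xmul x y d = Mul (x d) (y d)"

definition xeq :: "xtm \<Rightarrow> xtm \<Rightarrow> xfm" (infix "=\<^sub>f" 50) where
  "xeq x y d s = Eq (x d) (y d)"
definition xless :: "xtm \<Rightarrow> xtm \<Rightarrow> xfm" (infix "<\<^sub>f" 50) where
  "xless x y d s = Less (x d) (y d)"
definition xneg :: "xfm \<Rightarrow> xfm" ("\<not>\<^sub>f _" [40] 40) where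
  "xneg p d s = Neg (p d s)"
definition xconj :: "xfm \<Rightarrow> xfm \<Rightarrow> xfm" (infixr "\<and>\<^sub>f" 35) where
  "xconj p q d s = Conj (p d s) (q d s)"
definition xdisj :: "xfm \<Rightarrow> xfm \<Rightarrow> xfm" (infixr "\<or>\<^sub>f" 30) where
  "xdisj p q d s = Disj (p d s) (q d s)"
definition ximp :: "xfm \<Rightarrow> xfm \<Rightarrow> xfm" (infixr "\<longrightarrow>\<^sub>f" 25) where
  "ximp p q d s = Imp (p d s) (q d s)"
definition xiff :: "xfm \<Rightarrow> xfm \<Rightarrow> xfm" (infixr "\<longleftrightarrow>\<^sub>f" 25) where
  "xiff p q d s = Iff (p d s) (q d s)"
definition xall :: "(xtm \<Rightarrow> xfm) \<Rightarrow> xfm" (binder "\<forall>\<^sub>f" 10) where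
  "xall P d s = Forall (P (\<lambda>d'. Var (d' - Suc d)) (Suc d) s)"
definition xex :: "(xtm \<Rightarrow> xfm) \<Rightarrow> xfm" (binder "\<exists>\<^sub>f" 10) where
  "xex P d s = Exists (P (\<lambda>d'. Var (d' - Suc d)) (Suc d) s)"
definition xallS :: "(xcl \<Rightarrow> xfm) \<Rightarrow> xfm" (binder "\<forall>\<^sub>S" 10) where
  "xallS P d s = ForallS (P (\<lambda>t d' s'. Mem (t d') (s' - Suc s)) d (Suc s))"
definition xexS :: "(xcl \<Rightarrow> xfm) \<Rightarrow> xfm" (binder "\<exists>\<^sub>S" 10) where
  "xexS P d s = ExistsS (P (\<lambda>t d' s'. Mem (t d') (s' - Suc s)) d (Suc s))"

definition xle :: "xtm \<Rightarrow> xtm \<Rightarrow> xfm" (infix "\<le>\<^sub>f" 50) where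
  "x \<le>\<^sub>f y = (x <\<^sub>f y \<or>\<^sub>f x =\<^sub>f y)"
definition xdvd :: "xtm \<Rightarrow> xtm \<Rightarrow> xfm" (infix "dvd\<^sub>f" 50) where
  "x dvd\<^sub>f y = (\<exists>\<^sub>f z. y =\<^sub>f x *\<^sub>f z)"

text \<open>An injective pairing, and the sections of a binary relation. Partial functions and
  sequences of sets are represented by sets of pairs.\<close>

definition xpair :: "xtm \<Rightarrow> xtm \<Rightarrow> xtm" where
  "xpair x y = (x +\<^sub>f y) *\<^sub>f (x +\<^sub>f y) +\<^sub>f x"
definition xapp :: "xcl \<Rightarrow> xtm \<Rightarrow> xcl" where
  "xapp F x y = F (xpair x y)"

definition xmin :: "xcl \<Rightarrow> xtm \<Rightarrow> xfm" where
  "xmin B x = (B x \<and>\<^sub>f (\<forall>\<^sub>f y. B y \<longrightarrow>\<^sub>f x \<le>\<^sub>f y))"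
definition xmax :: "xcl \<Rightarrow> xtm \<Rightarrow> xfm" where
  "xmax B x = (B x \<and>\<^sub>f (\<forall>\<^sub>f y. B y \<longrightarrow>\<^sub>f y \<le>\<^sub>f x))"

definition xbase_of :: "xcl \<Rightarrow> xtm \<Rightarrow> xcl" where
  "xbase_of B n b = (\<exists>\<^sub>f m. xmin B m \<and>\<^sub>f
    ((m \<le>\<^sub>f n \<and>\<^sub>f xmax (\<lambda>x. B x \<and>\<^sub>f x \<le>\<^sub>f n) b) \<or>\<^sub>f (n <\<^sub>f m \<and>\<^sub>f b =\<^sub>f m)))"

definition xnext_base :: "xcl \<Rightarrow> xtm \<Rightarrow> xcl" where
  "xnext_base B n = xmin (\<lambda>x. B x \<and>\<^sub>f n <\<^sub>f x)"

definition xcritical :: "xcl \<Rightarrow> xtm \<Rightarrow> xfm" where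
  "xcritical B n = (\<exists>\<^sub>f b. xbase_of B n b \<and>\<^sub>f b dvd\<^sub>f n)"

text \<open>\<open>x = b ^ e\<close>, via the set of all pairs \<open>(e, b ^ e)\<close>.\<close>

definition xpower :: "xtm \<Rightarrow> xtm \<Rightarrow> xcl" where
  "xpower b e x = (\<exists>\<^sub>S P.
    (\<forall>\<^sub>f k. \<forall>\<^sub>f y. xapp P k y \<longleftrightarrow>\<^sub>f
      (k =\<^sub>f 0\<^sub>f \<and>\<^sub>f y =\<^sub>f 1\<^sub>f) \<or>\<^sub>f
      (\<exists>\<^sub>f l. \<exists>\<^sub>f z. k =\<^sub>f l +\<^sub>f 1\<^sub>f \<and>\<^sub>f xapp P l z \<and>\<^sub>f y =\<^sub>f z *\<^sub>f b)) \<and>\<^sub>f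
    xapp P e x)"

text \<open>\<open>n = q * a + r\<close> with \<open>q = b ^ e\<close> is the \<open>b\<close>-decomposition of \<open>n\<close>.\<close>

definition xdecomp :: "xtm \<Rightarrow> xtm \<Rightarrow> xtm \<Rightarrow> xtm \<Rightarrow> xtm \<Rightarrow> xfm" where
  "xdecomp b n e a r = (\<exists>\<^sub>f q. xpower b e q \<and>\<^sub>f n =\<^sub>f q *\<^sub>f a +\<^sub>f r \<and>\<^sub>f
    q \<le>\<^sub>f n \<and>\<^sub>f n <\<^sub>f q *\<^sub>f b \<and>\<^sub>f 0\<^sub>f <\<^sub>f a \<and>\<^sub>f a <\<^sub>f b \<and>\<^sub>f r <\<^sub>f q)"

text \<open>The following predicates describe the graphs of partial functions; the value \<open>\<infinity>\<close> is
  rendered by the absence of a value.\<close>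

definition xchange :: "xcl \<Rightarrow> xtm \<Rightarrow> xtm \<Rightarrow> xtm \<Rightarrow> xcl" where
  "xchange U b c n x = (\<exists>\<^sub>S F.
    (\<forall>\<^sub>f m. \<forall>\<^sub>f v. xapp F m v \<longleftrightarrow>\<^sub>f
      (m <\<^sub>f b \<and>\<^sub>f xapp U m v) \<or>\<^sub>f
      (b \<le>\<^sub>f m \<and>\<^sub>f (\<exists>\<^sub>f e. \<exists>\<^sub>f a. \<exists>\<^sub>f r. xdecomp b m e a r \<and>\<^sub>f
        (\<exists>\<^sub>f e'. \<exists>\<^sub>f a'. \<exists>\<^sub>f r'. \<exists>\<^sub>f p. xapp F e e' \<and>\<^sub>f xapp U a a' \<and>\<^sub>f xapp F r r' \<and>\<^sub>f
          xpower c e' p \<and>\<^sub>f v =\<^sub>f p *\<^sub>f a' +\<^sub>f r')))) \<and>\<^sub>f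
    xapp F n x)"

text \<open>\<open>c \<in> C\<close> satisfies the requirement in the definition of \<open>\<up>n\<close>, with \<open>\<langle>b \<rightarrow> c\<rangle>n = v\<close>.\<close>

definition xadmissible :: "xcl \<Rightarrow> xcl \<Rightarrow> xtm \<Rightarrow> xtm \<Rightarrow> xtm \<Rightarrow> xtm \<Rightarrow> xfm" where
  "xadmissible C U b n c v = (C c \<and>\<^sub>f xchange U b c n v \<and>\<^sub>f
    (\<exists>\<^sub>f p. \<exists>\<^sub>f w. n =\<^sub>f p +\<^sub>f 1\<^sub>f \<and>\<^sub>f xapp U p w \<and>\<^sub>f w <\<^sub>f v) \<and>\<^sub>f
    (\<forall>\<^sub>f s. xnext_base C c s \<longrightarrow>\<^sub>f v <\<^sub>f s))"

definition xis_upgrade :: "xcl \<Rightarrow> xcl \<Rightarrow> xcl \<Rightarrow> xfm" where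
  "xis_upgrade B C U = (\<exists>\<^sub>f m. xmin B m \<and>\<^sub>f
    (\<forall>\<^sub>f n. \<forall>\<^sub>f v. xapp U n v \<longleftrightarrow>\<^sub>f
      (n <\<^sub>f m \<and>\<^sub>f v =\<^sub>f n) \<or>\<^sub>f
      (m \<le>\<^sub>f n \<and>\<^sub>f (\<exists>\<^sub>f b. xbase_of B n b \<and>\<^sub>f
        (\<exists>\<^sub>f c. xadmissible C U b n c v \<and>\<^sub>f
          (\<forall>\<^sub>f c'. c' <\<^sub>f c \<longrightarrow>\<^sub>f \<not>\<^sub>f (\<exists>\<^sub>f v'. xadmissible C U b n c' v')))))))"

definition xiter_change :: "xcl \<Rightarrow> xtm \<Rightarrow> xtm \<Rightarrow> xtm \<Rightarrow> xtm \<Rightarrow> xcl" where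
  "xiter_change U b n c j x = (\<exists>\<^sub>S D.
    (\<forall>\<^sub>f k. \<forall>\<^sub>f y. xapp D k y \<longleftrightarrow>\<^sub>f
      (k =\<^sub>f 0\<^sub>f \<and>\<^sub>f y =\<^sub>f c) \<or>\<^sub>f
      (\<exists>\<^sub>f l. \<exists>\<^sub>f d. k =\<^sub>f l +\<^sub>f 1\<^sub>f \<and>\<^sub>f xapp D l d \<and>\<^sub>f xchange U b d n y)) \<and>\<^sub>f
    xapp D j x)"

text \<open>The elements added in passing from stage \<open>p\<close>, which is \<open>C\<close>, to stage \<open>n = p + 1\<close>.\<close>

definition xnew_base :: "xcl \<Rightarrow> xtm \<Rightarrow> xcl \<Rightarrow> xtm \<Rightarrow> xtm \<Rightarrow> xcl" where
  "xnew_base B i C p n x = (xcritical B n \<and>\<^sub>f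
    (\<exists>\<^sub>f c. xmax C c \<and>\<^sub>f (\<exists>\<^sub>S U. xis_upgrade B C U \<and>\<^sub>f
      ((B n \<and>\<^sub>f (\<exists>\<^sub>f b. xbase_of B p b \<and>\<^sub>f (\<exists>\<^sub>f a. x =\<^sub>f c *\<^sub>f a \<and>\<^sub>f
          (\<exists>\<^sub>f w. xchange U b c p w \<and>\<^sub>f w <\<^sub>f c *\<^sub>f a \<and>\<^sub>f
            (\<forall>\<^sub>f a'. a' <\<^sub>f a \<longrightarrow>\<^sub>f \<not>\<^sub>f w <\<^sub>f c *\<^sub>f a'))))) \<or>\<^sub>f
       ((\<not>\<^sub>f B n) \<and>\<^sub>f (\<exists>\<^sub>f b. xbase_of B n b \<and>\<^sub>f
          (\<exists>\<^sub>f j. 1\<^sub>f \<le>\<^sub>f j \<and>\<^sub>f j \<le>\<^sub>f i \<and>\<^sub>f xiter_change U b n c j x)))))))"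

text \<open>\<open>Z\<close> is the sequence of the stages of the Ouroboros successor.\<close>

definition xis_ouro_stages :: "xcl \<Rightarrow> xtm \<Rightarrow> xcl \<Rightarrow> xfm" where
  "xis_ouro_stages B i Z = (\<exists>\<^sub>f m. xmin B m \<and>\<^sub>f
    (\<forall>\<^sub>f n. \<forall>\<^sub>f x. xapp Z n x \<longleftrightarrow>\<^sub>f
      (n \<le>\<^sub>f m \<and>\<^sub>f x =\<^sub>f m +\<^sub>f 1\<^sub>f) \<or>\<^sub>f
      (m <\<^sub>f n \<and>\<^sub>f (\<exists>\<^sub>f p. n =\<^sub>f p +\<^sub>f 1\<^sub>f \<and>\<^sub>f
        (xapp Z p x \<or>\<^sub>f xnew_base B i (xapp Z p) p n x)))))"

definition xis_ouro_seq :: "xcl \<Rightarrow> xcl \<Rightarrow> xfm" where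
  "xis_ouro_seq X H = (
    (\<forall>\<^sub>f x. xapp H 0\<^sub>f x \<longleftrightarrow>\<^sub>f X x) \<and>\<^sub>f
    (\<forall>\<^sub>f i. \<exists>\<^sub>S Z. xis_ouro_stages (xapp H i) (i +\<^sub>f 1\<^sub>f) Z \<and>\<^sub>f
      (\<forall>\<^sub>f x. xapp H (i +\<^sub>f 1\<^sub>f) x \<longleftrightarrow>\<^sub>f (\<exists>\<^sub>f n. xapp Z n x))))"

definition xis_goodstein :: "xcl \<Rightarrow> xtm \<Rightarrow> xcl \<Rightarrow> xfm" where
  "xis_goodstein H n W = (
    (\<forall>\<^sub>f x. xapp W 0\<^sub>f x \<longleftrightarrow>\<^sub>f x =\<^sub>f n) \<and>\<^sub>f
    (\<forall>\<^sub>f i. \<forall>\<^sub>f x. xapp W (i +\<^sub>f 1\<^sub>f) x \<longleftrightarrow>\<^sub>f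
      (\<exists>\<^sub>f k. xapp W i k \<and>\<^sub>f
        ((k =\<^sub>f 0\<^sub>f \<and>\<^sub>f x =\<^sub>f 0\<^sub>f) \<or>\<^sub>f
         (0\<^sub>f <\<^sub>f k \<and>\<^sub>f (\<exists>\<^sub>S U. xis_upgrade (xapp H i) (xapp H (i +\<^sub>f 1\<^sub>f)) U \<and>\<^sub>f
            xapp U k (x +\<^sub>f 1\<^sub>f)))))))"

definition xgoodstein_principle :: "xcl \<Rightarrow> xfm" where
  "xgoodstein_principle X =
    (\<forall>\<^sub>S H. xis_ouro_seq X H \<longrightarrow>\<^sub>f
      (\<forall>\<^sub>f n. \<forall>\<^sub>S W. xis_goodstein H n W \<longrightarrow>\<^sub>f (\<exists>\<^sub>f i. xapp W i 0\<^sub>f)))"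

text \<open>The hierarchy \<open>B\<^sub>0\<close> is the free set variable 0. See \<open>goodstein_principle_correct\<close> below for
  the meaning of this formula in the standard model.\<close>

definition goodstein_principle :: fm where
  "goodstein_principle = xgoodstein_principle (\<lambda>t d s. Mem (t d) (s - 1)) 0 1"


section \<open>The formula expresses the Goodstein principle\<close>

text \<open>Proof of \<open>goodstein_principle_correct\<close>: in the standard model, \<open>goodstein_principle\<close> says
  that for the sequence \<open>ouro_seq B\<close> every Goodstein sequence reaches 0.

  A world fixes the values of the variables bound so far, by depth; it is extended when passing
  under a quantifier. \<open>tden\<close>, \<open>fden\<close> and \<open>cden\<close> relate terms, formulas and classes to their values
  in all extensions of a world.\<close>

type_synonym world = "(nat \<times> (nat \<Rightarrow> nat)) \<times> (nat \<times> (nat \<Rightarrow> nat set))"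

definition env :: "nat \<Rightarrow> (nat \<Rightarrow> 'a) \<Rightarrow> (nat \<Rightarrow> 'a) \<Rightarrow> nat \<Rightarrow> 'a" where
  "env d \<nu> e i = (if i < d then \<nu> (d - Suc i) else e (i - d))"

lemma env_case: "case_nat v (env d \<nu> e) = env (Suc d) (\<nu>(d := v)) e"
  by (rule ext) (auto simp: env_def split: nat.splits)

fun wle :: "world \<Rightarrow> world \<Rightarrow> bool" where
  "wle ((d, \<nu>), (s, N)) ((d', \<nu>'), (s', N')) \<longleftrightarrow>
     d \<le> d' \<and> s \<le> s' \<and> (\<forall>k<d. \<nu>' k = \<nu> k) \<and> (\<forall>k<s. N' k = N k)"

lemma wle_refl: "wle w w" by (cases w) auto
lemma wle_trans: "wle w w' \<Longrightarrow> wle w' w'' \<Longrightarrow> wle w w''"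
  by (cases "(w, w')" rule: wle.cases, cases w'') auto

definition pr :: "nat \<Rightarrow> nat \<Rightarrow> nat" where "pr x y = (x + y) * (x + y) + x"

locale base_env = fixes e0 :: "nat \<Rightarrow> nat" and E0 :: "nat \<Rightarrow> nat set"
begin

fun ev :: "world \<Rightarrow> xtm \<Rightarrow> nat" where
  "ev ((d, \<nu>), (s, N)) t = eval (env d \<nu> e0) (t d)"
fun st :: "world \<Rightarrow> xfm \<Rightarrow> bool" where
  "st ((d, \<nu>), (s, N)) p = sat (env d \<nu> e0) (env s N E0) (p d s)"

definition "tden w t v \<longleftrightarrow> (\<forall>w'. wle w w' \<longrightarrow> ev w' t = v)"
definition "fden w p P \<longleftrightarrow> (\<forall>w'. wle w w' \<longrightarrow> st w' p = P)"
definition "cden w C A \<longleftrightarrow> (\<forall>w' t v. wle w w' \<longrightarrow> tden w' t v \<longrightarrow> fden w' (C t) (v \<in> A))"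

lemma tden_mono: "tden w t v \<Longrightarrow> wle w w' \<Longrightarrow> tden w' t v"
  unfolding tden_def using wle_trans by blast
lemma fden_mono: "fden w p P \<Longrightarrow> wle w w' \<Longrightarrow> fden w' p P"
  unfolding fden_def using wle_trans by blast
lemma cden_mono: "cden w C A \<Longrightarrow> wle w w' \<Longrightarrow> cden w' C A"
  unfolding cden_def using wle_trans by blast

lemma den_zero: "tden w 0\<^sub>f 0" and den_one: "tden w 1\<^sub>f 1"
  by (auto simp: tden_def xzero_def xone_def)
lemma den_add: "tden w x a \<Longrightarrow> tden w y b \<Longrightarrow> tden w (x +\<^sub>f y) (a + b)"
  and den_mul: "tden w x a \<Longrightarrow> tden w y b \<Longrightarrow> tden w (x *\<^sub>f y) (a * b)"
  by (fastforce simp: tden_def xadd_def xmul_def)+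
lemma den_eq: "tden w x a \<Longrightarrow> tden w y b \<Longrightarrow> fden w (x =\<^sub>f y) (a = b)"
  and den_less: "tden w x a \<Longrightarrow> tden w y b \<Longrightarrow> fden w (x <\<^sub>f y) (a < b)"
  by (fastforce simp: tden_def fden_def xeq_def xless_def)+
lemma den_neg: "fden w p P \<Longrightarrow> fden w (\<not>\<^sub>f p) (\<not> P)"
  and den_conj: "fden w p P \<Longrightarrow> fden w q Q \<Longrightarrow> fden w (p \<and>\<^sub>f q) (P \<and> Q)"
  and den_disj: "fden w p P \<Longrightarrow> fden w q Q \<Longrightarrow> fden w (p \<or>\<^sub>f q) (P \<or> Q)"
  and den_imp: "fden w p P \<Longrightarrow> fden w q Q \<Longrightarrow> fden w (p \<longrightarrow>\<^sub>f q) (P \<longrightarrow> Q)"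
  and den_iff: "fden w p P \<Longrightarrow> fden w q Q \<Longrightarrow> fden w (p \<longleftrightarrow>\<^sub>f q) (P \<longleftrightarrow> Q)"
  by (fastforce simp: fden_def xneg_def xconj_def xdisj_def ximp_def xiff_def
      Neg_def Conj_def Disj_def Iff_def)+

lemma den_all:
  assumes "\<And>w' t v. wle w w' \<Longrightarrow> tden w' t v \<Longrightarrow> fden w' (P t) (Q v)"
  shows "fden w (\<forall>\<^sub>f x. P x) (\<forall>v. Q v)"
  unfolding fden_def
proof (intro allI impI)
  fix w' assume w: "wle w w'"
  obtain d \<nu> s N where w': "w' = ((d, \<nu>), (s, N))" by (cases w') auto
  let ?t = "\<lambda>d'. Var (d' - Suc d)"
  have "sat (case_nat v (env d \<nu> e0)) (env s N E0) (P ?t (Suc d) s) = Q v" for v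
  proof -
    let ?w = "((Suc d, \<nu>(d := v)), (s, N))"
    have le: "wle w' ?w" by (simp add: w')
    have "tden ?w ?t v"
      unfolding tden_def
    proof (intro allI impI)
      fix w2 assume "wle ?w w2"
      then show "ev w2 ?t = v"
        by (cases w2) (auto simp: env_def)
    qed
    then have "fden ?w (P ?t) (Q v)" using assms wle_trans[OF w le] by blast
    then show ?thesis using wle_refl[of ?w] unfolding fden_def by (auto simp: env_case)
  qed
  then show "st w' (\<forall>\<^sub>f x. P x) = (\<forall>v. Q v)" by (simp add: w' xall_def)
qed

lemma xex_eq: "xex P = (\<not>\<^sub>f (\<forall>\<^sub>f x. \<not>\<^sub>f P x))"
  by (intro ext) (simp add: xex_def xall_def xneg_def Exists_def)

lemma den_ex:
  assumes "\<And>w' t v. wle w w' \<Longrightarrow> tden w' t v \<Longrightarrow> fden w' (P t) (Q v)"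
  shows "fden w (\<exists>\<^sub>f x. P x) (\<exists>v. Q v)"
proof -
  have "fden w (\<not>\<^sub>f (\<forall>\<^sub>f x. \<not>\<^sub>f P x)) (\<not> (\<forall>v. \<not> Q v))"
    by (intro den_neg den_all assms)
  then show ?thesis by (simp add: xex_eq)
qed

lemma den_allS:
  assumes "\<And>w' C A. wle w w' \<Longrightarrow> cden w' C A \<Longrightarrow> fden w' (P C) (Q A)"
  shows "fden w (\<forall>\<^sub>S X. P X) (\<forall>A. Q A)"
  unfolding fden_def
proof (intro allI impI)
  fix w' assume w: "wle w w'"
  obtain d \<nu> s N where w': "w' = ((d, \<nu>), (s, N))" by (cases w') auto
  let ?C = "\<lambda>t d' s'. Mem (t d') (s' - Suc s)"
  have "sat (env d \<nu> e0) (case_nat A (env s N E0)) (P ?C d (Suc s)) = Q A" for A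
  proof -
    let ?w = "((d, \<nu>), (Suc s, N(s := A)))"
    have le: "wle w' ?w" by (simp add: w')
    have "cden ?w ?C A"
      unfolding cden_def fden_def
    proof (intro allI impI)
      fix w2 t v w3 assume *: "wle ?w w2" "tden w2 t v" "wle w2 w3"
      obtain d3 \<nu>3 s3 N3 where w3: "w3 = ((d3, \<nu>3), (s3, N3))" by (cases w3) auto
      have "ev w3 t = v" using *(2,3) unfolding tden_def by blast
      moreover have "wle ?w w3" using * wle_trans by blast
      ultimately show "st w3 (?C t) = (v \<in> A)" by (auto simp: w3 env_def)
    qed
    then have "fden ?w (P ?C) (Q A)" using assms wle_trans[OF w le] by blast
    then show ?thesis using wle_refl[of ?w] unfolding fden_def by (auto simp: env_case)
  qed
  then show "st w' (\<forall>\<^sub>S X. P X) = (\<forall>A. Q A)" by (simp add: w' xallS_def)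
qed

lemma xexS_eq: "xexS P = (\<not>\<^sub>f (\<forall>\<^sub>S X. \<not>\<^sub>f P X))"
  by (intro ext) (simp add: xexS_def xallS_def xneg_def ExistsS_def)

lemma den_exS:
  assumes "\<And>w' C A. wle w w' \<Longrightarrow> cden w' C A \<Longrightarrow> fden w' (P C) (Q A)"
  shows "fden w (\<exists>\<^sub>S X. P X) (\<exists>A. Q A)"
proof -
  have "fden w (\<not>\<^sub>f (\<forall>\<^sub>S X. \<not>\<^sub>f P X)) (\<not> (\<forall>A. \<not> Q A))"
    by (intro den_neg den_allS assms)
  then show ?thesis by (simp add: xexS_eq)
qed

lemma den_app: "cden w C A \<Longrightarrow> tden w t v \<Longrightarrow> fden w (C t) (v \<in> A)"
  using wle_refl unfolding cden_def by blast

lemma den_class: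
  assumes "\<And>w' t v. wle w w' \<Longrightarrow> tden w' t v \<Longrightarrow> fden w' (P t) (Q v)"
  shows "cden w P {v. Q v}"
  using assms unfolding cden_def by simp

lemma den_le: "tden w x a \<Longrightarrow> tden w y b \<Longrightarrow> fden w (x \<le>\<^sub>f y) (a \<le> b)"
  unfolding xle_def le_less by (intro den_disj den_less den_eq)


lemma den_pair: "tden w x a \<Longrightarrow> tden w y b \<Longrightarrow> tden w (xpair x y) (pr a b)"
  unfolding xpair_def pr_def by (intro den_add den_mul)

lemma den_xapp: "cden w C A \<Longrightarrow> tden w x a \<Longrightarrow> tden w y b \<Longrightarrow> fden w (xapp C x y) (pr a b \<in> A)"
  unfolding xapp_def by (intro den_app den_pair)

lemma den_section: "cden w C A \<Longrightarrow> tden w x a \<Longrightarrow> cden w (xapp C x) {y. pr a y \<in> A}"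
  by (intro den_class den_xapp) (auto intro: cden_mono tden_mono)

lemmas den_rules = den_zero den_one den_add den_mul den_eq den_less den_le den_neg den_conj
  den_disj den_imp den_iff den_all den_ex den_allS den_exS den_xapp
lemmas den_monos = tden_mono cden_mono

lemma den_dvd: "tden w x a \<Longrightarrow> tden w y b \<Longrightarrow> fden w (x dvd\<^sub>f y) (a dvd b)"
  unfolding xdvd_def dvd_def by (assumption | rule den_rules | (erule (1) den_monos))+

lemma den_min: "cden w B A \<Longrightarrow> tden w x a \<Longrightarrow> fden w (xmin B x) (a \<in> A \<and> (\<forall>y. y \<in> A \<longrightarrow> a \<le> y))"
  unfolding xmin_def by (assumption | rule den_rules | (erule (1) den_monos)| rule den_app)+

lemma den_max: "cden w B A \<Longrightarrow> tden w x a \<Longrightarrow> fden w (xmax B x) (a \<in> A \<and> (\<forall>y. y \<in> A \<longrightarrow> y \<le> a))"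
  unfolding xmax_def by (assumption | rule den_rules | (erule (1) den_monos)| rule den_app)+

end

lemma pr_inj: "pr a b = pr c d \<longleftrightarrow> a = c \<and> b = d"
proof
  assume *: "pr a b = pr c d"
  have aux: "pr x y < pr u v" if "x + y < u + v" for x y u v
  proof -
    have "Suc (x + y) * Suc (x + y) \<le> (u + v) * (u + v)"
      using that by (intro mult_le_mono) auto
    then show ?thesis unfolding pr_def by simp
  qed
  have "a + b = c + d" using * aux[of a b c d] aux[of c d a b] by (cases "a + b" "c + d" rule: linorder_cases) auto
  with * show "a = c \<and> b = d" by (simp add: pr_def)
qed simp

text \<open>Sets of pairs specified by well-founded recursion exist and are determined on pairs.\<close>

lemma rec_set:
  assumes "\<And>A n v. (\<And>k v. k < n \<Longrightarrow> pr k v \<in> A \<longleftrightarrow> f k v) \<Longrightarrow> \<Phi> A n v \<longleftrightarrow> f n v"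
  shows "(\<forall>n v. pr n v \<in> A \<longleftrightarrow> \<Phi> A n v) \<longleftrightarrow> (\<forall>n v. pr n v \<in> A \<longleftrightarrow> f n v)"
proof
  assume *: "\<forall>n v. pr n v \<in> A \<longleftrightarrow> \<Phi> A n v"
  have "\<forall>v. pr n v \<in> A \<longleftrightarrow> f n v" for n
    by (induction n rule: less_induct) (use * assms in blast)
  then show "\<forall>n v. pr n v \<in> A \<longleftrightarrow> f n v" by blast
next
  assume "\<forall>n v. pr n v \<in> A \<longleftrightarrow> f n v"
  then show "\<forall>n v. pr n v \<in> A \<longleftrightarrow> \<Phi> A n v" using assms by blast
qed

lemma ex_pair_set: "(\<exists>A. (\<forall>n v. pr n v \<in> A \<longleftrightarrow> f n v) \<and> pr n v \<in> A) \<longleftrightarrow> f n v"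
proof -
  have "\<forall>m u. pr m u \<in> {z. \<exists>k w. z = pr k w \<and> f k w} \<longleftrightarrow> f m u" by (auto simp: pr_inj)
  then show ?thesis by blast
qed

lemma ex_rec_set:
  assumes "\<And>A n v. (\<And>k v. k < n \<Longrightarrow> pr k v \<in> A \<longleftrightarrow> f k v) \<Longrightarrow> \<Phi> A n v \<longleftrightarrow> f n v"
  shows "(\<exists>A. (\<forall>n v. pr n v \<in> A \<longleftrightarrow> \<Phi> A n v) \<and> pr n v \<in> A) \<longleftrightarrow> f n v"
  by (simp only: rec_set[of f \<Phi>, OF assms] ex_pair_set)

lemma fden_cong: "base_env.fden e E w p P \<Longrightarrow> P = Q \<Longrightarrow> base_env.fden e E w p Q"
  by simp

lemma nonempty_min: "(\<exists>m. (m \<in> A \<and> (\<forall>y. y \<in> A \<longrightarrow> m \<le> y)) \<and> P m) \<longleftrightarrow> A \<noteq> {} \<and> P (Inf A)"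
  for A :: "nat set"
proof
  assume "\<exists>m. (m \<in> A \<and> (\<forall>y. y \<in> A \<longrightarrow> m \<le> y)) \<and> P m"
  then obtain m where m: "m \<in> A" "\<forall>y. y \<in> A \<longrightarrow> m \<le> y" "P m" by blast
  then have "Inf A = m" by (intro cInf_eq_minimum) auto
  with m show "A \<noteq> {} \<and> P (Inf A)" by auto
next
  assume "A \<noteq> {} \<and> P (Inf A)"
  then show "\<exists>m. (m \<in> A \<and> (\<forall>y. y \<in> A \<longrightarrow> m \<le> y)) \<and> P m"
    by (intro exI[of _ "Inf A"]) (auto intro: Inf_nat_def1 cInf_lower)
qed

lemma decomp_iff:
  "n = b ^ e * a + r \<and> b ^ e \<le> n \<and> n < b ^ e * b \<and> 0 < a \<and> a < b \<and> r < b ^ e \<longleftrightarrow>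
   2 \<le> b \<and> 0 < n \<and> e = bexp b n \<and> a = n div b ^ bexp b n \<and> r = n mod b ^ bexp b n"
  for b n e a r :: nat
proof
  assume *: "n = b ^ e * a + r \<and> b ^ e \<le> n \<and> n < b ^ e * b \<and> 0 < a \<and> a < b \<and> r < b ^ e"
  then have b: "2 \<le> b" by auto
  then have n: "0 < n" using * by (metis less_le_trans less_nat_zero_code neq0_conv zero_less_power pos2 gr_zeroI)
  have "b ^ e < b ^ Suc (bexp b n)" "b ^ bexp b n < b ^ Suc e"
    using bexp_bounds[OF b n] * by (auto simp: mult.commute)
  then have "e = bexp b n" using b by (simp add: power_strict_increasing_iff del: power_Suc)
  moreover have "a = n div b ^ e" "r = n mod b ^ e" using * by auto
  ultimately show "2 \<le> b \<and> 0 < n \<and> e = bexp b n \<and> a = n div b ^ bexp b n \<and> r = n mod b ^ bexp b n"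
    using b n by simp
next
  assume *: "2 \<le> b \<and> 0 < n \<and> e = bexp b n \<and> a = n div b ^ bexp b n \<and> r = n mod b ^ bexp b n"
  then have "b ^ e \<le> n" "n < b ^ e * b" using bexp_bounds[of b n] by (auto simp: mult.commute)
  moreover have "0 < b ^ e" using * by simp
  ultimately show "n = b ^ e * a + r \<and> b ^ e \<le> n \<and> n < b ^ e * b \<and> 0 < a \<and> a < b \<and> r < b ^ e"
    using * by (auto simp: div_greater_zero_iff less_mult_imp_div_less mult.commute)
qed

function chset :: "nat set \<Rightarrow> nat \<Rightarrow> nat \<Rightarrow> nat \<Rightarrow> nat set" where
  "chset A b c m =
    (if m < b then {v. pr m v \<in> A}
     else if b < 2 \<or> m = 0 then {}
     else {c ^ e' * a' + r' | e' a' r'. e' \<in> chset A b c (bexp b m) \<and>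
            pr (m div b ^ bexp b m) a' \<in> A \<and> r' \<in> chset A b c (m mod b ^ bexp b m)})"
  by pat_completeness auto
termination
  by (relation "measure (\<lambda>(u, b, c, m). m)") (auto intro!: bexp_less bmod_less)
declare chset.simps [simp del]

primrec itset :: "nat set \<Rightarrow> nat \<Rightarrow> nat \<Rightarrow> nat \<Rightarrow> nat \<Rightarrow> nat set" where
  "itset A b n c 0 = {c}"
| "itset A b n c (Suc j) = {y. \<exists>d\<in>itset A b n c j. y \<in> chset A b d n}"

context base_env
begin

lemma den_base_of:
  assumes "cden w B A" "tden w n k" "tden w b x"
  shows "fden w (xbase_of B n b) (A \<noteq> {} \<and> x = base_of A k)"
proof (rule fden_cong)
  show "fden w (xbase_of B n b) (\<exists>m. (m \<in> A \<and> (\<forall>y. y \<in> A \<longrightarrow> m \<le> y)) \<and>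
     (m \<le> k \<and> (x \<in> {b. b \<in> A \<and> b \<le> k} \<and> (\<forall>y. y \<in> {b. b \<in> A \<and> b \<le> k} \<longrightarrow> y \<le> x)) \<or> k < m \<and> x = m))"
    unfolding xbase_of_def using assms
    by - (assumption | rule den_min den_max den_class den_rules | blast intro: den_monos wle_trans | rule den_app)+
  have fin: "finite {b \<in> A. b \<le> k}" by simp
  show "(\<exists>m. (m \<in> A \<and> (\<forall>y. y \<in> A \<longrightarrow> m \<le> y)) \<and>
     (m \<le> k \<and> (x \<in> {b. b \<in> A \<and> b \<le> k} \<and> (\<forall>y. y \<in> {b. b \<in> A \<and> b \<le> k} \<longrightarrow> y \<le> x)) \<or> k < m \<and> x = m)) \<longleftrightarrow>
    A \<noteq> {} \<and> x = base_of A k"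
    unfolding nonempty_min
  proof (intro conj_cong refl)
    assume "A \<noteq> {}"
    then have "Inf A \<in> A" by (rule Inf_nat_def1)
    then show "(Inf A \<le> k \<and> (x \<in> {b. b \<in> A \<and> b \<le> k} \<and> (\<forall>y. y \<in> {b. b \<in> A \<and> b \<le> k} \<longrightarrow> y \<le> x)) \<or>
      k < Inf A \<and> x = Inf A) = (x = base_of A k)"
      using eq_Max_iff[OF fin, of x] by (auto simp: base_of_def)
  qed
qed

lemma den_next_base:
  assumes "cden w B A" "tden w n k" "tden w b x"
  shows "fden w (xnext_base B n b) (next_base A k = enat x)"
proof (rule fden_cong)
  show "fden w (xnext_base B n b) (x \<in> {b. b \<in> A \<and> k < b} \<and> (\<forall>y. y \<in> {b. b \<in> A \<and> k < b} \<longrightarrow> x \<le> y))"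
    unfolding xnext_base_def using assms
    by - (assumption | rule den_min den_max den_class den_rules | blast intro: den_monos wle_trans | rule den_app)+
  show "(x \<in> {b. b \<in> A \<and> k < b} \<and> (\<forall>y. y \<in> {b. b \<in> A \<and> k < b} \<longrightarrow> x \<le> y)) =
    (next_base A k = enat x)"
    unfolding next_base_def
    by (auto intro!: Least_equality intro: LeastI2_wellorder)
qed

lemma den_critical:
  assumes "cden w B A" "tden w n k"
  shows "fden w (xcritical B n) (A \<noteq> {} \<and> critical A k)"
proof (rule fden_cong)
  show "fden w (xcritical B n) (\<exists>b. (A \<noteq> {} \<and> b = base_of A k) \<and> b dvd k)"
    unfolding xcritical_def using assms
    by - (assumption | rule den_base_of den_dvd den_rules | blast intro: den_monos wle_trans | rule den_app)+
qed (auto simp: critical_def)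

lemma den_power:
  assumes "tden w b x" "tden w e y" "tden w z v"
  shows "fden w (xpower b e z) (v = x ^ y)"
proof (rule fden_cong)
  let ?\<Phi> = "\<lambda>A k y. (k = 0 \<and> y = 1) \<or> (\<exists>l z. k = l + 1 \<and> pr l z \<in> A \<and> y = z * x)"
  show "fden w (xpower b e z) (\<exists>A. (\<forall>k y. (pr k y \<in> A) = ?\<Phi> A k y) \<and> pr y v \<in> A)"
    unfolding xpower_def using assms
    by - (assumption | rule den_rules | blast intro: den_monos wle_trans | rule den_app)+
  show "(\<exists>A. (\<forall>k y. (pr k y \<in> A) = ?\<Phi> A k y) \<and> pr y v \<in> A) = (v = x ^ y)"
  proof (rule ex_rec_set[of "\<lambda>n v. v = x ^ n"])
    fix A n v assume *: "\<And>k v. k < n \<Longrightarrow> (pr k v \<in> A) = (v = x ^ k)"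
    show "?\<Phi> A n v = (v = x ^ n)"
      by (cases n) (use * in \<open>auto simp: mult.commute\<close>)
  qed
qed

lemma den_decomp:
  assumes "tden w b x" "tden w n y" "tden w e e'" "tden w a a'" "tden w r r'"
  shows "fden w (xdecomp b n e a r) (2 \<le> x \<and> 0 < y \<and> e' = bexp x y \<and>
    a' = y div x ^ bexp x y \<and> r' = y mod x ^ bexp x y)"
proof (rule fden_cong)
  show "fden w (xdecomp b n e a r) (\<exists>q. q = x ^ e' \<and> y = q * a' + r' \<and> q \<le> y \<and> y < q * x \<and>
    0 < a' \<and> a' < x \<and> r' < q)"
    unfolding xdecomp_def using assms
    by - (assumption | rule den_power den_rules | blast intro: den_monos wle_trans | rule den_app)+
qed (simp add: decomp_iff)

lemma den_change:
  assumes "cden w U A" "tden w b y" "tden w c z" "tden w n k" "tden w x v"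
  shows "fden w (xchange U b c n x) (v \<in> chset A y z k)"
proof (rule fden_cong)
  let ?\<Phi> = "\<lambda>F m v. (m < y \<and> pr m v \<in> A) \<or>
      (y \<le> m \<and> (\<exists>e a r. (2 \<le> y \<and> 0 < m \<and> e = bexp y m \<and> a = m div y ^ bexp y m \<and> r = m mod y ^ bexp y m) \<and>
        (\<exists>e' a' r' p. pr e e' \<in> F \<and> pr a a' \<in> A \<and> pr r r' \<in> F \<and> p = z ^ e' \<and> v = p * a' + r')))"
  show "fden w (xchange U b c n x) (\<exists>F. (\<forall>m v. (pr m v \<in> F) = ?\<Phi> F m v) \<and> pr k v \<in> F)"
    unfolding xchange_def using assms
    by - (assumption | rule den_power den_decomp den_rules | blast intro: den_monos wle_trans | rule den_app)+
  show "(\<exists>F. (\<forall>m v. (pr m v \<in> F) = ?\<Phi> F m v) \<and> pr k v \<in> F) = (v \<in> chset A y z k)"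
  proof (rule ex_rec_set[of "\<lambda>m v. v \<in> chset A y z m"])
    fix F m v assume *: "\<And>k v. k < m \<Longrightarrow> (pr k v \<in> F) = (v \<in> chset A y z k)"
    show "?\<Phi> F m v = (v \<in> chset A y z m)"
      by (subst chset.simps) (auto simp: * bexp_less bmod_less)
  qed
qed

lemma den_ex_min:
  assumes "cden w B A" "\<And>w' t v. wle w w' \<Longrightarrow> tden w' t v \<Longrightarrow> fden w' (P t) (Q v)"
  shows "fden w (\<exists>\<^sub>f m. xmin B m \<and>\<^sub>f P m) (A \<noteq> {} \<and> Q (Inf A))"
  unfolding nonempty_min[symmetric] using assms
  by - (assumption | rule den_min den_rules | blast intro: den_monos wle_trans)+

definition adm where
  "adm C A b n c v \<longleftrightarrow> c \<in> C \<and> v \<in> chset A b c n \<and> (\<exists>p w. n = p + 1 \<and> pr p w \<in> A \<and> w < v) \<and>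
    (\<forall>s. next_base C c = enat s \<longrightarrow> v < s)"

lemma den_admissible:
  assumes "cden w C' C" "cden w U A" "tden w b y" "tden w c z" "tden w n k" "tden w x v"
  shows "fden w (xadmissible C' U b n c x) (adm C A y k z v)"
  unfolding adm_def xadmissible_def using assms
  by - (assumption | rule den_change den_next_base den_rules | blast intro: den_monos wle_trans | rule den_app)+

definition is_upg where
  "is_upg B C A \<longleftrightarrow> B \<noteq> {} \<and> (\<forall>n v. pr n v \<in> A \<longleftrightarrow>
    (n < Inf B \<and> v = n) \<or> (Inf B \<le> n \<and> (\<exists>b. (B \<noteq> {} \<and> b = base_of B n) \<and>
      (\<exists>c. adm C A b n c v \<and> (\<forall>c'. c' < c \<longrightarrow> \<not> (\<exists>v'. adm C A b n c' v'))))))"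

lemma den_is_upgrade:
  assumes "cden w B' B" "cden w C' C" "cden w U A"
  shows "fden w (xis_upgrade B' C' U) (is_upg B C A)"
  unfolding is_upg_def xis_upgrade_def using assms
  by - (rule den_ex_min[where Q = "\<lambda>m. \<forall>n v. pr n v \<in> A \<longleftrightarrow>
    (n < m \<and> v = n) \<or> (m \<le> n \<and> (\<exists>b. (B \<noteq> {} \<and> b = base_of B n) \<and>
      (\<exists>c. adm C A b n c v \<and> (\<forall>c'. c' < c \<longrightarrow> \<not> (\<exists>v'. adm C A b n c' v')))))"],
    (assumption | rule den_admissible den_base_of den_min den_rules | blast intro: den_monos wle_trans | rule den_app)+)

lemma den_iter_change:
  assumes "cden w U A" "tden w b y" "tden w c z" "tden w n k" "tden w j i" "tden w x v"
  shows "fden w (xiter_change U b n c j x) (v \<in> itset A y k z i)"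
proof (rule fden_cong)
  let ?\<Phi> = "\<lambda>D i v. (i = 0 \<and> v = z) \<or> (\<exists>l d. i = l + 1 \<and> pr l d \<in> D \<and> v \<in> chset A y d k)"
  show "fden w (xiter_change U b n c j x) (\<exists>F. (\<forall>m v. (pr m v \<in> F) = ?\<Phi> F m v) \<and> pr i v \<in> F)"
    unfolding xiter_change_def using assms
    by - (assumption | rule den_change den_rules | blast intro: den_monos wle_trans | rule den_app)+
  show "(\<exists>F. (\<forall>m v. (pr m v \<in> F) = ?\<Phi> F m v) \<and> pr i v \<in> F) = (v \<in> itset A y k z i)"
  proof (rule ex_rec_set[of "\<lambda>m v. v \<in> itset A y k z m"])
    fix F m v assume *: "\<And>k' v. k' < m \<Longrightarrow> (pr k' v \<in> F) = (v \<in> itset A y k z k')"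
    show "?\<Phi> F m v = (v \<in> itset A y k z m)"
      by (cases m) (auto simp: *)
  qed
qed

definition is_new where
  "is_new B i C p n x \<longleftrightarrow> (B \<noteq> {} \<and> critical B n) \<and>
    (\<exists>c. (c \<in> C \<and> (\<forall>y. y \<in> C \<longrightarrow> y \<le> c)) \<and> (\<exists>A. is_upg B C A \<and>
      ((n \<in> B \<and> (\<exists>b. (B \<noteq> {} \<and> b = base_of B p) \<and> (\<exists>a. x = c * a \<and>
         (\<exists>w. w \<in> chset A b c p \<and> w < c * a \<and> (\<forall>a'. a' < a \<longrightarrow> \<not> w < c * a'))))) \<or>
       (n \<notin> B \<and> (\<exists>b. (B \<noteq> {} \<and> b = base_of B n) \<and>
         (\<exists>j. 1 \<le> j \<and> j \<le> i \<and> x \<in> itset A b n c j))))))"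

lemma den_new_base:
  assumes "cden w B' B" "cden w C' C" "tden w i i'" "tden w p p'" "tden w n n'" "tden w x x'"
  shows "fden w (xnew_base B' i C' p n x) (is_new B i' C p' n' x')"
  unfolding is_new_def xnew_base_def using assms
  by - (assumption | rule den_critical den_max den_is_upgrade den_change den_iter_change den_base_of den_rules | blast intro: den_monos wle_trans | rule den_app)+

definition is_stages where
  "is_stages B i Z \<longleftrightarrow> B \<noteq> {} \<and> (\<forall>n x. pr n x \<in> Z \<longleftrightarrow>
    (n \<le> Inf B \<and> x = Inf B + 1) \<or> (Inf B < n \<and> (\<exists>p. n = p + 1 \<and>
      (pr p x \<in> Z \<or> is_new B i {x. pr p x \<in> Z} p n x))))"

lemma den_is_ouro_stages:
  assumes "cden w B' B" "tden w i i'" "cden w Z' Z"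
  shows "fden w (xis_ouro_stages B' i Z') (is_stages B i' Z)"
  unfolding is_stages_def xis_ouro_stages_def using assms
  by - (rule den_ex_min[where Q = "\<lambda>m. \<forall>n x. pr n x \<in> Z \<longleftrightarrow>
    (n \<le> m \<and> x = m + 1) \<or> (m < n \<and> (\<exists>p. n = p + 1 \<and>
      (pr p x \<in> Z \<or> is_new B i' {x. pr p x \<in> Z} p n x)))"],
    (assumption | rule den_new_base den_section den_min den_rules | blast intro: den_monos wle_trans | rule den_app)+)

definition is_seq where
  "is_seq X H \<longleftrightarrow> (\<forall>x. pr 0 x \<in> H \<longleftrightarrow> x \<in> X) \<and>
    (\<forall>i. \<exists>Z. is_stages {x. pr i x \<in> H} (i + 1) Z \<and> (\<forall>x. pr (i + 1) x \<in> H \<longleftrightarrow> (\<exists>n. pr n x \<in> Z)))"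

lemma den_is_ouro_seq:
  assumes "cden w X' X" "cden w H' H"
  shows "fden w (xis_ouro_seq X' H') (is_seq X H)"
  unfolding is_seq_def xis_ouro_seq_def using assms
  by - (assumption | rule den_is_ouro_stages den_section den_rules | blast intro: den_monos wle_trans | rule den_app)+

definition is_good where
  "is_good H n W \<longleftrightarrow> (\<forall>x. pr 0 x \<in> W \<longleftrightarrow> x = n) \<and>
    (\<forall>i x. pr (i + 1) x \<in> W \<longleftrightarrow> (\<exists>k. pr i k \<in> W \<and> (k = 0 \<and> x = 0 \<or>
      0 < k \<and> (\<exists>A. is_upg {x. pr i x \<in> H} {x. pr (i + 1) x \<in> H} A \<and> pr k (x + 1) \<in> A))))"

lemma den_is_goodstein:
  assumes "cden w H' H" "tden w n k" "cden w W' W"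
  shows "fden w (xis_goodstein H' n W') (is_good H k W)"
  unfolding is_good_def xis_goodstein_def using assms
  by - (assumption | rule den_is_upgrade den_section den_rules | blast intro: den_monos wle_trans | rule den_app)+

lemma den_goodstein_principle:
  assumes "cden w X' X"
  shows "fden w (xgoodstein_principle X')
    (\<forall>H. is_seq X H \<longrightarrow> (\<forall>n W. is_good H n W \<longrightarrow> (\<exists>i. pr i 0 \<in> W)))"
  unfolding xgoodstein_principle_def using assms
  by - (assumption | rule den_is_ouro_seq den_is_goodstein den_rules | blast intro: den_monos wle_trans | rule den_app)+

lemma sat_goodstein_principle_raw:
  "sat e0 (case_nat X E0) goodstein_principle \<longleftrightarrow>
    (\<forall>H. is_seq X H \<longrightarrow> (\<forall>n W. is_good H n W \<longrightarrow> (\<exists>i. pr i 0 \<in> W)))"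
proof -
  let ?C = "\<lambda>t d s. Mem (t d) (s - 1)" and ?w = "((0, \<lambda>_. 0), (1, \<lambda>_. X))"
  have "cden ?w ?C X"
    unfolding cden_def fden_def
  proof (intro allI impI)
    fix w2 t v w3 assume *: "wle ?w w2" "tden w2 t v" "wle w2 w3"
    obtain d3 \<nu>3 s3 N3 where w3: "w3 = ((d3, \<nu>3), (s3, N3))" by (cases w3) auto
    have "ev w3 t = v" using *(2,3) unfolding tden_def by blast
    moreover have "wle ?w w3" using * wle_trans by blast
    ultimately show "st w3 (?C t) = (v \<in> X)" by (auto simp: w3 env_def)
  qed
  from den_goodstein_principle[OF this] wle_refl[of ?w]
  have "st ?w (xgoodstein_principle ?C) \<longleftrightarrow>
    (\<forall>H. is_seq X H \<longrightarrow> (\<forall>n W. is_good H n W \<longrightarrow> (\<exists>i. pr i 0 \<in> W)))"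
    unfolding fden_def by blast
  moreover have "env 0 (\<lambda>_. 0) e0 = e0" "env 1 (\<lambda>_. X) E0 = case_nat X E0"
    by (auto simp: env_def fun_eq_iff split: nat.splits)
  ultimately show ?thesis by (simp add: goodstein_principle_def)
qed

end

definition ok :: "nat set \<Rightarrow> bool" where "ok B \<longleftrightarrow> B \<noteq> {} \<and> B \<subseteq> {2..}"

lemma ok_min: "ok B \<Longrightarrow> 2 \<le> Inf B" "ok B \<Longrightarrow> Inf B \<in> B"
  unfolding ok_def using Inf_nat_def1[of B] by auto

lemma base_of_bounds:
  assumes "ok B" "Inf B \<le> n"
  shows "base_of B n \<in> B" "base_of B n \<le> n"
proof -
  have "{b \<in> B. b \<le> n} \<noteq> {}" using assms ok_min[of B] by blast
  then have "Max {b \<in> B. b \<le> n} \<in> {b \<in> B. b \<le> n}" by (intro Max_in) auto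
  then have "base_of B n \<in> {b \<in> B. b \<le> n}"
    unfolding base_of_def using assms by simp
  then show "base_of B n \<in> B" "base_of B n \<le> n" by auto
qed

lemma base_of_ge2: assumes "ok B" shows "2 \<le> base_of B n"
proof (cases "Inf B \<le> n")
  case True then show ?thesis using base_of_bounds[OF assms] assms by (auto simp: ok_def)
next
  case False then show ?thesis using ok_min[OF assms] by (simp add: base_of_def)
qed

lemma bdiv_bounds:
  assumes "2 \<le> b" "b \<le> n"
  shows "0 < n div b ^ bexp b n" "n div b ^ bexp b n < b" "0 < bexp b n"
proof -
  have *: "n = b ^ bexp b n * (n div b ^ bexp b n) + n mod b ^ bexp b n \<and> b ^ bexp b n \<le> n \<and>
    n < b ^ bexp b n * b \<and> 0 < n div b ^ bexp b n \<and> n div b ^ bexp b n < b \<and>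
    n mod b ^ bexp b n < b ^ bexp b n"
    by (subst decomp_iff) (use assms in auto)
  then show "0 < n div b ^ bexp b n" "n div b ^ bexp b n < b" by auto
  show "0 < bexp b n" using * assms by (cases "bexp b n") auto
qed

lemma change_cong:
  assumes "2 \<le> b" "\<And>m. m < b \<Longrightarrow> u m = u' m"
  shows "change u b c n = change u' b c n"
proof (induction n rule: less_induct)
  case (less n)
  show ?case
  proof (cases "n < b")
    case True then show ?thesis using assms by (simp add: change.simps[of _ b c n])
  next
    case False
    then have "b \<le> n" by simp
    then show ?thesis
      using less bdiv_bounds[OF assms(1)] bexp_less[of b n] bmod_less[of b n] assms
      by (simp add: change.simps[of _ b c n])
  qed
qed

lemma enat_eq_plus: "x + y = enat v \<longleftrightarrow> (\<exists>a b. x = enat a \<and> y = enat b \<and> v = a + b)"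
  by (cases x; cases y) auto

lemma enat_eq_mul:
  assumes "x \<noteq> 0" "y \<noteq> 0"
  shows "x * y = enat v \<longleftrightarrow> (\<exists>a b. x = enat a \<and> y = enat b \<and> v = a * b)"
  using assms by (cases x; cases y) (auto simp: zero_enat_def imult_is_infinity)

lemma epow_eq: "epow c x = enat v \<longleftrightarrow> (\<exists>k. x = enat k \<and> v = c ^ k)"
  by (cases x) auto

lemma epow_ne0: "1 \<le> c \<Longrightarrow> epow c x \<noteq> 0"
  by (cases x) (auto simp: zero_enat_def)

lemma chset_change:
  assumes b: "2 \<le> b" and c: "1 \<le> c"
    and A: "\<And>k v. k < b \<Longrightarrow> pr k v \<in> A \<longleftrightarrow> u k = enat v"
    and pos: "\<And>k. 0 < k \<Longrightarrow> k < b \<Longrightarrow> u k \<noteq> 0"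
  shows "v \<in> chset A b c n \<longleftrightarrow> change u b c n = enat v"
proof (induction n arbitrary: v rule: less_induct)
  case (less n)
  show ?case
  proof (cases "n < b")
    case True then show ?thesis using A by (simp add: change.simps[of _ b c n] chset.simps[of _ b c n])
  next
    case False
    then have n: "b \<le> n" "0 < n" using b by auto
    note d = bdiv_bounds[OF b n(1)]
    have IH: "v \<in> chset A b c (bexp b n) \<longleftrightarrow> change u b c (bexp b n) = enat v"
      "v \<in> chset A b c (n mod b ^ bexp b n) \<longleftrightarrow> change u b c (n mod b ^ bexp b n) = enat v" for v
      using less bexp_less[OF b n(2)] bmod_less[OF b n(2)] by auto
    have p: "u (n div b ^ bexp b n) \<noteq> 0" using pos d by blast
    have "change u b c n = enat v \<longleftrightarrow>
      (\<exists>e' a' r'. change u b c (bexp b n) = enat e' \<and> u (n div b ^ bexp b n) = enat a' \<and>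
         change u b c (n mod b ^ bexp b n) = enat r' \<and> v = c ^ e' * a' + r')"
      using n b by (subst change.simps)
        (auto simp: enat_eq_plus enat_eq_mul[OF epow_ne0[OF c] p] epow_eq; blast)
    also have "\<dots> \<longleftrightarrow> v \<in> chset A b c n"
      using n b by (subst chset.simps) (auto simp: IH A[OF d(2)])
    finally show ?thesis by simp
  qed
qed

lemma change_ge:
  assumes b: "2 \<le> b" and c: "2 \<le> c" and pos: "\<And>k. 0 < k \<Longrightarrow> k < b \<Longrightarrow> u k \<noteq> 0"
  shows "0 < n \<Longrightarrow> change u b c n \<noteq> 0" "b \<le> n \<Longrightarrow> 2 \<le> change u b c n"
proof -
  have *: "change u b c n \<noteq> 0 \<and> (b \<le> n \<longrightarrow> 2 \<le> change u b c n)" if "0 < n" for n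
    using that
  proof (induction n rule: less_induct)
    case (less n)
    show ?case
    proof (cases "n < b")
      case True then show ?thesis using less pos by (simp add: change.simps[of _ b c n])
    next
      case False
      then have n: "b \<le> n" "0 < n" using b by auto
      note d = bdiv_bounds[OF b n(1)]
      have "change u b c (bexp b n) \<noteq> 0" using less.IH[OF bexp_less[OF b n(2)] d(3)] by simp
      then have "enat 2 \<le> epow c (change u b c (bexp b n))"
      proof (cases "change u b c (bexp b n)")
        case (enat k)
        then have "c ^ 1 \<le> c ^ k" using c \<open>change u b c (bexp b n) \<noteq> 0\<close>
          by (intro power_increasing) (auto simp: zero_enat_def)
        then show ?thesis using enat c by simp
      qed simp
      moreover have "enat 1 \<le> u (n div b ^ bexp b n)"
        using pos[OF d(1,2)] by (cases "u (n div b ^ bexp b n)") (auto simp: zero_enat_def)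
      ultimately have "enat 2 * enat 1 \<le> epow c (change u b c (bexp b n)) * u (n div b ^ bexp b n)"
        by (rule mult_mono) auto
      then have "2 \<le> change u b c n" using n b
        by (subst change.simps) (auto simp: numeral_eq_enat intro: add_increasing2)
      then show ?thesis by auto
    qed
  qed
  show "0 < n \<Longrightarrow> change u b c n \<noteq> 0" using * by blast
  show "b \<le> n \<Longrightarrow> 2 \<le> change u b c n" using * b by auto
qed

lemma upgrade_less: "n < Inf B \<Longrightarrow> upgrade B C n = enat n"
  by (simp add: upgrade.simps)

lemma upgrade_eq:
  assumes "ok B" "Inf B \<le> n"
  shows "upgrade B C n =
    (let u = upgrade B C; b = base_of B n;
         K = {c \<in> C. u (n - 1) < change u b c n \<and> change u b c n < next_base C c}
     in if K = {} then \<infinity> else change u b (Inf K) n)"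
proof -
  let ?u = "\<lambda>m. if m < n then upgrade B C m else 0"
  have 1: "change ?u (base_of B n) c n = change (upgrade B C) (base_of B n) c n" for c
    by (rule change_cong) (use base_of_ge2[OF assms(1), of n] base_of_bounds(2)[OF assms] in auto)
  have 2: "n - 1 < n" using ok_min[OF assms(1)] assms(2) by linarith
  show ?thesis using assms(2) 2 by (subst upgrade.simps) (simp add: Let_def 1 cong: conj_cong)
qed

lemma upgrade_pos: assumes "ok B" "0 < n" shows "upgrade B C n \<noteq> 0"
proof (cases "n < Inf B")
  case True then show ?thesis using assms by (simp add: upgrade_less zero_enat_def)
next
  case False
  define K where "K = {c \<in> C. upgrade B C (n - 1) < change (upgrade B C) (base_of B n) c n \<and>
    change (upgrade B C) (base_of B n) c n < next_base C c}"
  have up: "upgrade B C n = (if K = {} then \<infinity> else change (upgrade B C) (base_of B n) (Inf K) n)"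
    using False upgrade_eq[OF assms(1), of n C] unfolding Let_def K_def[symmetric] by simp
  have "0 < change (upgrade B C) (base_of B n) (Inf K) n" if "K \<noteq> {}"
    using Inf_nat_def1[OF that] unfolding K_def by (auto dest: less_le_trans intro: le_less_trans[OF zero_le])
  then show ?thesis by (auto simp: up)
qed

lemma is_upg_iff:
  assumes B: "ok B" and C: "C \<subseteq> {1..}"
  shows "base_env.is_upg B C A \<longleftrightarrow> (\<forall>n v. pr n v \<in> A \<longleftrightarrow> upgrade B C n = enat v)"
proof -
  have ne: "B \<noteq> {}" using B by (simp add: ok_def)
  have "base_env.is_upg B C A \<longleftrightarrow> (\<forall>n v. pr n v \<in> A \<longleftrightarrow>
      (n < Inf B \<and> v = n \<or> Inf B \<le> n \<and> (\<exists>b. b = base_of B n \<and>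
      (\<exists>c. base_env.adm C A b n c v \<and> (\<forall>c'<c. \<not> (\<exists>v'. base_env.adm C A b n c' v'))))))"
    unfolding base_env.is_upg_def by (simp add: ne)
  also have "\<dots> \<longleftrightarrow> (\<forall>n v. pr n v \<in> A \<longleftrightarrow> upgrade B C n = enat v)"
  proof (rule rec_set)
    fix A n v assume A: "\<And>k v. k < n \<Longrightarrow> pr k v \<in> A \<longleftrightarrow> upgrade B C k = enat v"
    show "(n < Inf B \<and> v = n \<or> Inf B \<le> n \<and> (\<exists>b. b = base_of B n \<and>
      (\<exists>c. base_env.adm C A b n c v \<and> (\<forall>c'<c. \<not> (\<exists>v'. base_env.adm C A b n c' v'))))) \<longleftrightarrow>
      upgrade B C n = enat v"
    proof (cases "n < Inf B")
      case True then show ?thesis by (auto simp: upgrade_less)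
    next
      case False
      then have n: "Inf B \<le> n" by simp
      let ?b = "base_of B n" and ?u = "upgrade B C"
      define K where "K = {c \<in> C. ?u (n - 1) < change ?u ?b c n \<and> change ?u ?b c n < next_base C c}"
      have n0: "n = (n - 1) + 1" "n - 1 < n" using ok_min(1)[OF B] n by auto
      have ch: "v \<in> chset A ?b c n \<longleftrightarrow> change ?u ?b c n = enat v" if "c \<in> C" for c v
      proof (rule chset_change)
        show "2 \<le> ?b" by (rule base_of_ge2[OF B])
        show "1 \<le> c" using that C by auto
        show "pr k v \<in> A \<longleftrightarrow> ?u k = enat v" if "k < ?b" for k v
          using A base_of_bounds(2)[OF B n] that by auto
      qed (simp add: upgrade_pos B)
      have "(\<exists>p w. n = p + 1 \<and> pr p w \<in> A \<and> w < v) \<longleftrightarrow> (\<exists>w. pr (n - 1) w \<in> A \<and> w < v)" for v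
        using n0(2) by (cases n) auto
      then have prev: "(\<exists>p w. n = p + 1 \<and> pr p w \<in> A \<and> w < v) \<longleftrightarrow> ?u (n - 1) < enat v" for v
        using A[OF n0(2)] by (cases "?u (n - 1)") auto
      have nxt: "(\<forall>s. next_base C c = enat s \<longrightarrow> v < s) \<longleftrightarrow> enat v < next_base C c" for c v
        by (cases "next_base C c") auto
      have adm: "base_env.adm C A ?b n c v \<longleftrightarrow> c \<in> K \<and> change ?u ?b c n = enat v" for c v
        unfolding base_env.adm_def prev nxt K_def using ch[of c v] by auto
      have fin: "\<exists>v. change ?u ?b c n = enat v" if "c \<in> K" for c
        using that unfolding K_def by (cases "change ?u ?b c n") auto
      have exadm: "(\<exists>v'. c \<in> K \<and> change ?u ?b c n = enat v') \<longleftrightarrow> c \<in> K" for c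
        using fin by blast
      have up: "?u n = (if K = {} then \<infinity> else change ?u ?b (Inf K) n)"
        using upgrade_eq[OF B n, of C] unfolding Let_def K_def[symmetric] .
      have "(\<exists>c. base_env.adm C A ?b n c v \<and> (\<forall>c'<c. \<not> (\<exists>v'. base_env.adm C A ?b n c' v'))) \<longleftrightarrow>
        (\<exists>c. c \<in> K \<and> change ?u ?b c n = enat v \<and> (\<forall>c'<c. c' \<notin> K))"
        by (simp only: adm exadm conj_assoc)
      also have "\<dots> \<longleftrightarrow> ?u n = enat v"
      proof (cases "K = {}")
        case True then show ?thesis by (simp add: up)
      next
        case False
        then have K: "Inf K \<in> K" by (rule Inf_nat_def1)
        have lower: "Inf K \<le> c" if "c \<in> K" for c using that by (intro cInf_lower) auto
        have "c = Inf K" if "c \<in> K" "\<forall>c'<c. c' \<notin> K" for c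
          using that(2) K lower[OF that(1)] by (cases "Inf K < c") auto
        moreover have "\<forall>c'<Inf K. c' \<notin> K" using lower by (meson not_le)
        ultimately have "(\<exists>c. c \<in> K \<and> change ?u ?b c n = enat v \<and> (\<forall>c'<c. c' \<notin> K)) \<longleftrightarrow>
          change ?u ?b (Inf K) n = enat v" using K by blast
        then show ?thesis using False by (simp only: up if_False)
      qed
      finally show ?thesis using n False by auto
    qed
  qed
  finally show ?thesis .
qed

lemma ex_upg:
  assumes "ok B" "C \<subseteq> {1..}"
  shows "\<exists>A. base_env.is_upg B C A"
proof
  show "base_env.is_upg B C {z. \<exists>k w. z = pr k w \<and> upgrade B C k = enat w}"
    by (subst is_upg_iff) (use assms in \<open>auto simp: pr_inj\<close>)
qed

lemma iter_ge2:
  assumes "2 \<le> b" "2 \<le> c" "b \<le> n" "\<And>k. 0 < k \<Longrightarrow> k < b \<Longrightarrow> u k \<noteq> 0"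
  shows "2 \<le> iter_change u b n c j"
proof (induction j)
  case 0 then show ?case using assms by (simp add: numeral_eq_enat)
next
  case (Suc j)
  then show ?case using change_ge(2)[OF assms(1) _ assms(4) assms(3)]
    by (auto split: enat.splits simp: numeral_eq_enat)
qed

lemma itset_iter:
  assumes "2 \<le> b" "2 \<le> c" "b \<le> n" "\<And>k. 0 < k \<Longrightarrow> k < b \<Longrightarrow> u k \<noteq> 0"
    "\<And>k v. pr k v \<in> A \<longleftrightarrow> u k = enat v"
  shows "x \<in> itset A b n c j \<longleftrightarrow> iter_change u b n c j = enat x"
proof (induction j arbitrary: x)
  case (Suc j)
  show ?case
  proof (cases "iter_change u b n c j")
    case (enat d)
    then have "1 \<le> d" using iter_ge2[of b c n u j] assms(1-4) by (simp add: numeral_eq_enat)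
    from chset_change[OF assms(1) this assms(5) assms(4)] show ?thesis using Suc enat by auto
  next
    case infinity
    then show ?thesis using Suc by auto
  qed
qed auto

lemma least_mult: "{c * a | a. w < enat (c * a) \<and> (\<forall>a'<a. \<not> w < enat (c * a'))} \<subseteq>
   {c * (LEAST a. w < enat (c * a))}"
  by (auto intro!: arg_cong[of _ _ "(*) c"] Least_equality[symmetric]) (meson not_le)

declare ouro_stage.simps(2) [simp del]

lemma stage_ok:
  assumes B: "ok B"
  shows "finite (ouro_stage B i n) \<and> ok (ouro_stage B i n)"
proof (induction n)
  case 0 then show ?case using ok_min[OF B] by (simp add: ok_def)
next
  case (Suc p)
  let ?C = "ouro_stage B i p" and ?n = "Suc p"
  let ?c = "Max ?C" and ?u = "upgrade B ?C"
  have c: "?c \<in> ?C" using Suc Max_in[of ?C] by (simp add: ok_def)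
  moreover have "?C \<subseteq> {2..}" using Suc by (simp add: ok_def)
  ultimately have c2: "2 \<le> ?c" by auto
  define N1 where "N1 = {?c * a | a. change ?u (base_of B p) ?c p < enat (?c * a) \<and>
                        (\<forall>a'<a. \<not> change ?u (base_of B p) ?c p < enat (?c * a'))}"
  define N2 where "N2 = {x. \<exists>j. 1 \<le> j \<and> j \<le> i \<and> iter_change ?u (base_of B ?n) ?n ?c j = enat x}"
  have N1f: "finite N1" unfolding N1_def by (rule finite_subset[OF least_mult]) simp
  have N1s: "N1 \<subseteq> {2..}"
  proof
    fix x assume "x \<in> N1"
    then obtain a where a: "x = ?c * a" "change ?u (base_of B p) ?c p < enat (?c * a)"
      unfolding N1_def by blast
    then have "a \<noteq> 0" by (intro notI) (simp add: zero_enat_def[symmetric])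
    then show "x \<in> {2..}" using c2 a(1) by (cases a) simp_all
  qed
  have N2f: "finite N2"
  proof (rule finite_subset)
    show "N2 \<subseteq> (\<lambda>j. the_enat (iter_change ?u (base_of B ?n) ?n ?c j)) ` {..i}"
    proof
      fix x assume "x \<in> N2"
      then obtain j where j: "j \<le> i" "iter_change ?u (base_of B ?n) ?n ?c j = enat x"
        unfolding N2_def by blast
      then show "x \<in> (\<lambda>j. the_enat (iter_change ?u (base_of B ?n) ?n ?c j)) ` {..i}"
        by (intro image_eqI[of _ _ j]) simp_all
    qed
  qed simp
  have N2s: "N2 \<subseteq> {2..}" if n: "Inf B \<le> ?n"
  proof
    fix x assume "x \<in> N2"
    then obtain j where "iter_change ?u (base_of B ?n) ?n ?c j = enat x"
      unfolding N2_def by blast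
    moreover have "2 \<le> iter_change ?u (base_of B ?n) ?n ?c j"
      by (rule iter_ge2[OF base_of_ge2[OF B] c2 base_of_bounds(2)[OF B n]]) (rule upgrade_pos[OF B])
    ultimately show "x \<in> {2..}" by (simp add: numeral_eq_enat)
  qed
  have eq: "ouro_stage B i ?n = (if ?n \<le> Inf B then {Inf B + 1} else if \<not> critical B ?n then ?C
    else if ?n \<in> B then ?C \<union> N1 else ?C \<union> N2)"
    unfolding N1_def N2_def ouro_stage.simps(2)[of B i p] Let_def ..
  have C: "finite ?C" "?C \<noteq> {}" "?C \<subseteq> {2..}" using Suc by (auto simp: ok_def)
  show ?case
  proof (cases "?n \<le> Inf B")
    case True
    then show ?thesis using ok_min[OF B] by (simp only: eq if_True) (simp add: ok_def)
  next
    case False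
    then have "N2 \<subseteq> {2..}" by (intro N2s) simp
    then show ?thesis unfolding eq ok_def using False C N1f N1s N2f by simp
  qed
qed

lemma is_new_iff:
  assumes B: "ok B" and n: "Inf B < Suc p"
  shows "x \<in> ouro_stage B i p \<or> base_env.is_new B i (ouro_stage B i p) p (Suc p) x \<longleftrightarrow>
    x \<in> ouro_stage B i (Suc p)"
proof -
  let ?C = "ouro_stage B i p" and ?n = "Suc p"
  let ?c = "Max ?C" and ?u = "upgrade B ?C"
  have C: "finite ?C" "?C \<noteq> {}" "ok ?C" using stage_ok[OF B, of i p] by (auto simp: ok_def)
  then have C1: "?C \<subseteq> {1..}" by (auto simp: ok_def)
  have mx: "c \<in> ?C \<and> (\<forall>y. y \<in> ?C \<longrightarrow> y \<le> c) \<longleftrightarrow> c = ?c" for c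
    using eq_Max_iff[OF C(1,2)] by blast
  have c: "2 \<le> ?c" using Max_in[OF C(1,2)] C(3) by (auto simp: ok_def)
  obtain A where A: "base_env.is_upg B ?C A" using ex_upg[OF B C1] by blast
  have ch: "v \<in> chset A' (base_of B m) ?c m \<longleftrightarrow> change ?u (base_of B m) ?c m = enat v"
    if "base_env.is_upg B ?C A'" for A' m v
    using that chset_change[OF base_of_ge2[OF B], where c = ?c and A = A' and u = ?u] c
    by (auto simp: is_upg_iff[OF B C1] upgrade_pos[OF B])
  have it: "v \<in> itset A' (base_of B ?n) ?n ?c j \<longleftrightarrow>
    iter_change ?u (base_of B ?n) ?n ?c j = enat v" if "base_env.is_upg B ?C A'" for A' j v
    using that itset_iter[OF base_of_ge2[OF B] c base_of_bounds(2)[OF B], where A = A' and u = ?u] n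
    by (auto simp: is_upg_iff[OF B C1] upgrade_pos[OF B])
  have w: "(\<exists>w. y = enat w \<and> w < s \<and> (\<forall>a'<a. \<not> w < t a')) \<longleftrightarrow>
     y < enat s \<and> (\<forall>a'<a. \<not> y < enat (t a'))" for y s a and t :: "nat \<Rightarrow> nat"
    by (cases y) auto
  have ne: "B \<noteq> {}" using B by (simp add: ok_def)
  define R1 where "R1 A' \<longleftrightarrow> (\<exists>a. x = ?c * a \<and> (\<exists>w. w \<in> chset A' (base_of B p) ?c p \<and> w < ?c * a \<and>
         (\<forall>a'<a. \<not> w < ?c * a')))" for A'
  define R2 where "R2 A' \<longleftrightarrow> (\<exists>j. 1 \<le> j \<and> j \<le> i \<and> x \<in> itset A' (base_of B ?n) ?n ?c j)" for A'
  define N1 where "N1 = {?c * a | a. change ?u (base_of B p) ?c p < enat (?c * a) \<and>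
                        (\<forall>a'<a. \<not> change ?u (base_of B p) ?c p < enat (?c * a'))}"
  define N2 where "N2 = {x. \<exists>j. 1 \<le> j \<and> j \<le> i \<and> iter_change ?u (base_of B ?n) ?n ?c j = enat x}"
  have eq: "ouro_stage B i ?n = (if ?n \<le> Inf B then {Inf B + 1} else if \<not> critical B ?n then ?C
    else if ?n \<in> B then ?C \<union> N1 else ?C \<union> N2)"
    unfolding N1_def N2_def ouro_stage.simps(2)[of B i p] Let_def ..
  have R1: "R1 A' \<longleftrightarrow> x \<in> N1" if "base_env.is_upg B ?C A'" for A'
    unfolding R1_def N1_def ch[OF that] w by blast
  have R2: "R2 A' \<longleftrightarrow> x \<in> N2" if "base_env.is_upg B ?C A'" for A'
    unfolding R2_def N2_def it[OF that] by blast
  have "base_env.is_new B i ?C p ?n x \<longleftrightarrow> critical B ?n \<and> (\<exists>A'. base_env.is_upg B ?C A' \<and>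
     ((?n \<in> B \<and> R1 A') \<or> (?n \<notin> B \<and> R2 A')))"
    unfolding base_env.is_new_def mx R1_def R2_def using ne by simp
  also have "\<dots> \<longleftrightarrow> critical B ?n \<and> ((?n \<in> B \<and> x \<in> N1) \<or> (?n \<notin> B \<and> x \<in> N2))"
    using A R1 R2 by blast
  finally show ?thesis using n by (simp add: eq)
qed

lemma is_stages_iff:
  assumes B: "ok B"
  shows "base_env.is_stages B i Z \<longleftrightarrow> (\<forall>n x. pr n x \<in> Z \<longleftrightarrow> x \<in> ouro_stage B i n)"
proof -
  have ne: "B \<noteq> {}" using B by (simp add: ok_def)
  have "base_env.is_stages B i Z \<longleftrightarrow> (\<forall>n x. pr n x \<in> Z \<longleftrightarrow>
      (n \<le> Inf B \<and> x = Inf B + 1 \<or> Inf B < n \<and> (\<exists>p. n = p + 1 \<and>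
      (pr p x \<in> Z \<or> base_env.is_new B i {x. pr p x \<in> Z} p n x))))"
    unfolding base_env.is_stages_def by (simp add: ne)
  also have "\<dots> \<longleftrightarrow> (\<forall>n x. pr n x \<in> Z \<longleftrightarrow> x \<in> ouro_stage B i n)"
  proof (rule rec_set)
    fix Z n x assume Z: "\<And>k v. k < n \<Longrightarrow> pr k v \<in> Z \<longleftrightarrow> v \<in> ouro_stage B i k"
    show "(n \<le> Inf B \<and> x = Inf B + 1 \<or> Inf B < n \<and> (\<exists>p. n = p + 1 \<and>
      (pr p x \<in> Z \<or> base_env.is_new B i {x. pr p x \<in> Z} p n x))) \<longleftrightarrow> x \<in> ouro_stage B i n"
    proof (cases n)
      case 0 then show ?thesis by auto
    next
      case (Suc p)
      have "{x. pr p x \<in> Z} = ouro_stage B i p" using Z[of p] Suc by auto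
      then have *: "(\<exists>q. n = q + 1 \<and> (pr q x \<in> Z \<or> base_env.is_new B i {x. pr q x \<in> Z} q n x)) \<longleftrightarrow>
        x \<in> ouro_stage B i p \<or> base_env.is_new B i (ouro_stage B i p) p (Suc p) x"
        using Z[of p x] Suc by auto
      show ?thesis
      proof (cases "Inf B < Suc p")
        case True
        then show ?thesis using is_new_iff[OF B True, of x i] unfolding * unfolding Suc by simp
      next
        case False
        then show ?thesis unfolding * unfolding Suc
          by (simp add: ouro_stage.simps(2)[of B i p] Let_def not_less)
      qed
    qed
  qed
  finally show ?thesis .
qed

lemma ouro_ok: assumes "ok B" shows "ok (ouro B i)"
proof -
  have "ouro_stage B i n \<noteq> {}" "ouro_stage B i n \<subseteq> {2..}" for n
    using stage_ok[OF assms, of i n] by (simp_all add: ok_def)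
  then show ?thesis unfolding ok_def ouro_def by fast
qed

lemma ouro_seq_ok: "ok B \<Longrightarrow> ok (ouro_seq B i)"
  by (induction i) (auto simp: ouro_ok)

lemma is_seq_iff:
  assumes X: "ok X"
  shows "base_env.is_seq X H \<longleftrightarrow> (\<forall>i x. pr i x \<in> H \<longleftrightarrow> x \<in> ouro_seq X i)"
proof -
  have step: "(\<exists>Z. base_env.is_stages (ouro_seq X i) (i + 1) Z \<and>
      (\<forall>x. pr (i + 1) x \<in> H \<longleftrightarrow> (\<exists>n. pr n x \<in> Z))) \<longleftrightarrow>
    (\<forall>x. pr (i + 1) x \<in> H \<longleftrightarrow> x \<in> ouro_seq X (Suc i))" for i
  proof -
    let ?S = "ouro_stage (ouro_seq X i) (i + 1)"
    obtain Z0 where Z0: "\<And>n x. pr n x \<in> Z0 \<longleftrightarrow> x \<in> ?S n"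
    proof
      show "pr n x \<in> {z. \<exists>k w. z = pr k w \<and> w \<in> ?S k} \<longleftrightarrow> x \<in> ?S n" for n x
        by (auto simp: pr_inj)
    qed
    have st: "base_env.is_stages (ouro_seq X i) (i + 1) Z \<longleftrightarrow> (\<forall>n x. pr n x \<in> Z \<longleftrightarrow> x \<in> ?S n)" for Z
      by (rule is_stages_iff[OF ouro_seq_ok[OF X]])
    have o: "x \<in> ouro_seq X (Suc i) \<longleftrightarrow> (\<exists>n. x \<in> ?S n)" for x
      by (simp add: ouro_def)
    show ?thesis
    proof
      assume "\<exists>Z. base_env.is_stages (ouro_seq X i) (i + 1) Z \<and>
        (\<forall>x. pr (i + 1) x \<in> H \<longleftrightarrow> (\<exists>n. pr n x \<in> Z))"
      then obtain Z where "\<forall>n x. pr n x \<in> Z \<longleftrightarrow> x \<in> ?S n"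
        "\<forall>x. pr (i + 1) x \<in> H \<longleftrightarrow> (\<exists>n. pr n x \<in> Z)" unfolding st by (elim exE conjE)
      then show "\<forall>x. pr (i + 1) x \<in> H \<longleftrightarrow> x \<in> ouro_seq X (Suc i)" by (simp only: o simp_thms)
    next
      assume "\<forall>x. pr (i + 1) x \<in> H \<longleftrightarrow> x \<in> ouro_seq X (Suc i)"
      then show "\<exists>Z. base_env.is_stages (ouro_seq X i) (i + 1) Z \<and>
        (\<forall>x. pr (i + 1) x \<in> H \<longleftrightarrow> (\<exists>n. pr n x \<in> Z))"
        by (intro exI[of _ Z0]) (simp only: st o Z0 simp_thms)
    qed
  qed
  have seq: "base_env.is_seq X H \<longleftrightarrow> (\<forall>x. pr 0 x \<in> H \<longleftrightarrow> x \<in> X) \<and>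
    (\<forall>i. \<exists>Z. base_env.is_stages {x. pr i x \<in> H} (i + 1) Z \<and>
      (\<forall>x. pr (i + 1) x \<in> H \<longleftrightarrow> (\<exists>n. pr n x \<in> Z)))"
    by (rule base_env.is_seq_def)
  show ?thesis
  proof
    assume *: "base_env.is_seq X H"
    have "\<forall>x. pr i x \<in> H \<longleftrightarrow> x \<in> ouro_seq X i" for i
    proof (induction i)
      case 0 then show ?case using conjunct1[OF *[unfolded seq]] by simp
    next
      case (Suc i)
      then have "{x. pr i x \<in> H} = ouro_seq X i" by auto
      with spec[OF conjunct2[OF *[unfolded seq]], of i] step[of i]
      show ?case by (simp only: Suc_eq_plus1 simp_thms)
    qed
    then show "\<forall>i x. pr i x \<in> H \<longleftrightarrow> x \<in> ouro_seq X i" by blast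
  next
    assume *: "\<forall>i x. pr i x \<in> H \<longleftrightarrow> x \<in> ouro_seq X i"
    then have eq: "{x. pr i x \<in> H} = ouro_seq X i" for i by auto
    show "base_env.is_seq X H" unfolding seq eq step using * by simp
  qed
qed

lemma is_good_iff:
  assumes H: "\<forall>i x. pr i x \<in> H \<longleftrightarrow> x \<in> S i" and S: "\<And>i. ok (S i)"
  shows "base_env.is_good H n W \<longleftrightarrow> (\<forall>i x. pr i x \<in> W \<longleftrightarrow> goodstein S n i = enat x)"
proof -
  have sec: "{x. pr i x \<in> H} = S i" for i using H by auto
  have S1: "S i \<subseteq> {1..}" for i using S[of i] by (auto simp: ok_def)
  have up: "(\<exists>A. base_env.is_upg (S i) (S (i + 1)) A \<and> pr k x \<in> A) \<longleftrightarrow>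
    upgrade (S i) (S (i + 1)) k = enat x" for i k x
  proof -
    obtain A where A: "base_env.is_upg (S i) (S (i + 1)) A" using ex_upg[OF S S1] by blast
    show ?thesis
      using A is_upg_iff[OF S S1, of i "i + 1"] by metis
  qed
  have step: "(\<exists>k. goodstein S n i = enat k \<and> (k = 0 \<and> x = 0 \<or>
      0 < k \<and> upgrade (S i) (S (i + 1)) k = enat (x + 1))) \<longleftrightarrow>
    goodstein S n (i + 1) = enat x" for i x
  proof (cases "goodstein S n i")
    case (enat k)
    have "upgrade (S i) (S (Suc i)) k = enat (x + 1) \<longleftrightarrow>
      upgrade (S i) (S (Suc i)) k - 1 = enat x" if "0 < k"
      using upgrade_pos[OF S that, of i "S (Suc i)"]
      by (cases "upgrade (S i) (S (Suc i)) k") (auto simp: one_enat_def zero_enat_def)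
    then show ?thesis using enat by (cases "0 < k") (auto simp: zero_enat_def)
  qed simp
  have good: "base_env.is_good H n W \<longleftrightarrow> (\<forall>x. pr 0 x \<in> W \<longleftrightarrow> x = n) \<and>
    (\<forall>i x. pr (i + 1) x \<in> W \<longleftrightarrow> (\<exists>k. pr i k \<in> W \<and> (k = 0 \<and> x = 0 \<or>
      0 < k \<and> upgrade (S i) (S (i + 1)) k = enat (x + 1))))"
    unfolding base_env.is_good_def sec up ..
  show ?thesis
  proof
    assume *: "base_env.is_good H n W"
    show "\<forall>i x. pr i x \<in> W \<longleftrightarrow> goodstein S n i = enat x"
    proof
      fix i show "\<forall>x. pr i x \<in> W \<longleftrightarrow> goodstein S n i = enat x"
      proof (induction i)
        case 0 then show ?case using conjunct1[OF *[unfolded good]] by auto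
      next
        case (Suc i)
        have "\<forall>x. pr (i + 1) x \<in> W \<longleftrightarrow> goodstein S n (i + 1) = enat x"
          using spec[OF conjunct2[OF *[unfolded good]], of i] unfolding spec[OF Suc] step .
        then show ?case unfolding Suc_eq_plus1 .
      qed
    qed
  next
    assume *: "\<forall>i x. pr i x \<in> W \<longleftrightarrow> goodstein S n i = enat x"
    have "pr (i + 1) x \<in> W \<longleftrightarrow> (\<exists>k. pr i k \<in> W \<and> (k = 0 \<and> x = 0 \<or>
      0 < k \<and> upgrade (S i) (S (i + 1)) k = enat (x + 1)))" for i x
      unfolding *[rule_format] step ..
    moreover have "pr 0 x \<in> W \<longleftrightarrow> x = n" for x unfolding *[rule_format] by auto
    ultimately show "base_env.is_good H n W" unfolding good by blast
  qed
qed

theorem goodstein_principle_correct: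
  assumes "base_hierarchy B"
  shows "sat e (case_nat B E) goodstein_principle \<longleftrightarrow>
    (\<forall>n. \<exists>i. goodstein (ouro_seq B) n i = 0)"
proof -
  let ?S = "ouro_seq B"
  have B: "ok B"
  proof -
    have "2 \<le> x" if "x \<in> B" for x
    proof -
      have "x \<noteq> 0" "x \<noteq> 1" using that assms by (auto simp: base_hierarchy_def)
      then show ?thesis by linarith
    qed
    then show ?thesis using assms by (auto simp: base_hierarchy_def ok_def)
  qed
  have good: "base_env.is_good H n W \<longleftrightarrow> (\<forall>i x. pr i x \<in> W \<longleftrightarrow> goodstein ?S n i = enat x)"
    if "\<forall>i x. pr i x \<in> H \<longleftrightarrow> x \<in> ?S i" for H n W
    by (rule is_good_iff[OF that ouro_seq_ok[OF B]])
  let ?H = "{z. \<exists>k w. z = pr k w \<and> w \<in> ?S k}"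
  let ?W = "\<lambda>n. {z. \<exists>k w. z = pr k w \<and> goodstein ?S n k = enat w}"
  have H: "\<forall>i x. pr i x \<in> ?H \<longleftrightarrow> x \<in> ?S i" by (auto simp: pr_inj)
  have W: "\<forall>i x. pr i x \<in> ?W n \<longleftrightarrow> goodstein ?S n i = enat x" for n by (auto simp: pr_inj)
  have "(\<forall>H. (\<forall>i x. pr i x \<in> H \<longleftrightarrow> x \<in> ?S i) \<longrightarrow>
      (\<forall>n W. base_env.is_good H n W \<longrightarrow> (\<exists>i. pr i 0 \<in> W))) \<longleftrightarrow>
    (\<forall>n. \<exists>i. goodstein ?S n i = enat 0)" (is "?L \<longleftrightarrow> ?R")
  proof (intro iffI allI impI)
    fix n assume ?L
    from this[rule_format, OF H[rule_format] iffD2[OF good[OF H] W]]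
    show "\<exists>i. goodstein ?S n i = enat 0" unfolding W[rule_format] .
  next
    fix H n W assume R: ?R and H: "\<forall>i x. pr i x \<in> H \<longleftrightarrow> x \<in> ?S i" and "base_env.is_good H n W"
    then have "\<forall>i x. pr i x \<in> W \<longleftrightarrow> goodstein ?S n i = enat x" using good by simp
    then show "\<exists>i. pr i 0 \<in> W" using R by simp
  qed
  then show ?thesis
    unfolding base_env.sat_goodstein_principle_raw is_seq_iff[OF B] zero_enat_def .
qed


section \<open>Soundness of \<open>ACA\<^sub>0\<close>\<close>

lemma eval_subst: "eval e (subst_tm \<sigma> t) = eval (\<lambda>n. eval e (\<sigma> n)) t"
  by (induction t) auto

lemma sat_subst:
  "sat e E (subst_fm \<sigma> \<rho> p) = sat (\<lambda>n. eval e (\<sigma> n)) (\<lambda>X. E (\<rho> X)) p"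
proof (induction p arbitrary: e E \<sigma> \<rho>)
  case (Forall p)
  have "(\<lambda>k. eval (case_nat n e) (case k of 0 \<Rightarrow> Var 0 | Suc m \<Rightarrow> lift_tm (\<sigma> m))) =
    case_nat n (\<lambda>m. eval e (\<sigma> m))" for n
    by (auto simp: fun_eq_iff lift_tm_def eval_subst split: nat.splits)
  then show ?case by (simp add: Forall)
next
  case (ForallS p)
  have "(\<lambda>k. (case_nat A E) (case k of 0 \<Rightarrow> 0 | Suc m \<Rightarrow> Suc (\<rho> m))) = case_nat A (\<lambda>m. E (\<rho> m))" for A
    by (auto simp: fun_eq_iff split: nat.splits)
  then show ?case by (simp add: ForallS)
qed (auto simp: eval_subst)

lemma sat_lift: "sat (case_nat n e) E (lift_fm p) = sat e E p"
  and sat_liftS: "sat e (case_nat A E) (liftS_fm p) = sat e E p"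
  and sat_inst: "sat e E (inst t p) = sat (case_nat (eval e t) e) E p"
  and sat_instS: "sat e E (instS X p) = sat e (case_nat (E X) E) p"
proof -
  have 1: "(\<lambda>n. eval e (case_nat t Var n)) = case_nat (eval e t) e"
    "(\<lambda>k. E (case_nat X id k)) = case_nat (E X) E"
    by (auto simp: fun_eq_iff split: nat.splits)
  show "sat (case_nat n e) E (lift_fm p) = sat e E p" "sat e (case_nat A E) (liftS_fm p) = sat e E p"
    "sat e E (inst t p) = sat (case_nat (eval e t) e) E p"
    "sat e E (instS X p) = sat e (case_nat (E X) E) p"
    by (simp_all add: lift_fm_def liftS_fm_def inst_def instS_def sat_subst 1)
qed

lemma sat_derived [simp]:
  "sat e E (Neg p) \<longleftrightarrow> \<not> sat e E p"
  "sat e E (Conj p q) \<longleftrightarrow> sat e E p \<and> sat e E q"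
  "sat e E (Disj p q) \<longleftrightarrow> sat e E p \<or> sat e E q"
  "sat e E (Iff p q) \<longleftrightarrow> (sat e E p \<longleftrightarrow> sat e E q)"
  "sat e E (Exists p) \<longleftrightarrow> (\<exists>n. sat (case_nat n e) E p)"
  "sat e E (ExistsS p) \<longleftrightarrow> (\<exists>X. sat e (case_nat X E) p)"
  unfolding Neg_def Conj_def Disj_def Iff_def Exists_def ExistsS_def by auto

lemma deriv_sound:
  assumes T: "\<And>q e E. q \<in> T \<Longrightarrow> sat e E q"
  shows "deriv T \<Gamma> p \<Longrightarrow> \<forall>q\<in>set \<Gamma>. sat e E q \<Longrightarrow> sat e E p"
proof (induction arbitrary: e E rule: deriv.induct)
  case (ImpI p \<Gamma> q)
  show ?case using ImpI.IH[of e E] ImpI.prems by simp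
next
  case (ImpE \<Gamma> p q)
  show ?case using ImpE.IH[of e E] ImpE.prems by simp
next
  case (Classical p \<Gamma>)
  show ?case using Classical.IH[of e E] Classical.prems by auto
next
  case (AllI \<Gamma> p)
  have "sat (case_nat n e) E p" for n
    by (rule AllI.IH) (simp add: AllI.prems sat_lift)
  then show ?case by simp
next
  case (AllSI \<Gamma> p)
  have "sat e (case_nat A E) p" for A
    by (rule AllSI.IH) (simp add: AllSI.prems sat_liftS)
  then show ?case by simp
next
  case (AllE \<Gamma> p t)
  show ?case using AllE.IH[OF AllE.prems] by (simp add: sat_inst)
next
  case (AllSE \<Gamma> p X)
  show ?case using AllSE.IH[OF AllSE.prems] by (simp add: sat_instS)
next
  case (Subst \<Gamma> s t p)
  show ?case using Subst.IH(1)[OF Subst.prems] Subst.IH(2)[OF Subst.prems] by (simp add: sat_inst)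
qed (simp_all add: T)

lemma ACA0_true:
  assumes "p \<in> ACA0"
  shows "sat e E p"
proof -
  consider "p \<in> basic_axioms" | "p = induction_axiom" | q where "p = comprehension q"
    using assms unfolding ACA0_def by blast
  then show ?thesis
  proof cases
    case 1
    then show ?thesis unfolding basic_axioms_def Let_def
      by (elim insertE emptyE) (simp_all add: less_Suc_eq)
  next
    case 2
    have "n \<in> E 0" if "0 \<in> E 0" "\<And>n. n \<in> E 0 \<Longrightarrow> Suc n \<in> E 0" for n
      by (induction n) (simp_all add: that)
    then show ?thesis unfolding 2 induction_axiom_def by simp
  next
    case 3
    have "\<exists>A. \<forall>n. n \<in> A \<longleftrightarrow> sat (case_nat n e) E q"
      by (rule exI[of _ "{n. sat (case_nat n e) E q}"]) simp
    then show ?thesis unfolding 3 comprehension_def by (simp add: sat_liftS)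
  qed
qed

theorem ACA0_sound: "ACA0 \<turnstile> p \<Longrightarrow> sat e E p"
  unfolding proves_def by (rule deriv_sound[of ACA0 "[]"]) (simp_all add: ACA0_true)

end

theory Submission
  imports Defs "HOL-Library.Countable"
begin

text \<open>Below a multiple \<open>b a\<close> of a base \<open>b\<close> with \<open>b a < S(b)\<close>, the Ouroboros successor \<open>B\<^sub>+\<^sub>i\<close> gets
  \<open>i\<close> new bases, each of which is the preceding base times \<open>\<up>a\<close>. Hence if the Goodstein process needs
  \<open>\<alpha>\<close>-many steps to bring the factor \<open>a\<close> down, then it needs \<open>\<omega>\<^sup>\<alpha>\<close>-many to bring down \<open>b a\<close>, and the same
  is possible again at the new bases. By the hypothesis on \<open>B\<^sub>0\<close> this can be iterated as often as we
  wish, and there are Goodstein sequences that stay positive on tower-large intervals \<open>{m..<t}\<close>,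
  although they start at most at \<open>2 m\<close>.

  By repeated thinning, such intervals yield, in an ultrapower of the natural numbers, an initial
  segment \<open>I\<close> that contains the starting value, lies below the length of the sequence, and
  is a strong cut, so that together with the internal sets of bounded level it is a model of \<open>ACA\<^sub>0\<close>.
  A true \<open>\<Pi>\<^sup>0\<^sub>1\<close> formula holds in \<open>I\<close>. The internal hierarchy and the internal Goodstein sequence
  satisfy their definitions in \<open>I\<close>, where the sequence never reaches zero. So the
  Goodstein principle fails in this model.\<close>

section \<open>Well-founded trees and large sets\<close>

text \<open>The values of the sequence may leave \<open>I\<close>, but nothing has to be total
  there: the formulas describe graphs of partial functions, and it suffices that no index in
  \<open>I\<close> carries the value 0. What has to be checked is that each clause of the recursions
  means the same in \<open>I\<close> as at almost every index. It does, since the auxiliary numbers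
  (exponents, digits, candidate bases, stages) are bounded by the value, the argument or the index
  at hand, and since the graphs are put among the internal sets from the beginning.

  The factor \<open>a + 2\<close> in \<open>expo\<close> has three origins. In a thinning, at most
  \<open>a + 1\<close> values \<open>g x\<close> with \<open>x \<le> a\<close> have to be avoided,
  so one of \<open>a + 2\<close> blocks is free of them. Passing to the last of \<open>a + 2\<close>
  blocks iterates a growth function \<open>a + 2\<close> times. And \<open>B (i + 1)\<close>, up to
  the upgrade of \<open>b * a\<close>, has the \<open>i + 2\<close> bases \<open>d 0\<close>, ...,
  \<open>d (i + 1)\<close> in geometric progression, one block for each. The bound
  \<open>2 * m\<close> is what puts the starting value into \<open>I\<close>: the elements of the
  intervals are step numbers, and \<open>I\<close> is closed under doubling.\<close>

text \<open>Trees stand for ordinals below \<open>\<epsilon>\<^sub>0\<close> with fundamental sequences: \<open>Node f\<close> has \<open>f a\<close> as its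
  \<open>a\<close>-th member. \<open>expo\<close> plays the role of \<open>\<omega>\<^sup>\<alpha>\<close>, and \<open>large \<alpha> A\<close> that of
  ``\<open>A\<close> is \<open>\<alpha>\<close>-large'' for an increasing list \<open>A\<close>.\<close>

datatype tree = Leaf | Node "nat \<Rightarrow> tree"

primrec plus_tree :: "tree \<Rightarrow> tree \<Rightarrow> tree" where
  "plus_tree \<alpha> Leaf = \<alpha>"
| "plus_tree \<alpha> (Node f) = Node (\<lambda>a. plus_tree \<alpha> (f a))"

primrec times_tree :: "tree \<Rightarrow> nat \<Rightarrow> tree" where
  "times_tree \<alpha> 0 = Leaf"
| "times_tree \<alpha> (Suc m) = plus_tree (times_tree \<alpha> m) \<alpha>"

primrec expo :: "tree \<Rightarrow> tree" where
  "expo Leaf = Node (\<lambda>_. Leaf)"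
| "expo (Node f) = Node (\<lambda>a. times_tree (expo (f a)) (a + 2))"

definition tower :: "nat \<Rightarrow> tree" where "tower k = (expo ^^ k) Leaf"

lemma tower_simps [simp]: "tower 0 = Leaf" "tower (Suc k) = expo (tower k)"
  by (simp_all add: tower_def)

primrec large :: "tree \<Rightarrow> nat list \<Rightarrow> bool" where
  "large Leaf = (\<lambda>A. True)"
| "large (Node f) = (\<lambda>A. case A of [] \<Rightarrow> False | a # A' \<Rightarrow> large (f a) A')"

text \<open>The recursion of \<open>plus_tree\<close> runs on its second argument, so that summand
  is used up first, by the initial part of the list.\<close>

lemma large_plus:
  "large (plus_tree \<alpha> \<beta>) A \<Longrightarrow> \<exists>A1 A2. A = A1 @ A2 \<and> large \<beta> A1 \<and> large \<alpha> A2"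
proof (induction \<beta> arbitrary: A)
  case Leaf then show ?case by force
next
  case (Node f)
  then obtain a A' where A: "A = a # A'" "large (plus_tree \<alpha> (f a)) A'" by (auto split: list.splits)
  then obtain A1 A2 where "A' = A1 @ A2" "large (f a) A1" "large \<alpha> A2" using Node.IH[of "f a"] by blast
  then show ?case using A by (intro exI[of _ "a # A1"] exI[of _ A2]) auto
qed

lemma large_expo_ne: "large (expo \<alpha>) A \<Longrightarrow> A \<noteq> []"
  by (cases \<alpha>) auto

subsection \<open>Thinning\<close>

definition inc :: "nat list \<Rightarrow> bool" where "inc A \<longleftrightarrow> sorted_wrt (<) A"

lemma inc_simps [simp]: "inc []" "inc (a # A) \<longleftrightarrow> (\<forall>x\<in>set A. a < x) \<and> inc A"
  "inc (A @ A') \<longleftrightarrow> inc A \<and> inc A' \<and> (\<forall>x\<in>set A. \<forall>y\<in>set A'. x < y)"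
  by (auto simp: inc_def sorted_wrt_append)

text \<open>The finite trace of a strong cut: \<open>g x\<close> never lands among the elements
  above \<open>a\<close>, so a single comparison, with the next element or with the last one,
  decides on which side of a cut between these elements it lies.\<close>

definition approximates :: "(nat \<Rightarrow> nat) \<Rightarrow> nat list \<Rightarrow> bool" where
  "approximates g A \<longleftrightarrow> (\<forall>a\<in>set A. \<forall>x\<le>a.
     (\<forall>b\<in>set A. a < b \<longrightarrow> g x < b) \<or> (\<forall>b\<in>set A. a < b \<longrightarrow> b < g x))"

text \<open>Pigeonhole: a value lies inside the span of at most one of the \<open>m\<close>
  consecutive blocks. If some \<open>v\<close> in \<open>V\<close> lies inside the first one, it is
  below all later blocks, and the induction continues with \<open>V - {v}\<close> and one block
  less.\<close>

lemma free_block: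
  assumes "large (times_tree \<beta> m) A" "inc A" "finite V" "card V < m"
  shows "\<exists>A'. set A' \<subseteq> set A \<and> inc A' \<and> large \<beta> A' \<and>
    (\<forall>v\<in>V. (\<forall>p\<in>set A'. v < p) \<or> (\<forall>p\<in>set A'. p < v))"
  using assms
proof (induction m arbitrary: A V)
  case (Suc m)
  obtain A1 A2 where A: "A = A1 @ A2" "large \<beta> A1" "large (times_tree \<beta> m) A2"
    using large_plus Suc.prems(1) by (metis times_tree.simps(2))
  show ?case
  proof (cases "\<forall>v\<in>V. (\<forall>p\<in>set A1. v < p) \<or> (\<forall>p\<in>set A1. p < v)")
    case True
    then show ?thesis using A Suc.prems(2) by (intro exI[of _ A1]) auto
  next
    case False
    then obtain v p q where v: "v \<in> V" "p \<in> set A1" "q \<in> set A1" "p \<le> v" "v \<le> q"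
      by (meson not_less)
    have "card (V - {v}) < m" using v(1) Suc.prems(3,4) by (simp add: card_Diff_singleton)
        (metis Suc_diff_1 card_gt_0_iff empty_iff not_less_eq less_Suc_eq_le diff_Suc_1 Suc_pred)
    then obtain A' where A': "set A' \<subseteq> set A2" "inc A'" "large \<beta> A'"
      "\<forall>v\<in>V - {v}. (\<forall>p\<in>set A'. v < p) \<or> (\<forall>p\<in>set A'. p < v)"
      using Suc.IH[OF A(3), of "V - {v}"] Suc.prems A by auto
    have "\<forall>p\<in>set A'. v < p" using A'(1) v(3,5) Suc.prems(2) A(1) by force
    then show ?thesis using A' A(1) by (intro exI[of _ A']) auto
  qed
qed simp

text \<open>The head \<open>a\<close> is kept and the rest is taken from a block that is free of the
  values \<open>g x\<close> with \<open>x \<le> a\<close>; inside it, the induction hypothesis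
  handles the later elements. One application of \<open>expo\<close> pays for one function
  \<open>g\<close>.\<close>

lemma thinning:
  assumes "large (expo \<alpha>) A" "inc A"
  shows "\<exists>A'. set A' \<subseteq> set A \<and> inc A' \<and> large \<alpha> A' \<and> approximates g A'"
  using assms
proof (induction \<alpha> arbitrary: A)
  case Leaf
  show ?case by (intro exI[of _ "[]"]) (auto simp: approximates_def)
next
  case (Node f)
  then obtain a A0 where A: "A = a # A0" "large (times_tree (expo (f a)) (a + 2)) A0"
    by (auto split: list.splits)
  have "card (g ` {..a}) < a + 2" using card_image_le[of "{..a}" g] by simp
  then obtain A1 where A1: "set A1 \<subseteq> set A0" "inc A1" "large (expo (f a)) A1"
    "\<forall>v\<in>g ` {..a}. (\<forall>p\<in>set A1. v < p) \<or> (\<forall>p\<in>set A1. p < v)"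
    using free_block[OF A(2), of "g ` {..a}"] Node.prems A(1) by auto
  obtain A2 where A2: "set A2 \<subseteq> set A1" "inc A2" "large (f a) A2" "approximates g A2"
    using Node.IH[of "f a" A1] A1 by auto
  have lt: "\<forall>x\<in>set A2. a < x" using A1 A2 A Node.prems by auto
  have "approximates g (a # A2)"
    unfolding approximates_def
  proof (intro ballI allI impI)
    fix a' x assume *: "a' \<in> set (a # A2)" "x \<le> a'"
    show "(\<forall>b\<in>set (a # A2). a' < b \<longrightarrow> g x < b) \<or> (\<forall>b\<in>set (a # A2). a' < b \<longrightarrow> b < g x)"
    proof (cases "a' = a")
      case True
      then have "g x \<in> g ` {..a}" using * by auto
      then show ?thesis using A1(4) A2(1) True by (auto 4 3)
    next
      case False
      then have a': "a' \<in> set A2" using * by simp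
      then have "a < a'" using lt by simp
      then show ?thesis using A2(4)[unfolded approximates_def, rule_format, OF a' *(2)] by auto
    qed
  qed
  then show ?case using A1 A2 A lt by (intro exI[of _ "a # A2"]) auto
qed

section \<open>Sparse sets and a fast-growing hierarchy\<close>

primrec hyp :: "nat \<Rightarrow> nat \<Rightarrow> nat" where
  "hyp 0 = Suc"
| "hyp (Suc r) = (\<lambda>a. (hyp r ^^ (a + 2)) a)"

lemma funpow_grow:
  fixes h :: "nat \<Rightarrow> nat"
  assumes "mono h" "\<And>x. x < h x"
  shows "mono (h ^^ m)" "x + m \<le> (h ^^ m) x" "m \<le> m' \<Longrightarrow> (h ^^ m) x \<le> (h ^^ m') x"
proof -
  show "mono (h ^^ m)" using assms(1) by (induction m) (auto simp: mono_def)
  show "x + m \<le> (h ^^ m) x"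
  proof (induction m)
    case (Suc m) then show ?case using assms(2)[of "(h ^^ m) x"] by simp
  qed simp
  show "(h ^^ m) x \<le> (h ^^ m') x" if "m \<le> m'"
    using that
  proof (induction rule: dec_induct)
    case (step n) then show ?case using assms(2)[of "(h ^^ n) x"] by simp
  qed simp
qed

lemma hyp_grow: "mono (hyp r)" "x < hyp r x"
proof (induction r arbitrary: x)
  case (Suc r)
  { case 1
    show ?case
    proof (rule monoI)
      fix x y :: nat assume "x \<le> y"
      then have "(hyp r ^^ (x + 2)) x \<le> (hyp r ^^ (x + 2)) y"
        using \<open>x \<le> y\<close> by (intro monoD[OF funpow_grow(1)[OF Suc]])
      also have "\<dots> \<le> (hyp r ^^ (y + 2)) y" using \<open>x \<le> y\<close> by (intro funpow_grow(3)[OF Suc]) simp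
      finally show "hyp (Suc r) x \<le> hyp (Suc r) y" by simp
    qed
  next
    case 2
    show ?case using funpow_grow(2)[OF Suc, of x "x + 2"] by simp
  }
qed (auto simp: mono_def)

text \<open>An initial segment in which elements of such a set are cofinal, without a largest one,
  is closed under a monotone \<open>h\<close>; this is how the cut becomes closed under
  arithmetic.\<close>

definition sparse :: "(nat \<Rightarrow> nat) \<Rightarrow> nat list \<Rightarrow> bool" where
  "sparse h A \<longleftrightarrow> (\<forall>a\<in>set A. \<forall>b\<in>set A. a < b \<longrightarrow> h a \<le> b)"

lemma sparse_subset: "sparse h A \<Longrightarrow> set A' \<subseteq> set A \<Longrightarrow> sparse h A'"
  unfolding sparse_def by blast

text \<open>Every block passed contributes one application of \<open>h\<close>: if \<open>z\<close>
  bounds the first block from below and \<open>p\<close> lies in it, then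
  \<open>h z \<le> h p \<le> x\<close> for all \<open>x\<close> in the later blocks. Blocks of the
  form \<open>expo \<beta>\<close> are never empty, so such a \<open>p\<close> exists.\<close>

lemma last_block:
  assumes "mono h" "large (times_tree (expo \<beta>) (Suc m)) A" "inc A" "sparse h A" "\<forall>x\<in>set A. z \<le> x"
  shows "\<exists>A'. set A' \<subseteq> set A \<and> inc A' \<and> large (expo \<beta>) A' \<and> (\<forall>x\<in>set A'. (h ^^ m) z \<le> x)"
  using assms
proof (induction m arbitrary: A z)
  case 0
  have "plus_tree Leaf \<alpha> = \<alpha>" for \<alpha> by (induction \<alpha>) auto
  then show ?case using 0 by (intro exI[of _ A]) auto
next
  case (Suc m)
  obtain A1 A2 where A: "A = A1 @ A2" "large (expo \<beta>) A1" "large (times_tree (expo \<beta>) (Suc m)) A2"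
    using large_plus Suc.prems(2) by (metis times_tree.simps(2))
  obtain p where p: "p \<in> set A1" using large_expo_ne[OF A(2)] by (cases A1) auto
  have "h z \<le> x" if "x \<in> set A2" for x
  proof -
    have "p < x" using p that Suc.prems(3) A(1) by auto
    then have "h p \<le> x" using Suc.prems(4) p that A(1) by (auto simp: sparse_def)
    moreover have "h z \<le> h p" using Suc.prems(1,5) p A(1) by (auto simp: mono_def)
    ultimately show ?thesis by simp
  qed
  moreover have "sparse h A2" using Suc.prems(4) A(1) by (auto simp: sparse_def)
  ultimately obtain A' where "set A' \<subseteq> set A2" "inc A'" "large (expo \<beta>) A'"
    "\<forall>x\<in>set A'. (h ^^ m) (h z) \<le> x"
    using Suc.IH[OF Suc.prems(1) A(3), of "h z"] Suc.prems(3) A(1) by auto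
  then show ?case using A(1) by (intro exI[of _ A']) (auto simp: funpow_swap1)
qed

text \<open>As in \<open>thinning\<close>, but the last block is taken instead of a free one. The
  \<open>a + 2\<close> iterations that make up \<open>hyp (Suc r) a\<close> are one for the step
  from \<open>a\<close> to the remaining list and \<open>a + 1\<close> for the blocks
  passed.\<close>

lemma sparsify:
  assumes "large (expo \<alpha>) A" "inc A" "sparse (hyp r) A"
  shows "\<exists>A'. set A' \<subseteq> set A \<and> inc A' \<and> large \<alpha> A' \<and> sparse (hyp (Suc r)) A'"
  using assms
proof (induction \<alpha> arbitrary: A)
  case Leaf
  show ?case by (intro exI[of _ "[]"]) (auto simp: sparse_def)
next
  case (Node f)
  then obtain a A0 where A: "A = a # A0" "large (times_tree (expo (f a)) (Suc (a + 1))) A0"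
    by (auto split: list.splits)
  have "\<forall>x\<in>set A0. hyp r a \<le> x" using Node.prems A(1) by (auto simp: sparse_def)
  moreover have "sparse (hyp r) A0" using Node.prems A(1) by (auto simp: sparse_def)
  ultimately obtain A1 where A1: "set A1 \<subseteq> set A0" "inc A1" "large (expo (f a)) A1"
    "\<forall>x\<in>set A1. (hyp r ^^ (a + 1)) (hyp r a) \<le> x"
    using last_block[OF hyp_grow(1) A(2), of r "hyp r a"] Node.prems A(1) by auto
  have A1h: "\<forall>x\<in>set A1. hyp (Suc r) a \<le> x" using A1(4) by (simp add: funpow_swap1)
  have "sparse (hyp r) A1" by (rule sparse_subset[OF Node.prems(3)]) (use A(1) A1(1) in auto)
  then obtain A2 where A2: "set A2 \<subseteq> set A1" "inc A2" "large (f a) A2" "sparse (hyp (Suc r)) A2"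
    using Node.IH[of "f a" A1] A1 by auto
  have lt: "\<forall>x\<in>set A2. a < x" using A1 A2 A Node.prems by auto
  have "sparse (hyp (Suc r)) (a # A2)"
    unfolding sparse_def
  proof (intro ballI impI)
    fix a' b assume *: "a' \<in> set (a # A2)" "b \<in> set (a # A2)" "a' < b"
    have b: "b \<in> set A2" using * lt by auto
    show "hyp (Suc r) a' \<le> b"
    proof (cases "a' = a")
      case True then show ?thesis using A1h A2(1) b by blast
    next
      case False then show ?thesis using A2(4) * b by (simp add: sparse_def del: hyp.simps)
    qed
  qed
  then show ?case using A1 A2 A lt by (intro exI[of _ "a # A2"]) auto
qed

lemma sparsify_tower:
  assumes "large (tower (k + r)) A" "inc A"
  shows "\<exists>A'. set A' \<subseteq> set A \<and> inc A' \<and> large (tower k) A' \<and> sparse (hyp r) A'"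
  using assms
proof (induction r arbitrary: k)
  case 0
  then show ?case by (intro exI[of _ A]) (auto simp: sparse_def)
next
  case (Suc r)
  then obtain A1 where A1: "set A1 \<subseteq> set A" "inc A1" "large (tower (Suc k)) A1" "sparse (hyp r) A1"
    using Suc.IH[of "Suc k"] by auto
  then show ?case using sparsify[of "tower k" A1 r] by (auto simp del: hyp.simps)
qed

subsection \<open>Large sets are long\<close>

text \<open>No path through such a tree ends in fewer than \<open>r\<close> steps, whatever numbers
  are read on the way; this bounds the length of large lists from below.\<close>

primrec deep :: "nat \<Rightarrow> tree \<Rightarrow> bool" where
  "deep 0 \<alpha> = True"
| "deep (Suc r) \<alpha> = (\<exists>f. \<alpha> = Node f \<and> (\<forall>a. deep r (f a)))"

lemma deep_plus: "deep r \<beta> \<Longrightarrow> deep r (plus_tree \<alpha> \<beta>)"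
  by (induction r arbitrary: \<beta>) auto

lemma deep_length: "deep r \<alpha> \<Longrightarrow> large \<alpha> A \<Longrightarrow> r \<le> length A"
  by (induction r arbitrary: \<alpha> A) (fastforce split: list.splits)+

lemma deep_expo: "deep r \<alpha> \<Longrightarrow> deep (Suc r) (expo \<alpha>)"
proof (induction r arbitrary: \<alpha>)
  case 0
  show ?case by (cases \<alpha>) auto
next
  case (Suc r)
  then obtain f where f: "\<alpha> = Node f" "\<And>a. deep r (f a)" by auto
  then have "deep (Suc r) (expo (f a))" for a using Suc.IH by blast
  then have "deep (Suc r) (times_tree (expo (f a)) (a + 2))" for a
    using deep_plus[of "Suc r"] by (simp del: deep.simps)
  then show ?case using f(1) by simp
qed

lemma tower_length: "large (tower k) A \<Longrightarrow> k \<le> length A"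
proof -
  have "deep k (tower k)" by (induction k) (auto simp: deep_expo simp del: deep.simps(2))
  then show "large (tower k) A \<Longrightarrow> k \<le> length A" by (rule deep_length)
qed

section \<open>The Ouroboros successor\<close>

subsection \<open>Change of base with finite values\<close>

text \<open>For the Ouroboros successor all upgrades turn out to be finite, so that
  \<open>change\<close> can be replaced by a function with values in \<open>nat\<close>.\<close>

function chn :: "(nat \<Rightarrow> nat) \<Rightarrow> nat \<Rightarrow> nat \<Rightarrow> nat \<Rightarrow> nat" where
  "chn v b c m =
    (if m < b \<or> b < 2 then v m
     else c ^ chn v b c (bexp b m) * v (m div b ^ bexp b m) + chn v b c (m mod b ^ bexp b m))"
  by pat_completeness auto
termination
  by (relation "measure (\<lambda>(v, b, c, m). m)") (auto intro!: bexp_less bmod_less)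

declare chn.simps [simp del]

lemma change_chn:
  assumes "2 \<le> b" "\<And>m. m < b \<Longrightarrow> u m = enat (v m)"
  shows "change u b c n = enat (chn v b c n)"
proof (induction n rule: less_induct)
  case (less n)
  show ?case
  proof (cases "n < b")
    case True then show ?thesis using assms by (simp add: change.simps[of _ b c n] chn.simps[of _ b c n])
  next
    case False
    then have "b \<le> n" by simp
    then show ?thesis
      using less bdiv_bounds[OF assms(1)] bexp_less[of b n] bmod_less[of b n] assms
      by (simp add: change.simps[of _ b c n] chn.simps[of _ b c n])
  qed
qed

lemma chn_less: "m < b \<Longrightarrow> chn v b c m = v m"
  by (simp add: chn.simps)

lemma decomp_bounds:
  assumes "2 \<le> b" "b \<le> n"
  obtains e a r where "n = b ^ e * a + r" "0 < a" "a < b" "r < b ^ e" "1 \<le> e" "e < n" "r < n"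
    "bexp b n = e" "b ^ e \<le> n"
    "\<And>v c. chn v b c n = c ^ chn v b c e * v a + chn v b c r"
proof -
  let ?e = "bexp b n" and ?a = "n div b ^ bexp b n" and ?r = "n mod b ^ bexp b n"
  have *: "n = b ^ ?e * ?a + ?r \<and> b ^ ?e \<le> n \<and> n < b ^ ?e * b \<and> 0 < ?a \<and> ?a < b \<and> ?r < b ^ ?e"
    by (subst decomp_iff) (use assms in auto)
  show ?thesis
    using that[of ?e ?a ?r] * bdiv_bounds[OF assms] bexp_less[of b n] bmod_less[of b n] assms
    by (simp add: chn.simps[of _ b _ n])
qed

lemma chn_decomp:
  assumes "2 \<le> b" "n = b ^ e * a + r" "0 < a" "a < b" "r < b ^ e" "1 \<le> e"
  shows "chn v b c n = c ^ chn v b c e * v a + chn v b c r"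
proof -
  have "b ^ 1 \<le> b ^ e" using assms by (intro power_increasing) auto
  moreover have "b ^ e * 1 \<le> b ^ e * a" using assms(3) by (intro mult_le_mono) auto
  ultimately have n: "b \<le> n" and be: "b ^ e \<le> n"
    unfolding assms(2) power_one_right mult_1_right by linarith+
  have "b ^ e * a + r < b ^ e * (a + 1)" using assms(5) by simp
  also have "\<dots> \<le> b ^ e * b" using assms(4) by (intro mult_le_mono) auto
  finally have "2 \<le> b \<and> 0 < n \<and> e = bexp b n \<and> a = n div b ^ bexp b n \<and> r = n mod b ^ bexp b n"
    using assms be by (subst decomp_iff[symmetric]) auto
  then show ?thesis using n assms(1) by (subst chn.simps) auto
qed

text \<open>What makes the change of base order preserving: digits below \<open>b\<close> go to
  digits below \<open>c\<close> in increasing order, with 0 and 1 fixed. Only values of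
  \<open>v\<close> below \<open>b\<close> are mentioned, since exponents are rewritten by
  \<open>chn\<close> itself.\<close>

definition digits :: "(nat \<Rightarrow> nat) \<Rightarrow> nat \<Rightarrow> nat \<Rightarrow> bool" where
  "digits v b c \<longleftrightarrow> 2 \<le> b \<and> 2 \<le> c \<and> v 0 = 0 \<and> v 1 = 1 \<and>
    (\<forall>m n. m < n \<longrightarrow> n < b \<longrightarrow> v m < v n) \<and> (\<forall>m<b. v m < c)"

text \<open>Comparison of leading terms, as for Cantor normal forms. If the leading exponents
  differ, a bound for all numbers below \<open>b ^ e\<close> is required; it is proved inside the
  induction on \<open>n\<close>, since it compares exponents that are less than
  \<open>n\<close>.\<close>

lemma chn_strict_mono:
  assumes d: "digits v b c" and "m < n"
  shows "chn v b c m < chn v b c n"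
  using assms(2)
proof (induction n arbitrary: m rule: less_induct)
  case (less n)
  note D = d[unfolded digits_def]
  have b: "2 \<le> b" and c: "2 \<le> c" using D by auto
  have zero: "chn v b c 0 = 0" using D by (simp add: chn_less)
  have pw: "chn v b c m < c ^ chn v b c e" if "m < n" "e < n" "1 \<le> e" "m < b ^ e" for m e
    using that
  proof (induction m arbitrary: e rule: less_induct)
    case (less m e)
    have e1: "1 \<le> chn v b c e" using less.prems \<open>\<And>y m. y < n \<Longrightarrow> m < y \<Longrightarrow> chn v b c m < chn v b c y\<close>[of e 0] zero by simp
    show ?case
    proof (cases "m < b")
      case True
      then have "chn v b c m < c" using D by (simp add: chn_less)
      also have "c = c ^ 1" by simp
      also have "\<dots> \<le> c ^ chn v b c e" using c e1 by (intro power_increasing) auto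
      finally show ?thesis .
    next
      case False
      obtain e' a' r' where m: "m = b ^ e' * a' + r'" "0 < a'" "a' < b" "r' < b ^ e'" "1 \<le> e'" "e' < m" "r' < m"
        "b ^ e' \<le> m" "chn v b c m = c ^ chn v b c e' * v a' + chn v b c r'"
        using decomp_bounds[OF b, of m] False by (metis not_less)
      have "e' < e" using m(8) less.prems(4) b by (metis le_less_trans power_less_imp_less_exp one_less_numeral_iff less_le_trans semiring_norm(76))
      then have lt: "chn v b c e' < chn v b c e" using less.prems(2) \<open>\<And>y m. y < n \<Longrightarrow> m < y \<Longrightarrow> chn v b c m < chn v b c y\<close> by blast
      have "chn v b c r' < c ^ chn v b c e'" using less.IH[OF m(7), of e'] less.prems m by auto
      then have "chn v b c m < c ^ chn v b c e' * (v a' + 1)" using m(9) by simp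
      also have "\<dots> \<le> c ^ chn v b c e' * c" using D m(3) by (intro mult_le_mono) (auto simp: Suc_le_eq)
      also have "\<dots> = c ^ Suc (chn v b c e')" by simp
      also have "\<dots> \<le> c ^ chn v b c e" using c lt by (intro power_increasing) auto
      finally show ?thesis .
    qed
  qed
  show ?case
  proof (cases "n < b")
    case True then show ?thesis using less.prems D by (simp add: chn_less)
  next
    case False
    obtain e a r where n: "n = b ^ e * a + r" "0 < a" "a < b" "r < b ^ e" "1 \<le> e" "e < n" "r < n"
      "bexp b n = e" "chn v b c n = c ^ chn v b c e * v a + chn v b c r"
      using decomp_bounds[OF b, of n] False by (metis not_less)
    let ?E = "chn v b c e"
    have va: "1 \<le> v a" using D n(2,3) by (metis One_nat_def Suc_leI gr_zeroI not_less0)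
    show ?thesis
    proof (cases "m < b ^ e")
      case True
      then have "chn v b c m < c ^ ?E" using pw[OF less.prems n(6,5)] by simp
      also have "\<dots> \<le> c ^ ?E * v a" using va by simp
      finally show ?thesis using n(9) by simp
    next
      case False
      define a' r' where "a' = m div b ^ e" and "r' = m mod b ^ e"
      have m: "m = b ^ e * a' + r'" "r' < b ^ e" using n b by (auto simp: a'_def r'_def)
      have a'0: "0 < a'" using False b by (auto simp: a'_def div_greater_zero_iff)
      have a'a: "a' \<le> a"
      proof -
        have "m div b ^ e \<le> n div b ^ e" using less.prems by (intro div_le_mono) simp
        also have "n div b ^ e = a" using n by simp
        finally show ?thesis by (simp add: a'_def)
      qed
      have cm: "chn v b c m = c ^ ?E * v a' + chn v b c r'"
        using chn_decomp[OF b m(1) a'0 _ m(2) n(5)] a'a n(3) by simp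
      show ?thesis
      proof (cases "a' = a")
        case True
        then have "r' < r" using m(1) n(1) less.prems by simp
        then show ?thesis using less.IH[OF n(7)] cm n(9) True by simp
      next
        case False
        then have "v a' < v a" using a'a D n(3) by simp
        have "chn v b c r' < c ^ ?E"
        proof (rule pw)
          show "r' < n" using m(2) n(1,2) less.prems m(1) by linarith
        qed (use n m in auto)
        then have "chn v b c m < c ^ ?E * (v a' + 1)" using cm by simp
        also have "\<dots> \<le> c ^ ?E * v a" using \<open>v a' < v a\<close> by (intro mult_le_mono) auto
        finally show ?thesis using n(9) by simp
      qed
    qed
  qed
qed

lemma chn_mult:
  assumes "digits v b c" "0 < a" "a < b"
  shows "chn v b c (b * a) = c * v a"
  using chn_decomp[of b "b * a" 1 a 0 v c] assms by (simp add: digits_def chn_less)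

lemma chn_base: "digits v b c \<Longrightarrow> chn v b c b = c"
  using chn_mult[of v b c 1] by (simp add: digits_def)

lemma chn_square:
  assumes "digits v b c"
  shows "c ^ 2 \<le> chn v b c (b ^ 2)"
proof -
  have "chn v b c (b ^ 2) = c ^ chn v b c 2"
    using chn_decomp[of b "b ^ 2" 2 1 0 v c] assms by (simp add: digits_def chn_less)
  moreover have "2 \<le> chn v b c 2"
    using chn_strict_mono[OF assms, of 1 2] assms by (simp add: digits_def chn_less)
  ultimately show ?thesis using assms by (simp add: digits_def power_increasing)
qed

subsection \<open>The upgrade into an Ouroboros successor\<close>

lemma base_of_max: "ok B \<Longrightarrow> Inf B \<le> n \<Longrightarrow> b' \<in> B \<Longrightarrow> b' \<le> n \<Longrightarrow> b' \<le> base_of B n"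
  by (auto simp: base_of_def)

lemma base_of_eqI:
  assumes "ok B" "b \<in> B" "b \<le> n" "\<And>b'. b' \<in> B \<Longrightarrow> b' \<le> n \<Longrightarrow> b' \<le> b"
  shows "base_of B n = b"
proof -
  have "Inf B \<le> n" using cInf_lower[of b B] assms by (auto intro: le_trans)
  then show ?thesis using assms base_of_bounds[of B n] base_of_max[of B n b]
    by (auto intro: order_antisym)
qed

lemma base_of_Suc:
  assumes "ok B" "Inf B \<le> p" "Suc p \<notin> B"
  shows "base_of B (Suc p) = base_of B p"
proof (rule base_of_eqI[OF assms(1)])
  show "base_of B p \<in> B" using assms base_of_bounds by blast
  show "base_of B p \<le> Suc p" using assms base_of_bounds by (auto intro: le_SucI)
  show "b' \<le> base_of B p" if "b' \<in> B" "b' \<le> Suc p" for b'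
    using that assms base_of_max[OF assms(1,2), of b'] by (cases "b' = Suc p") auto
qed

lemma base_of_self: "ok B \<Longrightarrow> n \<in> B \<Longrightarrow> base_of B n = n"
  by (rule base_of_eqI) auto

lemma next_base_le: "c' \<in> C \<Longrightarrow> c < c' \<Longrightarrow> next_base C c \<le> enat c'"
  by (auto simp: next_base_def intro: Least_le)

lemma next_base_gt:
  assumes "\<And>c'. c' \<in> C \<Longrightarrow> c < c' \<Longrightarrow> x < c'"
  shows "enat x < next_base C c"
proof (cases "\<exists>b\<in>C. c < b")
  case True
  then have "\<exists>b. b \<in> C \<and> c < b" by blast
  from LeastI_ex[OF this] show ?thesis using True assms by (simp add: next_base_def)
qed (auto simp: next_base_def)

lemma next_base_ge:
  assumes "\<And>c'. c' \<in> C \<Longrightarrow> c < c' \<Longrightarrow> x \<le> c'"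
  shows "enat x \<le> next_base C c"
proof (cases "\<exists>b\<in>C. c < b")
  case True
  then have "\<exists>b. b \<in> C \<and> c < b" by blast
  from LeastI_ex[OF this] show ?thesis using True assms by (simp add: next_base_def)
qed (auto simp: next_base_def)

lemma upgrade_step:
  assumes B: "ok B" "Inf B \<le> n" and u: "\<And>m. m < n \<Longrightarrow> upgrade B C m = enat (v m)"
    and c: "c \<in> C" "v (n - 1) < chn v (base_of B n) c n" "enat (chn v (base_of B n) c n) < next_base C c"
    and least: "\<And>c'. c' \<in> C \<Longrightarrow> c' < c \<Longrightarrow>
      \<not> (v (n - 1) < chn v (base_of B n) c' n \<and> enat (chn v (base_of B n) c' n) < next_base C c')"
  shows "upgrade B C n = enat (chn v (base_of B n) c n)"
proof -
  let ?b = "base_of B n"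
  have ch: "change (upgrade B C) ?b c' n = enat (chn v ?b c' n)" for c'
    by (rule change_chn) (use base_of_ge2[OF B(1), of n] base_of_bounds(2)[OF B] u in auto)
  have n0: "upgrade B C (n - 1) = enat (v (n - 1))"
    using u ok_min[OF B(1)] B(2) by simp
  define K where "K = {c \<in> C. upgrade B C (n - 1) < change (upgrade B C) ?b c n \<and>
    change (upgrade B C) ?b c n < next_base C c}"
  have "upgrade B C n = (if K = {} then \<infinity> else change (upgrade B C) ?b (Inf K) n)"
    using upgrade_eq[OF B, of C] unfolding Let_def K_def[symmetric] .
  moreover have "Inf K = c"
  proof (rule cInf_eq_minimum)
    show "c \<in> K" using c by (simp add: K_def ch n0 del: One_nat_def)
    show "c \<le> c'" if "c' \<in> K" for c' using that least[of c'] by (auto simp: K_def ch n0 not_less[symmetric] simp del: One_nat_def)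
  qed
  moreover have "c \<in> K" using c by (simp add: K_def ch n0 del: One_nat_def)
  ultimately show ?thesis by (auto simp: ch)
qed

locale ouro_step =
  fixes B :: "nat set" and i :: nat
  assumes B: "ok B" and i: "1 \<le> i"
begin

abbreviation "S \<equiv> ouro_stage B i"
abbreviation "b0 \<equiv> Inf B"
definition cc where "cc n = Max (S n)"
text \<open>The upgrade of \<open>n\<close> is evaluated with the bases of stage \<open>n\<close>
  only; \<open>inv\<close> shows that later stages do not change it.\<close>

definition vv where "vv n = the_enat (upgrade B (S n) n)"

lemma S_ok: "finite (S n)" "ok (S n)" and cc_in: "cc n \<in> S n" and cc_ge: "c \<in> S n \<Longrightarrow> c \<le> cc n"
proof -
  show *: "finite (S n)" "ok (S n)" using stage_ok[OF B] by auto
  then show "cc n \<in> S n" unfolding cc_def by (intro Max_in) (auto simp: ok_def)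
  show "c \<in> S n \<Longrightarrow> c \<le> cc n" unfolding cc_def using * by simp
qed

lemma cc_ge2: "2 \<le> cc n"
  using cc_in[of n] S_ok(2)[of n] by (auto simp: ok_def)

lemma b02: "2 \<le> b0" "b0 \<in> B"
  using ok_min[OF B] by auto

lemma S_cut: "cc n \<le> w \<Longrightarrow> S n \<inter> {..w} = S n"
  using cc_ge[of _ n] le_trans[of _ "cc n" w] by blast

lemma vv_small: "n < b0 \<Longrightarrow> vv n = n"
  by (simp add: vv_def upgrade_less)

text \<open>The second clause is the point: values up to \<open>p\<close> depend only on the bases
  up to \<open>vv p\<close>, and all bases added later are greater. So the upgrade into the union of
  the stages can be computed stage by stage. The last clause provides \<open>digits\<close> for the
  next step.\<close>

definition inv where
  "inv p \<longleftrightarrow> cc p \<le> vv p \<and>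
     (\<forall>C' m. m \<le> p \<longrightarrow> C' \<inter> {..vv p} = S p \<longrightarrow> upgrade B C' m = enat (vv m)) \<and>
     (\<forall>m n. m < n \<longrightarrow> n \<le> p \<longrightarrow> vv m < vv n) \<and>
     vv p = chn vv (base_of B p) (cc p) p \<and> vv (base_of B p - 1) < cc p"

lemma inv_upg: "inv p \<Longrightarrow> m \<le> p \<Longrightarrow> C' \<inter> {..vv p} = S p \<Longrightarrow> upgrade B C' m = enat (vv m)"
  by (simp add: inv_def)

lemma inv_self: "inv p \<Longrightarrow> m \<le> p \<Longrightarrow> upgrade B (S p) m = enat (vv m)"
proof -
  assume *: "inv p" "m \<le> p"
  have "cc p \<le> vv p" using *(1) unfolding inv_def by blast
  from inv_upg[OF * S_cut[OF this]] show ?thesis .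
qed

lemma inv_digits:
  assumes "inv p" "b0 \<le> p" "vv (b - 1) < c" "2 \<le> b" "b \<le> Suc p"
  shows "digits vv b c"
proof -
  have mono: "m < n \<Longrightarrow> n \<le> p \<Longrightarrow> vv m < vv n" for m n using assms(1) by (simp add: inv_def)
  have "vv 0 = 0" "vv 1 = 1" using vv_small[of 0] vv_small[of 1] b02 by auto
  moreover have "vv m < c" if "m < b" for m
  proof (cases "m = b - 1")
    case False
    then have "vv m < vv (b - 1)" using that assms(5) by (intro mono) auto
    then show ?thesis using assms(3) by simp
  qed (use assms in simp)
  moreover from this[of 1] have "2 \<le> c" using \<open>vv 1 = 1\<close> assms(4) by simp
  ultimately show ?thesis using assms(4,5) by (auto simp: digits_def intro!: mono)
qed

text \<open>The largest base \<open>cc (Suc p)\<close> is the one chosen for \<open>Suc p\<close>,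
  because every smaller candidate fails. A candidate below \<open>cc p\<close> would need a value
  above \<open>vv p\<close> and yet below its next base, which is at most
  \<open>cc p \<le> vv p\<close>; for the candidates from \<open>cc p\<close> on, failure is the
  assumption \<open>least\<close>.\<close>

lemma inv_SucI:
  assumes p: "inv p" "b0 \<le> p"
    and S: "S (Suc p) \<inter> {..vv p} = S p" "S p \<subseteq> S (Suc p)"
    and w: "w = chn vv (base_of B (Suc p)) (cc (Suc p)) (Suc p)" "vv p < w" "cc (Suc p) \<le> w"
    and least: "\<And>d. d \<in> S (Suc p) \<Longrightarrow> cc p \<le> d \<Longrightarrow> d < cc (Suc p) \<Longrightarrow>
       \<exists>d'\<in>S (Suc p). d < d' \<and>
         (d' \<le> chn vv (base_of B (Suc p)) d (Suc p) \<or> chn vv (base_of B (Suc p)) d (Suc p) \<le> vv p)"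
    and b: "vv (base_of B (Suc p) - 1) < cc (Suc p)"
  shows "inv (Suc p) \<and> vv (Suc p) = w"
proof -
  let ?n = "Suc p" and ?b = "base_of B (Suc p)"
  have up: "upgrade B C' m = enat (if m = ?n then w else vv m)" if C': "C' \<inter> {..w} = S ?n" and "m \<le> ?n" for C' m
  proof -
    have "C' \<inter> {..vv p} = (C' \<inter> {..w}) \<inter> {..vv p}" using w(2) by auto
    also have "\<dots> = S p" unfolding C' by (rule S(1))
    finally have Cp: "C' \<inter> {..vv p} = S p" .
    have old: "upgrade B C' m = enat (vv m)" if "m \<le> p" for m
      by (rule inv_upg[OF p(1) that Cp])
    have sub: "S ?n \<subseteq> C'" and sup: "x \<in> C' \<Longrightarrow> x \<le> w \<Longrightarrow> x \<in> S ?n" for x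
      using C' by blast+
    have new: "upgrade B C' ?n = enat (chn vv ?b (cc ?n) ?n)"
    proof (rule upgrade_step[OF B])
      show "cc ?n \<in> C'" using cc_in[of ?n] sub by blast
      show "enat (chn vv ?b (cc ?n) ?n) < next_base C' (cc ?n)"
        unfolding w(1)[symmetric]
      proof (rule next_base_gt, rule ccontr)
        fix c' assume *: "c' \<in> C'" "cc ?n < c'" "\<not> w < c'"
        then have "c' \<in> S ?n" by (intro sup) simp_all
        then show False using cc_ge[of c' ?n] *(2) by simp
      qed
      show "vv (?n - 1) < chn vv ?b (cc ?n) ?n" unfolding w(1)[symmetric] using w(2) by simp
      fix m assume "m < ?n" then show "upgrade B C' m = enat (vv m)" by (intro old) simp
    next
      fix c' assume c': "c' \<in> C'" "c' < cc ?n"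
      show "\<not> (vv (?n - 1) < chn vv ?b c' ?n \<and> enat (chn vv ?b c' ?n) < next_base C' c')"
      proof (cases "cc p \<le> c'")
        case True
        have "c' \<in> S ?n" using c' w(3) by (intro sup) simp_all
        then obtain d' where d': "d' \<in> S ?n" "c' < d'" "d' \<le> chn vv ?b c' ?n \<or> chn vv ?b c' ?n \<le> vv p"
          using least[OF _ True c'(2)] by blast
        have "d' \<in> C'" using d'(1) sub by blast
        then have "next_base C' c' \<le> enat d'" using d'(2) by (rule next_base_le)
        then have "vv p < chn vv ?b c' ?n \<Longrightarrow> \<not> enat (chn vv ?b c' ?n) < next_base C' c'"
          using d'(3) by (cases "next_base C' c'") auto
        then show ?thesis by auto
      next
        case False
        have "cc p \<in> C'" using cc_in[of p] S(2) sub by blast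
        then have "next_base C' c' \<le> enat (cc p)" using False by (intro next_base_le) auto
        also have "\<dots> \<le> enat (vv p)" using p(1) by (simp add: inv_def)
        finally have "next_base C' c' \<le> enat (vv p)" .
        then show ?thesis by (cases "next_base C' c'") auto
      qed
    qed (use p in simp)
    then show ?thesis unfolding w(1)[symmetric] using old that(2) by (cases "m = ?n") simp_all
  qed
  have vw: "vv ?n = w" using up[OF S_cut[OF w(3)], of ?n] by (simp add: vv_def)
  have mono: "vv m < vv n" if "m < n" "n \<le> p" for m n using p(1) that by (simp add: inv_def)
  have mono': "vv m < vv n" if "m < n" "n \<le> ?n" for m n
  proof (cases "n = ?n")
    case True
    have "vv m \<le> vv p" using mono[of m p] that True by (cases "m = p") simp_all
    then show ?thesis unfolding True vw using w(2) by simp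
  qed (use mono[of m n] that in simp)
  have up': "upgrade B C' m = enat (vv m)" if "m \<le> ?n" "C' \<inter> {..vv ?n} = S ?n" for C' m
    using up[of C' m] that vw by (cases "m = ?n") simp_all
  have "inv ?n"
    unfolding inv_def
  proof (intro conjI allI impI)
    show "cc ?n \<le> vv ?n" unfolding vw by (rule w(3))
    show "vv ?n = chn vv ?b (cc ?n) ?n" unfolding vw by (rule w(1))
  qed (rule up' mono' b; assumption?)+
  then show ?thesis using vw by simp
qed

lemma inv_b0: "inv b0" "vv b0 = b0 + 1"
proof -
  have S0: "S n = {b0 + 1}" if "n \<le> b0" for n using that
    by (cases n) (auto simp: ouro_stage.simps(2) Let_def)
  then have c0: "cc b0 = b0 + 1" by (simp add: cc_def)
  have base: "base_of B b0 = b0" using B b02 by (intro base_of_self)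
  have ch: "chn vv b0 c b0 = c" if "b0 \<le> c" for c
    using that vv_small b02(1) by (intro chn_base) (auto simp: digits_def)
  have up: "upgrade B C' b0 = enat (b0 + 1)" if C': "C' \<inter> {..b0 + 1} = {b0 + 1}" for C'
  proof -
    have "upgrade B C' b0 = enat (chn vv (base_of B b0) (b0 + 1) b0)"
    proof (rule upgrade_step[OF B])
      fix m assume "m < b0" then show "upgrade B C' m = enat (vv m)" by (simp add: upgrade_less vv_small)
    next
      show "b0 + 1 \<in> C'" using C' by auto
      show "enat (chn vv (base_of B b0) (b0 + 1) b0) < next_base C' (b0 + 1)"
        unfolding base using ch[of "b0 + 1"] by (intro next_base_gt) auto
      show "vv (b0 - 1) < chn vv (base_of B b0) (b0 + 1) b0"
        unfolding base using ch[of "b0 + 1"] b02 vv_small[of "b0 - 1"] by simp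
      fix c' assume "c' \<in> C'" "c' < b0 + 1"
      then have "c' \<in> {b0 + 1}" unfolding C'[symmetric] by simp
      then show "\<not> (vv (b0 - 1) < chn vv (base_of B b0) c' b0 \<and> enat (chn vv (base_of B b0) c' b0) < next_base C' c')"
        using \<open>c' < b0 + 1\<close> by simp
    qed simp
    then show ?thesis using ch[of "b0 + 1"] base by simp
  qed
  show v0: "vv b0 = b0 + 1" using up[of "S b0"] S0[of b0] by (simp add: vv_def)
  have "vv m < vv n" if "m < n" "n \<le> b0" for m n
    using that v0 vv_small[of m] vv_small[of n] by (cases "n = b0") auto
  moreover have "upgrade B C' m = enat (vv m)" if "m \<le> b0" "C' \<inter> {..vv b0} = S b0" for C' m
    using that up[of C'] S0[of b0] v0 by (cases "m = b0") (auto simp: vv_small upgrade_less)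
  ultimately show "inv b0"
    unfolding inv_def base c0 using v0 ch[of "b0 + 1"] vv_small[of "b0 - 1"] b02 by auto
qed

fun dd where
  "dd p b 0 = cc p"
| "dd p b (Suc j) = chn vv b (dd p b j) (Suc p)"

lemma inv_base_digits:
  assumes p: "inv p" "b0 \<le> p" and "cc p \<le> c"
  shows "digits vv (base_of B p) c"
proof (rule inv_digits[OF p])
  show "vv (base_of B p - 1) < c" using assms by (auto simp: inv_def)
  show "2 \<le> base_of B p" by (rule base_of_ge2[OF B])
  show "base_of B p \<le> Suc p" using base_of_bounds[OF B p(2)] by simp
qed

text \<open>The base itself is changed to \<open>c\<close>, and \<open>Suc p\<close> exceeds the
  base, so changing to \<open>c\<close> sends \<open>Suc p\<close> above \<open>c\<close>.\<close>

lemma dd_ge: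
  assumes p: "inv p" "b0 \<le> p"
  shows "cc p \<le> dd p (base_of B p) j \<and> dd p (base_of B p) j < dd p (base_of B p) (Suc j)"
proof -
  let ?b = "base_of B p" and ?d = "dd p (base_of B p)"
  have step: "c < chn vv ?b c (Suc p)" if "cc p \<le> c" for c
  proof -
    note dig = inv_base_digits[OF p that]
    have "chn vv ?b c ?b < chn vv ?b c (Suc p)"
      by (rule chn_strict_mono[OF dig]) (use base_of_bounds[OF B p(2)] in auto)
    then show ?thesis using chn_base[OF dig] by simp
  qed
  show ?thesis
  proof (induction j)
    case 0
    show ?case using step[of "cc p"] by simp
  next
    case (Suc j)
    then have "cc p \<le> ?d (Suc j)" by simp
    from step[OF this] this show ?case by simp
  qed
qed

text \<open>If \<open>Suc p\<close> is not critical, the old base \<open>cc p\<close> serves again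
  and the value grows by monotonicity. If it is a base, it is upgraded to the new base itself, the
  old maximum being refused since it would only give the value \<open>cc p\<close>. Otherwise each
  \<open>d j\<close> with \<open>j < i\<close> is refused, because its value
  \<open>d (j + 1)\<close> is itself a base, and \<open>d i\<close> is accepted with value
  \<open>d (i + 1)\<close>.\<close>

lemma inv_Suc:
  assumes p: "inv p" "b0 \<le> p"
  shows "inv (Suc p)" "S (Suc p) \<inter> {..vv p} = S p"
    "\<not> critical B (Suc p) \<Longrightarrow> S (Suc p) = S p"
    "Suc p \<in> B \<Longrightarrow> \<exists>x. S (Suc p) = insert x (S p) \<and> vv p < x \<and> x \<le> vv p + cc p \<and> vv (Suc p) = x"
    "critical B (Suc p) \<Longrightarrow> Suc p \<notin> B \<Longrightarrow>
       S (Suc p) = S p \<union> dd p (base_of B p) ` {1..i} \<and> cc (Suc p) = dd p (base_of B p) i"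
proof -
  let ?n = "Suc p"
  have pv: "vv (base_of B p - 1) < cc p" "cc p \<le> vv p" "vv p = chn vv (base_of B p) (cc p) p"
    using p(1) by (auto simp: inv_def)
  have bp: "base_of B p \<in> B" "base_of B p \<le> p" "2 \<le> base_of B p"
    using base_of_bounds[OF B p(2)] base_of_ge2[OF B] by auto
  note dig = inv_base_digits[OF p]
  note Sle = S_cut[OF pv(2)]
  have chp: "change (upgrade B (S p)) b c m = enat (chn vv b c m)" if "2 \<le> b" "b \<le> Suc p" for b c m
    by (rule change_chn) (use that inv_self[OF p(1)] in auto)
  have eq: "S ?n = (if \<not> critical B ?n then S p else if ?n \<in> B then
       S p \<union> {cc p * a | a. vv p < cc p * a \<and> (\<forall>a'<a. \<not> vv p < cc p * a')}
       else S p \<union> {x. \<exists>j. 1 \<le> j \<and> j \<le> i \<and> iter_change (upgrade B (S p)) (base_of B ?n) ?n (cc p) j = enat x})"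
    using p(2) bp chp[of "base_of B p"] pv(3) by (simp add: ouro_stage.simps(2) Let_def cc_def[symmetric])
  consider (n) "\<not> critical B ?n" | (b) "?n \<in> B" | (c) "critical B ?n" "?n \<notin> B" by blast
  then have "inv ?n \<and> S ?n \<inter> {..vv p} = S p \<and> (\<not> critical B ?n \<longrightarrow> S ?n = S p) \<and>
     (?n \<in> B \<longrightarrow> (\<exists>x. S ?n = insert x (S p) \<and> vv p < x \<and> x \<le> vv p + cc p \<and> vv ?n = x)) \<and>
     (critical B ?n \<longrightarrow> ?n \<notin> B \<longrightarrow>
       S ?n = S p \<union> dd p (base_of B p) ` {1..i} \<and> cc ?n = dd p (base_of B p) i)"
  proof cases
    case n
    then have Sn: "S ?n = S p" using eq by simp
    then have cn: "cc ?n = cc p" by (simp add: cc_def)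
    have nB: "?n \<notin> B" using n base_of_self[OF B, of ?n] by (auto simp: critical_def)
    note bn = base_of_Suc[OF B p(2) nB]
    have "vv p < chn vv (base_of B p) (cc p) ?n"
      by (subst pv(3)) (rule chn_strict_mono[OF dig], auto)
    then have "inv ?n"
      using inv_SucI[OF p, of "chn vv (base_of B p) (cc p) ?n"] pv Sle by (auto simp: Sn cn bn)
    then show ?thesis using n nB Sn Sle by simp
  next
    case b
    note bn = base_of_self[OF B b]
    have crit: "critical B ?n" using bn by (simp add: critical_def)
    define a where "a = (LEAST a. vv p < cc p * a)"
    have ex: "\<exists>a. vv p < cc p * a"
      using mult_le_mono1[of 1 "cc p" "Suc (vv p)"] cc_ge2[of p] by (intro exI[of _ "Suc (vv p)"]) simp
    have a: "vv p < cc p * a" unfolding a_def by (rule LeastI_ex[OF ex])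
    have a': "\<not> vv p < cc p * a'" if "a' < a" for a' using not_less_Least that unfolding a_def by blast
    have uniq: "{cc p * a | a. vv p < cc p * a \<and> (\<forall>a'<a. \<not> vv p < cc p * a')} = {cc p * a}"
    proof -
      have "x = a" if "vv p < cc p * x" "\<forall>a'<x. \<not> vv p < cc p * a'" for x
        using that a a' by (metis linorder_neqE_nat)
      then show ?thesis using a a' by blast
    qed
    have Sn: "S ?n = insert (cc p * a) (S p)" using eq b crit by (simp add: uniq)
    have lt: "c < cc p * a" if "c \<in> S p" for c using cc_ge[OF that] pv(2) a by simp
    have cn: "cc ?n = cc p * a"
      unfolding cc_def[of ?n] Sn using S_ok(1)[of p] lt by (intro Max_eqI) (auto intro: less_imp_le)
    have "a > 0" using a by (cases a) auto
    then have up: "cc p * a \<le> vv p + cc p"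
      using a'[of "a - 1"] by (cases a) (auto simp: not_less)
    have dn: "digits vv ?n d" if "vv p < d" for d
      using that bp p(2) b02 by (intro inv_digits[OF p]) auto
    have Scut: "S ?n \<inter> {..vv p} = S p" using Sn a Sle by auto
    have "inv ?n \<and> vv ?n = cc p * a"
    proof (rule inv_SucI[OF p Scut])
      show "cc p * a = chn vv (base_of B ?n) (cc ?n) ?n"
        unfolding bn cn using chn_base[OF dn[OF a]] by simp
      show "vv (base_of B ?n - 1) < cc ?n" unfolding bn cn using a by simp
      fix d assume d: "d \<in> S ?n" "cc p \<le> d" "d < cc ?n"
      then have "d \<in> S p" using Sn cn by auto
      then have dc: "d = cc p" using d(2) cc_ge[of d p] by simp
      have "chn vv ?n d ?n \<le> vv p"
      proof -
        have "chn vv ?n d ?n = d"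
          using chn_decomp[of ?n ?n 1 1 0 vv d] b02 p(2) vv_small[of 0] vv_small[of 1] by (simp add: chn_less)
        then show ?thesis using dc pv(2) by simp
      qed
      then show "\<exists>d'\<in>S ?n. d < d' \<and> (d' \<le> chn vv (base_of B ?n) d ?n \<or> chn vv (base_of B ?n) d ?n \<le> vv p)"
        unfolding bn using d(3) cn cc_in[of ?n] by (intro bexI[of _ "cc ?n"]) auto
    qed (use Sn a cn in auto)
    then show ?thesis using b crit Sn a up Scut by (auto intro!: exI[of _ "cc p * a"])
  next
    case c
    note bn = base_of_Suc[OF B p(2) c(2)]
    let ?b = "base_of B p"
    let ?d = "dd p ?b"
    note ge = dd_ge[OF p]
    have dmono: "strict_mono ?d" using ge by (intro strict_mono_Suc_iff[THEN iffD2]) blast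
    have d1: "vv p < ?d 1"
      by (subst pv(3)) (simp add: chn_strict_mono[OF dig[OF order_refl]])
    have dj: "vv p < ?d j" if "1 \<le> j" for j
      using d1 dmono that by (metis le_neq_implies_less less_trans strict_mono_less)
    have it: "iter_change (upgrade B (S p)) ?b ?n (cc p) j = enat (?d j)" for j
      by (induction j) (use chp[of ?b] bp in auto)
    have Sn: "S ?n = S p \<union> ?d ` {1..i}"
      using eq c by (auto simp: bn it)
    have cn: "cc ?n = ?d i"
      unfolding cc_def[of ?n]
    proof (rule Max_eqI)
      show "?d i \<in> S ?n" using Sn i by auto
      show "y \<le> ?d i" if "y \<in> S ?n" for y
      proof -
        consider "y \<in> S p" | j where "1 \<le> j" "j \<le> i" "y = ?d j" using \<open>y \<in> S ?n\<close> Sn by auto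
        then show ?thesis
        proof cases
          case 1 then show ?thesis using cc_ge[OF 1] ge[of i] by simp
        next
          case 2 then show ?thesis using dmono by (simp add: strict_mono_less_eq)
        qed
      qed
    qed (rule S_ok)
    have Scut: "S ?n \<inter> {..vv p} = S p" using Sn dj Sle by (force simp: not_le[symmetric])
    have "inv ?n \<and> vv ?n = ?d (Suc i)"
    proof (rule inv_SucI[OF p Scut])
      show "?d (Suc i) = chn vv (base_of B ?n) (cc ?n) ?n" unfolding bn cn by simp
      show "vv p < ?d (Suc i)" by (rule dj) simp
      show "cc ?n \<le> ?d (Suc i)" unfolding cn using ge[of i] by simp
      show "vv (base_of B ?n - 1) < cc ?n" unfolding bn cn using pv(1) ge[of i] by simp
      fix d assume d: "d \<in> S ?n" "cc p \<le> d" "d < cc ?n"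
      obtain j where j: "j < i" "d = ?d j"
      proof (cases "d \<in> S p")
        case True
        then show ?thesis using cc_ge[OF True] d(2) i by (intro that[of 0]) auto
      next
        case False
        then obtain j where "j \<le> i" "d = ?d j" using d(1) Sn by auto
        then show ?thesis using d(3) cn by (intro that[of j]) (auto simp: le_less)
      qed
      have "?d (Suc j) \<in> S ?n" using Sn j(1) by (simp del: dd.simps)
      then show "\<exists>d'\<in>S ?n. d < d' \<and> (d' \<le> chn vv (base_of B ?n) d ?n \<or> chn vv (base_of B ?n) d ?n \<le> vv p)"
        unfolding bn using ge[of j] j by (intro bexI[of _ "?d (Suc j)"]) auto
    qed (use Sn in auto)
    then show ?thesis using c Sn cn Scut by simp
  qed
  then show "inv ?n" "S ?n \<inter> {..vv p} = S p" "\<not> critical B ?n \<Longrightarrow> S ?n = S p"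
    "?n \<in> B \<Longrightarrow> \<exists>x. S ?n = insert x (S p) \<and> vv p < x \<and> x \<le> vv p + cc p \<and> vv ?n = x"
    "critical B ?n \<Longrightarrow> ?n \<notin> B \<Longrightarrow> S ?n = S p \<union> dd p (base_of B p) ` {1..i} \<and> cc ?n = dd p (base_of B p) i"
    by auto
qed

lemma inv: "b0 \<le> p \<Longrightarrow> inv p"
  by (induction p rule: dec_induct) (auto intro: inv_b0 inv_Suc)

lemma S_small: "n \<le> b0 \<Longrightarrow> S n = {b0 + 1}"
  by (cases n) (auto simp: ouro_stage.simps(2) Let_def)

lemma vv_strict_mono: "strict_mono vv"
proof (rule strict_monoI)
  fix m n :: nat assume "m < n"
  then show "vv m < vv n" using inv[of "max n b0"] by (auto simp: inv_def)
qed

lemma vv_ge: "n \<le> vv n"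
  using strict_mono_imp_increasing[OF vv_strict_mono] .

lemma vv_mono: "m \<le> n \<Longrightarrow> vv m \<le> vv n"
  using vv_strict_mono by (simp add: strict_mono_less_eq)

lemma vv_eq: "b0 \<le> p \<Longrightarrow> vv p = chn vv (base_of B p) (cc p) p" "b0 \<le> p \<Longrightarrow> cc p \<le> vv p"
  using inv[unfolded inv_def] by blast+

lemma S_cut_le:
  assumes "b0 \<le> p" "p \<le> q"
  shows "S q \<inter> {..vv p} = S p"
  using assms(2)
proof (induction q rule: dec_induct)
  case base
  show ?case using S_cut[OF vv_eq(2)[OF assms(1)]] .
next
  case (step q)
  have "S (Suc q) \<inter> {..vv p} = (S (Suc q) \<inter> {..vv q}) \<inter> {..vv p}" using vv_mono[OF step(1)] by auto
  also have "\<dots> = S p" using inv_Suc(2)[OF inv, of q] step assms(1) by simp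
  finally show ?case .
qed

lemma S_mono: "p \<le> q \<Longrightarrow> S p \<subseteq> S q"
proof -
  assume pq: "p \<le> q"
  show ?thesis
  proof (cases "b0 \<le> p")
    case True then show ?thesis using S_cut_le[OF True pq] by auto
  next
    case False
    then show ?thesis using S_small[of p] S_small[of q] S_small[of b0] S_cut_le[of b0 q] by (cases "b0 \<le> q") auto
  qed
qed

lemma ouro_cut: "b0 \<le> p \<Longrightarrow> ouro B i \<inter> {..vv p} = S p"
proof
  assume p: "b0 \<le> p"
  show "ouro B i \<inter> {..vv p} \<subseteq> S p"
  proof
    fix x assume x: "x \<in> ouro B i \<inter> {..vv p}"
    then obtain q where "x \<in> S q" by (auto simp: ouro_def)
    then have "x \<in> S (max p q)" using S_mono[of q "max p q"] by auto
    then show "x \<in> S p" using S_cut_le[OF p, of "max p q"] x by auto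
  qed
  show "S p \<subseteq> ouro B i \<inter> {..vv p}" using S_cut[OF vv_eq(2)[OF p]] by (auto simp: ouro_def)
qed

text \<open>As \<open>x \<le> vv x\<close>, everything up to \<open>x\<close> is settled at stage
  \<open>x\<close>. This bounds the quantifier over stages by the element when it is evaluated in a
  cut.\<close>

lemma ouro_stage_bound: "x \<in> ouro B i \<Longrightarrow> x \<in> S x"
proof -
  assume x: "x \<in> ouro B i"
  have "b0 \<le> x"
  proof (rule ccontr)
    assume "\<not> b0 \<le> x"
    then have "x \<in> ouro B i \<inter> {..vv b0}" using x inv_b0(2) by auto
    then show False using ouro_cut[of b0] S_small[of b0] \<open>\<not> b0 \<le> x\<close> by auto
  qed
  then show ?thesis using ouro_cut[of x] x vv_ge[of x] by auto
qed

lemma upgrade_ouro: "upgrade B (ouro B i) n = enat (vv n)"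
  using inv_upg[OF inv, of "max n b0" n] ouro_cut[of "max n b0"] by simp

text \<open>The facts about a proper multiple \<open>n\<close> of a base \<open>b\<close> below the
  next base from which all lower bounds are derived: between \<open>d 0\<close> and
  \<open>vv n\<close> the successor has exactly the bases \<open>d 0\<close>, ...,
  \<open>d i\<close>.\<close>

lemma critical_up:
  assumes b: "b \<in> B" "b < n" "b dvd n" "enat n < next_base B b"
  obtains d where "vv b \<le> d 0" "\<And>j. d j < d (Suc j)" "\<And>j. d (Suc j) = chn vv b (d j) n"
    "\<And>j. digits vv b (d j)" "vv n = d (Suc i)" "\<And>j. j \<le> i \<Longrightarrow> d j \<in> ouro B i"
    "\<And>j. j < i \<Longrightarrow> enat (d (Suc j)) \<le> next_base (ouro B i) (d j)"
    "enat (vv n) < next_base (ouro B i) (d i)"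
proof -
  obtain p where p: "n = Suc p" using b(2) by (cases n) auto
  have b0b: "b0 \<le> b" using b(1) by (intro cInf_lower) auto
  have below: "b' \<le> b" if "b' \<in> B" "b' \<le> n" for b'
    using next_base_le[OF that(1), of b] b(4) that(2) by (cases "next_base B b") (auto simp: not_less[symmetric])
  have bp: "base_of B p = b" and bn: "base_of B n = b"
    by (rule base_of_eqI[OF B]; use b below p in auto)+
  have nB: "n \<notin> B" using below[of n] b(2) by auto
  have p0: "b0 \<le> p" using b0b b(2) p by simp
  note I = inv[OF p0]
  let ?d = "dd p b"
  note ge = dd_ge[OF I p0, unfolded bp]
  note C = inv_Suc(5)[OF I p0, folded p, unfolded critical_def bn bp, OF b(3) nB]
  have vn: "vv n = ?d (Suc i)" using vv_eq(1)[of n] p0 C by (simp add: p bn[unfolded p])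
  have mono: "strict_mono ?d" using ge by (intro strict_mono_Suc_iff[THEN iffD2]) blast
  have above: "vv n < d' \<or> (\<exists>k\<le>i. d' = ?d k \<and> j < k)" if "d' \<in> ouro B i" "?d j < d'" for d' j
  proof (cases "d' \<le> vv n")
    case True
    then have "d' \<in> S n" using ouro_cut[of n] that(1) p0 p by auto
    then consider "d' \<in> S p" | k where "1 \<le> k" "k \<le> i" "d' = ?d k" using C by auto
    then show ?thesis
    proof cases
      case 1 then show ?thesis using cc_ge[OF 1] ge[of j] that(2) by simp
    next
      case 2 then show ?thesis using that(2) mono by (auto simp: strict_mono_less)
    qed
  qed simp
  show ?thesis
  proof (rule that[of ?d])
    \<comment> \<open>\<open>b\<close> itself is upgraded to the maximum of stage \<open>b\<close>,
      and maxima of later stages are no smaller.\<close>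
    show "vv b \<le> ?d 0"
    proof -
      have "vv b = cc b"
        using vv_eq(1)[OF b0b] base_of_self[OF B b(1)] inv_base_digits[OF inv[OF b0b], of "cc b"] chn_base b0b by simp
      also have "\<dots> \<le> cc p" using S_mono[of b p] cc_in[of b] cc_ge[of "cc b" p] b(2) p by auto
      finally show ?thesis by simp
    qed
    show "?d j < ?d (Suc j)" for j using ge by blast
    show "?d (Suc j) = chn vv b (?d j) n" for j by (simp add: p)
    show "digits vv b (?d j)" for j using inv_base_digits[OF I p0, of "?d j"] ge[of j] bp by simp
    show "vv n = ?d (Suc i)" by (rule vn)
    show "?d j \<in> ouro B i" if "j \<le> i" for j
    proof -
      have "?d j \<in> S n"
        using C cc_in[of p] S_mono[of p n] p that by (cases "j = 0") auto
      then show ?thesis by (auto simp: ouro_def)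
    qed
    show "enat (?d (Suc j)) \<le> next_base (ouro B i) (?d j)" if "j < i" for j
    proof (rule next_base_ge)
      fix c' assume "c' \<in> ouro B i" "?d j < c'"
      from above[OF this] show "?d (Suc j) \<le> c'"
      proof
        assume "vv n < c'"
        moreover have "?d (Suc j) \<le> ?d (Suc i)" using that by (simp only: strict_mono_less_eq[OF mono] Suc_le_mono)
        ultimately show ?thesis unfolding vn by linarith
      next
        assume "\<exists>k\<le>i. c' = ?d k \<and> j < k"
        then obtain k where "c' = ?d k" "Suc j \<le> k" by auto
        then show ?thesis by (simp only: strict_mono_less_eq[OF mono])
      qed
    qed
    show "enat (vv n) < next_base (ouro B i) (?d i)"
    proof (rule next_base_gt)
      fix c' assume "c' \<in> ouro B i" "?d i < c'"
      from above[OF this] show "vv n < c'" by auto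
    qed
  qed
qed

lemma Inf_ouro: "Inf (ouro B i) = b0 + 1"
proof (rule cInf_eq_minimum)
  show "b0 + 1 \<in> ouro B i" using S_small[of b0] by (auto simp: ouro_def)
  fix x assume "x \<in> ouro B i"
  then have "x \<le> vv b0 \<Longrightarrow> x \<in> S b0" unfolding ouro_cut[OF order_refl, symmetric] by simp
  then show "b0 + 1 \<le> x" using inv_b0(2) S_small[of b0] by (cases "x \<le> vv b0") simp_all
qed

end

subsection \<open>Growth of the stages\<close>

text \<open>Bounds one node \<open>c ^ e * a + r\<close> of a changed number once \<open>c\<close>,
  the changed \<open>e\<close>, \<open>a\<close> and \<open>r\<close> are at most
  \<open>x\<close>.\<close>

definition ff :: "nat \<Rightarrow> nat" where "ff x = x ^ x * x + x"

lemma ff_mono: "mono ff"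
proof (rule monoI)
  fix x y :: nat assume xy: "x \<le> y"
  have "x ^ x \<le> y ^ y"
  proof (cases "x = 0")
    case True then show ?thesis by (cases "y = 0") (auto simp: Suc_le_eq)
  next
    case False
    have "x ^ x \<le> y ^ x" using xy by (intro power_mono) auto
    also have "\<dots> \<le> y ^ y" using xy False by (intro power_increasing) auto
    finally show ?thesis .
  qed
  then show "ff x \<le> ff y" unfolding ff_def using xy by (intro add_mono mult_le_mono)
qed

lemma ff_ge: "x \<le> ff x" by (simp add: ff_def)

lemma ff_pow:
  shows "mono (ff ^^ m)" "x \<le> (ff ^^ m) x" "m \<le> m' \<Longrightarrow> (ff ^^ m) x \<le> (ff ^^ m') x"
proof -
  show "mono (ff ^^ m)" using ff_mono by (induction m) (auto simp: mono_def)
  show "x \<le> (ff ^^ m) x"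
  proof (induction m)
    case (Suc m) then show ?case using ff_ge[of "(ff ^^ m) x"] by simp
  qed simp
  show "(ff ^^ m) x \<le> (ff ^^ m') x" if "m \<le> m'"
    using that
  proof (induction rule: dec_induct)
    case (step n) then show ?case using ff_ge[of "(ff ^^ n) x"] by simp
  qed simp
qed

lemma chn_bound:
  assumes "2 \<le> b" "c \<le> V" "1 \<le> V" "\<And>m. m < b \<Longrightarrow> v m \<le> V"
  shows "chn v b c n \<le> (ff ^^ n) V"
proof (induction n rule: less_induct)
  case (less n)
  show ?case
  proof (cases "n < b")
    case True
    then show ?thesis using assms(4)[OF True] ff_pow(2)[of V n] by (simp add: chn_less)
  next
    case False
    obtain e a r where n: "a < b" "e < n" "r < n" "chn v b c n = c ^ chn v b c e * v a + chn v b c r"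
      using decomp_bounds[OF assms(1), of n] False by (metis not_less)
    obtain k where k: "n = Suc k" using n(2) by (cases n) auto
    let ?y = "(ff ^^ k) V"
    have V: "V \<le> ?y" by (rule ff_pow)
    have e: "chn v b c e \<le> ?y" using less[OF n(2)] ff_pow(3)[of e k V] n(2) k by simp
    have r: "chn v b c r \<le> ?y" using less[OF n(3)] ff_pow(3)[of r k V] n(3) k by simp
    have "c ^ chn v b c e \<le> ?y ^ chn v b c e" using V assms(2) by (intro power_mono) auto
    also have "\<dots> \<le> ?y ^ ?y" using V assms(3) e by (intro power_increasing) auto
    finally have "c ^ chn v b c e * v a + chn v b c r \<le> ?y ^ ?y * ?y + ?y"
      using V assms(4)[OF n(1)] r by (intro add_mono mult_le_mono) auto
    also have "\<dots> = (ff ^^ n) V" unfolding k by (simp add: ff_def[of ?y])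
    finally show ?thesis unfolding n(4) .
  qed
qed

context ouro_step
begin

lemma vv_Suc_bound:
  assumes p: "b0 \<le> p"
  shows "vv (Suc p) \<le> (ff ^^ (Suc p * Suc i)) (vv p)"
proof -
  note I = inv[OF p]
  have bp: "2 \<le> base_of B p" "base_of B p \<le> p"
    using base_of_ge2[OF B] base_of_bounds[OF B p] by auto
  have v1: "1 \<le> vv p" using vv_ge[of p] p b02 by simp
  have small: "vv m \<le> (ff ^^ k) (vv p)" if "m < base_of B p" for m k
    using vv_mono[of m p] that bp ff_pow(2)[of "vv p" k] by simp
  have d: "dd p (base_of B p) j \<le> (ff ^^ (Suc p * j)) (vv p)" for j
  proof (induction j)
    case 0 then show ?case using vv_eq(2)[OF p] by simp
  next
    case (Suc j)
    have "dd p (base_of B p) (Suc j) \<le> (ff ^^ Suc p) ((ff ^^ (Suc p * j)) (vv p))"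
      unfolding dd.simps
      by (rule chn_bound[OF bp(1) Suc]) (use v1 ff_pow(2)[of "vv p" "Suc p * j"] small in auto)
    also have "\<dots> = (ff ^^ (Suc p * Suc j)) (vv p)" by (simp only: mult_Suc_right funpow_add comp_apply)
    finally show ?case .
  qed
  consider "\<not> critical B (Suc p)" | "Suc p \<in> B" | "critical B (Suc p)" "Suc p \<notin> B" by blast
  then show ?thesis
  proof cases
    case 1
    then have nB: "Suc p \<notin> B" using base_of_self[OF B, of "Suc p"] by (auto simp: critical_def)
    have "vv (Suc p) = dd p (base_of B p) 1"
      using vv_eq(1)[of "Suc p"] p inv_Suc(3)[OF I p 1] base_of_Suc[OF B p nB] by (simp add: cc_def)
    also have "\<dots> \<le> (ff ^^ (Suc p * 1)) (vv p)" by (rule d)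
    also have "\<dots> \<le> (ff ^^ (Suc p * Suc i)) (vv p)" by (rule ff_pow) simp
    finally show ?thesis .
  next
    case 2
    then have "vv (Suc p) \<le> vv p + vv p" using inv_Suc(4)[OF I p 2] vv_eq(2)[OF p] by auto
    also have "\<dots> \<le> ff (vv p)" using v1 by (simp add: ff_def)
    also have "\<dots> = (ff ^^ 1) (vv p)" by simp
    also have "\<dots> \<le> (ff ^^ (Suc p * Suc i)) (vv p)" by (rule ff_pow) simp
    finally show ?thesis .
  next
    case 3
    have "vv (Suc p) = dd p (base_of B p) (Suc i)"
      using vv_eq(1)[of "Suc p"] p inv_Suc(5)[OF I p 3] base_of_Suc[OF B p 3(2)] by simp
    then show ?thesis using d[of "Suc i"] by simp
  qed
qed

text \<open>The step to \<open>p\<close> involves at most \<open>i + 1\<close> changes of base, each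
  costing \<open>p\<close> applications of \<open>ff\<close>; summing over the steps gives the crude
  exponent. The purpose is to keep the elements of a stage within a cut that contains
  \<open>p\<close>, \<open>i\<close> and the least base.\<close>

lemma stage_bound: "x \<in> S p \<Longrightarrow> x \<le> (ff ^^ (p * p * Suc i)) (b0 + 1)"
proof -
  assume x: "x \<in> S p"
  have "vv p \<le> (ff ^^ (p * p * Suc i)) (b0 + 1)" if "b0 \<le> p"
    using that
  proof (induction p rule: dec_induct)
    case base then show ?case using inv_b0(2) ff_pow(2) by simp
  next
    case (step p)
    have "vv (Suc p) \<le> (ff ^^ (Suc p * Suc i)) (vv p)" by (rule vv_Suc_bound[OF step(1)])
    also have "\<dots> \<le> (ff ^^ (Suc p * Suc i)) ((ff ^^ (p * p * Suc i)) (b0 + 1))"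
      by (rule monoD[OF ff_pow(1)]) (rule step.IH)
    also have "\<dots> = (ff ^^ (Suc p * Suc i + p * p * Suc i)) (b0 + 1)" by (simp only: funpow_add comp_apply)
    also have "\<dots> \<le> (ff ^^ (Suc p * Suc p * Suc i)) (b0 + 1)"
      by (rule ff_pow) (simp add: algebra_simps)
    finally show ?case .
  qed
  moreover have "x \<le> vv p" if "b0 \<le> p" using cc_ge[OF x] vv_eq(2)[OF that] by simp
  moreover have "x \<le> b0 + 1" if "\<not> b0 \<le> p" using that x S_small[of p] by simp
  ultimately show ?thesis using ff_pow(2)[of "b0 + 1" "p * p * Suc i"] by (cases "b0 \<le> p") linarith+
qed

end

section \<open>Long Goodstein sequences\<close>

locale ouro_hierarchies =
  fixes B0 :: "nat set"
  assumes B0: "ok B0"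
begin

abbreviation "Bs \<equiv> ouro_seq B0"

definition up :: "nat \<Rightarrow> nat \<Rightarrow> nat" where "up i = ouro_step.vv (Bs i) (Suc i)"

sublocale level: ouro_step "Bs i" "Suc i" for i
  by unfold_locales (simp_all add: ouro_seq_ok B0)

lemma upgrade_up: "upgrade (Bs i) (Bs (Suc i)) n = enat (up i n)"
  using level.upgrade_ouro[of i n] by (simp add: up_def)

lemma up_mono: "strict_mono (up i)" and up_ge: "n \<le> up i n"
  using level.vv_strict_mono[of i] level.vv_ge[of n i] by (simp_all add: up_def)

lemma up_le: "m \<le> n \<Longrightarrow> up i m \<le> up i n" and up_less: "m < n \<Longrightarrow> up i m < up i n"
  using up_mono by (simp_all add: strict_mono_less_eq strict_mono_less)

fun ups :: "nat \<Rightarrow> nat \<Rightarrow> nat \<Rightarrow> nat" where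
  "ups i 0 x = x"
| "ups i (Suc d) x = up (i + d) (ups i d x)"

lemma ups_le: "x \<le> y \<Longrightarrow> ups i d x \<le> ups i d y" and ups_less: "x < y \<Longrightarrow> ups i d x < ups i d y"
  and ups_ge: "x \<le> ups i d x"
proof -
  show "x \<le> y \<Longrightarrow> ups i d x \<le> ups i d y" by (induction d) (auto intro: up_le)
  show "x < y \<Longrightarrow> ups i d x < ups i d y" by (induction d) (auto intro: up_less)
  show "x \<le> ups i d x"
  proof (induction d)
    case (Suc d) then show ?case using up_ge[of "ups i d x" "i + d"] by simp
  qed simp
qed

lemma ups_add: "ups (i + d) e (ups i d x) = ups i (d + e) x"
  by (induction e) (auto simp: add.assoc)

text \<open>Starting at stage \<open>i\<close> with the value \<open>x\<close>, at least \<open>\<alpha>\<close> many steps can be made before the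
  value drops below the upgrades of \<open>y\<close>, even if before each step an arbitrary number \<open>d\<close> of
  upgrades without subtraction is interposed. The delays \<open>d\<close> make the notion inherit to later
  stages, so that no monotonicity of fundamental sequences is needed.\<close>

primrec lasts :: "tree \<Rightarrow> nat \<Rightarrow> nat \<Rightarrow> nat \<Rightarrow> bool" where
  "lasts Leaf = (\<lambda>i x y. y \<le> x)"
| "lasts (Node f) = (\<lambda>i x y. y < x \<and>
     (\<forall>d. lasts (f (i + d)) (Suc (i + d)) (ups i (Suc d) x - 1) (ups i (Suc d) y)))"

lemma lasts_le: "lasts \<alpha> i x y \<Longrightarrow> y \<le> x"
  by (cases \<alpha>) auto

lemma lasts_mono: "lasts \<alpha> i x y \<Longrightarrow> x \<le> x' \<Longrightarrow> y' \<le> y \<Longrightarrow> lasts \<alpha> i x' y'"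
proof (induction \<alpha> arbitrary: i x y x' y')
  case (Node f)
  have "lasts (f (i + d)) (Suc (i + d)) (ups i (Suc d) x' - 1) (ups i (Suc d) y')" for d
  proof (rule Node.IH)
    show "lasts (f (i + d)) (Suc (i + d)) (ups i (Suc d) x - 1) (ups i (Suc d) y)" using Node.prems by simp
    show "ups i (Suc d) x - 1 \<le> ups i (Suc d) x' - 1" using ups_le[OF Node.prems(2)] by (rule diff_le_mono)
    show "ups i (Suc d) y' \<le> ups i (Suc d) y" using ups_le[OF Node.prems(3)] .
  qed simp
  then show ?case using Node.prems by simp
qed simp

text \<open>Delays add up, so after a delay by \<open>d\<close> only some of the delays already
  quantified over are left to consider.\<close>

lemma lasts_delay: "lasts \<alpha> i x y \<Longrightarrow> lasts \<alpha> (i + d) (ups i d x) (ups i d y)"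
proof (cases \<alpha>)
  case (Node f)
  assume *: "lasts \<alpha> i x y"
  have "lasts (f (i + d + e)) (Suc (i + d + e)) (ups (i + d) (Suc e) (ups i d x) - 1) (ups (i + d) (Suc e) (ups i d y))" for e
    using *[unfolded Node] unfolding ups_add lasts.simps by (simp add: add.assoc del: ups.simps)
  then show ?thesis using * Node by (simp add: ups_less del: ups.simps)
qed (simp add: ups_le)

text \<open>The value first comes down to \<open>y\<close> in \<beta> many steps and then to
  \<open>z\<close> in \<alpha> many. In the meantime \<open>y\<close> has itself been upgraded,
  which \<open>lasts_delay\<close> accounts for.\<close>

lemma lasts_plus: "lasts \<beta> i x y \<Longrightarrow> lasts \<alpha> i y z \<Longrightarrow> lasts (plus_tree \<alpha> \<beta>) i x z"
proof (induction \<beta> arbitrary: i x y z)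
  case Leaf then show ?case by (auto intro: lasts_mono)
next
  case (Node f)
  have "lasts (plus_tree \<alpha> (f (i + d))) (Suc (i + d)) (ups i (Suc d) x - 1) (ups i (Suc d) z)" for d
  proof (rule Node.IH)
    show "lasts (f (i + d)) (Suc (i + d)) (ups i (Suc d) x - 1) (ups i (Suc d) y)" using Node.prems by simp
    show "lasts \<alpha> (Suc (i + d)) (ups i (Suc d) y) (ups i (Suc d) z)"
      using lasts_delay[OF Node.prems(2), of "Suc d"] by simp
  qed simp
  then show ?case using Node.prems lasts_le[OF Node.prems(2)] by simp
qed

text \<open>For \<open>n = b * a\<close> with a digit \<open>a\<close>, changing \<open>b\<close> to
  \<open>d j\<close> gives \<open>d j * up i a\<close>, so the new bases form a geometric
  progression. The bound on \<open>d j * (up i a - 1)\<close> says that the situation of the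
  hypotheses recurs at every \<open>d j\<close>, with a factor lowered by 1.\<close>

lemma up_base:
  assumes "b \<in> Bs i" "2 \<le> a" "a < b" "enat (b * a) < next_base (Bs i) b"
  obtains d where "up i b \<le> d 0" "\<And>j. d (Suc j) = d j * up i a" "up i (b * a) = d (Suc i) * up i a"
    "\<And>j. j \<le> Suc i \<Longrightarrow> d j \<in> Bs (Suc i) \<and> up i a < d j \<and> 2 \<le> d j"
    "\<And>j. j \<le> Suc i \<Longrightarrow> enat (d j * (up i a - 1)) < next_base (Bs (Suc i)) (d j)"
    "enat (d (Suc i) * up i a) < next_base (Bs (Suc i)) (d (Suc i))"
proof -
  have b: "b < b * a" "b dvd b * a" using assms(2,3) by auto
  obtain d where d: "up i b \<le> d 0" "\<And>j. d j < d (Suc j)" "\<And>j. d (Suc j) = chn (up i) b (d j) (b * a)"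
    "\<And>j. digits (up i) b (d j)" "up i (b * a) = d (Suc (Suc i))" "\<And>j. j \<le> Suc i \<Longrightarrow> d j \<in> Bs (Suc i)"
    "\<And>j. j < Suc i \<Longrightarrow> enat (d (Suc j)) \<le> next_base (Bs (Suc i)) (d j)"
    "enat (up i (b * a)) < next_base (Bs (Suc i)) (d (Suc i))"
    using level.critical_up[OF assms(1) b assms(4)] unfolding up_def[symmetric] ouro_seq.simps[symmetric] by metis
  have s: "d (Suc j) = d j * up i a" for j
    using d(3)[of j] chn_mult[OF d(4)[of j], of a] assms(2,3) by simp
  have dj: "up i a < d j \<and> 2 \<le> d j" for j using d(4)[of j] assms(3) by (auto simp: digits_def)
  have a1: "1 \<le> up i a" using up_ge[of a i] assms(2) by simp
  have "enat (d j * (up i a - 1)) < next_base (Bs (Suc i)) (d j)" if "j \<le> Suc i" for j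
  proof -
    have lt: "d j * (up i a - 1) < d (Suc j)" unfolding s using dj[of j] a1 by simp
    show ?thesis
    proof (cases "j = Suc i")
      case True
      then show ?thesis using d(8) lt unfolding d(5) by (metis enat_ord_simps(2) less_trans)
    next
      case False
      then have "j < Suc i" using that by simp
      from d(7)[OF this] show ?thesis using lt by (metis enat_ord_simps(2) less_le_trans)
    qed
  qed
  note lt = this
  show ?thesis
  proof (rule that[of d])
    show "d j \<in> Bs (Suc i) \<and> up i a < d j \<and> 2 \<le> d j" if "j \<le> Suc i" for j using d(6)[OF that] dj by blast
    show "enat (d (Suc i) * up i a) < next_base (Bs (Suc i)) (d (Suc i))" using d(8) unfolding d(5) s .
    show "up i (b * a) = d (Suc i) * up i a" unfolding d(5) s ..
  qed (use d(1) s lt in auto)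
qed

text \<open>A delay keeps the shape base times factor: the last new base
  \<open>D (Suc (i + d))\<close> divides the upgraded value, with the upgraded factor as
  quotient.\<close>

lemma persist:
  assumes "b \<in> Bs i" "2 \<le> a" "a < b" "enat (b * a) < next_base (Bs i) b"
  shows "\<exists>b'. b' \<in> Bs (i + d) \<and> ups i d b \<le> b' \<and> ups i d (b * a) = b' * ups i d a \<and> ups i d a < b' \<and>
    enat (b' * ups i d a) < next_base (Bs (i + d)) b'"
proof (induction d)
  case 0 then show ?case using assms by auto
next
  case (Suc d)
  then obtain b' where b': "b' \<in> Bs (i + d)" "ups i d b \<le> b'" "ups i d (b * a) = b' * ups i d a" "ups i d a < b'"
    "enat (b' * ups i d a) < next_base (Bs (i + d)) b'" by blast
  have a2: "2 \<le> ups i d a" using ups_ge[of a i d] assms(2) by simp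
  obtain D where D: "up (i + d) b' \<le> D 0" "\<And>j. D (Suc j) = D j * up (i + d) (ups i d a)"
    "up (i + d) (b' * ups i d a) = D (Suc (i + d)) * up (i + d) (ups i d a)"
    "\<And>j. j \<le> Suc (i + d) \<Longrightarrow> D j \<in> Bs (Suc (i + d)) \<and> up (i + d) (ups i d a) < D j \<and> 2 \<le> D j"
    "enat (D (Suc (i + d)) * up (i + d) (ups i d a)) < next_base (Bs (Suc (i + d))) (D (Suc (i + d)))"
    using up_base[OF b'(1) a2 b'(4,5)] by metis
  have u1: "1 \<le> up (i + d) (ups i d a)" using a2 up_ge[of "ups i d a" "i + d"] by simp
  have "D 0 \<le> D j" for j
  proof (induction j)
    case (Suc j)
    have "D j * 1 \<le> D j * up (i + d) (ups i d a)" by (rule mult_le_mono2[OF u1])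
    then show ?case using Suc unfolding D(2)[of j] by linarith
  qed simp
  then have "ups i (Suc d) b \<le> D (Suc (i + d))"
    using D(1) up_le[OF b'(2), of "i + d"] by (metis le_trans ups.simps(2))
  then show ?case using D(3,5) D(4)[of "Suc (i + d)"] b'(3)
    by (intro exI[of _ "D (Suc (i + d))"]) (simp del: ouro_seq.simps)
qed

text \<open>The new bases \<open>d\<^sub>0 < \<dots> < d\<^bsub>i+1\<^esub>\<close> below \<open>\<up>(b a)\<close> satisfy \<open>d\<^bsub>j+1\<^esub> = d\<^sub>j \<sqdot> \<up>a\<close>, so
  after one step the situation is repeated \<open>i + 2\<close> times with \<open>\<up>a - 1\<close> in place of \<open>a\<close>.\<close>

lemma lasts_expo:
  "lasts \<alpha> i a y \<Longrightarrow> 2 \<le> y \<Longrightarrow> b \<in> Bs i \<Longrightarrow> a < b \<Longrightarrow> enat (b * a) < next_base (Bs i) b \<Longrightarrow>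
    lasts (expo \<alpha>) i (b * a) b"
proof (induction \<alpha> arbitrary: i a y b)
  case Leaf
  then have ba: "b < b * a" by auto
  have "ups i (Suc d) b \<le> ups i (Suc d) (b * a) - 1" for d using ups_less[OF ba, of i "Suc d"] by linarith
  then show ?case using ba by (simp del: ups.simps)
next
  case (Node f)
  \<comment> \<open>The threshold \<open>y \<ge> 2\<close> keeps the factor at least 2, so that
    \<open>b * a\<close> is a proper multiple of \<open>b\<close>.\<close>
  have a: "2 \<le> a" "y < a" using Node.prems(1,2) by auto
  have ba: "b < b * a" using a Node.prems(4) by simp
  have "lasts (times_tree (expo (f (i + d))) (i + d + 2)) (Suc (i + d)) (ups i (Suc d) (b * a) - 1) (ups i (Suc d) b)" for d
  proof -
    let ?i = "i + d"
    let ?a = "ups i d a"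
    let ?a' = "ups i (Suc d) a - 1"
    obtain b' where b': "b' \<in> Bs ?i" "ups i d b \<le> b'" "ups i d (b * a) = b' * ?a" "?a < b'"
      "enat (b' * ?a) < next_base (Bs ?i) b'" using persist[OF Node.prems(3) a(1) Node.prems(4,5)] by blast
    have a2: "2 \<le> ?a" using ups_ge[of a i d] a by simp
    obtain D where D: "up ?i b' \<le> D 0" "\<And>j. D (Suc j) = D j * up ?i ?a" "up ?i (b' * ?a) = D (Suc ?i) * up ?i ?a"
      "\<And>j. j \<le> Suc ?i \<Longrightarrow> D j \<in> Bs (Suc ?i) \<and> up ?i ?a < D j \<and> 2 \<le> D j"
      "\<And>j. j \<le> Suc ?i \<Longrightarrow> enat (D j * (up ?i ?a - 1)) < next_base (Bs (Suc ?i)) (D j)"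
      using up_base[OF b'(1) a2 b'(4,5)] by metis
    have la: "lasts (f ?i) (Suc ?i) ?a' (ups i (Suc d) y)" using Node.prems(1) by (simp del: ups.simps)
    have y2: "2 \<le> ups i (Suc d) y" using ups_ge[of y i "Suc d"] Node.prems(2) by (meson le_trans)
    have block: "lasts (expo (f ?i)) (Suc ?i) (D j * ?a') (D j)" if "j \<le> Suc ?i" for j
      using Node.IH[OF _ la y2, where b = "D j"] D(4)[OF that] D(5)[OF that] by auto
    have le: "D j * ?a' \<le> D (Suc j)" for j unfolding D(2) by simp
    \<comment> \<open>The blocks are stacked from below: the process for
      \<open>D (j + 1) * ?a'\<close> ends at \<open>D (j + 1)\<close>, which is at least
      \<open>D j * ?a'\<close>, where the next lower block starts.\<close>
    have "lasts (times_tree (expo (f ?i)) (Suc j)) (Suc ?i) (D j * ?a') (D 0)" if "j \<le> Suc ?i" for j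
      using that
    proof (induction j)
      case 0
      show ?case using lasts_plus[OF block[of 0], of Leaf "D 0"] by simp
    next
      case (Suc j)
      have "lasts (times_tree (expo (f ?i)) (Suc j)) (Suc ?i) (D (Suc j)) (D 0)"
        using Suc by (intro lasts_mono[OF Suc.IH le order_refl]) simp
      from lasts_plus[OF block[OF Suc.prems] this] show ?case
        unfolding times_tree.simps(2)[of _ "Suc j"] .
    qed
    from this[of "Suc ?i"] have "lasts (times_tree (expo (f ?i)) (?i + 2)) (Suc ?i) (D (Suc ?i) * ?a') (D 0)"
      by simp
    \<comment> \<open>\<open>D * u - 1 \<ge> D * (u - 1)\<close> for \<open>D \<ge> 1\<close>: after
      the subtraction enough is left to start the top block.\<close>
    moreover have "D (Suc ?i) * ?a' \<le> ups i (Suc d) (b * a) - 1"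
    proof -
      have "ups i (Suc d) (b * a) = D (Suc ?i) * up ?i ?a" using b'(3) D(3) by simp
      moreover have "1 \<le> D (Suc ?i)" using D(4)[of "Suc ?i"] by simp
      moreover have "1 \<le> up ?i ?a" using up_ge[of ?a ?i] a2 by simp
      ultimately show ?thesis by (simp add: diff_mult_distrib2)
    qed
    moreover have "ups i (Suc d) b \<le> D 0" using D(1) up_le[OF b'(2), of ?i] by simp
    ultimately show ?thesis by (rule lasts_mono)
  qed
  then show ?case using ba by (simp del: ups.simps times_tree.simps)
qed

text \<open>Products \<open>b_k * ... * b_1 * 2\<close> in which each partial product is less than
  the base it is multiplied with, and the result still lies before the base after that. By
  \<open>lasts_expo\<close> each factor contributes one exponential.\<close>

inductive chain :: "nat \<Rightarrow> nat \<Rightarrow> nat \<Rightarrow> bool" for i where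
  "chain i 0 2"
| "chain i k x \<Longrightarrow> b \<in> Bs i \<Longrightarrow> x < b \<Longrightarrow> enat (b * x) < next_base (Bs i) b \<Longrightarrow> chain i (Suc k) (b * x)"

lemma chain_lasts: "chain i k x \<Longrightarrow> lasts (tower k) i x 2"
proof (induction rule: chain.induct)
  case (2 k x b)
  have "2 \<le> b" using lasts_le[OF 2(5)] 2(3) by simp
  then show ?case using lasts_mono[OF lasts_expo[OF 2(5) _ 2(2,3,4)] order_refl] by simp
qed simp

section \<open>Goodstein sequences proper\<close>

definition good :: "nat \<Rightarrow> nat \<Rightarrow> nat" where "good n i = the_enat (goodstein Bs n i)"

lemma good: "goodstein Bs n i = enat (good n i)"
  and good_0: "good n 0 = n" and good_Suc: "good n (Suc i) = up i (good n i) - 1"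
proof -
  have *: "\<exists>k. goodstein Bs n i = enat k" for i
  proof (induction i)
    case (Suc i)
    then show ?case by (auto simp: upgrade_up one_enat_def zero_enat_def simp del: ouro_seq.simps)
  qed simp
  show eq: "goodstein Bs n i = enat (good n i)" for i using *[of i] by (auto simp: good_def)
  show "good n 0 = n" by (simp add: good_def)
  have "up i 0 = 0" using level.vv_small[of 0 i] level.b02(1)[of i] by (simp add: up_def)
  then have "goodstein Bs n (Suc i) = enat (up i (good n i) - 1)"
    using eq[of i] by (auto simp: upgrade_up one_enat_def zero_enat_def simp del: ouro_seq.simps)
  then show "good n (Suc i) = up i (good n i) - 1" by (simp add: good_def)
qed

text \<open>All delays are taken to be 0; the numbers read along the tree are then the stages
  \<open>i\<close>, \<open>i + 1\<close>, ... themselves, so that the list is an interval.\<close>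

lemma lasts_large: "lasts \<alpha> i (good n i) y \<Longrightarrow> \<exists>t\<ge>i. large \<alpha> [i..<t] \<and> (\<forall>j. i \<le> j \<longrightarrow> j < t \<longrightarrow> 0 < good n j)"
proof (induction \<alpha> arbitrary: i y)
  case Leaf
  show ?case by (intro exI[of _ i]) simp
next
  case (Node f)
  have "lasts (f i) (Suc i) (good n (Suc i)) (up i y)"
    using spec[OF conjunct2[OF Node.prems[unfolded lasts.simps]], of 0] by (simp add: good_Suc)
  then obtain t where t: "Suc i \<le> t" "large (f i) [Suc i..<t]" "\<forall>j. Suc i \<le> j \<longrightarrow> j < t \<longrightarrow> 0 < good n j"
    using Node.IH[of "f i" "Suc i"] by blast
  have "0 < good n i" using Node.prems by auto
  then have "\<forall>j. i \<le> j \<longrightarrow> j < t \<longrightarrow> 0 < good n j" using t(3) by (metis Suc_leI le_neq_implies_less)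
  moreover have "large (Node f) [i..<t]" using t(1,2) by (simp add: upt_conv_Cons)
  ultimately show ?case using t(1) by (intro exI[of _ t]) auto
qed

lemma good_zero:
  assumes "good n i = 0" "i \<le> j"
  shows "good n j = 0"
  using assms(2)
proof (induction j rule: dec_induct)
  case (step j)
  have "up j 0 = 0" using level.vv_small[of 0 j] level.b02(1)[of j] by (simp add: up_def)
  then show ?case using step by (simp add: good_Suc)
qed (rule assms)

text \<open>A subtraction of 1 costs at most one unit of the starting value, because
  \<open>ups\<close> is strictly increasing. So a value is preserved up to stage \<open>i\<close> by
  starting \<open>i\<close> higher.\<close>

lemma good_ge: "i \<le> n \<Longrightarrow> ups 0 i (n - i) \<le> good n i"
proof (induction i)
  case (Suc i)
  then have "n - Suc i < n - i" by simp
  from ups_less[OF this, of 0 "Suc i"] have "ups 0 (Suc i) (n - Suc i) < up i (ups 0 i (n - i))" by simp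
  also have "\<dots> \<le> up i (good n i)" using Suc by (intro up_le) simp
  finally show ?case by (simp add: good_Suc)
qed (simp add: good_0)

text \<open>If the next base is beyond \<open>b\<^sup>2\<close>, then \<open>b\<^sup>2\<close> is a
  proper multiple of \<open>b\<close> as in \<open>critical_up\<close>, and changing
  \<open>b\<close> to \<open>d j\<close> turns it into at least \<open>(d j)\<^sup>2\<close>. So the
  new bases again leave room for their squares.\<close>

lemma up_square:
  assumes "b \<in> Bs i" "enat (b\<^sup>2) < next_base (Bs i) b"
  obtains d where "\<And>j. j \<le> Suc i \<Longrightarrow> d j \<in> Bs (Suc i)" "\<And>j. 3 \<le> d j" "\<And>j. (d j)\<^sup>2 \<le> d (Suc j)"
    "\<And>j. j \<le> Suc i \<Longrightarrow> enat ((d j)\<^sup>2) \<le> next_base (Bs (Suc i)) (d j)"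
    "(d (Suc i))\<^sup>2 \<le> up i (b\<^sup>2)" "enat ((d (Suc i))\<^sup>2) < next_base (Bs (Suc i)) (d (Suc i))"
proof -
  have b: "2 \<le> b" using ouro_seq_ok[OF B0, of i] assms(1) by (auto simp: ok_def)
  then have bb: "b < b\<^sup>2" "b dvd b\<^sup>2" by (auto simp: power2_eq_square)
  obtain d where d: "up i b \<le> d 0" "\<And>j. d j < d (Suc j)" "\<And>j. d (Suc j) = chn (up i) b (d j) (b\<^sup>2)"
    "\<And>j. digits (up i) b (d j)" "up i (b\<^sup>2) = d (Suc (Suc i))" "\<And>j. j \<le> Suc i \<Longrightarrow> d j \<in> Bs (Suc i)"
    "\<And>j. j < Suc i \<Longrightarrow> enat (d (Suc j)) \<le> next_base (Bs (Suc i)) (d j)"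
    "enat (up i (b\<^sup>2)) < next_base (Bs (Suc i)) (d (Suc i))"
    using level.critical_up[OF assms(1) bb assms(2)] unfolding up_def[symmetric] ouro_seq.simps[symmetric] by metis
  have sq: "(d j)\<^sup>2 \<le> d (Suc j)" for j using chn_square[OF d(4)[of j]] unfolding d(3)[of j] .
  have "3 \<le> d j" for j
  proof (induction j)
    case 0
    have "Inf (Bs i) \<le> b" using assms(1) by (intro cInf_lower) auto
    from up_le[OF this, of i] have "Inf (Bs i) + 1 \<le> up i b" using level.inv_b0(2)[of i] by (simp add: up_def)
    then show ?case using level.b02(1)[of i] d(1) by linarith
  next
    case (Suc j) then show ?case using d(2)[of j] by simp
  qed
  moreover have "enat ((d j)\<^sup>2) \<le> next_base (Bs (Suc i)) (d j)" if "j \<le> Suc i" for j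
  proof (cases "j = Suc i")
    case True
    have "enat ((d j)\<^sup>2) \<le> enat (up i (b\<^sup>2))" using sq[of j] unfolding True d(5) by simp
    then show ?thesis using d(8) True by (metis le_less_trans less_imp_le)
  next
    case False
    have "enat ((d j)\<^sup>2) \<le> enat (d (Suc j))" using sq[of j] by simp
    also have "\<dots> \<le> next_base (Bs (Suc i)) (d j)" using that False by (intro d(7)) simp
    finally show ?thesis .
  qed
  moreover have "(d (Suc i))\<^sup>2 \<le> up i (b\<^sup>2)" unfolding d(5) by (rule sq)
  moreover from this have "enat ((d (Suc i))\<^sup>2) < next_base (Bs (Suc i)) (d (Suc i))"
    using d(8) by (metis enat_ord_simps(1) le_less_trans)
  ultimately show ?thesis using that[of d] d(6) sq by blast
qed

text \<open>The \<open>i + 2\<close> new bases, each at least the square of the preceding one, give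
  chains of any length \<open>k \<le> i + 1\<close>: if \<open>x < d k\<close>, then
  \<open>d k * x < (d k)\<^sup>2\<close>, which is at most the next base.\<close>

lemma square_chain:
  assumes "b \<in> Bs i" "enat (b\<^sup>2) < next_base (Bs i) b" "k \<le> Suc i"
  shows "\<exists>x. chain (Suc i) k x \<and> x < up i (b\<^sup>2)"
proof -
  obtain d where d: "\<And>j. j \<le> Suc i \<Longrightarrow> d j \<in> Bs (Suc i)" "\<And>j. 3 \<le> d j" "\<And>j. (d j)\<^sup>2 \<le> d (Suc j)"
    "\<And>j. j \<le> Suc i \<Longrightarrow> enat ((d j)\<^sup>2) \<le> next_base (Bs (Suc i)) (d j)" "(d (Suc i))\<^sup>2 \<le> up i (b\<^sup>2)"
    using up_square[OF assms(1,2)] by metis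
  have le: "d j \<le> (d j)\<^sup>2" for j using d(2)[of j] by (simp add: power2_eq_square)
  have "\<exists>x. chain (Suc i) k x \<and> x < d k" if "k \<le> Suc i" for k
    using that
  proof (induction k)
    case 0
    have "2 < d 0" using d(2)[of 0] by simp
    then show ?case using chain.intros(1) by blast
  next
    case (Suc k)
    then obtain x where x: "chain (Suc i) k x" "x < d k" by auto
    have lt: "d k * x < (d k)\<^sup>2" using x(2) d(2)[of k] by (simp add: power2_eq_square)
    have "chain (Suc i) (Suc k) (d k * x)"
    proof (rule chain.intros(2)[OF x(1) d(1) x(2)])
      show "enat (d k * x) < next_base (Bs (Suc i)) (d k)"
        using lt d(4)[of k] Suc.prems by (metis Suc_leD enat_ord_simps(2) less_le_trans)
    qed (use Suc.prems in simp)
    then show ?case using lt d(3)[of k] by (intro exI[of _ "d k * x"]) linarith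
  qed
  from this[OF assms(3)] obtain x where x: "chain (Suc i) k x" "x < d k" by blast
  have "d j \<le> d (Suc j)" for j using le[of j] d(3)[of j] by (rule le_trans)
  then have "d k \<le> d (Suc i)" using assms(3) by (rule lift_Suc_mono_le)
  then show ?thesis using x le[of "Suc i"] d(5) by (intro exI[of _ x]) linarith
qed

lemma square_persists:
  assumes "b \<in> B0" "enat (b\<^sup>2) < next_base B0 b"
  shows "\<exists>e. e \<in> Bs i \<and> enat (e\<^sup>2) < next_base (Bs i) e \<and> e\<^sup>2 \<le> ups 0 i (b\<^sup>2)"
proof (induction i)
  case 0 then show ?case using assms by auto
next
  case (Suc i)
  then obtain e where e: "e \<in> Bs i" "enat (e\<^sup>2) < next_base (Bs i) e" "e\<^sup>2 \<le> ups 0 i (b\<^sup>2)" by blast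
  obtain d where d: "d \<in> Bs (Suc i)" "enat (d\<^sup>2) < next_base (Bs (Suc i)) d" "d\<^sup>2 \<le> up i (e\<^sup>2)"
  proof (rule up_square[OF e(1,2)])
    fix d' :: "nat \<Rightarrow> nat"
    assume "\<And>j. j \<le> Suc i \<Longrightarrow> d' j \<in> Bs (Suc i)" "(d' (Suc i))\<^sup>2 \<le> up i (e\<^sup>2)"
      "enat ((d' (Suc i))\<^sup>2) < next_base (Bs (Suc i)) (d' (Suc i))"
    then show ?thesis using that[of "d' (Suc i)"] by (simp del: ouro_seq.simps)
  qed
  have "d\<^sup>2 \<le> ups 0 (Suc i) (b\<^sup>2)" using d(3) up_le[OF e(3), of i] by simp
  then show ?case using d(1,2) by blast
qed

text \<open>There are two ways to violate the growth condition on \<open>B0\<close>. Either some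
  base leaves room for its square, and then later stages have long chains. Or the next base is
  always at most \<open>b\<^sup>2\<close>; then for each \<open>x \<ge> 2\<close> some
  \<open>b\<close> has its next base beyond \<open>b * x\<close>, where \<open>x < b\<close>
  follows, and chains of every length exist already in \<open>B0\<close>.\<close>

theorem long_goodstein:
  assumes "\<not> (\<exists>c\<ge>2. \<forall>b\<in>B0. next_base B0 b \<le> min (enat (b\<^sup>2)) (enat (b * c)))"
  shows "\<exists>n m t. k \<le> m \<and> n \<le> 2 * m \<and> large (tower k) [m..<t] \<and> (\<forall>j<t. 0 < good n j)"
proof -
  have "\<exists>n m. k \<le> m \<and> n \<le> 2 * m \<and> lasts (tower k) m (good n m) 2"
  proof (cases "\<exists>b\<in>B0. enat (b\<^sup>2) < next_base B0 b")
    case True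
    then obtain b where b: "b \<in> B0" "enat (b\<^sup>2) < next_base B0 b" by blast
    \<comment> \<open>\<open>i \<ge> b\<^sup>2\<close> makes the start \<open>b\<^sup>2 + i\<close>
      at most \<open>2 * Suc i\<close>; \<open>i \<ge> k\<close> provides enough bases for a chain
      of length \<open>k\<close>.\<close>
    define i where "i = max k (b\<^sup>2)"
    have ki: "k \<le> Suc i" by (simp add: i_def)
    obtain e where e: "e \<in> Bs i" "enat (e\<^sup>2) < next_base (Bs i) e" "e\<^sup>2 \<le> ups 0 i (b\<^sup>2)"
      using square_persists[OF b] by blast
    obtain x where x: "chain (Suc i) k x" "x < up i (e\<^sup>2)"
      using square_chain[OF e(1,2) ki] by blast
    have "e\<^sup>2 \<le> good (b\<^sup>2 + i) i" using good_ge[of i "b\<^sup>2 + i"] e(3) by simp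
    from up_le[OF this, of i] have "x \<le> good (b\<^sup>2 + i) (Suc i)" using x(2) by (simp add: good_Suc)
    then have "lasts (tower k) (Suc i) (good (b\<^sup>2 + i) (Suc i)) 2"
      using lasts_mono[OF chain_lasts[OF x(1)]] by blast
    then show ?thesis by (intro exI[of _ "b\<^sup>2 + i"] exI[of _ "Suc i"]) (auto simp: i_def)
  next
    case False
    have "\<exists>x. chain 0 k x" for k
    proof (induction k)
      case 0 show ?case using chain.intros(1) by blast
    next
      case (Suc k)
      then obtain x where x: "chain 0 k x" by blast
      have "2 \<le> x" using lasts_le[OF chain_lasts[OF x]] .
      then obtain b where b: "b \<in> B0" "\<not> next_base B0 b \<le> min (enat (b\<^sup>2)) (enat (b * x))" using assms by blast
      then have sq: "next_base B0 b \<le> enat (b\<^sup>2)" and lt: "enat (b * x) < next_base B0 b"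
        using False by (auto simp: not_less[symmetric] min_def split: if_splits)
      then have "b * x < b * b" by (metis enat_ord_simps(2) less_le_trans power2_eq_square)
      then have "x < b" by simp
      then show ?case using chain.intros(2)[OF x, of b] b(1) lt by auto
    qed
    then obtain x where x: "chain 0 k x" by blast
    \<comment> \<open>The chain survives \<open>x + k\<close> delays, paid for by starting
      \<open>x + k\<close> higher; waiting that long makes \<open>n = x + (x + k)\<close> at most
      twice \<open>m = x + k\<close>.\<close>
    have "ups 0 (x + k) x \<le> good (x + (x + k)) (x + k)" using good_ge[of "x + k" "x + (x + k)"] by simp
    moreover have "2 \<le> ups 0 (x + k) 2" by (rule ups_ge)
    ultimately have "lasts (tower k) (x + k) (good (x + (x + k)) (x + k)) 2"
      using lasts_mono[OF lasts_delay[OF chain_lasts[OF x], of "x + k"]] by simp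
    then show ?thesis by (intro exI[of _ "x + (x + k)"] exI[of _ "x + k"]) simp
  qed
  then obtain n m where nm: "k \<le> m" "n \<le> 2 * m" "lasts (tower k) m (good n m) 2" by blast
  obtain t where t: "m \<le> t" "large (tower k) [m..<t]" "\<forall>j. m \<le> j \<longrightarrow> j < t \<longrightarrow> 0 < good n j"
    using lasts_large[OF nm(3)] by blast
  have "0 < good n m" using lasts_le[OF nm(3)] by simp
  \<comment> \<open>Before stage \<open>m\<close> the value cannot have been 0, as 0 is never
    left.\<close>
  then have "0 < good n j" if "j < t" for j
    using t(3) that good_zero[of n j m] by (cases "m \<le> j") auto
  then show ?thesis using nm t(2) by blast
qed

end

section \<open>Cuts in an ultrapower as models of \<open>ACA\<^sub>0\<close>\<close>

locale ultrafilter =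
  fixes \<U> :: "nat set set"
  assumes cofinite: "finite (- A) \<Longrightarrow> A \<in> \<U>"
    and Int: "A \<in> \<U> \<Longrightarrow> A' \<in> \<U> \<Longrightarrow> A \<inter> A' \<in> \<U>"
    and mono: "A \<in> \<U> \<Longrightarrow> A \<subseteq> A' \<Longrightarrow> A' \<in> \<U>"
    and compl: "- A \<in> \<U> \<longleftrightarrow> A \<notin> \<U>"

lemma ex_ultrafilter: "\<exists>\<U>. ultrafilter \<U>"
proof -
  define \<A> :: "nat set set set" where "\<A> = {F. (\<forall>A. finite (- A) \<longrightarrow> A \<in> F) \<and>
    (\<forall>A\<in>F. \<forall>A'\<in>F. A \<inter> A' \<in> F) \<and> (\<forall>A\<in>F. \<forall>A'. A \<subseteq> A' \<longrightarrow> A' \<in> F) \<and> {} \<notin> F}"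
  have "{A :: nat set. finite (- A)} \<in> \<A>"
    unfolding \<A>_def by (auto intro: finite_subset[of "- _" "- _"])
  moreover have "\<Union>\<C> \<in> \<A>" if "\<C> \<noteq> {}" and chain: "subset.chain \<A> \<C>" for \<C>
  proof -
    have sub: "F \<in> \<A>" if "F \<in> \<C>" for F using chain that by (auto simp: subset_chain_def)
    have "A \<inter> A' \<in> \<Union>\<C>" if A: "A \<in> \<Union>\<C>" "A' \<in> \<Union>\<C>" for A A'
    proof -
      obtain F F' where F: "F \<in> \<C>" "A \<in> F" "F' \<in> \<C>" "A' \<in> F'" using A by blast
      then consider "F \<subseteq> F'" | "F' \<subseteq> F" using chain by (auto simp: subset_chain_def)
      then show ?thesis
      proof cases
        case 1
        then have "A \<in> F'" using F by blast
        then have "A \<inter> A' \<in> F'" using sub[OF F(3)] F(4) unfolding \<A>_def by blast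
        then show ?thesis using F by blast
      next
        case 2
        then have "A' \<in> F" using F by blast
        then have "A \<inter> A' \<in> F" using sub[OF F(1)] F(2) unfolding \<A>_def by blast
        then show ?thesis using F by blast
      qed
    qed
    moreover have "A \<in> \<Union>\<C>" if "finite (- A)" for A
      using \<open>\<C> \<noteq> {}\<close> sub that unfolding \<A>_def by blast
    moreover have "A' \<in> \<Union>\<C>" if "A \<in> \<Union>\<C>" "A \<subseteq> A'" for A A'
      using sub that unfolding \<A>_def by blast
    moreover have "{} \<notin> \<Union>\<C>" using sub unfolding \<A>_def by blast
    ultimately show ?thesis unfolding \<A>_def by blast
  qed
  ultimately obtain M where M: "M \<in> \<A>" "\<And>X. X \<in> \<A> \<Longrightarrow> M \<subseteq> X \<Longrightarrow> X = M"
    using subset_Zorn_nonempty[of \<A>] by blast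
  have cof: "finite (- A) \<Longrightarrow> A \<in> M" for A using M(1) unfolding \<A>_def by blast
  have Int: "A \<in> M \<Longrightarrow> A' \<in> M \<Longrightarrow> A \<inter> A' \<in> M" for A A' using M(1) unfolding \<A>_def by blast
  have up: "A \<in> M \<Longrightarrow> A \<subseteq> A' \<Longrightarrow> A' \<in> M" for A A' using M(1) unfolding \<A>_def by blast
  have ne: "{} \<notin> M" using M(1) unfolding \<A>_def by blast
  have "- A \<in> M" if "A \<notin> M" for A
  proof (rule ccontr)
    assume n: "- A \<notin> M"
    \<comment> \<open>The filter generated by \<open>M\<close> and \<open>A\<close>, which by
      maximality would equal \<open>M\<close>.\<close>
    define X where "X = {A'. \<exists>Y\<in>M. Y \<inter> A \<subseteq> A'}"
    have "M \<subseteq> X" unfolding X_def by blast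
    have "{} \<notin> X" using n up[of _ "- A"] unfolding X_def by blast
    moreover have "A1 \<inter> A2 \<in> X" if A12: "A1 \<in> X" "A2 \<in> X" for A1 A2
    proof -
      obtain Y1 Y2 where "Y1 \<in> M" "Y1 \<inter> A \<subseteq> A1" "Y2 \<in> M" "Y2 \<inter> A \<subseteq> A2" using A12 unfolding X_def by blast
      then have "Y1 \<inter> Y2 \<in> M" "(Y1 \<inter> Y2) \<inter> A \<subseteq> A1 \<inter> A2" using Int by auto
      then show ?thesis unfolding X_def by blast
    qed
    moreover have "A' \<in> X" if "finite (- A')" for A' using cof[OF that] \<open>M \<subseteq> X\<close> by blast
    moreover have "A2 \<in> X" if "A1 \<in> X" "A1 \<subseteq> A2" for A1 A2 using that unfolding X_def by blast
    ultimately have "X \<in> \<A>" unfolding \<A>_def by blast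
    then have "X = M" using M(2) \<open>M \<subseteq> X\<close> by blast
    moreover have "A \<in> X" using cof[of UNIV] unfolding X_def by auto
    ultimately show False using that by blast
  qed
  moreover have "A \<notin> M" if "- A \<in> M" for A using Int[OF that, of A] ne by auto
  ultimately have "ultrafilter M" using cof Int up by unfold_locales blast+
  then show ?thesis by blast
qed

section \<open>Properties of almost all indices\<close>

context ultrafilter
begin

definition ev :: "(nat \<Rightarrow> bool) \<Rightarrow> bool" where "ev P \<longleftrightarrow> {k. P k} \<in> \<U>"

lemma ev_neg: "ev (\<lambda>k. \<not> P k) \<longleftrightarrow> \<not> ev P"
  unfolding ev_def using compl[of "{k. P k}"] by (simp add: Collect_neg_eq)

lemma ev_mono: "ev P \<Longrightarrow> (\<And>k. P k \<Longrightarrow> Q k) \<Longrightarrow> ev Q"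
  unfolding ev_def by (erule mono) blast

lemma ev_conj: "ev (\<lambda>k. P k \<and> Q k) \<longleftrightarrow> ev P \<and> ev Q"
proof
  show "ev P \<and> ev Q \<Longrightarrow> ev (\<lambda>k. P k \<and> Q k)" unfolding ev_def using Int by (simp add: Collect_conj_eq)
qed (auto elim: ev_mono)

lemma ev_mono2: "ev P \<Longrightarrow> ev Q \<Longrightarrow> (\<And>k. P k \<Longrightarrow> Q k \<Longrightarrow> R k) \<Longrightarrow> ev R"
  using ev_mono[of "\<lambda>k. P k \<and> Q k" R] by (simp add: ev_conj)

lemma ev_imp: "ev (\<lambda>k. P k \<longrightarrow> Q k) \<longleftrightarrow> (ev P \<longrightarrow> ev Q)"
  and ev_disj: "ev (\<lambda>k. P k \<or> Q k) \<longleftrightarrow> ev P \<or> ev Q"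
  and ev_iff: "ev (\<lambda>k. P k \<longleftrightarrow> Q k) \<longleftrightarrow> (ev P \<longleftrightarrow> ev Q)"
proof -
  show imp: "ev (\<lambda>k. P k \<longrightarrow> Q k) \<longleftrightarrow> (ev P \<longrightarrow> ev Q)" for P Q
    using ev_neg[of "\<lambda>k. P k \<and> \<not> Q k"] ev_conj[of P "\<lambda>k. \<not> Q k"] ev_neg[of Q] by simp
  show "ev (\<lambda>k. P k \<or> Q k) \<longleftrightarrow> ev P \<or> ev Q"
    using ev_neg[of "\<lambda>k. \<not> P k \<and> \<not> Q k"] ev_conj[of "\<lambda>k. \<not> P k" "\<lambda>k. \<not> Q k"] ev_neg[of Q] ev_neg[of P] by simp
  have "ev P \<Longrightarrow> ev (\<lambda>k. P k \<longleftrightarrow> Q k) \<Longrightarrow> ev Q" "ev Q \<Longrightarrow> ev (\<lambda>k. P k \<longleftrightarrow> Q k) \<Longrightarrow> ev P"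
    "ev P \<Longrightarrow> ev Q \<Longrightarrow> ev (\<lambda>k. P k \<longleftrightarrow> Q k)"
    "ev (\<lambda>k. \<not> P k) \<Longrightarrow> ev (\<lambda>k. \<not> Q k) \<Longrightarrow> ev (\<lambda>k. P k \<longleftrightarrow> Q k)"
    by (erule (1) ev_mono2, simp)+
  then show "ev (\<lambda>k. P k \<longleftrightarrow> Q k) \<longleftrightarrow> (ev P \<longleftrightarrow> ev Q)" unfolding ev_neg by blast
qed

lemma ev_all:
  assumes "\<And>k. P k"
  shows "ev P"
proof -
  have "{k. P k} = UNIV" using assms by simp
  then show ?thesis unfolding ev_def by (simp add: cofinite)
qed

lemma ev_const [simp]: "ev (\<lambda>k. P) \<longleftrightarrow> P"
  using ev_all[of "\<lambda>_. P"] ev_all[of "\<lambda>_. \<not> P"] ev_neg[of "\<lambda>_. P"] by blast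

lemma ev_ge: "(\<And>k. K \<le> k \<Longrightarrow> P k) \<Longrightarrow> ev P"
proof -
  assume *: "\<And>k. K \<le> k \<Longrightarrow> P k"
  have "- {k. P k} \<subseteq> {..<K}" using * by (auto simp: not_less[symmetric])
  then show ?thesis unfolding ev_def by (intro cofinite) (auto intro: finite_subset)
qed

end

section \<open>Coded environments and bounds on the hierarchy \<open>hyp\<close>\<close>

fun dec :: "nat \<Rightarrow> nat \<Rightarrow> nat" where
  "dec l 0 = fst (prod_decode l)"
| "dec l (Suc i) = dec (snd (prod_decode l)) i"

text \<open>Pairing prepends a value, which is exactly what a number quantifier does to the
  environment. A formula thus defines a set of numbers, the codes of its satisfying
  environments.\<close>

lemma dec_encode: "dec (prod_encode (n, l)) = case_nat n (dec l)"
  by (rule ext) (auto split: nat.split)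

primrec tmb :: "tm \<Rightarrow> nat" where
  "tmb (Var n) = Suc n"
| "tmb Zero = 0"
| "tmb One = 0"
| "tmb (Add s t) = max (tmb s) (tmb t)"
| "tmb (Mul s t) = max (tmb s) (tmb t)"

text \<open>An upper bound for the indices of the free number variables; it is not lowered at a
  quantifier, which only makes it coarser.\<close>

primrec fmb :: "fm \<Rightarrow> nat" where
  "fmb Bot = 0"
| "fmb (Eq s t) = max (tmb s) (tmb t)"
| "fmb (Less s t) = max (tmb s) (tmb t)"
| "fmb (Mem t X) = tmb t"
| "fmb (Imp p q) = max (fmb p) (fmb q)"
| "fmb (Forall p) = fmb p"
| "fmb (ForallS p) = fmb p"

lemma hyp_0_1: "hyp 1 a = 2 * a + 2"
proof -
  have "(Suc ^^ m) x = m + x" for m x by (induction m) auto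
  then show ?thesis by simp
qed

lemma hyp_2_ge: "x * x \<le> hyp 2 x"
proof -
  have "2 ^ m * x \<le> (hyp 1 ^^ m) x" for m
  proof (induction m)
    case (Suc m)
    have "2 ^ Suc m * x \<le> 2 * (hyp 1 ^^ m) x" using Suc by simp
    then show ?case using hyp_0_1[of "(hyp 1 ^^ m) x"] by (simp del: hyp.simps)
  qed simp
  from this[of "x + 2"] have "2 ^ (x + 2) * x \<le> hyp 2 x" by (simp add: numeral_2_eq_2)
  moreover have "x * x \<le> 2 ^ (x + 2) * x"
    using less_exp[of "x + 2"] by (intro mult_le_mono1) linarith
  ultimately show ?thesis by linarith
qed

lemma hyp_3_ge: "x ^ (x + 3) \<le> hyp 3 x"
proof -
  have "x \<le> (hyp 2 ^^ m) x \<and> x ^ Suc m \<le> (hyp 2 ^^ m) x" for m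
  proof (induction m)
    case (Suc m)
    let ?y = "(hyp 2 ^^ m) x"
    have "x ^ Suc (Suc m) \<le> ?y * ?y" using Suc mult_le_mono[of x ?y "x ^ Suc m" ?y] by simp
    also have "\<dots> \<le> (hyp 2 ^^ Suc m) x" using hyp_2_ge[of ?y] by simp
    finally show ?case using Suc hyp_grow(2)[of ?y 2] by simp
  qed simp
  from this[of "x + 2"] show ?thesis by (simp add: numeral_3_eq_3 numeral_2_eq_2 del: hyp.simps(1))
qed

lemma ff_le_hyp: "ff x \<le> hyp 3 x"
proof -
  consider "x = 0" | "x = 1" | "2 \<le> x" by linarith
  then show ?thesis
  proof cases
    case 2 then show ?thesis using hyp_grow(2)[of 1 3] by (simp add: ff_def)
  next
    case 3
    have "x \<le> x ^ Suc x" using self_le_power[of x "Suc x"] 3 by simp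
    then have "ff x \<le> 2 * x ^ Suc x" by (simp add: ff_def mult.commute)
    also have "\<dots> \<le> x * x ^ Suc x" using 3 by (rule mult_le_mono1)
    also have "\<dots> = x ^ (x + 2)" by (simp add: numeral_2_eq_2)
    also have "\<dots> \<le> x ^ (x + 3)" using 3 by (intro power_increasing) auto
    also have "\<dots> \<le> hyp 3 x" by (rule hyp_3_ge)
    finally show ?thesis .
  qed (simp add: ff_def)
qed

text \<open>\<open>ff\<close> is dominated by \<open>hyp 3\<close>, and \<open>hyp 4\<close>
  iterates \<open>hyp 3\<close> at least \<open>n\<close> times once its argument is at least
  \<open>n\<close>.\<close>

lemma ff_funpow_le_hyp: "(ff ^^ n) x \<le> hyp 4 (max n x)"
proof -
  have "(ff ^^ n) x \<le> (hyp 3 ^^ n) x"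
  proof (induction n)
    case (Suc n)
    have "ff ((ff ^^ n) x) \<le> hyp 3 ((ff ^^ n) x)" by (rule ff_le_hyp)
    also have "\<dots> \<le> hyp 3 ((hyp 3 ^^ n) x)" by (rule monoD[OF hyp_grow(1) Suc])
    finally show ?case by simp
  qed simp
  also have "\<dots> \<le> (hyp 3 ^^ n) (max n x)" by (rule monoD[OF funpow_grow(1)[OF hyp_grow]]) simp
  also have "\<dots> \<le> (hyp 3 ^^ (max n x + 2)) (max n x)" by (rule funpow_grow(3)[OF hyp_grow]) simp
  also have "\<dots> = hyp 4 (max n x)"
    using hyp.simps(2)[of 3] by (simp add: eval_nat_numeral del: hyp.simps)
  finally show ?thesis .
qed

section \<open>Initial segments closed under fast-growing functions\<close>

locale segment = ultrafilter +
  fixes I :: "(nat \<Rightarrow> nat) set"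
  assumes I_zero: "(\<lambda>_. 0) \<in> I"
    and I_down: "g \<in> I \<Longrightarrow> ev (\<lambda>k. h k \<le> g k) \<Longrightarrow> h \<in> I"
    and I_hyp: "g \<in> I \<Longrightarrow> (\<lambda>k. hyp r (g k)) \<in> I"
    and I_max: "g \<in> I \<Longrightarrow> h \<in> I \<Longrightarrow> (\<lambda>k. max (g k) (h k)) \<in> I"
begin

lemma I_le: "g \<in> I \<Longrightarrow> (\<And>k. h k \<le> g k) \<Longrightarrow> h \<in> I"
  using I_down[of g h] ev_all by blast

lemma I_add: "g \<in> I \<Longrightarrow> h \<in> I \<Longrightarrow> (\<lambda>k. g k + h k) \<in> I"
  by (rule I_le[OF I_hyp[OF I_max[of g h], of 1]]) (simp_all add: hyp_0_1[unfolded One_nat_def] del: hyp.simps)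

lemma I_mult: "g \<in> I \<Longrightarrow> h \<in> I \<Longrightarrow> (\<lambda>k. g k * h k) \<in> I"
proof (rule I_le[OF I_hyp[OF I_max[of g h], of 2]])
  show "g k * h k \<le> hyp 2 (max (g k) (h k))" for k
    using mult_le_mono[of "g k" "max (g k) (h k)" "h k" "max (g k) (h k)"] hyp_2_ge[of "max (g k) (h k)"] by simp
qed

lemma I_const [simp]: "(\<lambda>_. c) \<in> I"
proof (induction c)
  case (Suc c) then show ?case using I_hyp[of "\<lambda>_. c" 0] by simp
qed (rule I_zero)

lemma I_ff: "g \<in> I \<Longrightarrow> h \<in> I \<Longrightarrow> (\<lambda>k. (ff ^^ (h k)) (g k)) \<in> I"
  by (rule I_le[OF I_hyp[OF I_max[of h g], of 4]]) (simp_all only: ff_funpow_le_hyp)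

lemma I_power: "g \<in> I \<Longrightarrow> h \<in> I \<Longrightarrow> (\<lambda>k. g k ^ h k) \<in> I"
proof (rule I_le[OF I_add[OF I_const[of 1] I_hyp[OF I_max[of g h], of 3]]])
  fix k let ?m = "max (g k) (h k)"
  have "g k ^ h k \<le> 1 + ?m ^ (?m + 3)"
  proof (cases "?m = 0")
    case False
    have "g k ^ h k \<le> ?m ^ h k" by (rule power_mono) auto
    also have "\<dots> \<le> ?m ^ (?m + 3)" using False by (intro power_increasing) auto
    finally show ?thesis by simp
  qed auto
  then show "g k ^ h k \<le> 1 + hyp 3 ?m" using hyp_3_ge[of ?m] by linarith
qed

lemma I_encode: "g \<in> I \<Longrightarrow> h \<in> I \<Longrightarrow> (\<lambda>k. prod_encode (g k, h k)) \<in> I"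
proof -
  assume gh: "g \<in> I" "h \<in> I"
  show ?thesis
  proof (rule I_le)
    show "(\<lambda>k. (g k + h k) * (g k + h k + 1) + g k) \<in> I" by (intro I_add I_mult gh I_const)
    show "prod_encode (g k, h k) \<le> (g k + h k) * (g k + h k + 1) + g k" for k
      by (simp add: prod_encode_def triangle_def)
  qed
qed

end

text \<open>Numbers of the model are the members of \<open>I\<close> modulo \<open>\<U>\<close>, sets are the traces on \<open>I\<close> of the
  members of \<open>\<S>\<close>. Assumption \<open>S_all\<close> is the strength of the cut: a set defined by a quantifier over \<open>I\<close> is again such a
  trace.\<close>

locale cut = segment +
  fixes \<S> :: "(nat \<Rightarrow> nat set) set"
  assumes S_compl: "X \<in> \<S> \<Longrightarrow> (\<lambda>k. - X k) \<in> \<S>"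
    and S_Int: "X \<in> \<S> \<Longrightarrow> Y \<in> \<S> \<Longrightarrow> (\<lambda>k. X k \<inter> Y k) \<in> \<S>"
    and S_all: "X \<in> \<S> \<Longrightarrow> \<exists>Y\<in>\<S>. \<forall>l\<in>I. ev (\<lambda>k. l k \<in> Y k) \<longleftrightarrow>
      (\<forall>n\<in>I. ev (\<lambda>k. prod_encode (n k, l k) \<in> X k))"
    and S_section: "X \<in> \<S> \<Longrightarrow> p \<in> I \<Longrightarrow> (\<lambda>k. {x. prod_encode (x, p k) \<in> X k}) \<in> \<S>"
    and S_term: "X \<in> \<S> \<Longrightarrow> (\<lambda>k. {l. eval (dec l) t \<in> X k}) \<in> \<S>"
    and S_eq: "(\<lambda>k. {l. eval (dec l) s = eval (dec l) t}) \<in> \<S>"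
    and S_less: "(\<lambda>k. {l. eval (dec l) s < eval (dec l) t}) \<in> \<S>"
begin

section \<open>The structure with numbers from \<open>I\<close> and sets from
  \<open>\<S>\<close>\<close>

definition meval :: "(nat \<Rightarrow> nat \<Rightarrow> nat) \<Rightarrow> tm \<Rightarrow> nat \<Rightarrow> nat" where
  "meval e t = (\<lambda>k. eval (\<lambda>n. e n k) t)"

lemma meval_I: "(\<And>n. e n \<in> I) \<Longrightarrow> meval e t \<in> I"
  unfolding meval_def by (induction t) (auto intro: I_add I_mult)

primrec msat :: "(nat \<Rightarrow> nat \<Rightarrow> nat) \<Rightarrow> (nat \<Rightarrow> nat \<Rightarrow> nat set) \<Rightarrow> fm \<Rightarrow> bool" where
  "msat e E Bot = False"
| "msat e E (Eq s t) = ev (\<lambda>k. meval e s k = meval e t k)"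
| "msat e E (Less s t) = ev (\<lambda>k. meval e s k < meval e t k)"
| "msat e E (Mem t X) = ev (\<lambda>k. meval e t k \<in> E X k)"
| "msat e E (Imp p q) = (msat e E p \<longrightarrow> msat e E q)"
| "msat e E (Forall p) = (\<forall>g\<in>I. msat (case_nat g e) E p)"
| "msat e E (ForallS p) = (\<forall>X\<in>\<S>. msat e (case_nat X E) p)"

lemma msat_derived [simp]:
  "msat e E (Neg p) \<longleftrightarrow> \<not> msat e E p"
  "msat e E (Conj p q) \<longleftrightarrow> msat e E p \<and> msat e E q"
  "msat e E (Disj p q) \<longleftrightarrow> msat e E p \<or> msat e E q"
  "msat e E (Iff p q) \<longleftrightarrow> (msat e E p \<longleftrightarrow> msat e E q)"
  "msat e E (Exists p) \<longleftrightarrow> (\<exists>g\<in>I. msat (case_nat g e) E p)"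
  "msat e E (ExistsS p) \<longleftrightarrow> (\<exists>X\<in>\<S>. msat e (case_nat X E) p)"
  unfolding Neg_def Conj_def Disj_def Iff_def Exists_def ExistsS_def by auto

lemma meval_subst: "meval e (subst_tm \<sigma> t) = meval (\<lambda>n. meval e (\<sigma> n)) t"
  by (simp add: meval_def eval_subst)

lemma msat_subst:
  "msat e E (subst_fm \<sigma> \<rho> p) = msat (\<lambda>n. meval e (\<sigma> n)) (\<lambda>X. E (\<rho> X)) p"
proof (induction p arbitrary: e E \<sigma> \<rho>)
  case (Forall p)
  have "(\<lambda>m. meval (case_nat g e) (case m of 0 \<Rightarrow> Var 0 | Suc m \<Rightarrow> lift_tm (\<sigma> m))) =
    case_nat g (\<lambda>m. meval e (\<sigma> m))" for g
    by (auto simp: fun_eq_iff lift_tm_def meval_def eval_subst split: nat.splits)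
  then show ?case by (simp add: Forall)
next
  case (ForallS p)
  have "(\<lambda>k. (case_nat A E) (case k of 0 \<Rightarrow> 0 | Suc m \<Rightarrow> Suc (\<rho> m))) = case_nat A (\<lambda>m. E (\<rho> m))" for A
    by (auto simp: fun_eq_iff split: nat.splits)
  then show ?case by (simp add: ForallS)
qed (auto simp: meval_subst)

lemma msat_lift: "msat (case_nat g e) E (lift_fm p) = msat e E p"
  and msat_liftS: "msat e (case_nat A E) (liftS_fm p) = msat e E p"
  and msat_inst: "msat e E (inst t p) = msat (case_nat (meval e t) e) E p"
  and msat_instS: "msat e E (instS X p) = msat e (case_nat (E X) E) p"
proof -
  have 1: "(\<lambda>n. meval e (case_nat t Var n)) = case_nat (meval e t) e"
    "(\<lambda>k. E (case_nat X id k)) = case_nat (E X) E"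
    by (auto simp: fun_eq_iff meval_def split: nat.splits)
  show "msat (case_nat g e) E (lift_fm p) = msat e E p" "msat e (case_nat A E) (liftS_fm p) = msat e E p"
    "msat e E (inst t p) = msat (case_nat (meval e t) e) E p"
    "msat e E (instS X p) = msat e (case_nat (E X) E) p"
    unfolding lift_fm_def liftS_fm_def inst_def instS_def msat_subst 1 by (simp_all add: meval_def)
qed

text \<open>Equality in the model is equality at almost all indices; this congruence is what
  validates the substitution rule.\<close>

lemma msat_cong:
  assumes "\<And>n. ev (\<lambda>k. e n k = e' n k)"
  shows "msat e E p = msat e' E p"
  using assms
proof (induction p arbitrary: e e' E)
  have tm: "ev (\<lambda>k. meval e t k = meval e' t k)" if e: "\<And>n. ev (\<lambda>k. e n k = e' n k)" for e e' t
  proof (induction t)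
    case (Add s t) then show ?case unfolding meval_def by (rule ev_mono2) simp
  next
    case (Mul s t) then show ?case unfolding meval_def by (rule ev_mono2) simp
  qed (simp_all add: meval_def e)
  {
    case (Eq s t)
    have "ev (\<lambda>k. meval e s k = meval e t k \<longleftrightarrow> meval e' s k = meval e' t k)"
      using ev_mono2[OF tm[where t = s and e = e and e' = e', OF Eq] tm[where t = t and e = e and e' = e', OF Eq]] by simp
    then show ?case by (simp add: ev_iff)
  next
    case (Less s t)
    have "ev (\<lambda>k. meval e s k < meval e t k \<longleftrightarrow> meval e' s k < meval e' t k)"
      using ev_mono2[OF tm[where t = s and e = e and e' = e', OF Less] tm[where t = t and e = e and e' = e', OF Less]] by simp
    then show ?case by (simp add: ev_iff)
  next
    case (Mem t X)
    have "ev (\<lambda>k. meval e t k \<in> E X k \<longleftrightarrow> meval e' t k \<in> E X k)"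
      using ev_mono[OF tm[where t = t and e = e and e' = e', OF Mem]] by simp
    then show ?case by (simp add: ev_iff)
  next
    case (Imp p q)
    show ?case using Imp.IH(1)[OF Imp.prems] Imp.IH(2)[OF Imp.prems] by simp
  next
    case (Forall p)
    have "msat (case_nat g e) E p = msat (case_nat g e') E p" for g
      by (rule Forall.IH) (use Forall.prems in \<open>auto split: nat.splits intro: ev_all\<close>)
    then show ?case by simp
  next
    case (ForallS p)
    show ?case using ForallS.IH[OF ForallS.prems] by simp
  }
qed simp

lemma meval_tmb: "(\<And>i. i < tmb t \<Longrightarrow> e i = e' i) \<Longrightarrow> meval e t = meval e' t"
proof (induction t)
  case (Add s t)
  have "meval e s = meval e' s" by (rule Add.IH(1), rule Add.prems, simp)
  moreover have "meval e t = meval e' t" by (rule Add.IH(2), rule Add.prems, simp)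
  ultimately show ?case by (simp add: meval_def fun_eq_iff)
next
  case (Mul s t)
  have "meval e s = meval e' s" by (rule Mul.IH(1), rule Mul.prems, simp)
  moreover have "meval e t = meval e' t" by (rule Mul.IH(2), rule Mul.prems, simp)
  ultimately show ?case by (simp add: meval_def fun_eq_iff)
qed (simp_all add: meval_def)

lemma msat_fmb: "(\<And>i. i < fmb p \<Longrightarrow> e i = e' i) \<Longrightarrow> msat e E p = msat e' E p"
proof (induction p arbitrary: e e' E)
  case (Eq s t)
  have "meval e s = meval e' s" "meval e t = meval e' t" by (rule meval_tmb, rule Eq.prems, simp)+
  then show ?case by simp
next
  case (Less s t)
  have "meval e s = meval e' s" "meval e t = meval e' t" by (rule meval_tmb, rule Less.prems, simp)+
  then show ?case by simp
next
  case (Mem t X)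
  have "meval e t = meval e' t" by (rule meval_tmb, rule Mem.prems, simp)
  then show ?case by simp
next
  case (Imp p q)
  have "msat e E p = msat e' E p" by (rule Imp.IH(1), rule Imp.prems, simp)
  moreover have "msat e E q = msat e' E q" by (rule Imp.IH(2), rule Imp.prems, simp)
  ultimately show ?case by simp
next
  case (Forall p)
  have "msat (case_nat g e) E p = msat (case_nat g e') E p" for g
  proof (rule Forall.IH)
    fix i assume "i < fmb p"
    then show "case_nat g e i = case_nat g e' i" using Forall.prems[of "i - 1"] by (cases i) simp_all
  qed
  then show ?case by simp
next
  case (ForallS p)
  have "msat e (case_nat X E) p = msat e' (case_nat X E) p" for X
    by (rule ForallS.IH, rule ForallS.prems, simp)
  then show ?case by simp
qed simp

lemma msat_sound:
  assumes T: "\<And>q e E. q \<in> T \<Longrightarrow> (\<And>n. e n \<in> I) \<Longrightarrow> (\<And>n. E n \<in> \<S>) \<Longrightarrow> msat e E q"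
  shows "deriv T \<Gamma> p \<Longrightarrow> (\<And>n. e n \<in> I) \<Longrightarrow> (\<And>n. E n \<in> \<S>) \<Longrightarrow> \<forall>q\<in>set \<Gamma>. msat e E q \<Longrightarrow> msat e E p"
proof (induction arbitrary: e E rule: deriv.induct)
  case (ImpI p \<Gamma> q)
  show ?case using ImpI.IH[of e E] ImpI.prems by simp
next
  case (ImpE \<Gamma> p q)
  show ?case using ImpE.IH[of e E] ImpE.prems by simp
next
  case (Classical p \<Gamma>)
  show ?case using Classical.IH[of e E] Classical.prems by auto
next
  case (AllI \<Gamma> p)
  have "msat (case_nat g e) E p" if "g \<in> I" for g
    by (rule AllI.IH) (use that AllI.prems in \<open>auto simp: msat_lift split: nat.splits\<close>)
  then show ?case by simp
next
  case (AllSI \<Gamma> p)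
  have "msat e (case_nat A E) p" if "A \<in> \<S>" for A
    by (rule AllSI.IH) (use that AllSI.prems in \<open>auto simp: msat_liftS split: nat.splits\<close>)
  then show ?case by simp
next
  case (AllE \<Gamma> p t)
  show ?case using AllE.IH[OF AllE.prems] meval_I[OF AllE.prems(1)] by (simp add: msat_inst)
next
  case (AllSE \<Gamma> p X)
  show ?case using AllSE.IH[OF AllSE.prems] AllSE.prems(2) by (simp add: msat_instS)
next
  case (Refl \<Gamma> t)
  show ?case by simp
next
  case (Subst \<Gamma> s t p)
  have "msat (case_nat (meval e s) e) E p = msat (case_nat (meval e t) e) E p"
    by (rule msat_cong) (use Subst.IH(1)[OF Subst.prems] in \<open>auto split: nat.splits\<close>)
  then show ?case using Subst.IH(2)[OF Subst.prems] by (simp add: msat_inst)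
qed (simp_all add: T)

text \<open>With environments coded as single numbers, arithmetical formulas become unary sets and
  the closure conditions of \<open>cut\<close> match the connectives; the quantifier is the one
  place where the strength of the cut enters.\<close>

lemma definable:
  assumes "arithmetical p" "\<And>n. E n \<in> \<S>"
  shows "\<exists>X\<in>\<S>. \<forall>l\<in>I. ev (\<lambda>k. l k \<in> X k) \<longleftrightarrow> msat (\<lambda>i k. dec (l k) i) E p"
  using assms(1)
proof (induction p)
  case Bot
  show ?case using S_eq[of Zero One] by (intro bexI) auto
next
  case (Eq s t)
  show ?case using S_eq[of s t] by (intro bexI) (auto simp: meval_def)
next
  case (Less s t)
  show ?case using S_less[of s t] by (intro bexI) (auto simp: meval_def)
next
  case (Mem t X)
  show ?case using S_term[OF assms(2), of t X] by (intro bexI) (auto simp: meval_def)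
next
  case (Imp p q)
  then obtain X Y where X: "X \<in> \<S>" "\<forall>l\<in>I. ev (\<lambda>k. l k \<in> X k) \<longleftrightarrow> msat (\<lambda>i k. dec (l k) i) E p"
    and Y: "Y \<in> \<S>" "\<forall>l\<in>I. ev (\<lambda>k. l k \<in> Y k) \<longleftrightarrow> msat (\<lambda>i k. dec (l k) i) E q" by auto
  have "(\<lambda>k. - (X k \<inter> - Y k)) \<in> \<S>" by (intro S_compl S_Int X Y)
  then show ?case using X(2) Y(2) by (intro bexI) (auto simp: ev_imp)
next
  case (Forall p)
  then obtain X where X: "X \<in> \<S>" "\<forall>l\<in>I. ev (\<lambda>k. l k \<in> X k) \<longleftrightarrow> msat (\<lambda>i k. dec (l k) i) E p" by auto
  obtain Y where Y: "Y \<in> \<S>" "\<forall>l\<in>I. ev (\<lambda>k. l k \<in> Y k) \<longleftrightarrow> (\<forall>n\<in>I. ev (\<lambda>k. prod_encode (n k, l k) \<in> X k))"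
    using S_all[OF X(1)] by blast
  have "(\<lambda>i k. dec (prod_encode (n k, l k)) i) = case_nat n (\<lambda>i k. dec (l k) i)" for n l :: "nat \<Rightarrow> nat"
    by (auto simp: fun_eq_iff dec_encode split: nat.splits)
  then have "ev (\<lambda>k. prod_encode (n k, l k) \<in> X k) \<longleftrightarrow> msat (case_nat n (\<lambda>i k. dec (l k) i)) E p"
    if "n \<in> I" "l \<in> I" for n l using bspec[OF X(2) I_encode[OF that]] by simp
  then show ?case using Y by (intro bexI[OF _ Y(1)]) auto
qed simp

lemma encode_env:
  assumes "\<And>n. e n \<in> I"
  shows "\<exists>l\<in>I. \<forall>i<N. \<forall>k. dec (l k) i = e i k"
  using assms
proof (induction N arbitrary: e)
  case 0 then show ?case by (intro bexI[OF _ I_zero]) simp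
next
  case (Suc N)
  obtain l where l: "l \<in> I" "\<forall>i<N. \<forall>k. dec (l k) i = e (Suc i) k"
    using Suc.IH[of "\<lambda>i. e (Suc i)"] Suc.prems by blast
  show ?case using l(2) I_encode[OF Suc.prems[of 0] l(1)]
    by (intro bexI[of _ "\<lambda>k. prod_encode (e 0 k, l k)"]) (auto simp: dec_encode split: nat.splits)
qed

text \<open>The theorem of Los for bounded formulas. If a bounded universal statement fails at
  almost all indices, counterexamples chosen index by index lie below the bounding term, hence in
  \<open>I\<close>.\<close>

lemma delta0_msat:
  "delta0 p \<Longrightarrow> (\<And>n. e n \<in> I) \<Longrightarrow> msat e E p \<longleftrightarrow> ev (\<lambda>k. sat (\<lambda>i. e i k) (\<lambda>X. E X k) p)"
proof (induction arbitrary: e rule: delta0.induct)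
  case (5 p q)
  then show ?case by (simp add: ev_imp)
next
  case (6 p t)
  have t: "eval (case_nat n e') (lift_tm t) = eval e' t" for n e'
    by (simp add: lift_tm_def eval_subst)
  have nat: "(\<lambda>i. (case i of 0 \<Rightarrow> g | Suc n \<Rightarrow> e n) k) = case_nat (g k) (\<lambda>i. e i k)" for g k
    by (auto simp: fun_eq_iff split: nat.splits)
  have IH: "msat (case_nat g e) E p \<longleftrightarrow> ev (\<lambda>k. sat (case_nat (g k) (\<lambda>i. e i k)) (\<lambda>X. E X k) p)" if "g \<in> I" for g
    using "6.IH"[of "case_nat g e"] that "6.prems" by (simp add: nat split: nat.splits)
  have m: "msat e E (Forall (Imp (Less (Var 0) (lift_tm t)) p)) \<longleftrightarrow>
     (\<forall>g\<in>I. ev (\<lambda>k. g k < meval e t k \<longrightarrow> sat (case_nat (g k) (\<lambda>i. e i k)) (\<lambda>X. E X k) p))"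
    by (simp add: IH ev_imp meval_def nat t)
  have "(\<forall>g\<in>I. ev (\<lambda>k. g k < meval e t k \<longrightarrow> sat (case_nat (g k) (\<lambda>i. e i k)) (\<lambda>X. E X k) p)) \<longleftrightarrow>
    ev (\<lambda>k. \<forall>n. n < meval e t k \<longrightarrow> sat (case_nat n (\<lambda>i. e i k)) (\<lambda>X. E X k) p)" (is "?L \<longleftrightarrow> ev ?R")
  proof
    assume L: ?L
    show "ev ?R"
    proof (rule ccontr)
      assume "\<not> ev ?R"
      define P where "P k n \<longleftrightarrow> n < meval e t k \<and> \<not> sat (case_nat n (\<lambda>i. e i k)) (\<lambda>X. E X k) p" for k n
      define g where "g k = (SOME n. P k n)" for k
      have "ev (\<lambda>k. \<exists>n. P k n)" using \<open>\<not> ev ?R\<close> unfolding P_def by (simp add: ev_neg[symmetric])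
      then have g: "ev (\<lambda>k. P k (g k))" by (rule ev_mono) (auto simp: g_def intro: someI)
      have tI: "meval e t \<in> I" by (rule meval_I) (rule "6.prems")
      have "g \<in> I" by (rule I_down[OF tI ev_mono[OF g]]) (simp add: P_def)
      from bspec[OF L this] show False using g by (simp add: P_def ev_conj ev_neg ev_imp)
    qed
  qed (auto elim: ev_mono)
  then show ?case unfolding m by (simp add: meval_def t)
qed (auto simp: meval_def)

lemma delta0_basic: "p \<in> basic_axioms \<Longrightarrow> delta0 p"
  unfolding basic_axioms_def Let_def Iff_def Conj_def Disj_def Neg_def
  by (elim insertE emptyE) (simp_all add: delta0.intros(1-5))

text \<open>The basic axioms are bounded and thus transferred. Induction: the least counterexample
  is taken at each index; it and its predecessor lie in \<open>I\<close> because \<open>n\<close>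
  does. Comprehension: the parameters are packed into one code \<open>l\<close>, and the section at
  \<open>l\<close> of the definable set is the set wanted.\<close>

lemma ACA0_msat:
  assumes "p \<in> ACA0" "\<And>n. e n \<in> I" "\<And>n. E n \<in> \<S>"
  shows "msat e E p"
proof -
  consider "p \<in> basic_axioms" | "p = induction_axiom" | q where "p = comprehension q" "arithmetical q"
    using assms(1) unfolding ACA0_def by blast
  then show ?thesis
  proof cases
    case 1
    then show ?thesis
      using delta0_msat[OF delta0_basic assms(2)] ACA0_true[OF assms(1)] by (simp add: ev_all)
  next
    case 2
    have "ev (\<lambda>k. n k \<in> E 0 k)" if 0: "ev (\<lambda>k. 0 \<in> E 0 k)"
      and Suc: "\<And>g. g \<in> I \<Longrightarrow> ev (\<lambda>k. g k \<in> E 0 k) \<Longrightarrow> ev (\<lambda>k. Suc (g k) \<in> E 0 k)" and "n \<in> I" for n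
    proof (rule ccontr)
      assume n: "\<not> ev (\<lambda>k. n k \<in> E 0 k)"
      define m where "m k = (LEAST j. j \<notin> E 0 k)" for k
      have m: "n k \<notin> E 0 k \<Longrightarrow> m k \<notin> E 0 k \<and> m k \<le> n k" "j < m k \<Longrightarrow> j \<in> E 0 k" for j k
        unfolding m_def using LeastI[of "\<lambda>j. j \<notin> E 0 k" "n k"] Least_le[of "\<lambda>j. j \<notin> E 0 k" "n k"]
          not_less_Least[of j "\<lambda>j. j \<notin> E 0 k"] by blast+
      have "ev (\<lambda>k. m k \<notin> E 0 k \<and> m k \<le> n k)" by (rule ev_mono[OF n[folded ev_neg]]) (rule m(1))
      then have m1: "ev (\<lambda>k. m k \<notin> E 0 k)" and "m \<in> I" using I_down[OF \<open>n \<in> I\<close>] by (auto simp: ev_conj)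
      then have "(\<lambda>k. m k - 1) \<in> I" by (rule_tac I_le) auto
      moreover have "ev (\<lambda>k. m k - 1 \<in> E 0 k \<and> Suc (m k - 1) \<notin> E 0 k)"
      proof (rule ev_mono2[OF m1 0])
        fix k assume *: "m k \<notin> E 0 k" "0 \<in> E 0 k"
        then have "0 < m k" by (intro gr0I) auto
        then show "m k - 1 \<in> E 0 k \<and> Suc (m k - 1) \<notin> E 0 k" using m(2)[of "m k - 1" k] * by simp
      qed
      ultimately show False using Suc[of "\<lambda>k. m k - 1"] by (simp add: ev_conj ev_neg)
    qed
    then show ?thesis unfolding 2 induction_axiom_def by (simp add: meval_def)
  next
    case 3
    obtain X where X: "X \<in> \<S>" "\<forall>l\<in>I. ev (\<lambda>k. l k \<in> X k) \<longleftrightarrow> msat (\<lambda>i k. dec (l k) i) E q"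
      using definable[OF 3(2), of E, OF assms(3)] by (elim bexE)
    obtain l where l: "l \<in> I" "\<forall>i<fmb q. \<forall>k. dec (l k) i = e i k" using encode_env[of e "fmb q", OF assms(2)] by (elim bexE)
    have "ev (\<lambda>k. prod_encode (g k, l k) \<in> X k) \<longleftrightarrow> msat (case_nat g e) E q" if "g \<in> I" for g
    proof -
      have "ev (\<lambda>k. prod_encode (g k, l k) \<in> X k) \<longleftrightarrow> msat (\<lambda>i k. dec (prod_encode (g k, l k)) i) E q"
        by (rule bspec[OF X(2) I_encode[OF that l(1)]])
      also have "\<dots> \<longleftrightarrow> msat (case_nat g e) E q"
      proof (rule msat_fmb)
        fix i assume "i < fmb q"
        then show "(\<lambda>k. dec (prod_encode (g k, l k)) i) = case_nat g e i"
          using l(2)[rule_format, of "i - 1"] by (cases i) (simp_all add: fun_eq_iff)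
      qed
      finally show ?thesis .
    qed
    then have "\<forall>g\<in>I. ev (\<lambda>k. g k \<in> {x. prod_encode (x, l k) \<in> X k}) \<longleftrightarrow> msat (case_nat g e) E q" by simp
    then have "\<exists>A\<in>\<S>. \<forall>g\<in>I. ev (\<lambda>k. g k \<in> A k) \<longleftrightarrow> msat (case_nat g e) E q"
      by (intro bexI[of _ "\<lambda>k. {x. prod_encode (x, l k) \<in> X k}"] S_section[OF X(1) l(1)])
    then show ?thesis unfolding 3(1) comprehension_def by (simp add: msat_liftS meval_def)
  qed
qed

text \<open>A universal formula that holds at every index for all values continues to hold when the
  values are restricted to \<open>I\<close>; bounded formulas inside it are handled by
  \<open>delta0_msat\<close>. This is where the complexity of the description matters.\<close>

lemma pi1_msat:
  "pi1 p \<Longrightarrow> (\<And>k e. sat e (\<lambda>X. E X k) p) \<Longrightarrow> (\<And>n. e n \<in> I) \<Longrightarrow> msat e E p"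
proof (induction arbitrary: e rule: pi1.induct)
  case (1 p)
  then show ?case by (simp add: delta0_msat ev_all)
next
  case (2 p)
  have "sat e' (\<lambda>X. E X k) p" for e' k
  proof -
    have "case_nat (e' 0) (\<lambda>i. e' (Suc i)) = e'" by (rule ext) (simp split: nat.split)
    then show ?thesis using 2(3)[of "\<lambda>i. e' (Suc i)" k, unfolded sat.simps, THEN spec, of "e' 0"] by simp
  qed
  then have "msat (case_nat g e) E p" if "g \<in> I" for g
    by (rule "2.IH") (use that 2(4) in \<open>auto split: nat.splits\<close>)
  then show ?case by simp
qed

end

section \<open>A strong cut between large sets\<close>

text \<open>At index \<open>k\<close> of the ultraproduct a \<open>tower k\<close>-large set is thinned \<open>k\<close> times. The \<open>t\<close>-th
  thinning makes the quantifier \<open>\<forall>n\<in>I\<close> in front of a set of level \<open>t\<close> equivalent to a quantifier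
  bounded by the maximum of the thinned set.\<close>

instance tm :: countable by countable_datatype

text \<open>Codes \<open>(oper, e)\<close> for the operations required by \<open>cut\<close>, with
  terms numbered by \<open>to_nat\<close>. Operation 0 keeps the old sets, so that levels are
  cumulative; operation 3 is the universal quantifier, bounded by \<open>c\<close> instead of
  ranging over \<open>I\<close>.\<close>

definition closure_step :: "(nat \<Rightarrow> nat set) \<Rightarrow> nat \<Rightarrow> nat \<Rightarrow> nat set" where
  "closure_step X c z = (case prod_decode z of (oper, e) \<Rightarrow>
     if oper = 0 then X e
     else if oper = 1 then - X e
     else if oper = 2 then X (fst (prod_decode e)) \<inter> X (snd (prod_decode e))
     else if oper = 3 then {l. \<forall>n\<le>c. prod_encode (n, l) \<in> X e}
     else if oper = 4 then {x. prod_encode (x, snd (prod_decode e)) \<in> X (fst (prod_decode e))}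
     else {l. eval (dec l) (from_nat (oper - 5)) \<in> X e})"

lemma closure_step_simps:
  "closure_step X c (prod_encode (0, e)) = X e"
  "closure_step X c (prod_encode (1, e)) = - X e"
  "closure_step X c (prod_encode (2, prod_encode (e, e'))) = X e \<inter> X e'"
  "closure_step X c (prod_encode (3, e)) = {l. \<forall>n\<le>c. prod_encode (n, l) \<in> X e}"
  "closure_step X c (prod_encode (4, prod_encode (e, p))) = {x. prod_encode (x, p) \<in> X e}"
  "closure_step X c (prod_encode (5 + to_nat t, e)) = {l. eval (dec l) t \<in> X e}"
  by (simp_all add: closure_step_def)

text \<open>A Skolem function for operation 3: on the pair of a set code and a parameter it gives
  the least failing instance. Where none exists the value is unspecified; conclusions are drawn only
  for pairs with a failing instance.\<close>

definition counterexample :: "(nat \<Rightarrow> nat set) \<Rightarrow> nat \<Rightarrow> nat" where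
  "counterexample X z = (LEAST n. prod_encode (n, snd (prod_decode z)) \<notin> X (fst (prod_decode z)))"

definition thin :: "nat list \<Rightarrow> tree \<Rightarrow> (nat \<Rightarrow> nat) \<Rightarrow> nat list" where
  "thin A \<alpha> g = (SOME A'. set A' \<subseteq> set A \<and> inc A' \<and> large \<alpha> A' \<and> approximates g A')"

definition start :: "(nat \<Rightarrow> nat set) \<Rightarrow> nat \<Rightarrow> nat set" where
  "start R z = (case prod_decode z of (oper, e) \<Rightarrow>
     if oper = 0 then R e
     else if oper = 1 then {l. eval (dec l) (fst (from_nat e :: tm \<times> tm)) = eval (dec l) (snd (from_nat e :: tm \<times> tm))}
     else {l. eval (dec l) (fst (from_nat e :: tm \<times> tm)) < eval (dec l) (snd (from_nat e :: tm \<times> tm))})"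

lemma start_simps:
  "start R (prod_encode (0, e)) = R e"
  "start R (prod_encode (1, to_nat (s, t))) = {l. eval (dec l) s = eval (dec l) t}"
  "start R (prod_encode (2, to_nat (s, t))) = {l. eval (dec l) s < eval (dec l) t}"
  by (simp_all add: start_def)

lemma hyp_le: "r \<le> r' \<Longrightarrow> hyp r x \<le> hyp r' x"
proof (induction rule: dec_induct)
  case (step n)
  have "hyp n x \<le> hyp (Suc n) x" using funpow_grow(3)[OF hyp_grow, of 1 "x + 2" n x] by simp
  then show ?case using step by simp
qed simp

lemma inc_nth: "inc A \<Longrightarrow> i < j \<Longrightarrow> j < length A \<Longrightarrow> A ! i < A ! j"
  by (simp add: inc_def sorted_wrt_nth_less)

text \<open>Deleting elements can only increase the \<open>j\<close>-th one.\<close>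

lemma inc_subset_nth:
  assumes "inc A" "inc B" "set B \<subseteq> set A"
  shows "j < length B \<Longrightarrow> j < length A \<and> A ! j \<le> B ! j"
proof (induction j)
  case 0
  then have "B ! 0 \<in> set A" using assms(3) by auto
  then obtain i where "i < length A" "B ! 0 = A ! i" by (auto simp: in_set_conv_nth)
  then show ?case using inc_nth[OF assms(1), of 0 i] by (cases "i = 0") auto
next
  case (Suc j)
  then have "B ! Suc j \<in> set A" using assms(3) by auto
  then obtain i where i: "i < length A" "B ! Suc j = A ! i" by (auto simp: in_set_conv_nth)
  have "A ! j < A ! i" using Suc inc_nth[OF assms(2), of j "Suc j"] i by simp
  then have "j < i" using inc_nth[OF assms(1), of i j] Suc by (cases "i = j"; cases "i < j") auto
  then show ?case using i inc_nth[OF assms(1), of "Suc j" i] by (cases "i = Suc j") auto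
qed

section \<open>Iterated thinning and the resulting cut\<close>

locale large_sets = ultrafilter +
  fixes A0 :: "nat \<Rightarrow> nat list" and R :: "nat \<Rightarrow> nat set"
  assumes A0: "inc (A0 k)" "large (tower k) (A0 k)" "sparse (hyp k) (A0 k)"
begin

primrec st :: "nat \<Rightarrow> nat \<Rightarrow> nat list \<times> (nat \<Rightarrow> nat set)" where
  "st k 0 = (A0 k, start R)"
| "st k (Suc t) = (let A' = thin (fst (st k t)) (tower (k - Suc t)) (counterexample (snd (st k t)))
     in (A', closure_step (snd (st k t)) (Max (set A'))))"

definition "A k t = fst (st k t)"
definition "X k t = snd (st k t)"

lemma A_X_simps: "A k 0 = A0 k" "X k 0 = start R"
  "A k (Suc t) = thin (A k t) (tower (k - Suc t)) (counterexample (X k t))"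
  "X k (Suc t) = closure_step (X k t) (Max (set (A k (Suc t))))"
  by (simp_all add: A_def X_def Let_def)

lemma A_Suc:
  assumes "t < k" "inc (A k t)" "large (tower (k - t)) (A k t)"
  shows "set (A k (Suc t)) \<subseteq> set (A k t) \<and> inc (A k (Suc t)) \<and> large (tower (k - Suc t)) (A k (Suc t)) \<and>
    approximates (counterexample (X k t)) (A k (Suc t))"
proof -
  have "k - t = Suc (k - Suc t)" using assms(1) by simp
  then have "large (expo (tower (k - Suc t))) (A k t)" using assms(3) by simp
  from someI_ex[OF thinning[OF this assms(2)]] show ?thesis unfolding A_X_simps(3) thin_def .
qed

lemma A_inv: "t \<le> k \<Longrightarrow> inc (A k t) \<and> large (tower (k - t)) (A k t) \<and> sparse (hyp k) (A k t)"
proof (induction t)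
  case 0 then show ?case using A0 by (simp add: A_X_simps)
next
  case (Suc t)
  then show ?case using A_Suc[of t k] sparse_subset[of "hyp k" "A k t" "A k (Suc t)"] by auto
qed

lemma A_mono: "t \<le> t' \<Longrightarrow> t' \<le> k \<Longrightarrow> set (A k t') \<subseteq> set (A k t)"
proof (induction t' rule: dec_induct)
  case (step n) then show ?case using A_Suc[of n k] A_inv[of n k] by auto
qed simp

text \<open>A diagonal: the \<open>t\<close>-th entry of the \<open>t\<close>-th thinning. For large
  \<open>k\<close> these entries increase with \<open>t\<close>, and from \<open>s\<close> on they
  all belong to the \<open>s\<close>-th thinning, so that each thinning is cofinal in the
  cut.\<close>

definition a :: "nat \<Rightarrow> nat \<Rightarrow> nat" where "a t k = A k t ! t"

text \<open>After \<open>t\<close> thinnings the list is still large for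
  \<open>tower (k - t)\<close> and so has at least \<open>k - t\<close> entries, more than
  \<open>t\<close> if \<open>2 * t < k\<close>.\<close>

lemma a_in: "2 * t < k \<Longrightarrow> a t k \<in> set (A k t)"
  using A_inv[of t k] tower_length[of "k - t" "A k t"] by (auto simp: a_def)

lemma a_in_le: "t \<le> s \<Longrightarrow> 2 * s < k \<Longrightarrow> a s k \<in> set (A k t)"
  using a_in[of s k] A_mono[of t s k] by auto

lemma a_less: "2 * Suc t < k \<Longrightarrow> a t k < a (Suc t) k"
proof -
  assume k: "2 * Suc t < k"
  have l: "Suc t < length (A k (Suc t))"
    using A_inv[of "Suc t" k] tower_length[of "k - Suc t" "A k (Suc t)"] k by auto
  have "A k t ! t \<le> A k (Suc t) ! t"
    using inc_subset_nth[of "A k t" "A k (Suc t)" t] A_inv[of t k] A_inv[of "Suc t" k] A_mono[of t "Suc t" k] k l by auto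
  also have "\<dots> < A k (Suc t) ! Suc t" using inc_nth[of "A k (Suc t)" t "Suc t"] A_inv[of "Suc t" k] k l by auto
  finally show ?thesis by (simp add: a_def)
qed

lemma a_le: "t \<le> s \<Longrightarrow> 2 * s < k \<Longrightarrow> a t k \<le> a s k"
proof (induction s rule: dec_induct)
  case (step n) then show ?case using a_less[of n k] by simp
qed simp

text \<open>The segment in which the sequence \<open>a 0\<close>, \<open>a 1\<close>, ... is
  cofinal. The maxima of the thinned lists lie above it, so they can serve as bounds for quantifiers
  over it.\<close>

definition I :: "(nat \<Rightarrow> nat) set" where "I = {g. \<exists>t. ev (\<lambda>k. g k \<le> a t k)}"

lemma I_above: "g \<in> I \<Longrightarrow> \<exists>s\<ge>t. ev (\<lambda>k. g k \<le> a s k \<and> 2 * Suc s < k)"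
proof -
  assume "g \<in> I"
  then obtain s where s: "ev (\<lambda>k. g k \<le> a s k)" by (auto simp: I_def)
  let ?s = "max s t"
  have "ev (\<lambda>k. 2 * Suc ?s < k)" by (rule ev_ge[of "Suc (2 * Suc ?s)"]) simp
  with s have "ev (\<lambda>k. g k \<le> a ?s k \<and> 2 * Suc ?s < k)"
  proof (rule ev_mono2)
    fix k assume "g k \<le> a s k" "2 * Suc ?s < k"
    then show "g k \<le> a ?s k \<and> 2 * Suc ?s < k" using a_le[of s ?s k] by simp
  qed
  then show ?thesis by (intro exI[of _ ?s]) simp
qed

sublocale segment \<U> I
proof
  show "(\<lambda>_. 0) \<in> I" by (auto simp: I_def)
  show "h \<in> I" if gh: "g \<in> I" "ev (\<lambda>k. h k \<le> g k)" for g h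
  proof -
    obtain t where "ev (\<lambda>k. g k \<le> a t k)" using gh(1) by (auto simp: I_def)
    with gh(2) have "ev (\<lambda>k. h k \<le> a t k)" by (rule ev_mono2) simp
    then show ?thesis by (auto simp: I_def)
  qed
  show "(\<lambda>k. hyp r (g k)) \<in> I" if gI: "g \<in> I" for g r
  proof -
    obtain t where t: "ev (\<lambda>k. g k \<le> a t k \<and> 2 * Suc t < k)" using I_above[OF gI, of 0] by blast
    \<comment> \<open>The lists at index \<open>k\<close> are sparse for \<open>hyp k\<close>, which
      dominates any fixed \<open>hyp r\<close> at almost all indices.\<close>
    have "ev (\<lambda>k. r \<le> k)" by (rule ev_ge)
    with t have "ev (\<lambda>k. hyp r (g k) \<le> a (Suc t) k)"
    proof (rule ev_mono2)
      fix k assume k: "g k \<le> a t k \<and> 2 * Suc t < k" "r \<le> k"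
      have "hyp r (g k) \<le> hyp k (a t k)"
        using hyp_le[OF k(2), of "g k"] monoD[OF hyp_grow(1)[of k], of "g k" "a t k"] k(1) by simp
      also have "\<dots> \<le> a (Suc t) k"
      proof -
        have "a t k \<in> set (A k t)" "a (Suc t) k \<in> set (A k t)" "a t k < a (Suc t) k"
          using k(1) by (auto intro!: a_in a_in_le a_less)
        moreover have "sparse (hyp k) (A k t)" using A_inv[of t k] k(1) by simp
        ultimately show ?thesis unfolding sparse_def by blast
      qed
      finally show "hyp r (g k) \<le> a (Suc t) k" .
    qed
    then show ?thesis unfolding I_def by blast
  qed
  show "(\<lambda>k. max (g k) (h k)) \<in> I" if gh: "g \<in> I" "h \<in> I" for g h
  proof -
    obtain t where t: "ev (\<lambda>k. g k \<le> a t k \<and> 2 * Suc t < k)" using I_above[OF gh(1), of 0] by blast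
    obtain s where s: "t \<le> s" "ev (\<lambda>k. h k \<le> a s k \<and> 2 * Suc s < k)" using I_above[OF gh(2), of t] by blast
    from t s(2) have "ev (\<lambda>k. max (g k) (h k) \<le> a s k)"
    proof (rule ev_mono2)
      fix k assume k: "g k \<le> a t k \<and> 2 * Suc t < k" "h k \<le> a s k \<and> 2 * Suc s < k"
      have "a t k \<le> a s k" by (rule a_le[OF s(1)]) (use k(2) in simp)
      then show "max (g k) (h k) \<le> a s k" using k by simp
    qed
    then show ?thesis unfolding I_def by blast
  qed
qed

definition level :: "nat \<Rightarrow> (nat \<Rightarrow> nat) \<Rightarrow> nat \<Rightarrow> nat set" where "level t e = (\<lambda>k. X k t (e k))"
definition \<S> :: "(nat \<Rightarrow> nat set) set" where "\<S> = {level t e | t e. e \<in> I}"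

lemma level_S: "e \<in> I \<Longrightarrow> level t e \<in> \<S>"
  unfolding \<S>_def by blast

lemma code_I: "e \<in> I \<Longrightarrow> (\<lambda>k. prod_encode (c, e k)) \<in> I"
  by (rule I_encode[OF I_const])

lemma level_up:
  assumes "e \<in> I" "t \<le> t'"
  shows "\<exists>e'\<in>I. level t' e' = level t e"
  using assms(2)
proof (induction t' rule: dec_induct)
  case base
  show ?case using assms(1) by blast
next
  case (step n)
  then obtain e' where e': "e' \<in> I" "level n e' = level t e" by blast
  have "level (Suc n) (\<lambda>k. prod_encode (0, e' k)) = level n e'"
    unfolding level_def A_X_simps closure_step_simps ..
  then show ?case using code_I[OF e'(1), of 0] e'(2) by (intro bexI[of _ "\<lambda>k. prod_encode (0, e' k)"]) simp_all
qed

lemma Max_ge_a: "t \<le> s \<Longrightarrow> 2 * s < k \<Longrightarrow> a s k \<le> Max (set (A k t))"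
  using a_in_le[of t s k] by simp

text \<open>If the bounded statement fails, the least counterexample is at most the maximum of the
  thinned list. It is the value of the approximated function at a code below some
  \<open>a s\<close>, so it lies below or above all later entries; above is excluded by the maximum,
  so it is below \<open>a (Suc s)\<close> and belongs to \<open>I\<close>. The other direction holds
  because the maximum is above \<open>I\<close>.\<close>

lemma level_all:
  assumes e: "e \<in> I" and l: "l \<in> I"
  shows "ev (\<lambda>k. \<forall>n\<le>Max (set (A k (Suc t))). prod_encode (n, l k) \<in> X k t (e k)) \<longleftrightarrow>
    (\<forall>n\<in>I. ev (\<lambda>k. prod_encode (n k, l k) \<in> X k t (e k)))" (is "ev ?L \<longleftrightarrow> ?R")
proof
  assume L: "ev ?L"
  show ?R
  proof
    fix n assume "n \<in> I"
    then obtain s where s: "Suc t \<le> s" "ev (\<lambda>k. n k \<le> a s k \<and> 2 * Suc s < k)" using I_above[of n "Suc t"] by blast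
    show "ev (\<lambda>k. prod_encode (n k, l k) \<in> X k t (e k))"
    proof (rule ev_mono2[OF L s(2)])
      fix k assume L: "?L k" and k: "n k \<le> a s k \<and> 2 * Suc s < k"
      have "a s k \<le> Max (set (A k (Suc t)))" by (rule Max_ge_a[OF s(1)]) (use k in simp)
      then show "prod_encode (n k, l k) \<in> X k t (e k)" using L k by simp
    qed
  qed
next
  assume R: ?R
  show "ev ?L"
  proof (rule ccontr)
    assume "\<not> ev ?L"
    then have nL: "ev (\<lambda>k. \<not> ?L k)" by (simp only: ev_neg not_False_eq_True)
    let ?z = "\<lambda>k. prod_encode (e k, l k)"
    define g where "g k = counterexample (X k t) (?z k)" for k
    obtain s where s: "Suc t \<le> s" "ev (\<lambda>k. ?z k \<le> a s k \<and> 2 * Suc s < k)"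
      using I_above[OF I_encode[OF e l], of "Suc t"] by blast
    have "ev (\<lambda>k. prod_encode (g k, l k) \<notin> X k t (e k) \<and> g k \<le> a (Suc s) k)"
    proof (rule ev_mono2[OF nL s(2)])
      fix k assume "\<not> ?L k" and k: "?z k \<le> a s k \<and> 2 * Suc s < k"
      then obtain n where n: "n \<le> Max (set (A k (Suc t)))" "prod_encode (n, l k) \<notin> X k t (e k)" by blast
      have gL: "g k = (LEAST n. prod_encode (n, l k) \<notin> X k t (e k))" by (simp add: g_def counterexample_def)
      have g: "prod_encode (g k, l k) \<notin> X k t (e k)" "g k \<le> Max (set (A k (Suc t)))"
        unfolding gL using LeastI[of "\<lambda>n. prod_encode (n, l k) \<notin> X k t (e k)", OF n(2)]
          Least_le[of "\<lambda>n. prod_encode (n, l k) \<notin> X k t (e k)", OF n(2)] n(1) by simp_all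
      have tk: "t < k" using s(1) k by simp
      have ap: "approximates (counterexample (X k t)) (A k (Suc t))" using A_Suc[OF tk] A_inv[of t k] tk by simp
      have as: "a s k \<in> set (A k (Suc t))" by (rule a_in_le[OF s(1)]) (use k in simp)
      have as': "a (Suc s) k \<in> set (A k (Suc t))" by (rule a_in_le) (use s(1) k in simp_all)
      have lt: "a s k < a (Suc s) k" by (rule a_less) (use k in simp)
      have M: "Max (set (A k (Suc t))) \<in> set (A k (Suc t))" using as by (intro Max_in) auto
      have "a (Suc s) k \<le> Max (set (A k (Suc t)))" using as' by simp
      then have "a s k < Max (set (A k (Suc t)))" using lt by simp
      then have "g k < a (Suc s) k"
        using ap[unfolded approximates_def, rule_format, OF as, of "?z k"] k as' lt M g(2)
        unfolding g_def[symmetric] by (auto simp: not_less[symmetric])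
      then show "prod_encode (g k, l k) \<notin> X k t (e k) \<and> g k \<le> a (Suc s) k" using g by simp
    qed
    then have 1: "ev (\<lambda>k. prod_encode (g k, l k) \<notin> X k t (e k))" and 2: "ev (\<lambda>k. g k \<le> a (Suc s) k)"
      unfolding ev_conj by blast+
    have "g \<in> I" using 2 unfolding I_def by blast
    then have "ev (\<lambda>k. prod_encode (g k, l k) \<in> X k t (e k))" using R by blast
    then show False using 1 unfolding ev_neg by blast
  qed
qed

sublocale cut \<U> I \<S>
proof
  show "(\<lambda>k. - Y k) \<in> \<S>" if Y: "Y \<in> \<S>" for Y
  proof -
    obtain t e where e: "e \<in> I" "Y = level t e" using Y unfolding \<S>_def by blast
    have "(\<lambda>k. - Y k) = level (Suc t) (\<lambda>k. prod_encode (1, e k))"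
      unfolding e(2) level_def A_X_simps closure_step_simps ..
    then show ?thesis using level_S[OF code_I[OF e(1)]] by simp
  qed
  show "(\<lambda>k. Y k \<inter> Y' k) \<in> \<S>" if Y: "Y \<in> \<S>" "Y' \<in> \<S>" for Y Y'
  proof -
    obtain t e where e: "e \<in> I" "Y = level t e" using Y(1) unfolding \<S>_def by blast
    obtain t' e' where e': "e' \<in> I" "Y' = level t' e'" using Y(2) unfolding \<S>_def by blast
    let ?t = "max t t'"
    obtain d where d: "d \<in> I" "level ?t d = Y" using level_up[OF e(1), of t ?t] e(2) by auto
    obtain d' where d': "d' \<in> I" "level ?t d' = Y'" using level_up[OF e'(1), of t' ?t] e'(2) by auto
    have "(\<lambda>k. Y k \<inter> Y' k) = level (Suc ?t) (\<lambda>k. prod_encode (2, prod_encode (d k, d' k)))"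
      unfolding d(2)[symmetric] d'(2)[symmetric] level_def A_X_simps closure_step_simps ..
    then show ?thesis using level_S[OF code_I[OF I_encode[OF d(1) d'(1)]]] by simp
  qed
  show "\<exists>Y'\<in>\<S>. \<forall>l\<in>I. ev (\<lambda>k. l k \<in> Y' k) \<longleftrightarrow> (\<forall>n\<in>I. ev (\<lambda>k. prod_encode (n k, l k) \<in> Y k))"
    if Y: "Y \<in> \<S>" for Y
  proof -
    obtain t e where e: "e \<in> I" "Y = level t e" using Y unfolding \<S>_def by blast
    have "ev (\<lambda>k. l k \<in> level (Suc t) (\<lambda>k. prod_encode (3, e k)) k) \<longleftrightarrow>
      (\<forall>n\<in>I. ev (\<lambda>k. prod_encode (n k, l k) \<in> Y k))" if "l \<in> I" for l
      unfolding e(2) level_def A_X_simps closure_step_simps mem_Collect_eq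
      using level_all[OF e(1) that, of t] unfolding A_X_simps .
    then show ?thesis using level_S[OF code_I[OF e(1)]] by blast
  qed
  show "(\<lambda>k. {x. prod_encode (x, p k) \<in> Y k}) \<in> \<S>" if Y: "Y \<in> \<S>" "p \<in> I" for Y p
  proof -
    obtain t e where e: "e \<in> I" "Y = level t e" using Y(1) unfolding \<S>_def by blast
    have "(\<lambda>k. {x. prod_encode (x, p k) \<in> Y k}) = level (Suc t) (\<lambda>k. prod_encode (4, prod_encode (e k, p k)))"
      unfolding e(2) level_def A_X_simps closure_step_simps ..
    then show ?thesis using level_S[OF code_I[OF I_encode[OF e(1) Y(2)]]] by simp
  qed
  show "(\<lambda>k. {l. eval (dec l) s \<in> Y k}) \<in> \<S>" if Y: "Y \<in> \<S>" for Y s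
  proof -
    obtain t e where e: "e \<in> I" "Y = level t e" using Y unfolding \<S>_def by blast
    have "(\<lambda>k. {l. eval (dec l) s \<in> Y k}) = level (Suc t) (\<lambda>k. prod_encode (5 + to_nat s, e k))"
      unfolding e(2) level_def A_X_simps closure_step_simps ..
    then show ?thesis using level_S[OF code_I[OF e(1)]] by simp
  qed
  show "(\<lambda>k. {l. eval (dec l) s = eval (dec l) t}) \<in> \<S>" for s t
  proof -
    have "(\<lambda>k. {l. eval (dec l) s = eval (dec l) t}) = level 0 (\<lambda>k. prod_encode (1, to_nat (s, t)))"
      unfolding level_def A_X_simps start_simps ..
    then show ?thesis using level_S[OF I_const] by simp
  qed
  show "(\<lambda>k. {l. eval (dec l) s < eval (dec l) t}) \<in> \<S>" for s t
  proof -
    have "(\<lambda>k. {l. eval (dec l) s < eval (dec l) t}) = level 0 (\<lambda>k. prod_encode (2, to_nat (s, t)))"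
      unfolding level_def A_X_simps start_simps ..
    then show ?thesis using level_S[OF I_const] by simp
  qed
qed

lemma R_in_S: "e \<in> I \<Longrightarrow> (\<lambda>k. R (e k)) \<in> \<S>"
proof -
  assume "e \<in> I"
  moreover have "(\<lambda>k. R (e k)) = level 0 (\<lambda>k. prod_encode (0, e k))"
    unfolding level_def A_X_simps start_simps ..
  ultimately show ?thesis using level_S[OF code_I] by simp
qed

lemma hd_in_I: "(\<lambda>k. hd (A0 k)) \<in> I"
proof -
  have "ev (\<lambda>k. hd (A0 k) \<le> a 0 k)"
  proof (rule ev_ge[of 1])
    fix k :: nat assume "1 \<le> k"
    then have "A0 k \<noteq> []" using tower_length[OF A0(2), of k] by (cases "A0 k") auto
    then show "hd (A0 k) \<le> a 0 k" by (simp add: a_def A_X_simps hd_conv_nth)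
  qed
  then show ?thesis unfolding I_def by blast
qed

lemma I_below: "g \<in> I \<Longrightarrow> ev (\<lambda>k. \<exists>x\<in>set (A0 k). g k \<le> x)"
proof -
  assume "g \<in> I"
  then obtain s where s: "ev (\<lambda>k. g k \<le> a s k \<and> 2 * Suc s < k)" using I_above[of g 0] by blast
  show ?thesis
  proof (rule ev_mono[OF s])
    fix k assume k: "g k \<le> a s k \<and> 2 * Suc s < k"
    have "a s k \<in> set (A k 0)" by (rule a_in_le) (use k in simp_all)
    then show "\<exists>x\<in>set (A0 k). g k \<le> x" using k by (auto simp: A_X_simps)
  qed
qed

end

section \<open>The Goodstein principle in a cut\<close>

subsection \<open>Bounded quantifiers and recursion\<close>

context cut
begin

lemma ev_choice: "ev (\<lambda>k. \<exists>x. P k x) \<Longrightarrow> \<exists>f. ev (\<lambda>k. P k (f k))"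
  by (rule exI[of _ "\<lambda>k. SOME x. P k x"], erule ev_mono) (rule someI_ex)

text \<open>Witnesses can be chosen below \<open>bd\<close> at each index, so they lie in
  \<open>I\<close>. The later evaluations of number quantifiers come down to finding such
  bounds.\<close>

lemma I_ex:
  assumes "bd \<in> I" "ev (\<lambda>k. \<forall>v. Q k v \<longrightarrow> (\<exists>v'\<le>bd k. Q k v'))"
  shows "(\<exists>v\<in>I. ev (\<lambda>k. Q k (v k))) \<longleftrightarrow> ev (\<lambda>k. \<exists>v. Q k v)"
proof
  assume "\<exists>v\<in>I. ev (\<lambda>k. Q k (v k))"
  then show "ev (\<lambda>k. \<exists>v. Q k v)" by (elim bexE ev_mono) blast
next
  assume "ev (\<lambda>k. \<exists>v. Q k v)"
  then have "ev (\<lambda>k. \<exists>v. v \<le> bd k \<and> Q k v)" by (rule ev_mono2[OF assms(2)]) blast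
  from ev_choice[OF this] obtain f where f: "ev (\<lambda>k. f k \<le> bd k \<and> Q k (f k))" by (elim exE)
  then have "ev (\<lambda>k. f k \<le> bd k)" "ev (\<lambda>k. Q k (f k))" by (simp_all add: ev_conj)
  then show "\<exists>v\<in>I. ev (\<lambda>k. Q k (v k))" using I_down[OF assms(1), of f] by blast
qed

lemma I_all:
  assumes "bd \<in> I" "ev (\<lambda>k. \<forall>v. \<not> Q k v \<longrightarrow> (\<exists>v'\<le>bd k. \<not> Q k v'))"
  shows "(\<forall>v\<in>I. ev (\<lambda>k. Q k (v k))) \<longleftrightarrow> ev (\<lambda>k. \<forall>v. Q k v)"
proof -
  have "(\<exists>v\<in>I. ev (\<lambda>k. \<not> Q k (v k))) \<longleftrightarrow> ev (\<lambda>k. \<exists>v. \<not> Q k v)"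
    by (rule I_ex[OF assms])
  moreover have "ev (\<lambda>k. \<exists>v. \<not> Q k v) \<longleftrightarrow> \<not> ev (\<lambda>k. \<forall>v. Q k v)"
    unfolding ev_neg[symmetric] by simp
  ultimately show ?thesis unfolding ev_neg by blast
qed

definition rel :: "(nat \<Rightarrow> nat set) \<Rightarrow> (nat \<Rightarrow> nat) \<Rightarrow> (nat \<Rightarrow> nat) \<Rightarrow> bool" where
  "rel A x y \<longleftrightarrow> ev (\<lambda>k. pr (x k) (y k) \<in> A k)"

text \<open>The minimum is taken at each index; it lies in \<open>I\<close> because \<open>n\<close>
  bounds it.\<close>

lemma least_element:
  assumes "n \<in> I" "ev (\<lambda>k. n k \<in> X k)"
  shows "\<exists>m\<in>I. ev (\<lambda>k. m k \<in> X k) \<and> (\<forall>l. ev (\<lambda>k. l k < m k) \<longrightarrow> \<not> ev (\<lambda>k. l k \<in> X k))"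
proof -
  define m where "m k = (LEAST j. j \<in> X k)" for k
  have "ev (\<lambda>k. m k \<in> X k \<and> m k \<le> n k)"
  proof (rule ev_mono[OF assms(2)])
    show "m k \<in> X k \<and> m k \<le> n k" if "n k \<in> X k" for k
      unfolding m_def using LeastI[of "\<lambda>j. j \<in> X k", OF that] Least_le[of "\<lambda>j. j \<in> X k", OF that] by blast
  qed
  then have m: "ev (\<lambda>k. m k \<in> X k)" "m \<in> I" using I_down[OF assms(1)] by (simp_all add: ev_conj)
  have "\<not> ev (\<lambda>k. l k \<in> X k)" if "ev (\<lambda>k. l k < m k)" for l
  proof -
    have "ev (\<lambda>k. l k \<notin> X k)"
      by (rule ev_mono[OF that]) (unfold m_def, rule not_less_Least)
    then show ?thesis by (simp add: ev_neg)
  qed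
  then show ?thesis using m by blast
qed

text \<open>The arguments in \<open>I\<close> at which two internal relations differ are traced out
  by an internal set: the quantifier over the values is arithmetical, so \<open>definable\<close>
  applies.\<close>

lemma rel_differ:
  assumes "A \<in> \<S>" "G \<in> \<S>"
  shows "\<exists>X. \<forall>x\<in>I. ev (\<lambda>k. x k \<in> X k) \<longleftrightarrow> (\<exists>y\<in>I. rel A x y \<noteq> rel G x y)"
proof -
  \<comment> \<open>The polynomial of \<open>pr\<close>, at variable 1 for the argument and variable
    0 for the value.\<close>
  let ?T = "Add (Mul (Add (Var 1) (Var 0)) (Add (Var 1) (Var 0))) (Var 1)"
  let ?p = "Exists (Neg (Iff (Mem ?T 0) (Mem ?T 1)))"
  have E: "case_nat A (\<lambda>_. G) n \<in> \<S>" for n using assms by (cases n) simp_all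
  have "arithmetical ?p" by (simp add: Exists_def Neg_def Iff_def Conj_def)
  from definable[OF this, of "case_nat A (\<lambda>_. G)", OF E]
  obtain X where X: "\<forall>l\<in>I. ev (\<lambda>k. l k \<in> X k) \<longleftrightarrow> msat (\<lambda>i k. dec (l k) i) (case_nat A (\<lambda>_. G)) ?p" by (elim bexE)
  have "ev (\<lambda>k. prod_encode (x k, 0) \<in> X k) \<longleftrightarrow> (\<exists>y\<in>I. rel A x y \<noteq> rel G x y)" if "x \<in> I" for x
    using bspec[OF X I_encode[OF that I_const[of 0]]] by (simp add: meval_def rel_def pr_def)
  then show ?thesis by (intro exI[of _ "\<lambda>k. {x. prod_encode (x, 0) \<in> X k}"]) simp
qed

text \<open>Induction in the model, in the form of a least argument of disagreement. It gives
  uniqueness on \<open>I\<close> of the sets that satisfy a recursion; existence always comes from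
  an explicit graph in \<open>\<S>\<close>.\<close>

lemma rec_unique:
  assumes S: "A \<in> \<S>" "G \<in> \<S>"
    and A: "\<And>x y. x \<in> I \<Longrightarrow> y \<in> I \<Longrightarrow> rel A x y = \<Phi> (rel A) x y"
    and G: "\<And>x y. x \<in> I \<Longrightarrow> y \<in> I \<Longrightarrow> rel G x y = \<Phi> (rel G) x y"
    and dep: "\<And>D D' x y. x \<in> I \<Longrightarrow> y \<in> I \<Longrightarrow>
      (\<And>l z. l \<in> I \<Longrightarrow> z \<in> I \<Longrightarrow> ev (\<lambda>k. l k < x k) \<Longrightarrow> D l z = D' l z) \<Longrightarrow> \<Phi> D x y = \<Phi> D' x y"
    and "x \<in> I" "y \<in> I"
  shows "rel A x y = rel G x y"
proof (rule ccontr)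
  assume neq: "rel A x y \<noteq> rel G x y"
  obtain X where X: "\<And>x. x \<in> I \<Longrightarrow> ev (\<lambda>k. x k \<in> X k) \<longleftrightarrow> (\<exists>y\<in>I. rel A x y \<noteq> rel G x y)"
    using rel_differ[OF S] by blast
  have "ev (\<lambda>k. x k \<in> X k)" using X[OF assms(6)] neq assms(7) by blast
  from least_element[OF assms(6) this] obtain m where m: "m \<in> I" "ev (\<lambda>k. m k \<in> X k)"
    "\<And>l. ev (\<lambda>k. l k < m k) \<Longrightarrow> \<not> ev (\<lambda>k. l k \<in> X k)" by blast
  have "rel A l z = rel G l z" if "l \<in> I" "z \<in> I" "ev (\<lambda>k. l k < m k)" for l z
    using X[OF that(1)] m(3)[OF that(3)] that(2) by blast
  then have "\<Phi> (rel A) m z = \<Phi> (rel G) m z" if "z \<in> I" for z using dep[OF m(1) that] by blast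
  then have "rel A m z = rel G m z" if "z \<in> I" for z using A[OF m(1) that] G[OF m(1) that] that by blast
  then show False using X[OF m(1)] m(2) by blast
qed

end

subsection \<open>Denotations\<close>

type_synonym hworld = "(nat \<times> (nat \<Rightarrow> nat \<Rightarrow> nat)) \<times> (nat \<times> (nat \<Rightarrow> nat \<Rightarrow> nat set))"

fun hle :: "hworld \<Rightarrow> hworld \<Rightarrow> bool" where
  "hle ((d, \<nu>), (s, N)) ((d', \<nu>'), (s', N')) \<longleftrightarrow>
     d \<le> d' \<and> s \<le> s' \<and> (\<forall>k<d. \<nu>' k = \<nu> k) \<and> (\<forall>k<s. N' k = N k)"

lemma hle_refl: "hle w w" by (cases w) auto
lemma hle_trans: "hle w w' \<Longrightarrow> hle w' w'' \<Longrightarrow> hle w w''"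
  by (cases "(w, w')" rule: hle.cases, cases w'') auto

text \<open>Formulas are evaluated as in the standard model, except that values are sequences,
  number quantifiers range over \<open>I\<close> and set quantifiers over
  \<open>\<S>\<close>.\<close>

locale den = cut +
  fixes e0 :: "nat \<Rightarrow> nat \<Rightarrow> nat" and E0 :: "nat \<Rightarrow> nat \<Rightarrow> nat set"
begin

fun hev :: "hworld \<Rightarrow> xtm \<Rightarrow> nat \<Rightarrow> nat" where
  "hev ((d, \<nu>), (s, N)) t = meval (env d \<nu> e0) (t d)"
fun hst :: "hworld \<Rightarrow> xfm \<Rightarrow> bool" where
  "hst ((d, \<nu>), (s, N)) p = msat (env d \<nu> e0) (env s N E0) (p d s)"

definition "tden w t v \<longleftrightarrow> (\<forall>w'. hle w w' \<longrightarrow> hev w' t = v)"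
definition "fden w p P \<longleftrightarrow> (\<forall>w'. hle w w' \<longrightarrow> hst w' p = P)"
definition "cden w C A \<longleftrightarrow> (\<forall>w' t v. hle w w' \<longrightarrow> tden w' t v \<longrightarrow> v \<in> I \<longrightarrow> fden w' (C t) (ev (\<lambda>k. v k \<in> A k)))"
text \<open>In the recursions a set variable matters only through the pairs of members of
  \<open>I\<close> that it contains, so classes are also evaluated as relations on
  \<open>I\<close>.\<close>

definition "rden w F D \<longleftrightarrow> (\<forall>w' x y a b. hle w w' \<longrightarrow> tden w' x a \<longrightarrow> tden w' y b \<longrightarrow> a \<in> I \<longrightarrow> b \<in> I \<longrightarrow>
  fden w' (xapp F x y) (D a b))"

lemma tden_mono: "tden w t v \<Longrightarrow> hle w w' \<Longrightarrow> tden w' t v"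
  unfolding tden_def using hle_trans by blast
lemma cden_mono: "cden w C A \<Longrightarrow> hle w w' \<Longrightarrow> cden w' C A"
  unfolding cden_def using hle_trans by blast
lemma rden_mono: "rden w F D \<Longrightarrow> hle w w' \<Longrightarrow> rden w' F D"
  unfolding rden_def using hle_trans by blast

lemma den_zero: "tden w 0\<^sub>f (\<lambda>_. 0)" and den_one: "tden w 1\<^sub>f (\<lambda>_. 1)"
  by (auto simp: tden_def xzero_def xone_def meval_def)
lemma den_add: "tden w x a \<Longrightarrow> tden w y b \<Longrightarrow> tden w (x +\<^sub>f y) (\<lambda>k. a k + b k)"
  and den_mul: "tden w x a \<Longrightarrow> tden w y b \<Longrightarrow> tden w (x *\<^sub>f y) (\<lambda>k. a k * b k)"
  by (fastforce simp: tden_def xadd_def xmul_def meval_def)+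
lemma den_eq: "tden w x a \<Longrightarrow> tden w y b \<Longrightarrow> fden w (x =\<^sub>f y) (ev (\<lambda>k. a k = b k))"
  and den_less: "tden w x a \<Longrightarrow> tden w y b \<Longrightarrow> fden w (x <\<^sub>f y) (ev (\<lambda>k. a k < b k))"
  by (fastforce simp: tden_def fden_def xeq_def xless_def)+
lemma den_neg: "fden w p P \<Longrightarrow> fden w (\<not>\<^sub>f p) (\<not> P)"
  and den_conj: "fden w p P \<Longrightarrow> fden w q Q \<Longrightarrow> fden w (p \<and>\<^sub>f q) (P \<and> Q)"
  and den_disj: "fden w p P \<Longrightarrow> fden w q Q \<Longrightarrow> fden w (p \<or>\<^sub>f q) (P \<or> Q)"
  and den_imp: "fden w p P \<Longrightarrow> fden w q Q \<Longrightarrow> fden w (p \<longrightarrow>\<^sub>f q) (P \<longrightarrow> Q)"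
  and den_iff: "fden w p P \<Longrightarrow> fden w q Q \<Longrightarrow> fden w (p \<longleftrightarrow>\<^sub>f q) (P \<longleftrightarrow> Q)"
  by (fastforce simp: fden_def xneg_def xconj_def xdisj_def ximp_def xiff_def)+

lemma den_all:
  assumes "\<And>w' t v. hle w w' \<Longrightarrow> tden w' t v \<Longrightarrow> v \<in> I \<Longrightarrow> fden w' (P t) (Q v)"
  shows "fden w (\<forall>\<^sub>f x. P x) (\<forall>v\<in>I. Q v)"
  unfolding fden_def
proof (intro allI impI)
  fix w' assume w: "hle w w'"
  obtain d \<nu> s N where w': "w' = ((d, \<nu>), (s, N))" by (cases w') auto
  let ?t = "\<lambda>d'. Var (d' - Suc d)"
  have "msat (case_nat v (env d \<nu> e0)) (env s N E0) (P ?t (Suc d) s) = Q v" if "v \<in> I" for v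
  proof -
    let ?w = "((Suc d, \<nu>(d := v)), (s, N))"
    have le: "hle w' ?w" by (simp add: w')
    have "tden ?w ?t v"
      unfolding tden_def
    proof (intro allI impI)
      fix w2 assume "hle ?w w2"
      then show "hev w2 ?t = v"
        by (cases w2) (auto simp: env_def meval_def)
    qed
    then have "fden ?w (P ?t) (Q v)" using assms hle_trans[OF w le] that by blast
    then show ?thesis using hle_refl[of ?w] unfolding fden_def by (auto simp: env_case)
  qed
  then show "hst w' (\<forall>\<^sub>f x. P x) = (\<forall>v\<in>I. Q v)" by (simp add: w' xall_def)
qed

lemma den_ex:
  assumes "\<And>w' t v. hle w w' \<Longrightarrow> tden w' t v \<Longrightarrow> v \<in> I \<Longrightarrow> fden w' (P t) (Q v)"
  shows "fden w (\<exists>\<^sub>f x. P x) (\<exists>v\<in>I. Q v)"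
proof -
  have "fden w (\<not>\<^sub>f (\<forall>\<^sub>f x. \<not>\<^sub>f P x)) (\<not> (\<forall>v\<in>I. \<not> Q v))"
    by (intro den_neg den_all assms)
  then show ?thesis by (simp add: base_env.xex_eq)
qed

lemma den_allS:
  assumes "\<And>w' C A. hle w w' \<Longrightarrow> cden w' C A \<Longrightarrow> A \<in> \<S> \<Longrightarrow> fden w' (P C) (Q A)"
  shows "fden w (\<forall>\<^sub>S X. P X) (\<forall>A\<in>\<S>. Q A)"
  unfolding fden_def
proof (intro allI impI)
  fix w' assume w: "hle w w'"
  obtain d \<nu> s N where w': "w' = ((d, \<nu>), (s, N))" by (cases w') auto
  let ?C = "\<lambda>t d' s'. Mem (t d') (s' - Suc s)"
  have "msat (env d \<nu> e0) (case_nat A (env s N E0)) (P ?C d (Suc s)) = Q A" if "A \<in> \<S>" for A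
  proof -
    let ?w = "((d, \<nu>), (Suc s, N(s := A)))"
    have le: "hle w' ?w" by (simp add: w')
    have "cden ?w ?C A"
      unfolding cden_def fden_def
    proof (intro allI impI)
      fix w2 t v w3 assume *: "hle ?w w2" "tden w2 t v" "hle w2 w3"
      obtain d3 \<nu>3 s3 N3 where w3: "w3 = ((d3, \<nu>3), (s3, N3))" by (cases w3) auto
      have "hev w3 t = v" using *(2,3) unfolding tden_def by blast
      moreover have "hle ?w w3" using * hle_trans by blast
      ultimately show "hst w3 (?C t) = ev (\<lambda>k. v k \<in> A k)" by (auto simp: w3 env_def)
    qed
    then have "fden ?w (P ?C) (Q A)" using assms hle_trans[OF w le] that by blast
    then show ?thesis using hle_refl[of ?w] unfolding fden_def by (auto simp: env_case)
  qed
  then show "hst w' (\<forall>\<^sub>S X. P X) = (\<forall>A\<in>\<S>. Q A)" by (simp add: w' xallS_def)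
qed

lemma den_exS:
  assumes "\<And>w' C A. hle w w' \<Longrightarrow> cden w' C A \<Longrightarrow> A \<in> \<S> \<Longrightarrow> fden w' (P C) (Q A)"
  shows "fden w (\<exists>\<^sub>S X. P X) (\<exists>A\<in>\<S>. Q A)"
proof -
  have "fden w (\<not>\<^sub>f (\<forall>\<^sub>S X. \<not>\<^sub>f P X)) (\<not> (\<forall>A\<in>\<S>. \<not> Q A))"
    by (intro den_neg den_allS assms)
  then show ?thesis by (simp add: base_env.xexS_eq)
qed

lemma den_app: "cden w C A \<Longrightarrow> tden w t v \<Longrightarrow> v \<in> I \<Longrightarrow> fden w (C t) (ev (\<lambda>k. v k \<in> A k))"
  using hle_refl unfolding cden_def by blast

lemma den_class:
  assumes "\<And>w' t v. hle w w' \<Longrightarrow> tden w' t v \<Longrightarrow> v \<in> I \<Longrightarrow> fden w' (P t) (ev (\<lambda>k. Q k (v k)))"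
  shows "cden w P (\<lambda>k. {v. Q k v})"
  using assms unfolding cden_def by simp

lemma den_le: "tden w x a \<Longrightarrow> tden w y b \<Longrightarrow> fden w (x \<le>\<^sub>f y) (ev (\<lambda>k. a k \<le> b k))"
  unfolding xle_def le_less ev_disj by (intro den_disj den_less den_eq)

lemma I_pr: "a \<in> I \<Longrightarrow> b \<in> I \<Longrightarrow> (\<lambda>k. pr (a k) (b k)) \<in> I"
  unfolding pr_def by (intro I_add I_mult)

lemma den_pair: "tden w x a \<Longrightarrow> tden w y b \<Longrightarrow> tden w (xpair x y) (\<lambda>k. pr (a k) (b k))"
  unfolding xpair_def pr_def by (intro den_add den_mul)

lemma den_xapp: "cden w C A \<Longrightarrow> tden w x a \<Longrightarrow> tden w y b \<Longrightarrow> a \<in> I \<Longrightarrow> b \<in> I \<Longrightarrow> fden w (xapp C x y) (rel A a b)"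
  unfolding xapp_def rel_def by (intro den_app den_pair I_pr)

lemma cden_rden: "cden w C A \<Longrightarrow> rden w C (rel A)"
  unfolding rden_def by (intro allI impI den_xapp) (auto intro: cden_mono)

lemma den_section: "cden w C A \<Longrightarrow> tden w x a \<Longrightarrow> a \<in> I \<Longrightarrow> cden w (xapp C x) (\<lambda>k. {y. pr (a k) y \<in> A k})"
proof (rule den_class)
  fix w' t v assume *: "cden w C A" "tden w x a" "a \<in> I" "hle w w'" "tden w' t v" "v \<in> I"
  show "fden w' (xapp C x t) (ev (\<lambda>k. pr (a k) (v k) \<in> A k))"
    by (rule den_xapp[OF cden_mono[OF *(1,4)] tden_mono[OF *(2,4)] *(5,3,6), unfolded rel_def])
qed

lemma fden_cong: "fden w p P \<Longrightarrow> P = Q \<Longrightarrow> fden w p Q"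
  by simp

lemmas den_rules = den_zero den_one den_add den_mul den_eq den_less den_le den_neg den_conj
  den_disj den_imp den_iff den_all den_ex den_allS den_exS
lemmas den_monos = tden_mono cden_mono rden_mono
lemmas I_rules = I_add I_mult I_const

text \<open>The formula asserts that some set satisfying the recursion contains the pair; all such
  sets agree on \<open>I\<close> with the graph \<open>G\<close>, so the truth value is that of
  \<open>G\<close>.\<close>

lemma den_rec:
  assumes "G \<in> \<S>" "tden w e a" "tden w x b" "a \<in> I" "b \<in> I"
    and syn: "\<And>w' F A k y c d. hle w w' \<Longrightarrow> rden w' F (rel A) \<Longrightarrow> tden w' k c \<Longrightarrow> tden w' y d \<Longrightarrow>
      c \<in> I \<Longrightarrow> d \<in> I \<Longrightarrow> fden w' (\<Psi> F k y) (\<Phi> (rel A) c d)"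
    and G: "\<And>x y. x \<in> I \<Longrightarrow> y \<in> I \<Longrightarrow> rel G x y = \<Phi> (rel G) x y"
    and dep: "\<And>D D' x y. x \<in> I \<Longrightarrow> y \<in> I \<Longrightarrow>
      (\<And>l z. l \<in> I \<Longrightarrow> z \<in> I \<Longrightarrow> ev (\<lambda>k. l k < x k) \<Longrightarrow> D l z = D' l z) \<Longrightarrow> \<Phi> D x y = \<Phi> D' x y"
  shows "fden w (\<exists>\<^sub>S F. (\<forall>\<^sub>f k. \<forall>\<^sub>f y. xapp F k y \<longleftrightarrow>\<^sub>f \<Psi> F k y) \<and>\<^sub>f xapp F e x) (rel G a b)"
proof (rule fden_cong)
  show "fden w (\<exists>\<^sub>S F. (\<forall>\<^sub>f k. \<forall>\<^sub>f y. xapp F k y \<longleftrightarrow>\<^sub>f \<Psi> F k y) \<and>\<^sub>f xapp F e x)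
    (\<exists>A\<in>\<S>. (\<forall>c\<in>I. \<forall>d\<in>I. rel A c d \<longleftrightarrow> \<Phi> (rel A) c d) \<and> rel A a b)"
    using assms(2-5)
    by - (assumption | rule den_rules den_xapp syn cden_rden | blast intro: den_monos hle_trans)+
  show "(\<exists>A\<in>\<S>. (\<forall>c\<in>I. \<forall>d\<in>I. rel A c d \<longleftrightarrow> \<Phi> (rel A) c d) \<and> rel A a b) = rel G a b"
  proof
    assume "\<exists>A\<in>\<S>. (\<forall>c\<in>I. \<forall>d\<in>I. rel A c d \<longleftrightarrow> \<Phi> (rel A) c d) \<and> rel A a b"
    then obtain A where A: "A \<in> \<S>" "\<And>c d. c \<in> I \<Longrightarrow> d \<in> I \<Longrightarrow> rel A c d = \<Phi> (rel A) c d" "rel A a b" by blast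
    have "rel A a b = rel G a b"
      by (rule rec_unique[of A G \<Phi>, OF A(1) assms(1) A(2) G dep assms(4,5)])
    then show "rel G a b" using A(3) by simp
  qed (use G assms(1) in blast)
qed

end

subsection \<open>Bases, powers and changes of base\<close>

lemma base_of_unique:
  assumes "ok A"
  shows "(\<exists>m. (m \<in> A \<and> (\<forall>y. y \<in> A \<longrightarrow> m \<le> y)) \<and>
     (m \<le> k \<and> (x \<in> A \<and> x \<le> k) \<and> (\<forall>y. y \<in> A \<and> y \<le> k \<longrightarrow> y \<le> x) \<or> k < m \<and> x = m)) \<longleftrightarrow> x = base_of A k"
proof -
  have ne: "A \<noteq> {}" and min: "Inf A \<in> A" using assms ok_min(2) by (auto simp: ok_def)
  have "Inf A \<le> k \<Longrightarrow> {b \<in> A. b \<le> k} \<noteq> {}" using min by blast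
  then have "Inf A \<le> k \<Longrightarrow> (x = Max {b \<in> A. b \<le> k}) \<longleftrightarrow> (x \<in> A \<and> x \<le> k) \<and> (\<forall>y. y \<in> A \<and> y \<le> k \<longrightarrow> y \<le> x)"
    using eq_Max_iff[of "{b \<in> A. b \<le> k}" x] by auto
  then show ?thesis unfolding nonempty_min using ne by (auto simp: base_of_def)
qed

lemma next_base_unique: "(x \<in> A \<and> k < x) \<and> (\<forall>y. y \<in> A \<and> k < y \<longrightarrow> x \<le> y) \<longleftrightarrow> next_base A k = enat x"
  unfolding next_base_def by (auto intro!: Least_equality intro: LeastI2_wellorder)

definition chgraph :: "(nat \<Rightarrow> enat) \<Rightarrow> nat \<Rightarrow> nat \<Rightarrow> nat set" where
  "chgraph u b c = {pr m v | m v. change u b c m = enat v}"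

lemma pr_graph: "pr m v \<in> {pr m v | m v. P m v} \<longleftrightarrow> P m v"
  by (auto simp: pr_inj)

locale powers = den +
  assumes powers: "b \<in> I \<Longrightarrow> (\<lambda>k. {pr e v | e v. v = b k ^ e}) \<in> \<S>"
begin

lemma rden_rule: "rden w F D \<Longrightarrow> hle w w' \<Longrightarrow> tden w' x a \<Longrightarrow> tden w' y b \<Longrightarrow> a \<in> I \<Longrightarrow> b \<in> I \<Longrightarrow>
    fden w' (xapp F x y) (D a b)"
  unfolding rden_def by blast

lemma den_min:
  assumes "cden w B A" "tden w x a" "a \<in> I"
  shows "fden w (xmin B x) (ev (\<lambda>k. a k \<in> A k \<and> (\<forall>y. y \<in> A k \<longrightarrow> a k \<le> y)))"
proof (rule fden_cong)
  show "fden w (xmin B x) (ev (\<lambda>k. a k \<in> A k) \<and> (\<forall>y\<in>I. ev (\<lambda>k. y k \<in> A k) \<longrightarrow> ev (\<lambda>k. a k \<le> y k)))"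
    unfolding xmin_def using assms by - (assumption | rule den_rules den_app | (erule (1) den_monos))+
  have "(\<forall>y\<in>I. ev (\<lambda>k. y k \<in> A k \<longrightarrow> a k \<le> y k)) \<longleftrightarrow> ev (\<lambda>k. \<forall>y. y \<in> A k \<longrightarrow> a k \<le> y)"
    by (rule I_all[OF assms(3)]) (auto intro!: ev_all simp: not_le intro: less_imp_le)
  then show "(ev (\<lambda>k. a k \<in> A k) \<and> (\<forall>y\<in>I. ev (\<lambda>k. y k \<in> A k) \<longrightarrow> ev (\<lambda>k. a k \<le> y k))) =
    ev (\<lambda>k. a k \<in> A k \<and> (\<forall>y. y \<in> A k \<longrightarrow> a k \<le> y))" by (simp add: ev_conj ev_imp)
qed

text \<open>Unlike for a minimum, a counterexample is greater than \<open>a\<close>, so an upper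
  bound of the set within \<open>I\<close> is required.\<close>

lemma den_max:
  assumes "cden w B A" "tden w x a" "a \<in> I" "bd \<in> I" "ev (\<lambda>k. \<forall>y. y \<in> A k \<longrightarrow> y \<le> bd k)"
  shows "fden w (xmax B x) (ev (\<lambda>k. a k \<in> A k \<and> (\<forall>y. y \<in> A k \<longrightarrow> y \<le> a k)))"
proof (rule fden_cong)
  show "fden w (xmax B x) (ev (\<lambda>k. a k \<in> A k) \<and> (\<forall>y\<in>I. ev (\<lambda>k. y k \<in> A k) \<longrightarrow> ev (\<lambda>k. y k \<le> a k)))"
    unfolding xmax_def using assms(1-3) by - (assumption | rule den_rules den_app | (erule (1) den_monos))+
  have "(\<forall>y\<in>I. ev (\<lambda>k. y k \<in> A k \<longrightarrow> y k \<le> a k)) \<longleftrightarrow> ev (\<lambda>k. \<forall>y. y \<in> A k \<longrightarrow> y \<le> a k)"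
    by (rule I_all[OF assms(4)], rule ev_mono[OF assms(5)]) blast
  then show "(ev (\<lambda>k. a k \<in> A k) \<and> (\<forall>y\<in>I. ev (\<lambda>k. y k \<in> A k) \<longrightarrow> ev (\<lambda>k. y k \<le> a k))) =
    ev (\<lambda>k. a k \<in> A k \<and> (\<forall>y. y \<in> A k \<longrightarrow> y \<le> a k))" by (simp add: ev_conj ev_imp)
qed

lemma den_base_of:
  assumes "cden w B A" "tden w n a" "tden w b x" "a \<in> I" "x \<in> I"
    and A: "\<And>k. ok (A k)" "bd \<in> I" "ev (\<lambda>k. bd k \<in> A k)"
  shows "fden w (xbase_of B n b) (ev (\<lambda>k. x k = base_of (A k) (a k)))"
proof (rule fden_cong)
  have cl: "cden w' (\<lambda>x. B x \<and>\<^sub>f x \<le>\<^sub>f n) (\<lambda>k. {x. x \<in> A k \<and> x \<le> a k})" if "hle w w'" for w'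
    unfolding mem_Collect_eq
    by (rule den_class, unfold ev_conj, rule den_conj[OF den_app den_le])
      (use assms(1,2) that in \<open>blast intro: den_monos hle_trans\<close>)+
  have max: "fden w' (xmax (\<lambda>x. B x \<and>\<^sub>f x \<le>\<^sub>f n) b)
     (ev (\<lambda>k. (x k \<in> A k \<and> x k \<le> a k) \<and> (\<forall>y. y \<in> A k \<and> y \<le> a k \<longrightarrow> y \<le> x k)))" if "hle w w'" for w'
    using den_max[OF cl[OF that] tden_mono[OF assms(3) that] assms(5,4)] by (simp add: ev_all)
  show "fden w (xbase_of B n b) (\<exists>m\<in>I. ev (\<lambda>k. m k \<in> A k \<and> (\<forall>y. y \<in> A k \<longrightarrow> m k \<le> y)) \<and>
     ((ev (\<lambda>k. m k \<le> a k) \<and> ev (\<lambda>k. (x k \<in> A k \<and> x k \<le> a k) \<and> (\<forall>y. y \<in> A k \<and> y \<le> a k \<longrightarrow> y \<le> x k))) \<or>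
      ev (\<lambda>k. a k < m k) \<and> ev (\<lambda>k. x k = m k)))"
    unfolding xbase_of_def using assms(1-5)
    by - (assumption | rule den_rules den_min max | (erule (1) den_monos))+
  have "(\<exists>m\<in>I. ev (\<lambda>k. (m k \<in> A k \<and> (\<forall>y. y \<in> A k \<longrightarrow> m k \<le> y)) \<and>
     (m k \<le> a k \<and> (x k \<in> A k \<and> x k \<le> a k) \<and> (\<forall>y. y \<in> A k \<and> y \<le> a k \<longrightarrow> y \<le> x k) \<or> a k < m k \<and> x k = m k))) \<longleftrightarrow>
     ev (\<lambda>k. \<exists>m. (m \<in> A k \<and> (\<forall>y. y \<in> A k \<longrightarrow> m \<le> y)) \<and>
     (m \<le> a k \<and> (x k \<in> A k \<and> x k \<le> a k) \<and> (\<forall>y. y \<in> A k \<and> y \<le> a k \<longrightarrow> y \<le> x k) \<or> a k < m \<and> x k = m))"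
    by (rule I_ex[OF A(2)], rule ev_mono[OF A(3)]) blast
  then show "(\<exists>m\<in>I. ev (\<lambda>k. m k \<in> A k \<and> (\<forall>y. y \<in> A k \<longrightarrow> m k \<le> y)) \<and>
     ((ev (\<lambda>k. m k \<le> a k) \<and> ev (\<lambda>k. (x k \<in> A k \<and> x k \<le> a k) \<and> (\<forall>y. y \<in> A k \<and> y \<le> a k \<longrightarrow> y \<le> x k))) \<or>
      ev (\<lambda>k. a k < m k) \<and> ev (\<lambda>k. x k = m k))) = ev (\<lambda>k. x k = base_of (A k) (a k))"
    unfolding base_of_unique[OF A(1)] ev_conj ev_disj .
qed

lemma den_next_base:
  assumes "cden w B A" "tden w n a" "tden w b x" "a \<in> I" "x \<in> I"
  shows "fden w (xnext_base B n b) (ev (\<lambda>k. next_base (A k) (a k) = enat (x k)))"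
proof -
  have cl: "cden w (\<lambda>x. B x \<and>\<^sub>f n <\<^sub>f x) (\<lambda>k. {x. x \<in> A k \<and> a k < x})"
    by (rule den_class, unfold ev_conj, rule den_conj[OF den_app den_less])
      (use assms(1,2) in \<open>blast intro: den_monos hle_trans\<close>)+
  show ?thesis
    unfolding xnext_base_def using den_min[OF cl assms(3,5)] unfolding mem_Collect_eq next_base_unique .
qed

lemma den_dvd:
  assumes "tden w x a" "tden w y b" "a \<in> I" "b \<in> I" "ev (\<lambda>k. 0 < a k)"
  shows "fden w (x dvd\<^sub>f y) (ev (\<lambda>k. a k dvd b k))"
proof (rule fden_cong)
  show "fden w (x dvd\<^sub>f y) (\<exists>z\<in>I. ev (\<lambda>k. b k = a k * z k))"
    unfolding xdvd_def using assms(1-4) by - (assumption | rule den_rules | (erule (1) den_monos))+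
  show "(\<exists>z\<in>I. ev (\<lambda>k. b k = a k * z k)) = ev (\<lambda>k. a k dvd b k)"
    unfolding dvd_def
  proof (rule I_ex[OF assms(4)], rule ev_mono[OF assms(5)], intro allI impI)
    fix k v assume "0 < a k" "b k = a k * v"
    then have "v \<le> b k" by simp
    then show "\<exists>v'\<le>b k. b k = a k * v'" using \<open>b k = a k * v\<close> by blast
  qed
qed

lemma base_of_I:
  assumes "\<And>k. ok (A k)" "bd \<in> I" "ev (\<lambda>k. bd k \<in> A k)" "a \<in> I"
  shows "(\<lambda>k. base_of (A k) (a k)) \<in> I"
proof (rule I_down[OF I_max[OF assms(2,4)]], rule ev_mono[OF assms(3)])
  fix k assume "bd k \<in> A k"
  then have "Inf (A k) \<le> bd k" by (intro cInf_lower) auto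
  then show "base_of (A k) (a k) \<le> max (bd k) (a k)"
  proof (cases "Inf (A k) \<le> a k")
    case True then show ?thesis using base_of_bounds(2)[OF assms(1) True] by simp
  next
    case False then show ?thesis using \<open>Inf (A k) \<le> bd k\<close> by (simp add: base_of_def)
  qed
qed

lemma ex_eq_I:
  assumes "f \<in> I" "\<And>x. x \<in> I \<Longrightarrow> ev (\<lambda>k. x k = f k) \<Longrightarrow> P x = P f"
  shows "(\<exists>x\<in>I. ev (\<lambda>k. x k = f k) \<and> P x) \<longleftrightarrow> P f"
proof
  assume "\<exists>x\<in>I. ev (\<lambda>k. x k = f k) \<and> P x"
  then obtain x where x: "x \<in> I" "ev (\<lambda>k. x k = f k)" "P x" by (elim bexE conjE)
  then show "P f" using assms(2)[OF x(1,2)] by simp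
next
  assume "P f"
  then show "\<exists>x\<in>I. ev (\<lambda>k. x k = f k) \<and> P x" by (intro bexI[of _ f] conjI assms(1)) simp_all
qed

lemma den_critical:
  assumes "cden w B A" "tden w n a" "a \<in> I" and A: "\<And>k. ok (A k)" "bd \<in> I" "ev (\<lambda>k. bd k \<in> A k)"
  shows "fden w (xcritical B n) (ev (\<lambda>k. critical (A k) (a k)))"
proof (rule fden_cong)
  have "fden w' (xbase_of B n b \<and>\<^sub>f b dvd\<^sub>f n) (ev (\<lambda>k. x k = base_of (A k) (a k)) \<and> ev (\<lambda>k. x k dvd a k))"
    if w': "hle w w'" "tden w' b x" "x \<in> I" for w' b x
  \<comment> \<open>Divisibility is evaluated for positive divisors; if \<open>x\<close> is not the
    base, the first conjunct already fails.\<close>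
  proof (cases "ev (\<lambda>k. x k = base_of (A k) (a k))")
    case True
    have "ev (\<lambda>k. 0 < x k)" by (rule ev_mono[OF True]) (use base_of_ge2[OF A(1)] in \<open>metis less_le_trans pos2\<close>)
    then show ?thesis
      by (intro den_conj den_base_of[OF cden_mono[OF assms(1) w'(1)] tden_mono[OF assms(2) w'(1)] w'(2) assms(3) w'(3) A]
          den_dvd[OF w'(2) tden_mono[OF assms(2) w'(1)] w'(3) assms(3)])
  next
    case False
    have "fden w' (xbase_of B n b) False"
      using den_base_of[OF cden_mono[OF assms(1) w'(1)] tden_mono[OF assms(2) w'(1)] w'(2) assms(3) w'(3) A] False by simp
    then have "fden w' (xbase_of B n b \<and>\<^sub>f b dvd\<^sub>f n) False"
      by (auto simp: fden_def xconj_def)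
    then show ?thesis using False by simp
  qed
  then show "fden w (xcritical B n) (\<exists>x\<in>I. ev (\<lambda>k. x k = base_of (A k) (a k)) \<and> ev (\<lambda>k. x k dvd a k))"
    unfolding xcritical_def by (rule den_ex)
  show "(\<exists>x\<in>I. ev (\<lambda>k. x k = base_of (A k) (a k)) \<and> ev (\<lambda>k. x k dvd a k)) = ev (\<lambda>k. critical (A k) (a k))"
    unfolding critical_def
  proof (rule ex_eq_I[OF base_of_I[OF A assms(3)]])
    fix x assume "ev (\<lambda>k. x k = base_of (A k) (a k))"
    then have "ev (\<lambda>k. x k dvd a k \<longleftrightarrow> base_of (A k) (a k) dvd a k)" by (rule ev_mono) simp
    then show "ev (\<lambda>k. x k dvd a k) = ev (\<lambda>k. base_of (A k) (a k) dvd a k)" by (simp add: ev_iff)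
  qed
qed

lemma den_power:
  assumes "tden w b x" "tden w e y" "tden w z v" "x \<in> I" "y \<in> I" "v \<in> I"
  shows "fden w (xpower b e z) (ev (\<lambda>k. v k = x k ^ y k))"
proof -
  define G where "G k = {pr e v | e v. v = x k ^ e}" for k
  define \<Phi> where "\<Phi> D e y \<longleftrightarrow> (ev (\<lambda>k. e k = 0) \<and> ev (\<lambda>k. y k = 1)) \<or>
    (\<exists>l\<in>I. \<exists>z\<in>I. ev (\<lambda>k. e k = l k + 1) \<and> D l z \<and> ev (\<lambda>k. y k = z k * x k))" for D e y
  have GS: "G \<in> \<S>" using powers[OF assms(4)] unfolding G_def[abs_def] .
  have relG: "rel G e y \<longleftrightarrow> ev (\<lambda>k. y k = x k ^ e k)" for e y unfolding rel_def G_def pr_graph ..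
  have "fden w (xpower b e z) (rel G y v)"
    unfolding xpower_def
  proof (rule den_rec[where \<Phi> = \<Phi>, OF GS assms(2,3,5,6)])
    fix w' F A k y c d
    assume *: "hle w w'" "rden w' F (rel A)" "tden w' k c" "tden w' y d" "c \<in> I" "d \<in> I"
    note F = rden_rule[OF *(2)]
    show "fden w' (k =\<^sub>f 0\<^sub>f \<and>\<^sub>f y =\<^sub>f 1\<^sub>f \<or>\<^sub>f (\<exists>\<^sub>f l. \<exists>\<^sub>f z. k =\<^sub>f l +\<^sub>f 1\<^sub>f \<and>\<^sub>f xapp F l z \<and>\<^sub>f y =\<^sub>f z *\<^sub>f b)) (\<Phi> (rel A) c d)"
      unfolding \<Phi>_def using * assms(1)
      by - (assumption | rule den_rules F | blast intro: tden_mono hle_trans)+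
  next
    fix e y assume I: "e \<in> I" "y \<in> I"
    show "rel G e y = \<Phi> (rel G) e y"
      unfolding \<Phi>_def relG
    proof
      assume y: "ev (\<lambda>k. y k = x k ^ e k)"
      show "ev (\<lambda>k. e k = 0) \<and> ev (\<lambda>k. y k = 1) \<or>
        (\<exists>l\<in>I. \<exists>z\<in>I. ev (\<lambda>k. e k = l k + 1) \<and> ev (\<lambda>k. z k = x k ^ l k) \<and> ev (\<lambda>k. y k = z k * x k))"
      proof (cases "ev (\<lambda>k. e k = 0)")
        case True
        have "ev (\<lambda>k. y k = 1)" by (rule ev_mono2[OF y True]) simp
        then show ?thesis using True by blast
      next
        case False
        then have e: "ev (\<lambda>k. e k \<noteq> 0)" unfolding ev_neg .
        have l: "(\<lambda>k. e k - 1) \<in> I" by (rule I_le[OF I(1)]) simp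
        have z: "(\<lambda>k. x k ^ (e k - 1)) \<in> I" by (rule I_power[OF assms(4) l])
        have "ev (\<lambda>k. e k = e k - 1 + 1)" by (rule ev_mono[OF e]) simp
        moreover have "ev (\<lambda>k. y k = x k ^ (e k - 1) * x k)"
        proof (rule ev_mono2[OF y e])
          fix k assume "y k = x k ^ e k" "e k \<noteq> 0"
          then show "y k = x k ^ (e k - 1) * x k" by (cases "e k") (simp_all add: mult.commute)
        qed
        moreover have "ev (\<lambda>k. x k ^ (e k - 1) = x k ^ (e k - 1))" by simp
        ultimately have "\<exists>l\<in>I. \<exists>z\<in>I. ev (\<lambda>k. e k = l k + 1) \<and> ev (\<lambda>k. z k = x k ^ l k) \<and> ev (\<lambda>k. y k = z k * x k)"
          by (intro bexI[OF _ l] bexI[OF _ z] conjI)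
        then show ?thesis by blast
      qed
    next
      assume "ev (\<lambda>k. e k = 0) \<and> ev (\<lambda>k. y k = 1) \<or>
        (\<exists>l\<in>I. \<exists>z\<in>I. ev (\<lambda>k. e k = l k + 1) \<and> ev (\<lambda>k. z k = x k ^ l k) \<and> ev (\<lambda>k. y k = z k * x k))"
      then show "ev (\<lambda>k. y k = x k ^ e k)"
      proof (elim disjE conjE bexE)
        assume "ev (\<lambda>k. e k = 0)" "ev (\<lambda>k. y k = 1)"
        then show ?thesis by (rule ev_mono2) simp
      next
        fix l z assume "ev (\<lambda>k. e k = l k + 1)" "ev (\<lambda>k. z k = x k ^ l k)" "ev (\<lambda>k. y k = z k * x k)"
        then have "ev (\<lambda>k. e k = l k + 1 \<and> z k = x k ^ l k \<and> y k = z k * x k)" by (simp add: ev_conj)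
        then show ?thesis by (rule ev_mono) (simp add: mult.commute)
      qed
    qed
  next
    fix D D' :: "(nat \<Rightarrow> nat) \<Rightarrow> (nat \<Rightarrow> nat) \<Rightarrow> bool" and e y
    assume *: "\<And>l z. l \<in> I \<Longrightarrow> z \<in> I \<Longrightarrow> ev (\<lambda>k. l k < e k) \<Longrightarrow> D l z = D' l z"
    have "D l z = D' l z" if "l \<in> I" "z \<in> I" "ev (\<lambda>k. e k = l k + 1)" for l z
      by (rule *[OF that(1,2)], rule ev_mono[OF that(3)]) simp
    then show "\<Phi> D e y = \<Phi> D' e y" unfolding \<Phi>_def by (simp cong: bex_cong conj_cong)
  qed
  then show ?thesis unfolding relG .
qed

definition dcmp :: "nat \<Rightarrow> nat \<Rightarrow> nat \<Rightarrow> nat \<Rightarrow> nat \<Rightarrow> bool" where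
  "dcmp b n e a r \<longleftrightarrow> 2 \<le> b \<and> 0 < n \<and> e = bexp b n \<and> a = n div b ^ bexp b n \<and> r = n mod b ^ bexp b n"

lemma den_decomp:
  assumes "tden w b x" "tden w n y" "tden w e e'" "tden w a a'" "tden w r r'"
    and "x \<in> I" "y \<in> I" "e' \<in> I" "a' \<in> I" "r' \<in> I"
  shows "fden w (xdecomp b n e a r) (ev (\<lambda>k. dcmp (x k) (y k) (e' k) (a' k) (r' k)))"
proof (rule fden_cong)
  show "fden w (xdecomp b n e a r) (\<exists>q\<in>I. ev (\<lambda>k. q k = x k ^ e' k) \<and> ev (\<lambda>k. y k = q k * a' k + r' k) \<and>
    ev (\<lambda>k. q k \<le> y k) \<and> ev (\<lambda>k. y k < q k * x k) \<and> ev (\<lambda>k. 0 < a' k) \<and> ev (\<lambda>k. a' k < x k) \<and> ev (\<lambda>k. r' k < q k))"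
    unfolding xdecomp_def using assms
    by - (assumption | rule den_power den_rules I_rules | blast intro: den_monos hle_trans)+
  have "(\<exists>q\<in>I. ev (\<lambda>k. q k = x k ^ e' k \<and> y k = q k * a' k + r' k \<and> q k \<le> y k \<and> y k < q k * x k \<and>
      0 < a' k \<and> a' k < x k \<and> r' k < q k)) \<longleftrightarrow> ev (\<lambda>k. \<exists>q. q = x k ^ e' k \<and> y k = q * a' k + r' k \<and> q \<le> y k \<and>
      y k < q * x k \<and> 0 < a' k \<and> a' k < x k \<and> r' k < q)"
    by (rule I_ex[OF assms(7)], rule ev_all) blast
  also have "\<dots> \<longleftrightarrow> ev (\<lambda>k. dcmp (x k) (y k) (e' k) (a' k) (r' k))"
    unfolding dcmp_def decomp_iff[symmetric] by simp
  finally show "(\<exists>q\<in>I. ev (\<lambda>k. q k = x k ^ e' k) \<and> ev (\<lambda>k. y k = q k * a' k + r' k) \<and>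
    ev (\<lambda>k. q k \<le> y k) \<and> ev (\<lambda>k. y k < q k * x k) \<and> ev (\<lambda>k. 0 < a' k) \<and> ev (\<lambda>k. a' k < x k) \<and> ev (\<lambda>k. r' k < q k)) =
    ev (\<lambda>k. dcmp (x k) (y k) (e' k) (a' k) (r' k))" unfolding ev_conj .
qed

end

text \<open>Every ingredient of \<open>c ^ e * a + r\<close> is at most the value, since
  \<open>a \<ge> 1\<close>, \<open>e \<ge> 1\<close> and \<open>c \<ge> 2\<close>. So when a value
  belongs to a cut, all intermediate results of the recursion do.\<close>

lemma change_decomp:
  assumes b: "2 \<le> b" and c: "2 \<le> c" and m: "b \<le> m" and pos: "\<And>k. 0 < k \<Longrightarrow> k < b \<Longrightarrow> u k \<noteq> 0"
  shows "change u b c m = enat v \<longleftrightarrow> (\<exists>e a r. change u b c (bexp b m) = enat e \<and>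
    u (m div b ^ bexp b m) = enat a \<and> change u b c (m mod b ^ bexp b m) = enat r \<and> v = c ^ e * a + r \<and>
    c \<le> v \<and> e \<le> v \<and> a \<le> v \<and> r \<le> v \<and> c ^ e \<le> v)" (is "_ \<longleftrightarrow> ?R")
proof -
  note d = bdiv_bounds[OF b m]
  have p: "u (m div b ^ bexp b m) \<noteq> 0" using pos d by blast
  have ex: "change u b c m = enat v \<longleftrightarrow> (\<exists>e a r. change u b c (bexp b m) = enat e \<and>
    u (m div b ^ bexp b m) = enat a \<and> change u b c (m mod b ^ bexp b m) = enat r \<and> v = c ^ e * a + r)"
    using m b c by (subst change.simps) (auto simp: enat_eq_plus enat_eq_mul[OF epow_ne0 p] epow_eq; blast)
  have e0: "change u b c (bexp b m) \<noteq> 0" by (rule change_ge(1)[OF b c pos d(3)])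
  have "c \<le> v \<and> e \<le> v \<and> a \<le> v \<and> r \<le> v \<and> c ^ e \<le> v"
    if *: "change u b c (bexp b m) = enat e" "u (m div b ^ bexp b m) = enat a" "v = c ^ e * a + r" for e a r
  proof -
    have a1: "1 \<le> a" using p *(2) by (cases a) (auto simp: zero_enat_def)
    have e1: "1 \<le> e" using e0 *(1) by (cases e) (auto simp: zero_enat_def)
    have 1: "c ^ e * 1 \<le> c ^ e * a" by (rule mult_le_mono2[OF a1])
    have 2: "1 * a \<le> c ^ e * a" using c by (intro mult_le_mono1) simp
    have 3: "c ^ 1 \<le> c ^ e" using c e1 by (intro power_increasing) simp_all
    have 4: "e < c ^ e" by (rule power_gt_self[OF c])
    show ?thesis using 1 2 3 4 unfolding *(3) power_one_right mult_1 mult_1_right by linarith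
  qed
  then show ?thesis unfolding ex by blast
qed

lemma change_below: "m < b \<Longrightarrow> change u b c m = u m"
  by (simp add: change.simps[of u b c m])

lemma upgrade_least:
  assumes B: "ok B" and C: "ok C" and n: "Inf B \<le> n"
  defines "P \<equiv> \<lambda>c v. c \<in> C \<and> change (upgrade B C) (base_of B n) c n = enat v \<and>
    upgrade B C (n - 1) < enat v \<and> enat v < next_base C c"
  shows "upgrade B C n = enat v \<longleftrightarrow> (\<exists>c. P c v \<and> (\<forall>c'<c. \<not> (\<exists>v'. P c' v')))"
proof -
  let ?u = "upgrade B C" and ?b = "base_of B n"
  define K where "K = {c \<in> C. ?u (n - 1) < change ?u ?b c n \<and> change ?u ?b c n < next_base C c}"
  have up: "?u n = (if K = {} then \<infinity> else change ?u ?b (Inf K) n)"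
    using upgrade_eq[OF B n, of C] unfolding Let_def K_def[symmetric] .
  have K: "c \<in> K \<longleftrightarrow> (\<exists>v. P c v)" for c
    unfolding K_def P_def by (cases "change ?u ?b c n") auto
  have P: "P c v \<longleftrightarrow> c \<in> K \<and> change ?u ?b c n = enat v" for c v
    unfolding K_def P_def by auto
  show ?thesis
  proof (cases "K = {}")
    case True
    then have "\<not> P c v" for c v using K by blast
    then show ?thesis using up True by simp
  next
    case False
    have I: "Inf K \<in> K" by (rule Inf_nat_def1[OF False])
    have le: "Inf K \<le> c" if "c \<in> K" for c by (rule cInf_lower[OF that]) simp
    have "(\<exists>c. P c v \<and> (\<forall>c'<c. \<not> (\<exists>v'. P c' v'))) \<longleftrightarrow> change ?u ?b (Inf K) n = enat v" (is "?L \<longleftrightarrow> ?R")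
    proof
      assume ?L
      then obtain c where c: "P c v" "\<And>c'. c' < c \<Longrightarrow> c' \<notin> K" using K by blast
      then have cK: "c \<in> K" "change ?u ?b c n = enat v" using P by simp_all
      have "\<not> Inf K < c" using c(2)[of "Inf K"] I by blast
      then have "c = Inf K" using le[OF cK(1)] by simp
      then show ?R using cK(2) by simp
    next
      assume ?R
      then have "P (Inf K) v" using I P by simp
      moreover have "\<not> (\<exists>v'. P c' v')" if "c' < Inf K" for c'
        using le[of c'] that unfolding K[symmetric] by linarith
      ultimately show ?L by blast
    qed
    then show ?thesis using up False by simp
  qed
qed

context powers
begin

subsection \<open>Change of base\<close>

lemma den_back:
  "hle w w' \<Longrightarrow> tden w t v \<Longrightarrow> tden w' t v" "hle w w' \<Longrightarrow> cden w C A \<Longrightarrow> cden w' C A"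
  "hle w1 w \<Longrightarrow> hle w0 w1 \<Longrightarrow> hle w0 w"
  using tden_mono cden_mono hle_trans by blast+

definition chPhi where
  "chPhi Ud b c D m v \<longleftrightarrow> (ev (\<lambda>k. m k < b k) \<and> Ud m v) \<or>
    (ev (\<lambda>k. b k \<le> m k) \<and> (\<exists>e\<in>I. \<exists>a\<in>I. \<exists>r\<in>I. ev (\<lambda>k. dcmp (b k) (m k) (e k) (a k) (r k)) \<and>
      (\<exists>e'\<in>I. \<exists>a'\<in>I. \<exists>r'\<in>I. \<exists>p\<in>I. D e e' \<and> Ud a a' \<and> D r r' \<and> ev (\<lambda>k. p k = c k ^ e' k) \<and>
        ev (\<lambda>k. v k = p k * a' k + r' k))))"

definition chM where
  "chM Ud b c n x \<longleftrightarrow> (\<exists>A\<in>\<S>. (\<forall>m\<in>I. \<forall>v\<in>I. rel A m v \<longleftrightarrow> chPhi Ud b c (rel A) m v) \<and> rel A n x)"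

lemma den_change:
  assumes "rden w U Ud" "tden w b y" "tden w c z" "tden w n k" "tden w x v" "y \<in> I" "z \<in> I" "k \<in> I" "v \<in> I"
  shows "fden w (xchange U b c n x) (chM Ud y z k v)"
proof -
  note U = rden_rule[OF assms(1)]
  show ?thesis
    unfolding xchange_def chM_def chPhi_def using assms(2-9)
    by - (assumption | rule den_rules den_xapp den_power den_decomp U I_rules | erule den_back)+
qed

lemma chM_cong:
  assumes "\<And>m v. m \<in> I \<Longrightarrow> v \<in> I \<Longrightarrow> ev (\<lambda>k. m k < b k) \<Longrightarrow> Ud m v = Ud' m v"
  shows "chM Ud b c n x = chM Ud' b c n x"
proof -
  have 2: "Ud a a' = Ud' a a'" if "a \<in> I" "a' \<in> I" "ev (\<lambda>k. b k \<le> m k)" "ev (\<lambda>k. dcmp (b k) (m k) (e k) (a k) (r k))"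
    for m e a r a'
    by (rule assms[OF that(1,2)], rule ev_mono2[OF that(3,4)]) (auto simp: dcmp_def bdiv_bounds)
  have "chPhi Ud b c D m v = chPhi Ud' b c D m v" if "m \<in> I" "v \<in> I" for D m v
    unfolding chPhi_def using assms[OF that] 2 by (simp cong: bex_cong conj_cong)
  then show ?thesis unfolding chM_def by simp
qed

text \<open>The graph of \<open>change\<close> solves the recursion relative to \<open>I\<close>: by
  \<open>change_decomp\<close> the intermediate values are at most \<open>v\<close>, hence in
  \<open>I\<close>. By \<open>rec_unique\<close> every other solution agrees with it.\<close>

lemma chM_eq:
  assumes U: "\<And>m v. m \<in> I \<Longrightarrow> v \<in> I \<Longrightarrow> ev (\<lambda>k. m k < b k) \<Longrightarrow> Ud m v \<longleftrightarrow> ev (\<lambda>k. u k (m k) = enat (v k))"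
    and b: "ev (\<lambda>k. 2 \<le> b k)" and c: "ev (\<lambda>k. 2 \<le> c k)" and I: "b \<in> I" "c \<in> I" "n \<in> I" "x \<in> I"
    and pos: "ev (\<lambda>k. \<forall>m. 0 < m \<longrightarrow> m < b k \<longrightarrow> u k m \<noteq> 0)"
    and G: "(\<lambda>k. chgraph (u k) (b k) (c k)) \<in> \<S>"
  shows "chM Ud b c n x \<longleftrightarrow> ev (\<lambda>k. change (u k) (b k) (c k) (n k) = enat (x k))"
proof -
  let ?G = "\<lambda>k. chgraph (u k) (b k) (c k)"
  have relG: "rel ?G m v \<longleftrightarrow> ev (\<lambda>k. change (u k) (b k) (c k) (m k) = enat (v k))" for m v
    unfolding rel_def chgraph_def pr_graph ..
  have fixG: "rel ?G m v \<longleftrightarrow> chPhi Ud b c (rel ?G) m v" if mv: "m \<in> I" "v \<in> I" for m v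
  proof
    assume "rel ?G m v"
    then have v: "ev (\<lambda>k. change (u k) (b k) (c k) (m k) = enat (v k))" unfolding relG .
    show "chPhi Ud b c (rel ?G) m v"
    proof (cases "ev (\<lambda>k. m k < b k)")
      case True
      have "ev (\<lambda>k. u k (m k) = enat (v k))" by (rule ev_mono2[OF v True]) (simp add: change_below)
      then show ?thesis using U[OF mv True] True unfolding chPhi_def by blast
    next
      case False
      then have bm: "ev (\<lambda>k. b k \<le> m k)" unfolding ev_neg[symmetric] not_less .
      let ?Q = "\<lambda>k e a r. change (u k) (b k) (c k) (bexp (b k) (m k)) = enat e \<and>
        u k (m k div b k ^ bexp (b k) (m k)) = enat a \<and>
        change (u k) (b k) (c k) (m k mod b k ^ bexp (b k) (m k)) = enat r \<and> v k = c k ^ e * a + r \<and>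
        c k \<le> v k \<and> e \<le> v k \<and> a \<le> v k \<and> r \<le> v k \<and> c k ^ e \<le> v k"
      have "ev (\<lambda>k. 2 \<le> b k \<and> 2 \<le> c k \<and> b k \<le> m k \<and> (\<forall>m. 0 < m \<longrightarrow> m < b k \<longrightarrow> u k m \<noteq> 0) \<and>
        change (u k) (b k) (c k) (m k) = enat (v k))" unfolding ev_conj using b c bm pos v by blast
      then have "ev (\<lambda>k. \<exists>e a r. ?Q k e a r)"
      proof (rule ev_mono, elim conjE)
        fix k assume *: "2 \<le> b k" "2 \<le> c k" "b k \<le> m k" "\<forall>m. 0 < m \<longrightarrow> m < b k \<longrightarrow> u k m \<noteq> 0"
          "change (u k) (b k) (c k) (m k) = enat (v k)"
        show "\<exists>e a r. ?Q k e a r"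
          by (rule iffD1[OF change_decomp[OF *(1-3)] *(5)]) (use *(4) in blast)
      qed
      \<comment> \<open>Witnesses are chosen at each index and collected into sequences, one
        quantifier at a time.\<close>
      from ev_choice[OF this] obtain e' where "ev (\<lambda>k. \<exists>a r. ?Q k (e' k) a r)" by (elim exE)
      from ev_choice[OF this] obtain a' where "ev (\<lambda>k. \<exists>r. ?Q k (e' k) (a' k) r)" by (elim exE)
      from ev_choice[OF this] obtain r' where "ev (\<lambda>k. ?Q k (e' k) (a' k) (r' k))" by (elim exE)
      then have Q: "ev (\<lambda>k. change (u k) (b k) (c k) (bexp (b k) (m k)) = enat (e' k))"
        "ev (\<lambda>k. u k (m k div b k ^ bexp (b k) (m k)) = enat (a' k))"
        "ev (\<lambda>k. change (u k) (b k) (c k) (m k mod b k ^ bexp (b k) (m k)) = enat (r' k))"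
        "ev (\<lambda>k. v k = c k ^ e' k * a' k + r' k)"
        "ev (\<lambda>k. e' k \<le> v k)" "ev (\<lambda>k. a' k \<le> v k)" "ev (\<lambda>k. r' k \<le> v k)" "ev (\<lambda>k. c k ^ e' k \<le> v k)"
        unfolding ev_conj by blast+
      have bm2: "ev (\<lambda>k. 2 \<le> b k \<and> b k \<le> m k)" unfolding ev_conj using b bm by blast
      let ?e = "\<lambda>k. bexp (b k) (m k)" and ?a = "\<lambda>k. m k div b k ^ bexp (b k) (m k)"
      let ?r = "\<lambda>k. m k mod b k ^ bexp (b k) (m k)"
      have e: "?e \<in> I" by (rule I_down[OF mv(1)], rule ev_mono[OF bm2], rule less_imp_le, rule bexp_less) simp_all
      have a: "?a \<in> I" by (rule I_le[OF mv(1)]) (rule div_le_dividend)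
      have r: "?r \<in> I" by (rule I_le[OF mv(1)]) (rule mod_less_eq_dividend)
      have d: "ev (\<lambda>k. dcmp (b k) (m k) (?e k) (?a k) (?r k))"
        by (rule ev_mono[OF bm2]) (simp add: dcmp_def)
      have ab: "ev (\<lambda>k. ?a k < b k)" by (rule ev_mono[OF bm2]) (simp add: bdiv_bounds)
      note J = I_down[OF mv(2) Q(5)] I_down[OF mv(2) Q(6)] I_down[OF mv(2) Q(7)] I_down[OF mv(2) Q(8)]
      have "rel ?G ?e e'" "Ud ?a a'" "rel ?G ?r r'" using Q(1-3) U[OF a J(2) ab] unfolding relG by blast+
      moreover have "ev (\<lambda>k. c k ^ e' k = c k ^ e' k)" by simp
      ultimately have "\<exists>e'\<in>I. \<exists>a'\<in>I. \<exists>r'\<in>I. \<exists>p\<in>I. rel ?G ?e e' \<and> Ud ?a a' \<and> rel ?G ?r r' \<and>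
        ev (\<lambda>k. p k = c k ^ e' k) \<and> ev (\<lambda>k. v k = p k * a' k + r' k)"
        using Q(4) by (intro bexI[OF _ J(1)] bexI[OF _ J(2)] bexI[OF _ J(3)] bexI[OF _ J(4)] conjI)
      then show ?thesis unfolding chPhi_def
        by - (rule disjI2, rule conjI[OF bm], rule bexI[OF _ e], rule bexI[OF _ a], rule bexI[OF _ r], rule conjI[OF d])
    qed
  next
    assume "chPhi Ud b c (rel ?G) m v"
    then consider "ev (\<lambda>k. m k < b k)" "Ud m v" | e a r e' a' r' p where "ev (\<lambda>k. b k \<le> m k)" "a \<in> I" "a' \<in> I"
      "ev (\<lambda>k. dcmp (b k) (m k) (e k) (a k) (r k))" "rel ?G e e'" "Ud a a'" "rel ?G r r'"
      "ev (\<lambda>k. p k = c k ^ e' k)" "ev (\<lambda>k. v k = p k * a' k + r' k)"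
      unfolding chPhi_def by blast
    then show "rel ?G m v"
    proof cases
      case 1
      have "ev (\<lambda>k. u k (m k) = enat (v k))" using U[OF mv 1(1)] 1(2) by blast
      then show ?thesis unfolding relG using 1(1) by (rule ev_mono2) (simp add: change_below)
    next
      case 2
      have "ev (\<lambda>k. a k < b k)" by (rule ev_mono2[OF 2(1,4)]) (auto simp: dcmp_def bdiv_bounds)
      then have ua: "ev (\<lambda>k. u k (a k) = enat (a' k))" using U[OF 2(2,3)] 2(6) by blast
      have "ev (\<lambda>k. b k \<le> m k \<and> dcmp (b k) (m k) (e k) (a k) (r k) \<and> u k (a k) = enat (a' k) \<and>
        change (u k) (b k) (c k) (e k) = enat (e' k) \<and> change (u k) (b k) (c k) (r k) = enat (r' k) \<and>
        p k = c k ^ e' k \<and> v k = p k * a' k + r' k)"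
        unfolding ev_conj using 2 ua unfolding relG by blast
      then show ?thesis unfolding relG
      proof (rule ev_mono, elim conjE)
        fix k assume *: "b k \<le> m k" "dcmp (b k) (m k) (e k) (a k) (r k)" "u k (a k) = enat (a' k)"
          "change (u k) (b k) (c k) (e k) = enat (e' k)" "change (u k) (b k) (c k) (r k) = enat (r' k)"
          "p k = c k ^ e' k" "v k = p k * a' k + r' k"
        show "change (u k) (b k) (c k) (m k) = enat (v k)"
          using * unfolding dcmp_def by (subst change.simps) simp
      qed
    qed
  qed
  have dep: "chPhi Ud b c D m v = chPhi Ud b c D' m v"
    if *: "\<And>l z. l \<in> I \<Longrightarrow> z \<in> I \<Longrightarrow> ev (\<lambda>k. l k < m k) \<Longrightarrow> D l z = D' l z" for D D' m v
  proof -
    have "D e e' = D' e e'" "D r r' = D' r r'" if "e \<in> I" "r \<in> I" "e' \<in> I" "r' \<in> I"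
      and d: "ev (\<lambda>k. dcmp (b k) (m k) (e k) (a k) (r k))" for e a r e' r'
    proof -
      have "ev (\<lambda>k. e k < m k)" "ev (\<lambda>k. r k < m k)"
        by (rule ev_mono[OF d], simp add: dcmp_def bexp_less bmod_less)+
      then show "D e e' = D' e e'" "D r r' = D' r r'" using * that by blast+
    qed
    then show ?thesis unfolding chPhi_def by (simp cong: bex_cong conj_cong)
  qed
  show ?thesis
    unfolding relG[symmetric]
  proof
    assume "chM Ud b c n x"
    then obtain A where A: "A \<in> \<S>" "\<And>m v. m \<in> I \<Longrightarrow> v \<in> I \<Longrightarrow> rel A m v \<longleftrightarrow> chPhi Ud b c (rel A) m v" "rel A n x"
      unfolding chM_def by blast
    have "rel A n x = rel ?G n x" by (rule rec_unique[of A ?G, OF A(1) G A(2) fixG dep I(3,4)])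
    then show "rel ?G n x" using A(3) by blast
  next
    assume "rel ?G n x"
    then show "chM Ud b c n x" unfolding chM_def using G fixG by blast
  qed
qed

subsection \<open>Upgrade\<close>

text \<open>The formulas quantify over sets that code recursions. Such a set is unique by induction in the
  model, but its existence is required here: the standard graphs have to belong to \<open>\<S>\<close>.\<close>

definition rich :: "(nat \<Rightarrow> nat set) \<Rightarrow> (nat \<Rightarrow> nat set) \<Rightarrow> bool" where
  "rich B C \<longleftrightarrow> (\<forall>k. ok (B k) \<and> ok (C k)) \<and> (\<exists>bd\<in>I. ev (\<lambda>k. bd k \<in> B k)) \<and>
    (\<lambda>k. {pr n v | n v. upgrade (B k) (C k) n = enat v}) \<in> \<S> \<and>
    (\<forall>b\<in>I. \<forall>c\<in>I. (\<lambda>k. chgraph (upgrade (B k) (C k)) (b k) (c k)) \<in> \<S>) \<and>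
    (\<forall>b\<in>I. \<forall>n\<in>I. \<forall>c\<in>I. (\<lambda>k. {pr j x | j x. iter_change (upgrade (B k) (C k)) (b k) (n k) (c k) j = enat x}) \<in> \<S>)"

definition admM where
  "admM C D b n c v \<longleftrightarrow> ev (\<lambda>k. c k \<in> C k) \<and> chM D b c n v \<and>
    (\<exists>p\<in>I. \<exists>w\<in>I. ev (\<lambda>k. n k = p k + 1) \<and> D p w \<and> ev (\<lambda>k. w k < v k)) \<and>
    ev (\<lambda>k. enat (v k) < next_base (C k) (c k))"

definition upPhi where
  "upPhi B C D n v \<longleftrightarrow> (ev (\<lambda>k. n k < Inf (B k)) \<and> ev (\<lambda>k. v k = n k)) \<or>
    (ev (\<lambda>k. Inf (B k) \<le> n k) \<and> (\<exists>b\<in>I. ev (\<lambda>k. b k = base_of (B k) (n k)) \<and>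
      (\<exists>c\<in>I. admM C D b n c v \<and> (\<forall>c'\<in>I. ev (\<lambda>k. c' k < c k) \<longrightarrow> \<not> (\<exists>v'\<in>I. admM C D b n c' v')))))"

lemma den_admissible:
  assumes "cden w C' C" "rden w U D" "tden w b y" "tden w n a" "tden w c z" "tden w x v"
    "y \<in> I" "a \<in> I" "z \<in> I" "v \<in> I"
  shows "fden w (xadmissible C' U b n c x) (admM C D y a z v)"
proof -
  note U = rden_rule[OF assms(2)]
  have nb: "fden w (\<forall>\<^sub>f s. xnext_base C' c s \<longrightarrow>\<^sub>f x <\<^sub>f s) (ev (\<lambda>k. enat (v k) < next_base (C k) (z k)))"
  proof (rule fden_cong)
    show "fden w (\<forall>\<^sub>f s. xnext_base C' c s \<longrightarrow>\<^sub>f x <\<^sub>f s)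
      (\<forall>s\<in>I. ev (\<lambda>k. next_base (C k) (z k) = enat (s k)) \<longrightarrow> ev (\<lambda>k. v k < s k))"
      using assms(1,5,6,9,10) by - (assumption | rule den_rules den_next_base | erule den_back)+
    have "(\<forall>s\<in>I. ev (\<lambda>k. next_base (C k) (z k) = enat (s k) \<longrightarrow> v k < s k)) \<longleftrightarrow>
      ev (\<lambda>k. \<forall>s. next_base (C k) (z k) = enat s \<longrightarrow> v k < s)"
      by (rule I_all[OF assms(10)], rule ev_all) (meson not_less)
    moreover have "(\<forall>s. next_base (C k) (z k) = enat s \<longrightarrow> v k < s) \<longleftrightarrow> enat (v k) < next_base (C k) (z k)" for k
      by (cases "next_base (C k) (z k)") simp_all
    ultimately show "(\<forall>s\<in>I. ev (\<lambda>k. next_base (C k) (z k) = enat (s k)) \<longrightarrow> ev (\<lambda>k. v k < s k)) =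
      ev (\<lambda>k. enat (v k) < next_base (C k) (z k))" by (simp only: ev_imp)
  qed
  have ch: "fden w (xchange U b c n x) (chM D y z a v)" by (rule den_change) (rule assms)+
  have pr: "fden w (\<exists>\<^sub>f p. \<exists>\<^sub>f w. n =\<^sub>f p +\<^sub>f 1\<^sub>f \<and>\<^sub>f xapp U p w \<and>\<^sub>f w <\<^sub>f x)
     (\<exists>p\<in>I. \<exists>w\<in>I. ev (\<lambda>k. a k = p k + 1) \<and> D p w \<and> ev (\<lambda>k. w k < v k))"
    using assms(4,6,8,10) by - (assumption | rule den_rules U | erule den_back)+
  show ?thesis
    unfolding xadmissible_def admM_def by (intro den_conj den_app[OF assms(1,5,9)] ch pr nb)
qed

text \<open>Values at or above \<open>n\<close> do not enter: digits are below
  \<open>b \<le> n\<close>, and the other argument looked up is \<open>n - 1\<close>. This is what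
  makes the upgrade a recursion in the model.\<close>

lemma admM_cong:
  assumes "\<And>m v. m \<in> I \<Longrightarrow> v \<in> I \<Longrightarrow> ev (\<lambda>k. m k < n k) \<Longrightarrow> D m v = D' m v" "ev (\<lambda>k. b k \<le> n k)"
  shows "admM C D b n c v = admM C D' b n c v"
proof -
  have "D m v = D' m v" if "m \<in> I" "v \<in> I" "ev (\<lambda>k. m k < b k)" for m v
    by (rule assms(1)[OF that(1,2)], rule ev_mono2[OF that(3) assms(2)]) simp
  then have ch: "chM D b c n v = chM D' b c n v" by (rule chM_cong)
  have "D p w = D' p w" if "p \<in> I" "w \<in> I" "ev (\<lambda>k. n k = p k + 1)" for p w
    by (rule assms(1)[OF that(1,2)], rule ev_mono[OF that(3)]) simp
  then show ?thesis unfolding admM_def ch by (simp cong: bex_cong conj_cong)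
qed

lemma upPhi_cong:
  assumes B: "\<And>k. ok (B k)" and D: "\<And>m v. m \<in> I \<Longrightarrow> v \<in> I \<Longrightarrow> ev (\<lambda>k. m k < n k) \<Longrightarrow> D m v = D' m v"
  shows "upPhi B C D n v = upPhi B C D' n v"
proof -
  have "admM C D b n c v = admM C D' b n c v"
    if "ev (\<lambda>k. Inf (B k) \<le> n k)" "ev (\<lambda>k. b k = base_of (B k) (n k))" for b c v
    by (rule admM_cong[OF D], assumption+, rule ev_mono2[OF that]) (simp add: base_of_bounds(2)[OF B])
  then show ?thesis unfolding upPhi_def by (simp cong: bex_cong conj_cong)
qed

lemma admM_eq:
  assumes B: "\<And>k. ok (B k)" and C: "\<And>k. ok (C k)" and G: "(\<lambda>k. chgraph (upgrade (B k) (C k)) (b k) (c k)) \<in> \<S>"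
    and D: "\<And>n v. n \<in> I \<Longrightarrow> v \<in> I \<Longrightarrow> D n v \<longleftrightarrow> ev (\<lambda>k. upgrade (B k) (C k) (n k) = enat (v k))"
    and I: "b \<in> I" "c \<in> I" "n \<in> I" "v \<in> I"
    and n: "ev (\<lambda>k. Inf (B k) \<le> n k)" and b: "ev (\<lambda>k. b k = base_of (B k) (n k))"
  shows "admM C D b n c v \<longleftrightarrow> ev (\<lambda>k. c k \<in> C k \<and>
    change (upgrade (B k) (C k)) (base_of (B k) (n k)) (c k) (n k) = enat (v k) \<and>
    upgrade (B k) (C k) (n k - 1) < enat (v k) \<and> enat (v k) < next_base (C k) (c k))"
proof (cases "ev (\<lambda>k. c k \<in> C k)")
  case False
  then show ?thesis unfolding admM_def ev_conj by blast
next
  case True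
  let ?u = "\<lambda>k. upgrade (B k) (C k)"
  have c2: "ev (\<lambda>k. 2 \<le> c k)" by (rule ev_mono[OF True]) (use C in \<open>auto simp: ok_def\<close>)
  have b2: "ev (\<lambda>k. 2 \<le> b k)" by (rule ev_mono[OF b]) (simp add: base_of_ge2[OF B])
  have "chM D b c n v \<longleftrightarrow> ev (\<lambda>k. change (?u k) (b k) (c k) (n k) = enat (v k))"
    by (rule chM_eq[OF D b2 c2 I _ G]) (simp_all add: ev_all upgrade_pos[OF B])
  also have "\<dots> \<longleftrightarrow> ev (\<lambda>k. change (?u k) (base_of (B k) (n k)) (c k) (n k) = enat (v k))"
    unfolding ev_iff[symmetric] by (rule ev_mono[OF b]) simp
  finally have ch: "chM D b c n v \<longleftrightarrow> ev (\<lambda>k. change (?u k) (base_of (B k) (n k)) (c k) (n k) = enat (v k))" .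
  have n0: "ev (\<lambda>k. 0 < n k)"
  proof (rule ev_mono[OF n])
    fix k assume "Inf (B k) \<le> n k" then show "0 < n k" using ok_min(1)[OF B, of k] by linarith
  qed
  have p: "(\<exists>p\<in>I. \<exists>w\<in>I. ev (\<lambda>k. n k = p k + 1) \<and> D p w \<and> ev (\<lambda>k. w k < v k)) \<longleftrightarrow>
    ev (\<lambda>k. ?u k (n k - 1) < enat (v k))"
  proof
    assume "\<exists>p\<in>I. \<exists>w\<in>I. ev (\<lambda>k. n k = p k + 1) \<and> D p w \<and> ev (\<lambda>k. w k < v k)"
    then obtain p w where p: "p \<in> I" "w \<in> I" "ev (\<lambda>k. n k = p k + 1)" "D p w" "ev (\<lambda>k. w k < v k)" by blast
    have "ev (\<lambda>k. n k = p k + 1 \<and> ?u k (p k) = enat (w k) \<and> w k < v k)"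
      unfolding ev_conj using p D[OF p(1,2)] by blast
    then show "ev (\<lambda>k. ?u k (n k - 1) < enat (v k))" by (rule ev_mono) auto
  next
    assume "ev (\<lambda>k. ?u k (n k - 1) < enat (v k))"
    then have "ev (\<lambda>k. \<exists>w. ?u k (n k - 1) = enat w \<and> w < v k)"
    proof (rule ev_mono)
      fix k assume "?u k (n k - 1) < enat (v k)"
      then show "\<exists>w. ?u k (n k - 1) = enat w \<and> w < v k" by (cases "?u k (n k - 1)") simp_all
    qed
    from ev_choice[OF this] obtain w where "ev (\<lambda>k. ?u k (n k - 1) = enat (w k) \<and> w k < v k)" by (elim exE)
    then have w: "ev (\<lambda>k. ?u k (n k - 1) = enat (w k))" "ev (\<lambda>k. w k < v k)" unfolding ev_conj by blast+
    have pI: "(\<lambda>k. n k - 1) \<in> I" by (rule I_le[OF I(3)]) simp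
    have "ev (\<lambda>k. w k \<le> v k)" by (rule ev_mono[OF w(2)]) simp
    then have wI: "w \<in> I" by (rule I_down[OF I(4)])
    have "ev (\<lambda>k. n k = (n k - 1) + 1)" by (rule ev_mono[OF n0]) simp
    then show "\<exists>p\<in>I. \<exists>w\<in>I. ev (\<lambda>k. n k = p k + 1) \<and> D p w \<and> ev (\<lambda>k. w k < v k)"
      using w D[OF pI wI] by - (rule bexI[OF _ pI], rule bexI[OF _ wI], blast)
  qed
  show ?thesis unfolding admM_def ch p ev_conj by blast
qed

text \<open>Bounds the base by the value, both for the search in the upgrade and for the iterated
  change of base.\<close>

lemma change_ge_c:
  assumes "2 \<le> b" "2 \<le> c" "b \<le> n" "\<And>k. 0 < k \<Longrightarrow> k < b \<Longrightarrow> u k \<noteq> 0" "change u b c n = enat v"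
  shows "c \<le> v"
  using iffD1[OF change_decomp[OF assms(1-4)] assms(5)] by blast

text \<open>Two bounds keep the search for the least admissible base within \<open>I\<close>: an
  admissible \<open>c\<close> is at most its value, and an admissible \<open>c' < c\<close> would
  have a value below its next base, thus below \<open>c\<close>.\<close>

lemma upPhi_eq:
  assumes R: "rich B C" and D: "\<And>n v. n \<in> I \<Longrightarrow> v \<in> I \<Longrightarrow> D n v \<longleftrightarrow> ev (\<lambda>k. upgrade (B k) (C k) (n k) = enat (v k))"
    and I: "n \<in> I" "v \<in> I"
  shows "upPhi B C D n v \<longleftrightarrow> ev (\<lambda>k. upgrade (B k) (C k) (n k) = enat (v k))"
proof (cases "ev (\<lambda>k. n k < Inf (B k))")
  case True
  have "ev (\<lambda>k. v k = n k) \<longleftrightarrow> ev (\<lambda>k. upgrade (B k) (C k) (n k) = enat (v k))"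
    unfolding ev_iff[symmetric] by (rule ev_mono[OF True]) (auto simp: upgrade_less)
  moreover have "\<not> ev (\<lambda>k. Inf (B k) \<le> n k)" using True unfolding not_less[symmetric] ev_neg by blast
  ultimately show ?thesis unfolding upPhi_def using True by blast
next
  case False
  then have n: "ev (\<lambda>k. Inf (B k) \<le> n k)" unfolding not_less[symmetric] ev_neg .
  have B: "\<And>k. ok (B k)" and C: "\<And>k. ok (C k)" using R unfolding rich_def by blast+
  obtain bd where bd: "bd \<in> I" "ev (\<lambda>k. bd k \<in> B k)" using R unfolding rich_def by blast
  have G: "(\<lambda>k. chgraph (upgrade (B k) (C k)) (b k) (c k)) \<in> \<S>" if "b \<in> I" "c \<in> I" for b c
    using R that unfolding rich_def by blast
  let ?b = "\<lambda>k. base_of (B k) (n k)"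
  define P where "P k c v \<longleftrightarrow> c \<in> C k \<and> change (upgrade (B k) (C k)) (?b k) c (n k) = enat v \<and>
    upgrade (B k) (C k) (n k - 1) < enat v \<and> enat v < next_base (C k) c" for k c v
  have bI: "?b \<in> I" by (rule base_of_I[OF B bd I(1)])
  have adm: "admM C D b n c v \<longleftrightarrow> ev (\<lambda>k. P k (c k) (v k))"
    if "b \<in> I" "ev (\<lambda>k. b k = ?b k)" "c \<in> I" "v \<in> I" for b c v
    unfolding P_def by (rule admM_eq[OF B C G[OF that(1,3)] D that(1,3) I(1) that(4) n that(2)])
  have P_le: "ev (\<lambda>k. \<forall>c v. P k c v \<longrightarrow> c \<le> v)"
  proof (rule ev_mono[OF n], intro allI impI)
    fix k c v assume n: "Inf (B k) \<le> n k" and P: "P k c v"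
    have c: "c \<in> C k" and ch: "change (upgrade (B k) (C k)) (?b k) c (n k) = enat v"
      using P unfolding P_def by blast+
    have "2 \<le> c" using c C[of k] unfolding ok_def by auto
    from change_ge_c[OF base_of_ge2[OF B] this base_of_bounds(2)[OF B n] upgrade_pos[OF B] ch] show "c \<le> v" .
  qed
  have key: "(\<exists>c\<in>I. ev (\<lambda>k. P k (c k) (v k)) \<and> (\<forall>c'\<in>I. ev (\<lambda>k. c' k < c k) \<longrightarrow> \<not> (\<exists>v'\<in>I. ev (\<lambda>k. P k (c' k) (v' k))))) \<longleftrightarrow>
    ev (\<lambda>k. \<exists>c. P k c (v k) \<and> (\<forall>c'<c. \<not> (\<exists>v'. P k c' v')))"
  proof -
    have "(\<forall>c'\<in>I. ev (\<lambda>k. c' k < c k) \<longrightarrow> \<not> (\<exists>v'\<in>I. ev (\<lambda>k. P k (c' k) (v' k)))) \<longleftrightarrow>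
      ev (\<lambda>k. \<forall>c'. c' < c k \<longrightarrow> \<not> (\<exists>v'. P k c' v'))" if c: "c \<in> I" "ev (\<lambda>k. P k (c k) (v k))" for c
    proof -
      have "(\<exists>v'\<in>I. ev (\<lambda>k. P k (c' k) (v' k))) \<longleftrightarrow> ev (\<lambda>k. \<exists>v'. P k (c' k) v')" if "ev (\<lambda>k. c' k < c k)" for c'
      proof (rule I_ex[OF c(1)], rule ev_mono2[OF c(2) that], intro allI impI)
        fix k v' assume *: "P k (c k) (v k)" "c' k < c k" "P k (c' k) v'"
        have "next_base (C k) (c' k) \<le> enat (c k)" using *(1,2) unfolding P_def by (intro next_base_le) blast+
        then have "enat v' < enat (c k)" using *(3) unfolding P_def by (meson less_le_trans)
        then show "\<exists>v''\<le>c k. P k (c' k) v''" using *(3) by (intro exI[of _ v']) simp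
      qed
      then have "(\<forall>c'\<in>I. ev (\<lambda>k. c' k < c k) \<longrightarrow> \<not> (\<exists>v'\<in>I. ev (\<lambda>k. P k (c' k) (v' k)))) \<longleftrightarrow>
        (\<forall>c'\<in>I. ev (\<lambda>k. c' k < c k \<longrightarrow> \<not> (\<exists>v'. P k (c' k) v')))"
        unfolding ev_imp ev_neg by blast
      also have "\<dots> \<longleftrightarrow> ev (\<lambda>k. \<forall>c'. c' < c k \<longrightarrow> \<not> (\<exists>v'. P k c' v'))"
        by (rule I_all[OF c(1)], rule ev_all) (meson less_imp_le)
      finally show ?thesis .
    qed
    then have "(\<exists>c\<in>I. ev (\<lambda>k. P k (c k) (v k)) \<and> (\<forall>c'\<in>I. ev (\<lambda>k. c' k < c k) \<longrightarrow> \<not> (\<exists>v'\<in>I. ev (\<lambda>k. P k (c' k) (v' k))))) \<longleftrightarrow>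
      (\<exists>c\<in>I. ev (\<lambda>k. P k (c k) (v k)) \<and> ev (\<lambda>k. \<forall>c'. c' < c k \<longrightarrow> \<not> (\<exists>v'. P k c' v')))" by (simp cong: bex_cong conj_cong)
    also have "\<dots> \<longleftrightarrow> (\<exists>c\<in>I. ev (\<lambda>k. P k (c k) (v k) \<and> (\<forall>c'<c k. \<not> (\<exists>v'. P k c' v'))))" unfolding ev_conj ..
    also have "\<dots> \<longleftrightarrow> ev (\<lambda>k. \<exists>c. P k c (v k) \<and> (\<forall>c'<c. \<not> (\<exists>v'. P k c' v')))"
      by (rule I_ex[OF I(2)], rule ev_mono[OF P_le]) blast
    finally show ?thesis .
  qed
  have "(\<exists>b\<in>I. ev (\<lambda>k. b k = ?b k) \<and>
      (\<exists>c\<in>I. admM C D b n c v \<and> (\<forall>c'\<in>I. ev (\<lambda>k. c' k < c k) \<longrightarrow> \<not> (\<exists>v'\<in>I. admM C D b n c' v')))) \<longleftrightarrow>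
    (\<exists>b\<in>I. ev (\<lambda>k. b k = ?b k) \<and>
      (\<exists>c\<in>I. ev (\<lambda>k. P k (c k) (v k)) \<and> (\<forall>c'\<in>I. ev (\<lambda>k. c' k < c k) \<longrightarrow> \<not> (\<exists>v'\<in>I. ev (\<lambda>k. P k (c' k) (v' k))))))"
    using adm I(2) by (simp cong: bex_cong conj_cong)
  also have "\<dots> \<longleftrightarrow> ev (\<lambda>k. \<exists>c. P k c (v k) \<and> (\<forall>c'<c. \<not> (\<exists>v'. P k c' v')))"
    unfolding key by (rule ex_eq_I[OF bI]) (rule refl)
  also have "\<dots> \<longleftrightarrow> ev (\<lambda>k. upgrade (B k) (C k) (n k) = enat (v k))"
    unfolding ev_iff[symmetric] P_def by (rule ev_mono[OF n]) (simp add: upgrade_least[OF B C])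
  finally have "(\<exists>b\<in>I. ev (\<lambda>k. b k = ?b k) \<and>
      (\<exists>c\<in>I. admM C D b n c v \<and> (\<forall>c'\<in>I. ev (\<lambda>k. c' k < c k) \<longrightarrow> \<not> (\<exists>v'\<in>I. admM C D b n c' v')))) \<longleftrightarrow>
    ev (\<lambda>k. upgrade (B k) (C k) (n k) = enat (v k))" .
  then show ?thesis unfolding upPhi_def using n False by blast
qed

definition is_up where
  "is_up B C A \<longleftrightarrow> (\<forall>n\<in>I. \<forall>v\<in>I. rel A n v \<longleftrightarrow> ev (\<lambda>k. upgrade (B k) (C k) (n k) = enat (v k)))"

lemma upPhi_is_up:
  assumes R: "rich B C" and A: "A \<in> \<S>"
  shows "(\<forall>n\<in>I. \<forall>v\<in>I. rel A n v \<longleftrightarrow> upPhi B C (rel A) n v) \<longleftrightarrow> is_up B C A"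
proof -
  let ?G = "\<lambda>k. {pr n v | n v. upgrade (B k) (C k) n = enat v}"
  have G: "?G \<in> \<S>" and B: "\<And>k. ok (B k)" using R unfolding rich_def by blast+
  have relG: "rel ?G n v \<longleftrightarrow> ev (\<lambda>k. upgrade (B k) (C k) (n k) = enat (v k))" for n v
    unfolding rel_def pr_graph ..
  have fixG: "rel ?G n v \<longleftrightarrow> upPhi B C (rel ?G) n v" if "n \<in> I" "v \<in> I" for n v
    using upPhi_eq[OF R relG that] unfolding relG ..
  show ?thesis
  proof
    assume rec: "\<forall>n\<in>I. \<forall>v\<in>I. rel A n v \<longleftrightarrow> upPhi B C (rel A) n v"
    have "rel A n v = rel ?G n v" if "n \<in> I" "v \<in> I" for n v
    proof (rule rec_unique[of A ?G "upPhi B C", OF A G _ fixG _ that])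
      show "rel A x y = upPhi B C (rel A) x y" if "x \<in> I" "y \<in> I" for x y using rec that by blast
      show "upPhi B C D x y = upPhi B C D' x y"
        if "\<And>l z. l \<in> I \<Longrightarrow> z \<in> I \<Longrightarrow> ev (\<lambda>k. l k < x k) \<Longrightarrow> D l z = D' l z" for D D' x y
        by (rule upPhi_cong[OF B that])
    qed
    then show "is_up B C A" unfolding is_up_def relG by blast
  next
    assume "is_up B C A"
    then have eq: "rel A n v \<longleftrightarrow> ev (\<lambda>k. upgrade (B k) (C k) (n k) = enat (v k))" if "n \<in> I" "v \<in> I" for n v
      using that unfolding is_up_def by blast
    show "\<forall>n\<in>I. \<forall>v\<in>I. rel A n v \<longleftrightarrow> upPhi B C (rel A) n v"
      using upPhi_eq[OF R eq] eq by blast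
  qed
qed

lemma Inf_I: "rich B C \<Longrightarrow> (\<lambda>k. Inf (B k)) \<in> I"
proof -
  assume "rich B C"
  then obtain bd where bd: "bd \<in> I" "ev (\<lambda>k. bd k \<in> B k)" unfolding rich_def by blast
  show ?thesis by (rule I_down[OF bd(1)], rule ev_mono[OF bd(2)]) (simp add: cInf_lower)
qed

lemma min_Inf: "ok A \<Longrightarrow> (m \<in> A \<and> (\<forall>y. y \<in> A \<longrightarrow> m \<le> y)) \<longleftrightarrow> m = Inf A"
  using nonempty_min[of A "\<lambda>x. m = x"] ok_min(2)[of A] cInf_lower[of _ A] by (auto simp: ok_def)

lemma ev_less_cong:
  assumes "ev (\<lambda>k. m k = (m' k :: nat))"
  shows "ev (\<lambda>k. n k < m k) = ev (\<lambda>k. n k < m' k)" "ev (\<lambda>k. m k \<le> n k) = ev (\<lambda>k. m' k \<le> n k)"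
    "ev (\<lambda>k. n k \<le> m k) = ev (\<lambda>k. n k \<le> m' k)" "ev (\<lambda>k. m k < n k) = ev (\<lambda>k. m' k < n k)"
    "ev (\<lambda>k. n k = m k + c) = ev (\<lambda>k. n k = m' k + c)"
  unfolding ev_iff[symmetric] by (rule ev_mono[OF assms], simp)+

lemma den_is_upgrade:
  assumes "cden w B' B" "cden w C' C" "cden w U A" and R: "rich B C" and A: "A \<in> \<S>"
  shows "fden w (xis_upgrade B' C' U) (is_up B C A)"
proof (rule fden_cong)
  have B: "\<And>k. ok (B k)" using R unfolding rich_def by blast
  obtain bd where bd: "bd \<in> I" "ev (\<lambda>k. bd k \<in> B k)" using R unfolding rich_def by blast
  note adm = den_admissible[OF _ cden_rden]
  let ?P = "\<lambda>m. \<forall>n\<in>I. \<forall>v\<in>I. rel A n v \<longleftrightarrow> (ev (\<lambda>k. n k < m k) \<and> ev (\<lambda>k. v k = n k)) \<or>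
    (ev (\<lambda>k. m k \<le> n k) \<and> (\<exists>b\<in>I. ev (\<lambda>k. b k = base_of (B k) (n k)) \<and>
      (\<exists>c\<in>I. admM C (rel A) b n c v \<and> (\<forall>c'\<in>I. ev (\<lambda>k. c' k < c k) \<longrightarrow> \<not> (\<exists>v'\<in>I. admM C (rel A) b n c' v')))))"
  show "fden w (xis_upgrade B' C' U) (\<exists>m\<in>I. ev (\<lambda>k. m k \<in> B k \<and> (\<forall>y. y \<in> B k \<longrightarrow> m k \<le> y)) \<and> ?P m)"
    unfolding xis_upgrade_def using assms(1-3)
    by - (assumption | rule den_rules den_xapp den_min den_base_of[OF _ _ _ _ _ B bd] adm | erule den_back)+
  have "(\<exists>m\<in>I. ev (\<lambda>k. m k = Inf (B k)) \<and> ?P m) \<longleftrightarrow> ?P (\<lambda>k. Inf (B k))"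
    by (rule ex_eq_I[OF Inf_I[OF R]]) (simp only: ev_less_cong)
  also have "\<dots> \<longleftrightarrow> is_up B C A" unfolding upPhi_is_up[OF R A, symmetric] upPhi_def ..
  finally show "(\<exists>m\<in>I. ev (\<lambda>k. m k \<in> B k \<and> (\<forall>y. y \<in> B k \<longrightarrow> m k \<le> y)) \<and> ?P m) = is_up B C A"
    unfolding min_Inf[OF B] .
qed

end

subsection \<open>Iteration and the Ouroboros stages\<close>

context powers
begin

definition itPhi where
  "itPhi Ud b n c D j y \<longleftrightarrow> (ev (\<lambda>k. j k = 0) \<and> ev (\<lambda>k. y k = c k)) \<or>
    (\<exists>l\<in>I. \<exists>d\<in>I. ev (\<lambda>k. j k = l k + 1) \<and> D l d \<and> chM Ud b d n y)"

definition itM where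
  "itM Ud b n c j x \<longleftrightarrow> (\<exists>A\<in>\<S>. (\<forall>j\<in>I. \<forall>y\<in>I. rel A j y \<longleftrightarrow> itPhi Ud b n c (rel A) j y) \<and> rel A j x)"

lemma den_iter_change:
  assumes "rden w U Ud" "tden w b y" "tden w c z" "tden w n k" "tden w j l" "tden w x v"
    "y \<in> I" "z \<in> I" "k \<in> I" "l \<in> I" "v \<in> I"
  shows "fden w (xiter_change U b n c j x) (itM Ud y k z l v)"
proof -
  have ch: "fden w' (xchange U b d n y') (chM Ud y d' k v')"
    if "hle w w'" "tden w' d d'" "tden w' y' v'" "d' \<in> I" "v' \<in> I" for w' d d' y' v'
    by (rule den_change[OF rden_mono[OF assms(1) that(1)] tden_mono[OF assms(2) that(1)] that(2)
      tden_mono[OF assms(4) that(1)] that(3) assms(7) that(4) assms(9) that(5)])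
  show ?thesis
    unfolding xiter_change_def itM_def itPhi_def using assms(2-11)
    by - (assumption | rule den_rules den_xapp ch I_rules | erule den_back)+
qed

text \<open>As for a single change of base; an intermediate \<open>d\<close> is at most the result,
  because a change to base \<open>d\<close> of a number \<open>n \<ge> b\<close> gives at least
  \<open>d\<close>.\<close>

lemma itM_eq:
  assumes R: "rich B C" and D: "\<And>n v. n \<in> I \<Longrightarrow> v \<in> I \<Longrightarrow> D n v \<longleftrightarrow> ev (\<lambda>k. upgrade (B k) (C k) (n k) = enat (v k))"
    and b: "ev (\<lambda>k. 2 \<le> b k)" and bn: "ev (\<lambda>k. b k \<le> n k)" and c: "ev (\<lambda>k. 2 \<le> c k)"
    and I: "b \<in> I" "n \<in> I" "c \<in> I" "j \<in> I" "x \<in> I"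
  shows "itM D b n c j x \<longleftrightarrow> ev (\<lambda>k. iter_change (upgrade (B k) (C k)) (b k) (n k) (c k) (j k) = enat (x k))"
proof -
  let ?u = "\<lambda>k. upgrade (B k) (C k)"
  let ?it = "\<lambda>k. iter_change (?u k) (b k) (n k) (c k)"
  let ?G = "\<lambda>k. {pr j x | j x. ?it k j = enat x}"
  have B: "\<And>k. ok (B k)" and G: "?G \<in> \<S>" using R I unfolding rich_def by blast+
  have Gch: "(\<lambda>k. chgraph (?u k) (b k) (d k)) \<in> \<S>" if "d \<in> I" for d using R I(1) that unfolding rich_def by blast
  have pos: "ev (\<lambda>k. \<forall>m. 0 < m \<longrightarrow> m < b k \<longrightarrow> ?u k m \<noteq> 0)" by (rule ev_all) (simp add: upgrade_pos[OF B])
  have ch: "chM D b d n y \<longleftrightarrow> ev (\<lambda>k. change (?u k) (b k) (d k) (n k) = enat (y k))"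
    if "ev (\<lambda>k. 2 \<le> d k)" "d \<in> I" "y \<in> I" for d y
    by (rule chM_eq[OF D b that(1) I(1) that(2) I(2) that(3) pos Gch[OF that(2)]])
  have relG: "rel ?G j y \<longleftrightarrow> ev (\<lambda>k. ?it k (j k) = enat (y k))" for j y unfolding rel_def pr_graph ..
  have it2: "2 \<le> d" if "2 \<le> b k" "2 \<le> c k" "b k \<le> n k" "?it k l = enat d" for k l d
  proof -
    have "2 \<le> ?it k l" by (rule iter_ge2[OF that(1-3)]) (rule upgrade_pos[OF B])
    then show ?thesis using that(4) by (simp add: numeral_eq_enat)
  qed
  have base: "ev (\<lambda>k. 2 \<le> b k \<and> 2 \<le> c k \<and> b k \<le> n k)" unfolding ev_conj using b c bn by blast
  have fixG: "rel ?G j y \<longleftrightarrow> itPhi D b n c (rel ?G) j y" if jy: "j \<in> I" "y \<in> I" for j y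
  proof
    assume "rel ?G j y"
    then have y: "ev (\<lambda>k. ?it k (j k) = enat (y k))" unfolding relG .
    show "itPhi D b n c (rel ?G) j y"
    proof (cases "ev (\<lambda>k. j k = 0)")
      case True
      have "ev (\<lambda>k. y k = c k)" by (rule ev_mono2[OF y True]) simp
      then show ?thesis unfolding itPhi_def using True by blast
    next
      case False
      then have j0: "ev (\<lambda>k. j k \<noteq> 0)" unfolding ev_neg .
      have "ev (\<lambda>k. (2 \<le> b k \<and> 2 \<le> c k \<and> b k \<le> n k) \<and> j k \<noteq> 0 \<and> ?it k (j k) = enat (y k))"
        using base j0 y unfolding ev_conj by blast
      then have "ev (\<lambda>k. \<exists>d. ?it k (j k - 1) = enat d \<and> change (?u k) (b k) d (n k) = enat (y k) \<and> 2 \<le> d \<and> d \<le> y k)"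
      proof (rule ev_mono, elim conjE)
        fix k assume *: "2 \<le> b k" "2 \<le> c k" "b k \<le> n k" "j k \<noteq> 0" "?it k (j k) = enat (y k)"
        obtain l where l: "j k = Suc l" using *(4) by (cases "j k") simp_all
        obtain d where d: "?it k l = enat d" "change (?u k) (b k) d (n k) = enat (y k)"
          using *(5) unfolding l by (auto split: enat.splits)
        have "2 \<le> d" by (rule it2[OF *(1-3) d(1)])
        then show "\<exists>d. ?it k (j k - 1) = enat d \<and> change (?u k) (b k) d (n k) = enat (y k) \<and> 2 \<le> d \<and> d \<le> y k"
          using d change_ge_c[OF *(1) _ *(3) upgrade_pos[OF B] d(2)] l by (intro exI[of _ d]) simp
      qed
      from ev_choice[OF this] obtain d where "ev (\<lambda>k. ?it k (j k - 1) = enat (d k) \<and>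
        change (?u k) (b k) (d k) (n k) = enat (y k) \<and> 2 \<le> d k \<and> d k \<le> y k)" by (elim exE)
      then have d: "ev (\<lambda>k. ?it k (j k - 1) = enat (d k))" "ev (\<lambda>k. change (?u k) (b k) (d k) (n k) = enat (y k))"
        "ev (\<lambda>k. 2 \<le> d k)" "ev (\<lambda>k. d k \<le> y k)" unfolding ev_conj by blast+
      have dI: "d \<in> I" by (rule I_down[OF jy(2) d(4)])
      have lI: "(\<lambda>k. j k - 1) \<in> I" by (rule I_le[OF jy(1)]) simp
      have "ev (\<lambda>k. j k = (j k - 1) + 1)" by (rule ev_mono[OF j0]) simp
      moreover have "rel ?G (\<lambda>k. j k - 1) d" unfolding relG by (rule d(1))
      moreover have "chM D b d n y" using ch[OF d(3) dI jy(2)] d(2) by blast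
      ultimately have "\<exists>l\<in>I. \<exists>d\<in>I. ev (\<lambda>k. j k = l k + 1) \<and> rel ?G l d \<and> chM D b d n y"
        by - (rule bexI[OF _ lI], rule bexI[OF _ dI], blast)
      then show ?thesis unfolding itPhi_def by blast
    qed
  next
    assume "itPhi D b n c (rel ?G) j y"
    then consider "ev (\<lambda>k. j k = 0)" "ev (\<lambda>k. y k = c k)" |
      l d where "l \<in> I" "d \<in> I" "ev (\<lambda>k. j k = l k + 1)" "rel ?G l d" "chM D b d n y"
      unfolding itPhi_def by blast
    then show "rel ?G j y"
    proof cases
      case 1
      show ?thesis unfolding relG by (rule ev_mono2[OF 1]) simp
    next
      case 2
      have d: "ev (\<lambda>k. ?it k (l k) = enat (d k))" using 2(4) unfolding relG .
      have d2: "ev (\<lambda>k. 2 \<le> d k)" by (rule ev_mono2[OF base d]) (use it2 in blast)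
      have "ev (\<lambda>k. j k = l k + 1 \<and> ?it k (l k) = enat (d k) \<and> change (?u k) (b k) (d k) (n k) = enat (y k))"
        unfolding ev_conj using 2(3) d ch[OF d2 2(2) jy(2)] 2(5) by blast
      then show ?thesis unfolding relG by (rule ev_mono) simp
    qed
  qed
  have dep: "itPhi D b n c E j y = itPhi D b n c E' j y"
    if *: "\<And>l z. l \<in> I \<Longrightarrow> z \<in> I \<Longrightarrow> ev (\<lambda>k. l k < j k) \<Longrightarrow> E l z = E' l z" for E E' j y
  proof -
    have "E l d = E' l d" if "l \<in> I" "d \<in> I" "ev (\<lambda>k. j k = l k + 1)" for l d
      by (rule *[OF that(1,2)], rule ev_mono[OF that(3)]) simp
    then show ?thesis unfolding itPhi_def by (simp cong: bex_cong conj_cong)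
  qed
  show ?thesis
    unfolding relG[symmetric]
  proof
    assume "itM D b n c j x"
    then obtain A where A: "A \<in> \<S>" "\<And>j y. j \<in> I \<Longrightarrow> y \<in> I \<Longrightarrow> rel A j y \<longleftrightarrow> itPhi D b n c (rel A) j y" "rel A j x"
      unfolding itM_def by blast
    have "rel A j x = rel ?G j x" by (rule rec_unique[of A ?G, OF A(1) G A(2) fixG dep I(4,5)])
    then show "rel ?G j x" using A(3) by blast
  next
    assume "rel ?G j x"
    then show "itM D b n c j x" unfolding itM_def using G fixG by blast
  qed
qed

definition new_elem :: "nat set \<Rightarrow> nat \<Rightarrow> nat set \<Rightarrow> nat \<Rightarrow> nat \<Rightarrow> nat \<Rightarrow> bool" where
  "new_elem B i C p n x \<longleftrightarrow> critical B n \<and>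
    (n \<in> B \<and> (\<exists>a. x = Max C * a \<and> change (upgrade B C) (base_of B p) (Max C) p < enat (Max C * a) \<and>
        (\<forall>a'<a. \<not> change (upgrade B C) (base_of B p) (Max C) p < enat (Max C * a'))) \<or>
     n \<notin> B \<and> (\<exists>j. 1 \<le> j \<and> j \<le> i \<and> iter_change (upgrade B C) (base_of B n) n (Max C) j = enat x))"

definition newM where
  "newM B i C p n x \<longleftrightarrow> ev (\<lambda>k. critical (B k) (n k)) \<and>
    (\<exists>c\<in>I. ev (\<lambda>k. c k \<in> C k \<and> (\<forall>y. y \<in> C k \<longrightarrow> y \<le> c k)) \<and> (\<exists>A\<in>\<S>. is_up B C A \<and>
      (ev (\<lambda>k. n k \<in> B k) \<and> (\<exists>b\<in>I. ev (\<lambda>k. b k = base_of (B k) (p k)) \<and> (\<exists>a\<in>I. ev (\<lambda>k. x k = c k * a k) \<and>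
          (\<exists>w\<in>I. chM (rel A) b c p w \<and> ev (\<lambda>k. w k < c k * a k) \<and>
            (\<forall>a'\<in>I. ev (\<lambda>k. a' k < a k) \<longrightarrow> \<not> ev (\<lambda>k. w k < c k * a' k))))) \<or>
       \<not> ev (\<lambda>k. n k \<in> B k) \<and> (\<exists>b\<in>I. ev (\<lambda>k. b k = base_of (B k) (n k)) \<and>
          (\<exists>j\<in>I. ev (\<lambda>k. 1 \<le> j k) \<and> ev (\<lambda>k. j k \<le> i k) \<and> itM (rel A) b n c j x)))))"

lemma den_new_base:
  assumes "cden w B' B" "cden w C' C" "tden w i a" "tden w p b" "tden w n c" "tden w x v"
    "a \<in> I" "b \<in> I" "c \<in> I" "v \<in> I" and R: "rich B C" and M: "mx \<in> I" "ev (\<lambda>k. \<forall>y. y \<in> C k \<longrightarrow> y \<le> mx k)"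
  shows "fden w (xnew_base B' i C' p n x) (newM B a C b c v)"
proof -
  have B: "\<And>k. ok (B k)" using R unfolding rich_def by blast
  obtain bd where bd: "bd \<in> I" "ev (\<lambda>k. bd k \<in> B k)" using R unfolding rich_def by blast
  note ch = den_change[OF cden_rden] and it = den_iter_change[OF cden_rden]
  show ?thesis
    unfolding xnew_base_def newM_def using assms(1-10)
    by - (assumption | rule den_rules den_app den_critical[OF _ _ _ B bd] den_max[OF _ _ _ M] den_is_upgrade[OF _ _ _ R]
        den_base_of[OF _ _ _ _ _ B bd] ch it I_rules | erule den_back)+
qed

text \<open>Removes quantifiers over objects that are determined as far as matters: one exists, and
  the statement is the same for all of them.\<close>

lemma ex_const: "\<exists>x\<in>S. P x \<Longrightarrow> (\<And>x. x \<in> S \<Longrightarrow> P x \<Longrightarrow> Q x = Q') \<Longrightarrow> (\<exists>x\<in>S. P x \<and> Q x) \<longleftrightarrow> Q'"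
  by blast

lemma ex_is_up: "rich B C \<Longrightarrow> \<exists>A\<in>\<S>. is_up B C A"
proof -
  assume "rich B C"
  then have "(\<lambda>k. {pr n v | n v. upgrade (B k) (C k) n = enat v}) \<in> \<S>" unfolding rich_def by blast
  then show ?thesis by (rule bexI[rotated]) (unfold is_up_def rel_def pr_graph, intro ballI refl)
qed

text \<open>The bounds used are these: the multiplier is at most the new element, the auxiliary
  value \<open>w\<close> is below \<open>c * a\<close>, and the number of iterations is at most
  \<open>i\<close>. Maximum, base and upgrade are unique, so \<open>ex_const\<close> removes their
  quantifiers.\<close>

lemma newM_eq:
  assumes R: "rich B C" and M: "mx \<in> I" "ev (\<lambda>k. \<forall>y. y \<in> C k \<longrightarrow> y \<le> mx k)"
    and I: "i \<in> I" "p \<in> I" "n \<in> I" "x \<in> I" and n: "ev (\<lambda>k. n k = p k + 1)" "ev (\<lambda>k. Inf (B k) < n k)"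
  shows "newM B i C p n x \<longleftrightarrow> ev (\<lambda>k. new_elem (B k) (i k) (C k) (p k) (n k) (x k))"
proof -
  have B: "\<And>k. ok (B k)" and C: "\<And>k. ok (C k)" using R unfolding rich_def by blast+
  obtain bd where bd: "bd \<in> I" "ev (\<lambda>k. bd k \<in> B k)" using R unfolding rich_def by blast
  let ?u = "\<lambda>k. upgrade (B k) (C k)"
  have max: "c \<in> C k \<and> (\<forall>y. y \<in> C k \<longrightarrow> y \<le> c) \<longleftrightarrow> c = Max (C k)" "Max (C k) \<in> C k" "Max (C k) \<le> mx k"
    if "\<forall>y. y \<in> C k \<longrightarrow> y \<le> mx k" for c k
  proof -
    have sub: "C k \<subseteq> {..mx k}" using that by (intro subsetI) simp
    have fin: "finite (C k)" by (rule finite_subset[OF sub]) simp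
    have ne: "C k \<noteq> {}" using C[of k] unfolding ok_def by (rule conjunct1)
    show "c \<in> C k \<and> (\<forall>y. y \<in> C k \<longrightarrow> y \<le> c) \<longleftrightarrow> c = Max (C k)"
      unfolding eq_Max_iff[OF fin ne] Ball_def ..
    show m: "Max (C k) \<in> C k" by (rule Max_in[OF fin ne])
    show "Max (C k) \<le> mx k" using that[rule_format, OF m] .
  qed
  have mxI: "(\<lambda>k. Max (C k)) \<in> I" by (rule I_down[OF M(1)], rule ev_mono[OF M(2)]) (rule max(3))
  have isM: "ev (\<lambda>k. c k \<in> C k \<and> (\<forall>y. y \<in> C k \<longrightarrow> y \<le> c k)) \<longleftrightarrow> ev (\<lambda>k. c k = Max (C k))" for c
    unfolding ev_iff[symmetric] by (rule ev_mono[OF M(2)]) (rule max(1))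
  have M2: "ev (\<lambda>k. 2 \<le> Max (C k))"
  proof (rule ev_mono[OF M(2)])
    fix k assume "\<forall>y. y \<in> C k \<longrightarrow> y \<le> mx k"
    from max(2)[OF this] show "2 \<le> Max (C k)" using C[of k] unfolding ok_def by auto
  qed
  have main: "(ev (\<lambda>k. n k \<in> B k) \<and> (\<exists>b\<in>I. ev (\<lambda>k. b k = base_of (B k) (p k)) \<and> (\<exists>a\<in>I. ev (\<lambda>k. x k = c k * a k) \<and>
          (\<exists>w\<in>I. chM (rel A) b c p w \<and> ev (\<lambda>k. w k < c k * a k) \<and>
            (\<forall>a'\<in>I. ev (\<lambda>k. a' k < a k) \<longrightarrow> \<not> ev (\<lambda>k. w k < c k * a' k))))) \<or>
       \<not> ev (\<lambda>k. n k \<in> B k) \<and> (\<exists>b\<in>I. ev (\<lambda>k. b k = base_of (B k) (n k)) \<and>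
          (\<exists>j\<in>I. ev (\<lambda>k. 1 \<le> j k) \<and> ev (\<lambda>k. j k \<le> i k) \<and> itM (rel A) b n c j x))) \<longleftrightarrow>
      (ev (\<lambda>k. n k \<in> B k) \<and> ev (\<lambda>k. \<exists>a. x k = Max (C k) * a \<and>
          change (?u k) (base_of (B k) (p k)) (Max (C k)) (p k) < enat (Max (C k) * a) \<and>
        (\<forall>a'<a. \<not> change (?u k) (base_of (B k) (p k)) (Max (C k)) (p k) < enat (Max (C k) * a'))) \<or>
       \<not> ev (\<lambda>k. n k \<in> B k) \<and> ev (\<lambda>k. \<exists>j. 1 \<le> j \<and> j \<le> i k \<and>
         iter_change (?u k) (base_of (B k) (n k)) (n k) (Max (C k)) j = enat (x k)))"
    if c: "c \<in> I" "ev (\<lambda>k. c k = Max (C k))" and A: "is_up B C A" for c A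
  proof -
    have D: "rel A n v \<longleftrightarrow> ev (\<lambda>k. ?u k (n k) = enat (v k))" if "n \<in> I" "v \<in> I" for n v
      using A that unfolding is_up_def by blast
    have c2: "ev (\<lambda>k. 2 \<le> c k)" by (rule ev_mono2[OF c(2) M2]) simp
    have one: "(\<exists>a\<in>I. ev (\<lambda>k. x k = c k * a k) \<and> (\<exists>w\<in>I. chM (rel A) b c p w \<and> ev (\<lambda>k. w k < c k * a k) \<and>
            (\<forall>a'\<in>I. ev (\<lambda>k. a' k < a k) \<longrightarrow> \<not> ev (\<lambda>k. w k < c k * a' k)))) \<longleftrightarrow>
      ev (\<lambda>k. \<exists>a. x k = Max (C k) * a \<and>
          change (?u k) (base_of (B k) (p k)) (Max (C k)) (p k) < enat (Max (C k) * a) \<and>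
        (\<forall>a'<a. \<not> change (?u k) (base_of (B k) (p k)) (Max (C k)) (p k) < enat (Max (C k) * a')))"
      if b: "b \<in> I" "ev (\<lambda>k. b k = base_of (B k) (p k))" for b
    proof -
      let ?ch = "\<lambda>k. change (?u k) (b k) (c k) (p k)"
      have b2: "ev (\<lambda>k. 2 \<le> b k)" by (rule ev_mono[OF b(2)]) (simp add: base_of_ge2[OF B])
      have G: "(\<lambda>k. chgraph (?u k) (b k) (c k)) \<in> \<S>" using R b(1) c(1) unfolding rich_def by blast
      have ch: "chM (rel A) b c p w \<longleftrightarrow> ev (\<lambda>k. ?ch k = enat (w k))" if "w \<in> I" for w
        by (rule chM_eq[OF D b2 c2 b(1) c(1) I(2) that _ G]) (simp_all add: ev_all upgrade_pos[OF B])
      have a': "(\<forall>a'\<in>I. ev (\<lambda>k. a' k < a k) \<longrightarrow> \<not> ev (\<lambda>k. w k < c k * a' k)) \<longleftrightarrow>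
        ev (\<lambda>k. \<forall>a'. a' < a k \<longrightarrow> \<not> w k < c k * a')" if "a \<in> I" for a w
        unfolding ev_neg[symmetric] ev_imp[symmetric] by (rule I_all[OF that], rule ev_all) (meson less_imp_le)
      have w: "(\<exists>w\<in>I. chM (rel A) b c p w \<and> ev (\<lambda>k. w k < c k * a k) \<and>
            (\<forall>a'\<in>I. ev (\<lambda>k. a' k < a k) \<longrightarrow> \<not> ev (\<lambda>k. w k < c k * a' k))) \<longleftrightarrow>
          ev (\<lambda>k. \<exists>w. ?ch k = enat w \<and> w < c k * a k \<and> (\<forall>a'. a' < a k \<longrightarrow> \<not> w < c k * a'))" if "a \<in> I" for a
      proof -
        have "(\<exists>w\<in>I. chM (rel A) b c p w \<and> ev (\<lambda>k. w k < c k * a k) \<and>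
            (\<forall>a'\<in>I. ev (\<lambda>k. a' k < a k) \<longrightarrow> \<not> ev (\<lambda>k. w k < c k * a' k))) \<longleftrightarrow>
          (\<exists>w\<in>I. ev (\<lambda>k. ?ch k = enat (w k) \<and> w k < c k * a k \<and> (\<forall>a'. a' < a k \<longrightarrow> \<not> w k < c k * a')))"
          unfolding a'[OF that] ev_conj using ch by (simp cong: bex_cong)
        also have "\<dots> \<longleftrightarrow> ev (\<lambda>k. \<exists>w. ?ch k = enat w \<and> w < c k * a k \<and> (\<forall>a'. a' < a k \<longrightarrow> \<not> w < c k * a'))"
          by (rule I_ex[OF I_mult[OF c(1) that]], rule ev_all) (meson less_imp_le)
        finally show ?thesis .
      qed
      have "(\<exists>a\<in>I. ev (\<lambda>k. x k = c k * a k) \<and> (\<exists>w\<in>I. chM (rel A) b c p w \<and> ev (\<lambda>k. w k < c k * a k) \<and>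
            (\<forall>a'\<in>I. ev (\<lambda>k. a' k < a k) \<longrightarrow> \<not> ev (\<lambda>k. w k < c k * a' k)))) \<longleftrightarrow>
         (\<exists>a\<in>I. ev (\<lambda>k. x k = c k * a k \<and> (\<exists>w. ?ch k = enat w \<and> w < c k * a k \<and> (\<forall>a'. a' < a k \<longrightarrow> \<not> w < c k * a'))))"
        unfolding ev_conj using w by (simp cong: bex_cong)
      also have "\<dots> \<longleftrightarrow> ev (\<lambda>k. \<exists>a. x k = c k * a \<and> (\<exists>w. ?ch k = enat w \<and> w < c k * a \<and> (\<forall>a'. a' < a \<longrightarrow> \<not> w < c k * a')))"
      proof (rule I_ex[OF I(4)], rule ev_mono[OF c2], intro allI impI)
        fix k a assume c: "2 \<le> c k" and a: "x k = c k * a \<and> (\<exists>w. ?ch k = enat w \<and> w < c k * a \<and> (\<forall>a'. a' < a \<longrightarrow> \<not> w < c k * a'))"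
        have "1 * a \<le> c k * a" using c by (intro mult_le_mono1) simp
        then have "a \<le> x k" using a by simp
        then show "\<exists>a\<le>x k. x k = c k * a \<and> (\<exists>w. ?ch k = enat w \<and> w < c k * a \<and> (\<forall>a'. a' < a \<longrightarrow> \<not> w < c k * a'))"
          using a by blast
      qed
      also have "\<dots> \<longleftrightarrow> ev (\<lambda>k. \<exists>a. x k = Max (C k) * a \<and>
          change (?u k) (base_of (B k) (p k)) (Max (C k)) (p k) < enat (Max (C k) * a) \<and>
        (\<forall>a'<a. \<not> change (?u k) (base_of (B k) (p k)) (Max (C k)) (p k) < enat (Max (C k) * a')))"
        unfolding ev_iff[symmetric]
      proof (rule ev_mono2[OF b(2) c(2)])
        have w: "(\<exists>w. y = enat w \<and> w < s \<and> (\<forall>a'<a. \<not> w < t a')) \<longleftrightarrow>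
          y < enat s \<and> (\<forall>a'<a. \<not> y < enat (t a'))" for y s a and t :: "nat \<Rightarrow> nat"
          by (cases y) auto
        fix k assume e: "b k = base_of (B k) (p k)" "c k = Max (C k)"
        show "(\<exists>a. x k = c k * a \<and> (\<exists>w. ?ch k = enat w \<and> w < c k * a \<and> (\<forall>a'<a. \<not> w < c k * a'))) =
         (\<exists>a. x k = Max (C k) * a \<and>
          change (?u k) (base_of (B k) (p k)) (Max (C k)) (p k) < enat (Max (C k) * a) \<and>
        (\<forall>a'<a. \<not> change (?u k) (base_of (B k) (p k)) (Max (C k)) (p k) < enat (Max (C k) * a')))"
          unfolding w e ..
      qed
      finally show ?thesis .
    qed
    have two: "(\<exists>j\<in>I. ev (\<lambda>k. 1 \<le> j k) \<and> ev (\<lambda>k. j k \<le> i k) \<and> itM (rel A) b n c j x) \<longleftrightarrow>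
      ev (\<lambda>k. \<exists>j. 1 \<le> j \<and> j \<le> i k \<and> iter_change (?u k) (base_of (B k) (n k)) (n k) (Max (C k)) j = enat (x k))"
      if b: "b \<in> I" "ev (\<lambda>k. b k = base_of (B k) (n k))" for b
    proof -
      have b2: "ev (\<lambda>k. 2 \<le> b k)" by (rule ev_mono[OF b(2)]) (simp add: base_of_ge2[OF B])
      have bn: "ev (\<lambda>k. b k \<le> n k)" by (rule ev_mono2[OF b(2) n(2)]) (simp add: base_of_bounds(2)[OF B])
      have it: "itM (rel A) b n c j x \<longleftrightarrow> ev (\<lambda>k. iter_change (?u k) (b k) (n k) (c k) (j k) = enat (x k))"
        if "j \<in> I" for j
        by (rule itM_eq[where D = "rel A", OF R D b2 bn c2 b(1) I(3) c(1) that I(4)])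
      have "(\<exists>j\<in>I. ev (\<lambda>k. 1 \<le> j k) \<and> ev (\<lambda>k. j k \<le> i k) \<and> itM (rel A) b n c j x) \<longleftrightarrow>
        (\<exists>j\<in>I. ev (\<lambda>k. 1 \<le> j k \<and> j k \<le> i k \<and> iter_change (?u k) (b k) (n k) (c k) (j k) = enat (x k)))"
        unfolding ev_conj by (rule bex_cong[OF refl]) (simp only: it)
      also have "\<dots> \<longleftrightarrow> ev (\<lambda>k. \<exists>j. 1 \<le> j \<and> j \<le> i k \<and> iter_change (?u k) (b k) (n k) (c k) j = enat (x k))"
        by (rule I_ex[OF I(1)], rule ev_all) blast
      also have "\<dots> \<longleftrightarrow> ev (\<lambda>k. \<exists>j. 1 \<le> j \<and> j \<le> i k \<and> iter_change (?u k) (base_of (B k) (n k)) (n k) (Max (C k)) j = enat (x k))"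
        unfolding ev_iff[symmetric] by (rule ev_mono2[OF b(2) c(2)]) simp
      finally show ?thesis .
    qed
    have e1: "\<exists>b\<in>I. ev (\<lambda>k. b k = base_of (B k) (p k))" by (rule bexI[OF _ base_of_I[OF B bd I(2)]]) simp
    have e2: "\<exists>b\<in>I. ev (\<lambda>k. b k = base_of (B k) (n k))" by (rule bexI[OF _ base_of_I[OF B bd I(3)]]) simp
    show ?thesis
      by (rule arg_cong2[where f = "(\<or>)"], rule arg_cong2[where f = "(\<and>)", OF refl], rule ex_const[OF e1],
        erule (1) one, rule arg_cong2[where f = "(\<and>)", OF refl], rule ex_const[OF e2], erule (1) two)
  qed
  have "newM B i C p n x \<longleftrightarrow> ev (\<lambda>k. critical (B k) (n k)) \<and>
     (ev (\<lambda>k. n k \<in> B k) \<and> ev (\<lambda>k. \<exists>a. x k = Max (C k) * a \<and>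
          change (?u k) (base_of (B k) (p k)) (Max (C k)) (p k) < enat (Max (C k) * a) \<and>
        (\<forall>a'<a. \<not> change (?u k) (base_of (B k) (p k)) (Max (C k)) (p k) < enat (Max (C k) * a'))) \<or>
       \<not> ev (\<lambda>k. n k \<in> B k) \<and> ev (\<lambda>k. \<exists>j. 1 \<le> j \<and> j \<le> i k \<and>
         iter_change (?u k) (base_of (B k) (n k)) (n k) (Max (C k)) j = enat (x k)))"
    unfolding newM_def isM
  proof (rule conj_cong[OF refl], rule ex_const[OF bexI[OF _ mxI]], simp, rule ex_const[OF ex_is_up[OF R]])
  qed (rule main)
  then show ?thesis unfolding new_elem_def ev_conj ev_disj ev_neg .
qed

lemma stage_new_elem:
  assumes "Inf B < Suc p"
  shows "x \<in> ouro_stage B i (Suc p) \<longleftrightarrow> x \<in> ouro_stage B i p \<or> new_elem B i (ouro_stage B i p) p (Suc p) x"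
  using assms unfolding new_elem_def ouro_stage.simps(2)[of B i p] Let_def by simp

end

subsection \<open>Refutation of the Goodstein principle\<close>

context den
begin

text \<open>A true existential or a false universal statement has to be evaluated at one witness
  only. The remaining formula is thus never evaluated at sets other than the intended hierarchy and
  sequence, for which the bounds would be missing.\<close>

lemma den_exS_True:
  assumes A: "A \<in> \<S>" and P: "\<And>w' C. hle w w' \<Longrightarrow> cden w' C A \<Longrightarrow> fden w' (P C) True"
  shows "fden w (\<exists>\<^sub>S X. P X) True"
  unfolding fden_def
proof (intro allI impI)
  fix w' assume w: "hle w w'"
  obtain d \<nu> s N where w': "w' = ((d, \<nu>), (s, N))" by (cases w') auto
  let ?C = "\<lambda>t d' s'. Mem (t d') (s' - Suc s)"
  let ?w = "((d, \<nu>), (Suc s, N(s := A)))"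
  have le: "hle w' ?w" by (simp add: w')
  have "cden ?w ?C A"
    unfolding cden_def fden_def
  proof (intro allI impI)
    fix w2 t v w3 assume *: "hle ?w w2" "tden w2 t v" "hle w2 w3"
    obtain d3 \<nu>3 s3 N3 where w3: "w3 = ((d3, \<nu>3), (s3, N3))" by (cases w3) auto
    have "hev w3 t = v" using *(2,3) unfolding tden_def by blast
    moreover have "hle ?w w3" using * hle_trans by blast
    ultimately show "hst w3 (?C t) = ev (\<lambda>k. v k \<in> A k)" by (auto simp: w3 env_def)
  qed
  from P[OF hle_trans[OF w le] this] have "hst ?w (P ?C)" using hle_refl[of ?w] unfolding fden_def by blast
  then have "msat (env d \<nu> e0) (case_nat A (env s N E0)) (P ?C d (Suc s))" by (simp add: env_case)
  then show "hst w' (\<exists>\<^sub>S X. P X) = True" using A by (auto simp: w' xexS_def)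
qed

lemma den_all_True: "(\<And>w' t v. hle w w' \<Longrightarrow> tden w' t v \<Longrightarrow> v \<in> I \<Longrightarrow> fden w' (P t) True) \<Longrightarrow> fden w (\<forall>\<^sub>f x. P x) True"
  using den_all[of w P "\<lambda>_. True"] by simp

lemma den_allS_False:
  assumes A: "A \<in> \<S>" and P: "\<And>w' C. hle w w' \<Longrightarrow> cden w' C A \<Longrightarrow> fden w' (P C) False"
  shows "fden w (\<forall>\<^sub>S X. P X) False"
proof -
  have "fden w (\<exists>\<^sub>S X. \<not>\<^sub>f P X) True"
    by (rule den_exS_True[OF A]) (use den_neg[OF P] in simp)
  then have "fden w (\<not>\<^sub>f (\<exists>\<^sub>S X. \<not>\<^sub>f P X)) False" using den_neg by fastforce
  moreover have "hst w' (\<not>\<^sub>f (\<exists>\<^sub>S X. \<not>\<^sub>f P X)) = hst w' (\<forall>\<^sub>S X. P X)" for w'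
  proof -
    obtain d \<nu> s N where "w' = ((d, \<nu>), (s, N))" by (cases w') auto
    then show ?thesis by (simp add: xneg_def xexS_def xallS_def)
  qed
  ultimately show ?thesis unfolding fden_def by simp
qed

lemma den_all_False:
  assumes v: "v \<in> I" and P: "\<And>w' t. hle w w' \<Longrightarrow> tden w' t v \<Longrightarrow> fden w' (P t) False"
  shows "fden w (\<forall>\<^sub>f x. P x) False"
  unfolding fden_def
proof (intro allI impI)
  fix w' assume w: "hle w w'"
  obtain d \<nu> s N where w': "w' = ((d, \<nu>), (s, N))" by (cases w') auto
  let ?t = "\<lambda>d'. Var (d' - Suc d)"
  let ?w = "((Suc d, \<nu>(d := v)), (s, N))"
  have le: "hle w' ?w" by (simp add: w')
  have "tden ?w ?t v"
    unfolding tden_def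
  proof (intro allI impI)
    fix w2 assume "hle ?w w2"
    then show "hev w2 ?t = v" by (cases w2) (auto simp: env_def meval_def)
  qed
  from P[OF hle_trans[OF w le] this] have "\<not> hst ?w (P ?t)" using hle_refl[of ?w] unfolding fden_def by blast
  then have "\<not> msat (case_nat v (env d \<nu> e0)) (env s N E0) (P ?t (Suc d) s)" by (simp add: env_case)
  then show "hst w' (\<forall>\<^sub>f x. P x) = False" using v by (auto simp: w' xall_def)
qed

lemma den_conj_True: "fden w p True \<Longrightarrow> fden w q True \<Longrightarrow> fden w (p \<and>\<^sub>f q) True"
  using den_conj[of w p True q True] by simp

lemma den_imp_False: "fden w p True \<Longrightarrow> fden w q False \<Longrightarrow> fden w (p \<longrightarrow>\<^sub>f q) False"
  using den_imp[of w p True q False] by simp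

lemma fden_TrueI: "fden w p P \<Longrightarrow> P \<Longrightarrow> fden w p True"
  by simp

end

locale goodstein_cut = powers \<U> I \<S> e0 E0 + ouro_hierarchies B0
  for \<U> I \<S> e0 E0 B0 +
  fixes n0 :: "nat \<Rightarrow> nat"
  assumes n0: "n0 \<in> I"
    and S_H: "(\<lambda>_. {pr i x | i x. x \<in> Bs i}) \<in> \<S>"
    and S_Z: "i \<in> I \<Longrightarrow> (\<lambda>k. {pr n x | n x. x \<in> ouro_stage (Bs (i k)) (Suc (i k)) n}) \<in> \<S>"
    and S_W: "(\<lambda>k. {pr i x | i x. goodstein Bs (n0 k) i = enat x}) \<in> \<S>"
    and rich_seq: "i \<in> I \<Longrightarrow> rich (\<lambda>k. Bs (i k)) (\<lambda>k. Bs (Suc (i k)))"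
    and rich_stage: "i \<in> I \<Longrightarrow> p \<in> I \<Longrightarrow> rich (\<lambda>k. Bs (i k)) (\<lambda>k. ouro_stage (Bs (i k)) (Suc (i k)) (p k))"
    and pos: "i \<in> I \<Longrightarrow> ev (\<lambda>k. 0 < good (n0 k) (i k))"
begin

lemma stage_bounded:
  assumes "i \<in> I" "p \<in> I"
  shows "\<exists>mx\<in>I. ev (\<lambda>k. \<forall>y. y \<in> ouro_stage (Bs (i k)) (Suc (i k)) (p k) \<longrightarrow> y \<le> mx k)"
proof
  show "ev (\<lambda>k. \<forall>y. y \<in> ouro_stage (Bs (i k)) (Suc (i k)) (p k) \<longrightarrow>
    y \<le> (ff ^^ (p k * p k * (i k + 2))) (Inf (Bs (i k)) + 1))"
  proof (rule ev_all, intro allI impI)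
    fix k y assume "y \<in> ouro_stage (Bs (i k)) (Suc (i k)) (p k)"
    from level.stage_bound[OF this] show "y \<le> (ff ^^ (p k * p k * (i k + 2))) (Inf (Bs (i k)) + 1)" by simp
  qed
  show "(\<lambda>k. (ff ^^ (p k * p k * (i k + 2))) (Inf (Bs (i k)) + 1)) \<in> I"
    by (rule I_ff[OF I_add[OF Inf_I[OF rich_seq[OF assms(1)]] I_const]]) (intro I_mult I_add assms I_const)
qed

lemma den_stages:
  assumes "cden w B' (\<lambda>k. Bs (i k))" "tden w t (\<lambda>k. i k + 1)" "i \<in> I"
    "cden w Z' (\<lambda>k. {pr n x | n x. x \<in> ouro_stage (Bs (i k)) (Suc (i k)) n})"
  shows "fden w (xis_ouro_stages B' t Z') True"
proof (rule fden_TrueI)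
  let ?Z = "\<lambda>k. {pr n x | n x. x \<in> ouro_stage (Bs (i k)) (Suc (i k)) n}"
  let ?i = "\<lambda>k. i k + 1"
  have iI: "?i \<in> I" by (intro I_add assms I_const)
  have B: "\<And>k. ok (Bs (i k))" by (rule ouro_seq_ok[OF B0])
  have relZ: "rel ?Z n x \<longleftrightarrow> ev (\<lambda>k. x k \<in> ouro_stage (Bs (i k)) (Suc (i k)) (n k))" for n x
    unfolding rel_def pr_graph ..
  have secZ: "(\<lambda>k. {y. pr (p k) y \<in> ?Z k}) = (\<lambda>k. ouro_stage (Bs (i k)) (Suc (i k)) (p k))" for p
    unfolding pr_graph by simp
  have new: "fden w' (xnew_base B' t (xapp Z' p) p n x)
     (newM (\<lambda>k. Bs (i k)) ?i (\<lambda>k. ouro_stage (Bs (i k)) (Suc (i k)) (b k)) b c v)"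
    if h: "hle w w'" "tden w' p b" "tden w' n c" "tden w' x v" "b \<in> I" "c \<in> I" "v \<in> I" for w' p n x b c v
  proof -
    obtain mx where mx: "mx \<in> I" "ev (\<lambda>k. \<forall>y. y \<in> ouro_stage (Bs (i k)) (Suc (i k)) (b k) \<longrightarrow> y \<le> mx k)"
      using stage_bounded[OF assms(3) h(5)] by blast
    show ?thesis
      by (rule den_new_base[OF cden_mono[OF assms(1) h(1)] _ tden_mono[OF assms(2) h(1)] h(2-4) iI h(5-7)
          rich_stage[OF assms(3) h(5)] mx])
        (use den_section[OF cden_mono[OF assms(4) h(1)] h(2,5)] in \<open>simp only: secZ\<close>)
  qed
  let ?P = "\<lambda>m. \<forall>n\<in>I. \<forall>x\<in>I. rel ?Z n x \<longleftrightarrow> (ev (\<lambda>k. n k \<le> m k) \<and> ev (\<lambda>k. x k = m k + 1)) \<or>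
    (ev (\<lambda>k. m k < n k) \<and> (\<exists>p\<in>I. ev (\<lambda>k. n k = p k + 1) \<and> (rel ?Z p x \<or>
      newM (\<lambda>k. Bs (i k)) ?i (\<lambda>k. ouro_stage (Bs (i k)) (Suc (i k)) (p k)) p n x)))"
  show "fden w (xis_ouro_stages B' t Z')
    (\<exists>m\<in>I. ev (\<lambda>k. m k \<in> Bs (i k) \<and> (\<forall>y. y \<in> Bs (i k) \<longrightarrow> m k \<le> y)) \<and> ?P m)"
    unfolding xis_ouro_stages_def using assms(1,2,4)
    by - (assumption | rule den_rules den_xapp den_min new I_rules | erule den_back)+
  have PI: "?P (\<lambda>k. Inf (Bs (i k)))"
  proof (intro ballI)
    fix n x assume I: "n \<in> I" "x \<in> I"
    show "rel ?Z n x \<longleftrightarrow> (ev (\<lambda>k. n k \<le> Inf (Bs (i k))) \<and> ev (\<lambda>k. x k = Inf (Bs (i k)) + 1)) \<or>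
     (ev (\<lambda>k. Inf (Bs (i k)) < n k) \<and> (\<exists>p\<in>I. ev (\<lambda>k. n k = p k + 1) \<and> (rel ?Z p x \<or>
      newM (\<lambda>k. Bs (i k)) ?i (\<lambda>k. ouro_stage (Bs (i k)) (Suc (i k)) (p k)) p n x)))"
    proof (cases "ev (\<lambda>k. n k \<le> Inf (Bs (i k)))")
      case True
      have "rel ?Z n x \<longleftrightarrow> ev (\<lambda>k. x k = Inf (Bs (i k)) + 1)"
        unfolding relZ ev_iff[symmetric] by (rule ev_mono[OF True]) (simp add: level.S_small)
      moreover have "\<not> ev (\<lambda>k. Inf (Bs (i k)) < n k)" using True unfolding not_le[symmetric] ev_neg by blast
      ultimately show ?thesis using True by blast
    next
      case False
      then have n: "ev (\<lambda>k. Inf (Bs (i k)) < n k)" unfolding not_le[symmetric] ev_neg .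
      have pI: "(\<lambda>k. n k - 1) \<in> I" by (rule I_le[OF I(1)]) simp
      have np: "ev (\<lambda>k. n k = (n k - 1) + 1)" by (rule ev_mono[OF n]) simp
      have "(rel ?Z p x \<or> newM (\<lambda>k. Bs (i k)) ?i (\<lambda>k. ouro_stage (Bs (i k)) (Suc (i k)) (p k)) p n x) = rel ?Z n x"
        if p: "p \<in> I" "ev (\<lambda>k. n k = p k + 1)" for p
      proof -
        obtain mx where mx: "mx \<in> I" "ev (\<lambda>k. \<forall>y. y \<in> ouro_stage (Bs (i k)) (Suc (i k)) (p k) \<longrightarrow> y \<le> mx k)"
          using stage_bounded[OF assms(3) p(1)] by blast
        show ?thesis
          unfolding newM_eq[OF rich_stage[OF assms(3) p(1)] mx iI p(1) I p(2) n] relZ ev_disj[symmetric] ev_iff[symmetric]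
        proof (rule ev_mono2[OF n p(2)])
          fix k assume *: "Inf (Bs (i k)) < n k" "n k = p k + 1"
          then have "Inf (Bs (i k)) < Suc (p k)" by simp
          from stage_new_elem[OF this, of "x k" "Suc (i k)"] show
            "(x k \<in> ouro_stage (Bs (i k)) (Suc (i k)) (p k) \<or>
              new_elem (Bs (i k)) (i k + 1) (ouro_stage (Bs (i k)) (Suc (i k)) (p k)) (p k) (n k) (x k)) =
             (x k \<in> ouro_stage (Bs (i k)) (Suc (i k)) (n k))" using *(2) by simp
        qed
      qed
      then have "(\<exists>p\<in>I. ev (\<lambda>k. n k = p k + 1) \<and> (rel ?Z p x \<or>
        newM (\<lambda>k. Bs (i k)) ?i (\<lambda>k. ouro_stage (Bs (i k)) (Suc (i k)) (p k)) p n x)) \<longleftrightarrow> rel ?Z n x"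
        by (intro ex_const bexI[OF _ pI] np)
      then show ?thesis using n False by blast
    qed
  qed
  show "\<exists>m\<in>I. ev (\<lambda>k. m k \<in> Bs (i k) \<and> (\<forall>y. y \<in> Bs (i k) \<longrightarrow> m k \<le> y)) \<and> ?P m"
    unfolding min_Inf[OF B]
  proof (rule bexI[where x = "\<lambda>k. Inf (Bs (i k))"], rule conjI)
    show "ev (\<lambda>k. Inf (Bs (i k)) = Inf (Bs (i k)))" by simp
  qed (rule PI Inf_I[OF rich_seq[OF assms(3)]])+
qed

abbreviation "Hs \<equiv> \<lambda>_ :: nat. {pr i x | i x. x \<in> Bs i}"
abbreviation "Ws \<equiv> \<lambda>k. {pr i x | i x. goodstein Bs (n0 k) i = enat x}"

lemma rel_H: "rel Hs i x \<longleftrightarrow> ev (\<lambda>k. x k \<in> Bs (i k))"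
  unfolding rel_def pr_graph ..

lemma rel_W: "rel Ws i x \<longleftrightarrow> ev (\<lambda>k. goodstein Bs (n0 k) (i k) = enat (x k))"
  unfolding rel_def pr_graph ..

lemma section_H: "cden w H' Hs \<Longrightarrow> tden w t i \<Longrightarrow> i \<in> I \<Longrightarrow> cden w (xapp H' t) (\<lambda>k. Bs (i k))"
  using den_section[of w H' Hs t i] unfolding pr_graph by simp

lemma den_seq:
  assumes X: "cden w X' (\<lambda>_. B0)" and H: "cden w H' Hs"
  shows "fden w (xis_ouro_seq X' H') True"
  unfolding xis_ouro_seq_def
proof (rule den_conj_True[OF den_all_True den_all_True])
  fix w' t v assume w: "hle w w'" "tden w' t v" "v \<in> I"
  have "fden w' (xapp H' 0\<^sub>f t \<longleftrightarrow>\<^sub>f X' t) (rel Hs (\<lambda>_. 0) v \<longleftrightarrow> ev (\<lambda>k. v k \<in> B0))"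
    by (intro den_iff den_xapp[OF cden_mono[OF H w(1)] den_zero w(2) I_zero w(3)] den_app[OF cden_mono[OF X w(1)] w(2,3)])
  then show "fden w' (xapp H' 0\<^sub>f t \<longleftrightarrow>\<^sub>f X' t) True" by (rule fden_TrueI) (simp add: rel_H)
next
  fix w' t i assume w: "hle w w'" "tden w' t i" "i \<in> I"
  note H' = cden_mono[OF H w(1)]
  let ?i = "\<lambda>k. i k + 1"
  have i1: "?i \<in> I" "tden w' (t +\<^sub>f 1\<^sub>f) ?i" by (intro I_add w I_const, intro den_add w den_one)
  show "fden w' (\<exists>\<^sub>S Z. xis_ouro_stages (xapp H' t) (t +\<^sub>f 1\<^sub>f) Z \<and>\<^sub>f
      (\<forall>\<^sub>f x. xapp H' (t +\<^sub>f 1\<^sub>f) x \<longleftrightarrow>\<^sub>f (\<exists>\<^sub>f n. xapp Z n x))) True"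
  proof (rule den_exS_True[OF S_Z[OF w(3)]], rule den_conj_True)
    fix w2 Z assume Z: "hle w' w2" "cden w2 Z (\<lambda>k. {pr n x | n x. x \<in> ouro_stage (Bs (i k)) (Suc (i k)) n})"
    show "fden w2 (xis_ouro_stages (xapp H' t) (t +\<^sub>f 1\<^sub>f) Z) True"
      by (rule den_stages[OF cden_mono[OF section_H[OF H' w(2,3)] Z(1)] tden_mono[OF i1(2) Z(1)] w(3) Z(2)])
    let ?Z = "\<lambda>k. {pr n x | n x. x \<in> ouro_stage (Bs (i k)) (Suc (i k)) n}"
    have "fden w2 (\<forall>\<^sub>f x. xapp H' (t +\<^sub>f 1\<^sub>f) x \<longleftrightarrow>\<^sub>f (\<exists>\<^sub>f n. xapp Z n x))
      (\<forall>x\<in>I. rel Hs ?i x \<longleftrightarrow> (\<exists>n\<in>I. rel ?Z n x))"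
      using cden_mono[OF H' Z(1)] tden_mono[OF i1(2) Z(1)] i1(1) Z(2)
      by - (assumption | rule den_all den_ex den_iff den_xapp | erule den_back)+
    then show "fden w2 (\<forall>\<^sub>f x. xapp H' (t +\<^sub>f 1\<^sub>f) x \<longleftrightarrow>\<^sub>f (\<exists>\<^sub>f n. xapp Z n x)) True"
    proof (rule fden_TrueI, intro ballI)
      fix x assume x: "x \<in> I"
      have "(\<exists>n\<in>I. ev (\<lambda>k. x k \<in> ouro_stage (Bs (i k)) (Suc (i k)) (n k))) \<longleftrightarrow>
        ev (\<lambda>k. \<exists>n. x k \<in> ouro_stage (Bs (i k)) (Suc (i k)) n)"
      proof (rule I_ex[OF x], rule ev_all, intro allI impI)
        fix k n assume "x k \<in> ouro_stage (Bs (i k)) (Suc (i k)) n"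
        then have "x k \<in> ouro (Bs (i k)) (Suc (i k))" unfolding ouro_def by blast
        from level.ouro_stage_bound[OF this] show "\<exists>n\<le>x k. x k \<in> ouro_stage (Bs (i k)) (Suc (i k)) n" by blast
      qed
      then show "rel Hs ?i x \<longleftrightarrow> (\<exists>n\<in>I. rel ?Z n x)"
        unfolding rel_H unfolding rel_def pr_graph by (simp add: ouro_def)
    qed
  qed
qed

lemma den_goodstein:
  assumes H: "cden w H' Hs" and n: "tden w t n0" and W: "cden w W' Ws"
  shows "fden w (xis_goodstein H' t W') True"
  unfolding xis_goodstein_def
proof (rule den_conj_True[OF den_all_True den_all_True[OF den_all_True]])
  fix w' s v assume w: "hle w w'" "tden w' s v" "v \<in> I"
  have "fden w' (xapp W' 0\<^sub>f s \<longleftrightarrow>\<^sub>f s =\<^sub>f t) (rel Ws (\<lambda>_. 0) v \<longleftrightarrow> ev (\<lambda>k. v k = n0 k))"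
    by (intro den_iff den_eq den_xapp[OF cden_mono[OF W w(1)] den_zero w(2) I_zero w(3)] w(2) tden_mono[OF n w(1)])
  then show "fden w' (xapp W' 0\<^sub>f s \<longleftrightarrow>\<^sub>f s =\<^sub>f t) True"
    
    by (rule fden_TrueI) (unfold rel_W, simp add: eq_commute)
next
  fix w1 s i w2 x v assume w: "hle w w1" "tden w1 s i" "i \<in> I" "hle w1 w2" "tden w2 x v" "v \<in> I"
  let ?i = "\<lambda>k. i k + 1" and ?v = "\<lambda>k. v k + 1"
  note H2 = cden_mono[OF H hle_trans[OF w(1,4)]] and W2 = cden_mono[OF W hle_trans[OF w(1,4)]] and s2 = tden_mono[OF w(2,4)]
  have i1: "?i \<in> I" "tden w2 (s +\<^sub>f 1\<^sub>f) ?i" by (intro I_add w I_const, intro den_add s2 den_one)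
  have v1: "?v \<in> I" by (intro I_add w I_const)
  have Bi: "cden w2 (xapp H' s) (\<lambda>k. Bs (i k))" by (rule section_H[OF H2 s2 w(3)])
  have Bi1: "cden w2 (xapp H' (s +\<^sub>f 1\<^sub>f)) (\<lambda>k. Bs (Suc (i k)))" using section_H[OF H2 i1(2,1)] by simp
  have "fden w2 (xapp W' (s +\<^sub>f 1\<^sub>f) x \<longleftrightarrow>\<^sub>f (\<exists>\<^sub>f k. xapp W' s k \<and>\<^sub>f
        ((k =\<^sub>f 0\<^sub>f \<and>\<^sub>f x =\<^sub>f 0\<^sub>f) \<or>\<^sub>f
         (0\<^sub>f <\<^sub>f k \<and>\<^sub>f (\<exists>\<^sub>S U. xis_upgrade (xapp H' s) (xapp H' (s +\<^sub>f 1\<^sub>f)) U \<and>\<^sub>f xapp U k (x +\<^sub>f 1\<^sub>f))))))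
     (rel Ws ?i v \<longleftrightarrow> (\<exists>y\<in>I. rel Ws i y \<and> ((ev (\<lambda>k. y k = 0) \<and> ev (\<lambda>k. v k = 0)) \<or>
        (ev (\<lambda>k. 0 < y k) \<and> (\<exists>A\<in>\<S>. is_up (\<lambda>k. Bs (i k)) (\<lambda>k. Bs (Suc (i k))) A \<and> rel A y ?v)))))"
    using Bi Bi1 W2 s2 i1 w(3,5,6) v1
    by - (assumption | rule den_rules den_xapp den_is_upgrade[OF _ _ _ rich_seq] I_rules | erule den_back)+
  then show "fden w2 (xapp W' (s +\<^sub>f 1\<^sub>f) x \<longleftrightarrow>\<^sub>f (\<exists>\<^sub>f k. xapp W' s k \<and>\<^sub>f
        ((k =\<^sub>f 0\<^sub>f \<and>\<^sub>f x =\<^sub>f 0\<^sub>f) \<or>\<^sub>f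
         (0\<^sub>f <\<^sub>f k \<and>\<^sub>f (\<exists>\<^sub>S U. xis_upgrade (xapp H' s) (xapp H' (s +\<^sub>f 1\<^sub>f)) U \<and>\<^sub>f xapp U k (x +\<^sub>f 1\<^sub>f)))))) True"
  proof (rule fden_TrueI)
    have up: "(\<exists>A\<in>\<S>. is_up (\<lambda>k. Bs (i k)) (\<lambda>k. Bs (Suc (i k))) A \<and> rel A y ?v) \<longleftrightarrow>
      ev (\<lambda>k. up (i k) (y k) = v k + 1)" if y: "y \<in> I" for y
    proof (rule ex_const[OF ex_is_up[OF rich_seq[OF w(3)]]])
      fix A assume A: "is_up (\<lambda>k. Bs (i k)) (\<lambda>k. Bs (Suc (i k))) A"
      note A[unfolded is_up_def, THEN bspec, OF y, THEN bspec, OF v1]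
      then show "rel A y ?v \<longleftrightarrow> ev (\<lambda>k. up (i k) (y k) = v k + 1)" unfolding upgrade_up enat.inject .
    qed
    have up0: "up i 0 = 0" for i using level.vv_small[of 0 i] level.b02(1)[of i] by (simp add: up_def)
    have "(\<exists>y\<in>I. rel Ws i y \<and> ((ev (\<lambda>k. y k = 0) \<and> ev (\<lambda>k. v k = 0)) \<or>
        (ev (\<lambda>k. 0 < y k) \<and> (\<exists>A\<in>\<S>. is_up (\<lambda>k. Bs (i k)) (\<lambda>k. Bs (Suc (i k))) A \<and> rel A y ?v)))) \<longleftrightarrow>
      (\<exists>y\<in>I. ev (\<lambda>k. good (n0 k) (i k) = y k \<and> (y k = 0 \<and> v k = 0 \<or> 0 < y k \<and> up (i k) (y k) = v k + 1)))"
      unfolding rel_W unfolding good enat.inject ev_conj ev_disj using up by (simp cong: bex_cong)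
    also have "\<dots> \<longleftrightarrow> ev (\<lambda>k. \<exists>y. good (n0 k) (i k) = y \<and> (y = 0 \<and> v k = 0 \<or> 0 < y \<and> up (i k) y = v k + 1))"
    \<comment> \<open>The preceding value is at most its upgrade \<open>v + 1\<close>. So a value in
      \<open>I\<close> never comes from one outside \<open>I\<close>, and cutting the sequence off
      at \<open>I\<close> preserves its recursion.\<close>
    proof (rule I_ex[OF v1], rule ev_all, intro allI impI)
      fix k y assume *: "good (n0 k) (i k) = y \<and> (y = 0 \<and> v k = 0 \<or> 0 < y \<and> up (i k) y = v k + 1)"
      then have "y \<le> v k + 1" using up_ge[of y "i k"] by auto
      then show "\<exists>y\<le>v k + 1. good (n0 k) (i k) = y \<and> (y = 0 \<and> v k = 0 \<or> 0 < y \<and> up (i k) y = v k + 1)" using * by blast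
    qed
    also have "\<dots> \<longleftrightarrow> rel Ws ?i v"
      unfolding rel_W unfolding good enat.inject
    proof (rule arg_cong[where f = ev], rule ext)
      fix k
      have "0 < good (n0 k) (i k) \<Longrightarrow> 0 < up (i k) (good (n0 k) (i k))"
        using up_ge[of "good (n0 k) (i k)" "i k"] by simp
      then show "(\<exists>y. good (n0 k) (i k) = y \<and> (y = 0 \<and> v k = 0 \<or> 0 < y \<and> up (i k) y = v k + 1)) = (good (n0 k) (i k + 1) = v k)"
        by (cases "good (n0 k) (i k) = 0") (auto simp: good_Suc up0)
    qed
    finally show "rel Ws ?i v \<longleftrightarrow> (\<exists>y\<in>I. rel Ws i y \<and> ((ev (\<lambda>k. y k = 0) \<and> ev (\<lambda>k. v k = 0)) \<or>
        (ev (\<lambda>k. 0 < y k) \<and> (\<exists>A\<in>\<S>. is_up (\<lambda>k. Bs (i k)) (\<lambda>k. Bs (Suc (i k))) A \<and> rel A y ?v))))" by (rule sym)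
  qed
qed

text \<open>The hierarchy and the sequence are given as internal sets. In \<open>I\<close> the
  sequence may lack a value at some index, but where it has one it is not 0, and this already
  refutes the conclusion.\<close>

lemma den_principle:
  assumes X: "cden w X' (\<lambda>_. B0)"
  shows "fden w (xgoodstein_principle X') False"
  unfolding xgoodstein_principle_def
proof (rule den_allS_False[OF S_H], rule den_imp_False)
  fix w1 H assume H: "hle w w1" "cden w1 H Hs"
  show "fden w1 (xis_ouro_seq X' H) True" by (rule den_seq[OF cden_mono[OF X H(1)] H(2)])
  show "fden w1 (\<forall>\<^sub>f n. \<forall>\<^sub>S W. xis_goodstein H n W \<longrightarrow>\<^sub>f (\<exists>\<^sub>f i. xapp W i 0\<^sub>f)) False"
  proof (rule den_all_False[OF n0], rule den_allS_False[OF S_W], rule den_imp_False)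
    fix w2 t w3 W assume w: "hle w1 w2" "tden w2 t n0" "hle w2 w3" "cden w3 W Ws"
    show "fden w3 (xis_goodstein H t W) True"
      by (rule den_goodstein[OF cden_mono[OF H(2) hle_trans[OF w(1,3)]] tden_mono[OF w(2,3)] w(4)])
    have "fden w3 (\<exists>\<^sub>f i. xapp W i 0\<^sub>f) (\<exists>i\<in>I. rel Ws i (\<lambda>_. 0))"
      using w(4) I_zero by - (assumption | rule den_ex den_xapp den_zero | erule den_back)+
    moreover have "\<not> rel Ws i (\<lambda>_. 0)" if "i \<in> I" for i
      unfolding rel_W unfolding good enat.inject using pos[OF that] unfolding neq0_conv[symmetric] ev_neg .
    ultimately show "fden w3 (\<exists>\<^sub>f i. xapp W i 0\<^sub>f) False" by (simp cong: bex_cong)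
  qed
qed

lemma not_msat_principle: "\<not> msat e0 (case_nat (\<lambda>_. B0) E0) goodstein_principle"
proof -
  let ?C = "\<lambda>t d s. Mem (t d) (s - 1)" and ?w = "((0, \<lambda>_ _. 0), (1, \<lambda>_ _. B0)) :: hworld"
  have "cden ?w ?C (\<lambda>_. B0)"
    unfolding cden_def fden_def
  proof (intro allI impI)
    fix w2 t v w3 assume *: "hle ?w w2" "tden w2 t v" "hle w2 w3"
    obtain d3 \<nu>3 s3 N3 where w3: "w3 = ((d3, \<nu>3), (s3, N3))" by (cases w3) auto
    have "hev w3 t = v" using *(2,3) unfolding tden_def by blast
    moreover have "hle ?w w3" using * hle_trans by blast
    ultimately show "hst w3 (?C t) = ev (\<lambda>k. v k \<in> B0)" by (auto simp: w3 env_def)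
  qed
  from den_principle[OF this] hle_refl[of ?w] have "\<not> hst ?w (xgoodstein_principle ?C)" unfolding fden_def by blast
  moreover have "env 0 (\<lambda>_ _. 0) e0 = e0" "env 1 (\<lambda>_ _. B0) E0 = case_nat (\<lambda>_. B0) E0"
    by (auto simp: env_def fun_eq_iff split: nat.splits)
  ultimately show ?thesis by (simp add: goodstein_principle_def)
qed

end

section \<open>Unprovability\<close>

theorem theorem8p13:
  fixes B0 :: "nat set" and \<theta> :: fm
  assumes "base_hierarchy B0"
    and "\<not> (\<exists>c\<ge>2. \<forall>b\<in>B0. next_base B0 b \<le> min (enat (b\<^sup>2)) (enat (b * c)))"
    and "true_pi1 \<theta> B0"
  shows "\<not> ACA0 \<turnstile> Imp \<theta> goodstein_principle"
proof
  assume prov: "ACA0 \<turnstile> Imp \<theta> goodstein_principle"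
  have ok: "ok B0"
  proof -
    have "2 \<le> x" if "x \<in> B0" for x
    proof -
      have "x \<noteq> 0" "x \<noteq> 1" using that assms(1) by (auto simp: base_hierarchy_def)
      then show ?thesis by linarith
    qed
    then show ?thesis using assms(1) by (auto simp: base_hierarchy_def ok_def)
  qed
  interpret G: ouro_hierarchies B0 by unfold_locales (rule ok)
  \<comment> \<open>Of the \<open>2 * k\<close> exponentials, \<open>k\<close> are spent on
    sparseness for \<open>hyp k\<close>, and \<open>k\<close> are left for the \<open>k\<close>
    thinnings.\<close>
  have "\<exists>n m t A. n \<le> 2 * m \<and> (\<forall>j<t. 0 < G.good n j) \<and> set A \<subseteq> {m..<t} \<and> inc A \<and>
      large (tower k) A \<and> sparse (hyp k) A" for k
  proof -
    obtain n m t where nm: "n \<le> 2 * m" "large (tower (k + k)) [m..<t]" "\<forall>j<t. 0 < G.good n j"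
      using G.long_goodstein[OF assms(2), of "k + k"] by blast
    have "inc [m..<t]" by (simp add: inc_def)
    from sparsify_tower[OF nm(2) this] show ?thesis using nm(1,3) by (auto simp del: hyp.simps)
  qed
  then obtain n m t A where A: "\<And>k. n k \<le> 2 * m k" "\<And>k j. j < t k \<Longrightarrow> 0 < G.good (n k) j"
    "\<And>k. set (A k) \<subseteq> {m k..<t k}" "\<And>k. inc (A k)" "\<And>k :: nat. large (tower k) (A k)" "\<And>k. sparse (hyp k) (A k)"
    by metis
  \<comment> \<open>\<open>z\<close> codes a stage \<open>i\<close> and what the \<open>i\<close>-th hierarchy is upgraded to: its successor (second component 0)
    or the stage \<open>p\<close> of the successor (second component \<open>p + 1\<close>).\<close>
  define Bz where "Bz z = ouro_seq B0 (fst (prod_decode z))" for z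
  define Cz where "Cz z = (case snd (prod_decode z) of 0 \<Rightarrow> ouro_seq B0 (Suc (fst (prod_decode z))) |
     Suc p \<Rightarrow> ouro_stage (Bz z) (Suc (fst (prod_decode z))) p)" for z
  have Bz_Cz_simps: "Bz (prod_encode (i, x)) = ouro_seq B0 i"
    "Cz (prod_encode (i, 0)) = ouro_seq B0 (Suc i)"
    "Cz (prod_encode (i, x + 1)) = ouro_stage (ouro_seq B0 i) (Suc i) x" for i x
    unfolding Bz_def Cz_def prod_encode_inverse by simp_all
  \<comment> \<open>One family holds the sets that the formulas require as witnesses, each with its
    parameters in the code: hierarchy, stages, Goodstein sequences, powers, upgrades, changes of
    base and their iterations. Parameters in \<open>I\<close> then give internal sets.\<close>
  define R where "R z = (case prod_decode z of (oper, e) \<Rightarrow>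
     if oper = 0 then B0
     else if oper = 1 then {pr i x | i x. x \<in> ouro_seq B0 i}
     else if oper = 2 then {pr n x | n x. x \<in> ouro_stage (ouro_seq B0 e) (Suc e) n}
     else if oper = 3 then {pr i x | i x. goodstein (ouro_seq B0) e i = enat x}
     else if oper = 4 then {pr j v | j v. v = e ^ j}
     else if oper = 5 then {pr n v | n v. upgrade (Bz e) (Cz e) n = enat v}
     else if oper = 6 then (case prod_decode e of (z, bc) \<Rightarrow> case prod_decode bc of (b, c) \<Rightarrow>
       chgraph (upgrade (Bz z) (Cz z)) b c)
     else (case prod_decode e of (z, bc) \<Rightarrow> case prod_decode bc of (b, nc) \<Rightarrow> case prod_decode nc of (n, c) \<Rightarrow>
       {pr j x | j x. iter_change (upgrade (Bz z) (Cz z)) b n c j = enat x}))" for z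
  have R_simps:
    "R (prod_encode (0, e)) = B0"
    "R (prod_encode (1, e)) = {pr i x | i x. x \<in> ouro_seq B0 i}"
    "R (prod_encode (2, e)) = {pr n x | n x. x \<in> ouro_stage (ouro_seq B0 e) (Suc e) n}"
    "R (prod_encode (3, e)) = {pr i x | i x. goodstein (ouro_seq B0) e i = enat x}"
    "R (prod_encode (4, e)) = {pr j v | j v. v = e ^ j}"
    "R (prod_encode (5, e)) = {pr n v | n v. upgrade (Bz e) (Cz e) n = enat v}"
    "R (prod_encode (6, prod_encode (z, prod_encode (b, c)))) = chgraph (upgrade (Bz z) (Cz z)) b c"
    "R (prod_encode (7, prod_encode (z, prod_encode (b, prod_encode (n, c))))) =
      {pr j x | j x. iter_change (upgrade (Bz z) (Cz z)) b n c j = enat x}" for e z b n c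
    unfolding R_def prod_encode_inverse by simp_all
  obtain \<U> where U: "ultrafilter \<U>" using ex_ultrafilter by blast
  interpret L: large_sets \<U> A R
    by (intro large_sets.intro large_sets_axioms.intro U A)
  have R_in: "(\<lambda>k. R (prod_encode (c, e k))) \<in> L.\<S>" if "e \<in> L.I" for c e
    by (rule L.R_in_S[OF L.code_I[OF that]])
  interpret D: powers \<U> L.I L.\<S> "\<lambda>_ _. 0" "\<lambda>_ _. B0"
  proof
    show "(\<lambda>k. {pr e v | e v. v = b k ^ e}) \<in> L.\<S>" if "b \<in> L.I" for b
      using R_in[OF that, of 4] unfolding R_simps .
  qed
  \<comment> \<open>The least base grows by 1 with each stage, so it is in the cut if the stage
    is.\<close>
  have Inf_Bz: "Inf (ouro_seq B0 i) = Inf B0 + i" for i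
    by (induction i) (use G.level.Inf_ouro in simp_all)
  have Rich: "D.rich (\<lambda>k. Bz (z k)) (\<lambda>k. Cz (z k))" if z: "z \<in> L.I" for z
    unfolding D.rich_def
  proof (intro conjI allI ballI bexI)
    have okB: "ok (Bz z)" for z by (simp add: Bz_def ouro_seq_ok[OF ok])
    show "ok (Bz (z k))" for k by (rule okB)
    show "ok (Cz (z k))" for k
      using ouro_seq_ok[OF ok, of "Suc (fst (prod_decode (z k)))"] stage_ok[OF okB]
      unfolding Cz_def by (simp split: nat.split)
    show "L.ev (\<lambda>k. Inf (Bz (z k)) \<in> Bz (z k))" by (rule L.ev_all) (simp add: ok_min(2)[OF okB])
    show "(\<lambda>k. Inf (Bz (z k))) \<in> L.I"
    proof (rule L.I_le)
      show "(\<lambda>k. Inf B0 + z k) \<in> L.I" by (rule L.I_add[OF L.I_const z])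
      show "Inf (Bz (z k)) \<le> Inf B0 + z k" for k
        using le_prod_encode_1[of "fst (prod_decode (z k))" "snd (prod_decode (z k))"]
        by (simp add: Bz_def Inf_Bz)
    qed
    show "(\<lambda>k. {pr n v | n v. upgrade (Bz (z k)) (Cz (z k)) n = enat v}) \<in> L.\<S>"
      using R_in[OF z, of 5] unfolding R_simps .
    show "(\<lambda>k. chgraph (upgrade (Bz (z k)) (Cz (z k))) (b k) (c k)) \<in> L.\<S>" if "b \<in> L.I" "c \<in> L.I" for b c
      using R_in[OF L.I_encode[OF z L.I_encode[OF that]], of 6] unfolding R_simps .
    show "(\<lambda>k. {pr j x | j x. iter_change (upgrade (Bz (z k)) (Cz (z k))) (b k) (n k) (c k) j = enat x}) \<in> L.\<S>"
      if "b \<in> L.I" "n \<in> L.I" "c \<in> L.I" for b n c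
      using R_in[OF L.I_encode[OF z L.I_encode[OF that(1) L.I_encode[OF that(2,3)]]], of 7] unfolding R_simps .
  qed
  interpret C: goodstein_cut \<U> L.I L.\<S> "\<lambda>_ _. 0" "\<lambda>_ _. B0" B0 n
  proof
    show "n \<in> L.I"
    proof (rule L.I_down)
      \<comment> \<open>The list lies in the interval from \<open>m\<close> on, so its head is at
        least \<open>m\<close>, and \<open>n \<le> 2 * m\<close> puts \<open>n\<close> into the
        cut.\<close>
      show "(\<lambda>k. 2 * hd (A k)) \<in> L.I" by (rule L.I_mult[OF L.I_const L.hd_in_I])
      show "L.ev (\<lambda>k. n k \<le> 2 * hd (A k))"
      proof (rule L.ev_ge[of 1])
        fix k :: nat assume "1 \<le> k"
        then have "A k \<noteq> []" using tower_length[OF A(5), of k] by auto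
        then have "hd (A k) \<in> {m k..<t k}" using A(3)[of k] hd_in_set by blast
        then show "n k \<le> 2 * hd (A k)" using A(1)[of k] by simp
      qed
    qed
    show "(\<lambda>_. {pr i x | i x. x \<in> ouro_seq B0 i}) \<in> L.\<S>"
      using R_in[OF L.I_const, of 1 0] unfolding R_simps .
    show "(\<lambda>k. {pr n x | n x. x \<in> ouro_stage (ouro_seq B0 (i k)) (Suc (i k)) n}) \<in> L.\<S>" if "i \<in> L.I" for i
      using R_in[OF that, of 2] unfolding R_simps .
    show "(\<lambda>k. {pr i x | i x. goodstein (ouro_seq B0) (n k) i = enat x}) \<in> L.\<S>"
      using R_in[OF \<open>n \<in> L.I\<close>, of 3] unfolding R_simps .
    show "D.rich (\<lambda>k. ouro_seq B0 (i k)) (\<lambda>k. ouro_seq B0 (Suc (i k)))" if "i \<in> L.I" for i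
      using Rich[OF L.I_encode[OF that L.I_const[of 0]]] unfolding Bz_Cz_simps .
    show "D.rich (\<lambda>k. ouro_seq B0 (i k)) (\<lambda>k. ouro_stage (ouro_seq B0 (i k)) (Suc (i k)) (p k))"
      if "i \<in> L.I" "p \<in> L.I" for i p
      using Rich[OF L.I_encode[OF that(1) L.I_add[OF that(2) L.I_const[of 1]]]] unfolding Bz_Cz_simps .
    show "L.ev (\<lambda>k. 0 < G.good (n k) (i k))" if "i \<in> L.I" for i
    proof (rule L.ev_mono[OF L.I_below[OF that]])
      fix k assume "\<exists>x\<in>set (A k). i k \<le> x"
      then have "i k < t k" using A(3)[of k] by fastforce
      then show "0 < G.good (n k) (i k)" by (rule A(2))
    qed
  qed
  \<comment> \<open>Set variable 0 is the constant sequence \<open>B0\<close>; the values of the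
    remaining variables are arbitrary members of the structure.\<close>
  let ?e = "\<lambda>_ _. 0 :: nat" and ?E = "case_nat (\<lambda>_. B0) (\<lambda>_ _. B0) :: nat \<Rightarrow> nat \<Rightarrow> nat set"
  have "(\<lambda>_. B0) \<in> L.\<S>" using R_in[OF L.I_const, of 0 0] unfolding R_simps .
  then have E: "?E X \<in> L.\<S>" for X by (simp split: nat.split)
  have e: "?e x \<in> L.I" for x by (rule L.I_const)
  have "deriv ACA0 [] (Imp \<theta> goodstein_principle)" using prov by (simp add: proves_def)
  have "L.msat ?e ?E (Imp \<theta> goodstein_principle)"
  proof (rule L.msat_sound[OF L.ACA0_msat \<open>deriv ACA0 [] _\<close>])
    show "?e x \<in> L.I" "?E X \<in> L.\<S>" for x X by (rule e E)+
    show "\<forall>q\<in>set []. L.msat ?e ?E q" unfolding list.set ball_empty ..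
  qed
  moreover have "L.msat ?e ?E \<theta>"
  proof (rule L.pi1_msat)
    show "pi1 \<theta>" using assms(3) by (simp add: true_pi1_def)
    have "(\<lambda>X. ?E X k) = case_nat B0 (\<lambda>_. B0)" for k by (auto simp: fun_eq_iff split: nat.split)
    then show "sat e (\<lambda>X. ?E X k) \<theta>" for k e using assms(3) by (simp add: true_pi1_def)
  qed (rule e)
  ultimately have "L.msat ?e ?E goodstein_principle" unfolding L.msat.simps by (rule mp)
  then show False using C.not_msat_principle by blast
qed

end
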